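(* Consider any network family $\mathcal F(L,\boldsymbol p,s)$ with equal width $\boldsymbol p=(12pN,\dots,12pN)$, and suppose that $\max\{s\log(nL/s),\,Ls\log(pN)\}=o(n)$. Let $\widehat q$ be the variational posterior. Let $$r_n=\frac{Ls}{n}\log(12BpN)+\frac{s}{n}\log(nL/s),\qquad \xi_n=\inf_{\theta\in\Theta_B(L,\boldsymbol p,s)}\|f_\theta-f_0\|_\infty^2,$$ where the constant $B$ equals $B_0$ under the uniform slab prior and satisfies $B\ge 2$ under the normal slab prior, and let $$\varepsilon_n=M\sqrt{\frac{s\log(nL/s)+Ls\log(pN)}{n}}\,\log^{\delta}(n)$$ for any $\delta\ge 1$ and some large constant $M$. Then, with dominating probability, for some constants $C,C'>0$, $$\int d^2(P_\theta,P_0)\,\widehat q(\theta)\,d\theta\le C\varepsilon_n^2+3C'r_n+3C'\xi_n .$$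
   Context: Model. The observations $D_i=(X_i,Y_i)$, $i=1,\dots,n$, are i.i.d. with $X_i\sim\mathcal U([-1,1]^p)$ and $Y_i=f_0(X_i)+\epsilon_i$, where $\epsilon_i\sim N(0,\sigma_\epsilon^2)$ are i.i.d., $\sigma_\epsilon>0$ is a known constant and $f_0:[-1,1]^p\to\mathbb R$ is the unknown true function. Write $\boldsymbol D^{(n)}=(D_1,\dots,D_n)$. $P_0$ is the true distribution, with density $p_0(D_i)=\phi([Y_i-f_0(X_i)]/\sigma_\epsilon)/\sigma_\epsilon$ ($\phi$ the standard normal pdf); $P_\theta,p_\theta$ are the same with $f_0$ replaced by $f_\theta$. Densities of $\boldsymbol D^{(n)}$ are products. Networks. An $(L-1)$-hidden-layer ReLU network with hidden widths $\boldsymbol p=(p_1,\dots,p_{L-1})$, input dimension $p$ and scalar output is $f_\theta(X)=W_L\sigma_{b_{L-1}}(W_{L-1}\cdots\sigma_{b_1}(W_1X))+b_L$, where $W_i$ are weight matrices, $b_i$ bias vectors, $\sigma(x)=\max(0,x)$ and $\sigma_b(y)_i=\sigma(y_i-b_i)$. The vector $\theta=(\theta_1,\dots,\theta_H)$ collects all entries of the $W_i$ and $b_i$. $\Theta(L,\boldsymbol p,s)=\{\theta:\|\theta\|_0\le s\}$, $\mathcal F(L,\boldsymbol p,s)=\{f_\theta:\theta\in\Theta(L,\boldsymbol p,s)\}$, and $\Theta_B(L,\boldsymbol p,s)=\{\theta\in\Theta(L,\boldsymbol p,s):\|\theta\|_\infty\le B\}$. $L,N,s$ may depend on $n$; $\|f\|_\infty$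 is the sup norm on $[-1,1]^p$. Prior. With $\gamma\in\{0,1\}^H$: $\pi(\gamma)\propto 1\{\sum_i\gamma_i=s\}$ and, given $\gamma$, independently $\theta_i\sim\gamma_i\mathcal M_0+(1-\gamma_i)\delta_0$, where the slab $\mathcal M_0$ is either $\mathcal U([-B_0,B_0])$ (uniform prior, $B_0>1$ a fixed constant) or $N(0,\sigma_0^2)$ (normal prior, $\sigma_0^2>0$ a fixed constant). The posterior is $\pi(\theta|\boldsymbol D^{(n)})\propto\pi(\theta)p_\theta(\boldsymbol D^{(n)})$. Variational posterior. $\mathcal Q$ is the family of distributions with independent coordinates, $\gamma_i\sim\mathrm{Bern}(\nu_i)$, $0\le\nu_i\le1$, and $\theta_i|\gamma_i\sim\gamma_i\mathcal M_i+(1-\gamma_i)\delta_0$, where $\mathcal M_i=\mathcal U(l_i,u_i)$ with $-B_0\le l_i\le u_i\le B_0$ (uniform prior) or $\mathcal M_i=N(\mu_i,\sigma_i^2)$ (normal prior). $\widehat q=\arg\min_{q\in\mathcal Q}\mathrm{KL}(q(\theta)\|\pi(\theta|\boldsymbol D^{(n)}))$. Hellinger distance: $d^2(P_\theta,P_0)=\mathbb E_X\left(1-\exp\{-[f_\theta(X)-f_0(X)]^2/(8\sigma_\epsilon^2)\}\right)$. "With dominating probability" means with $P_0$-probability tending to one as $n\to\infty$; constants do not depend on $n$. *)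

theory Defs
  imports "HOL-Probability.Probability" "HOL-Library.Landau_Symbols"
begin

text \<open>
  Since depth and widths vary with the sample size, all vectors are functions on explicit finite
  index sets. An architecture is the list of layer dimensions
  (input dimension, hidden widths, 1); a list of length \<open>L + 1\<close> describes a network with
  \<open>L - 1\<close> hidden layers.
\<close>

definition equal_width :: "nat \<Rightarrow> nat \<Rightarrow> nat \<Rightarrow> nat list" where
  "equal_width p L w = p # replicate (L - 1) w @ [1]"

text \<open>
  \<open>Weight l i j\<close> is the entry \<open>(i, j)\<close> of \<open>W\<^sub>l\<close> and \<open>Bias l i\<close> the entry \<open>i\<close> of \<open>b\<^sub>l\<close>,
  with \<open>l\<close> running from 1 to \<open>L\<close> and entries counted from 0.
\<close>

datatype param = Weight nat nat nat | Bias nat nat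

definition params :: "nat list \<Rightarrow> param set" where
  "params ds =
     {Weight l i j | l i j. 1 \<le> l \<and> l < length ds \<and> i < ds ! l \<and> j < ds ! (l - 1)} \<union>
     {Bias l i | l i. 1 \<le> l \<and> l < length ds \<and> i < ds ! l}"

definition relu :: "real \<Rightarrow> real" where
  "relu x = max 0 x"

fun hidden :: "nat list \<Rightarrow> (param \<Rightarrow> real) \<Rightarrow> (nat \<Rightarrow> real) \<Rightarrow> nat \<Rightarrow> nat \<Rightarrow> real" where
  "hidden ds \<theta> x 0 i = x i"
| "hidden ds \<theta> x (Suc l) i =
     relu ((\<Sum>j<ds ! l. \<theta> (Weight (Suc l) i j) * hidden ds \<theta> x l j) - \<theta> (Bias (Suc l) i))"

definition net :: "nat list \<Rightarrow> (param \<Rightarrow> real) \<Rightarrow> (nat \<Rightarrow> real) \<Rightarrow> real" where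
  "net ds \<theta> x = (let L = length ds - 1 in
     (\<Sum>j<ds ! (L - 1). \<theta> (Weight L 0 j) * hidden ds \<theta> x (L - 1) j) + \<theta> (Bias L 0))"

definition sparse_params :: "nat list \<Rightarrow> nat \<Rightarrow> (param \<Rightarrow> real) set" where
  "sparse_params ds s =
     {\<theta> \<in> extensional (params ds). card {i \<in> params ds. \<theta> i \<noteq> 0} \<le> s}"

definition bounded_sparse_params :: "nat list \<Rightarrow> nat \<Rightarrow> real \<Rightarrow> (param \<Rightarrow> real) set" where
  "bounded_sparse_params ds s B = {\<theta> \<in> sparse_params ds s. \<forall>i \<in> params ds. \<bar>\<theta> i\<bar> \<le> B}"

definition cube :: "nat \<Rightarrow> (nat \<Rightarrow> real) set" where
  "cube p = ({..<p} \<rightarrow>\<^sub>E {-1..1})"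

text \<open>Extended-real valued, as the true regression function is not assumed to be bounded.\<close>

definition sup_norm :: "nat \<Rightarrow> ((nat \<Rightarrow> real) \<Rightarrow> real) \<Rightarrow> ereal" where
  "sup_norm p g = (SUP x \<in> cube p. ereal \<bar>g x\<bar>)"

definition approx_error ::
  "nat list \<Rightarrow> nat \<Rightarrow> real \<Rightarrow> nat \<Rightarrow> ((nat \<Rightarrow> real) \<Rightarrow> real) \<Rightarrow> ereal" where
  "approx_error ds s B p f0 =
     (INF \<theta> \<in> bounded_sparse_params ds s B. (sup_norm p (\<lambda>x. net ds \<theta> x - f0 x))\<^sup>2)"

definition normal_law :: "real \<Rightarrow> real \<Rightarrow> real measure" where
  "normal_law \<mu> \<sigma> = density lborel (\<lambda>x. ennreal (normal_density \<mu> \<sigma> x))"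

text \<open>The library's \<^const>\<open>uniform_measure\<close> on a one-point interval is not a point mass.\<close>

definition uniform_law :: "real \<Rightarrow> real \<Rightarrow> real measure" where
  "uniform_law l u = (if l < u then uniform_measure lborel {l..u} else return borel l)"

definition input_law :: "nat \<Rightarrow> (nat \<Rightarrow> real) measure" where
  "input_law p = (\<Pi>\<^sub>M i\<in>{..<p}. uniform_law (-1) 1)"

definition obs_law ::
  "nat \<Rightarrow> real \<Rightarrow> ((nat \<Rightarrow> real) \<Rightarrow> real) \<Rightarrow> ((nat \<Rightarrow> real) \<times> real) measure" where
  "obs_law p \<sigma> f = distr (input_law p \<Otimes>\<^sub>M normal_law 0 \<sigma>)
     ((\<Pi>\<^sub>M i\<in>{..<p}. borel) \<Otimes>\<^sub>M borel) (\<lambda>(x, e). (x, f x + e))"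

definition data_law ::
  "nat \<Rightarrow> real \<Rightarrow> ((nat \<Rightarrow> real) \<Rightarrow> real) \<Rightarrow> nat \<Rightarrow> (nat \<Rightarrow> (nat \<Rightarrow> real) \<times> real) measure" where
  "data_law p \<sigma> f n = (\<Pi>\<^sub>M i\<in>{..<n}. obs_law p \<sigma> f)"

text \<open>Density of \<^const>\<open>obs_law\<close> with respect to the product of \<^const>\<open>input_law\<close> and Lebesgue measure.\<close>

definition obs_density :: "real \<Rightarrow> ((nat \<Rightarrow> real) \<Rightarrow> real) \<Rightarrow> (nat \<Rightarrow> real) \<times> real \<Rightarrow> real" where
  "obs_density \<sigma> f = (\<lambda>(x, y). std_normal_density ((y - f x) / \<sigma>) / \<sigma>)"

definition likelihood ::
  "real \<Rightarrow> nat \<Rightarrow> (nat \<Rightarrow> (nat \<Rightarrow> real) \<times> real) \<Rightarrow> ((nat \<Rightarrow> real) \<Rightarrow> real) \<Rightarrow> real" where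
  "likelihood \<sigma> n D f = (\<Prod>i<n. obs_density \<sigma> f (D i))"

definition hellinger_sq ::
  "nat \<Rightarrow> real \<Rightarrow> ((nat \<Rightarrow> real) \<Rightarrow> real) \<Rightarrow> ((nat \<Rightarrow> real) \<Rightarrow> real) \<Rightarrow> real" where
  "hellinger_sq p \<sigma> f g = (\<integral>x. 1 - exp (- ((f x - g x)\<^sup>2 / (8 * \<sigma>\<^sup>2))) \<partial>input_law p)"

text \<open>
  \<open>Uniform_slab B\<^sub>0\<close> is the slab on \<open>[-B\<^sub>0, B\<^sub>0]\<close>; \<open>Normal_slab \<sigma>\<^sub>0\<close> has standard deviation \<open>\<sigma>\<^sub>0\<close>.
\<close>

datatype slab = Uniform_slab real | Normal_slab real

fun slab_law :: "slab \<Rightarrow> real measure" where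
  "slab_law (Uniform_slab B0) = uniform_law (- B0) B0"
| "slab_law (Normal_slab \<sigma>0) = normal_law 0 \<sigma>0"

fun slab_family :: "slab \<Rightarrow> real measure set" where
  "slab_family (Uniform_slab B0) = {uniform_law l u | l u. - B0 \<le> l \<and> l \<le> u \<and> u \<le> B0}"
| "slab_family (Normal_slab \<sigma>0) = {normal_law \<mu> \<sigma> | \<mu> \<sigma>. 0 < \<sigma>}"

definition spike_slab :: "bool \<Rightarrow> real measure \<Rightarrow> real measure" where
  "spike_slab g M = (if g then M else return borel 0)"

definition prior :: "nat list \<Rightarrow> nat \<Rightarrow> slab \<Rightarrow> (param \<Rightarrow> real) measure" where
  "prior ds s sl =
     measure_pmf (pmf_of_set {\<gamma> \<in> params ds \<rightarrow>\<^sub>E UNIV. card {i \<in> params ds. \<gamma> i} = s})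
       \<bind> (\<lambda>\<gamma>. \<Pi>\<^sub>M i\<in>params ds. spike_slab (\<gamma> i) (slab_law sl))"

definition posterior ::
  "nat list \<Rightarrow> nat \<Rightarrow> slab \<Rightarrow> real \<Rightarrow> nat \<Rightarrow> (nat \<Rightarrow> (nat \<Rightarrow> real) \<times> real) \<Rightarrow> (param \<Rightarrow> real) measure"
where
  "posterior ds s sl \<sigma> n D = density (prior ds s sl)
     (\<lambda>\<theta>. ennreal (likelihood \<sigma> n D (net ds \<theta>)) /
          (\<integral>\<^sup>+ \<theta>'. ennreal (likelihood \<sigma> n D (net ds \<theta>')) \<partial>prior ds s sl))"

definition variational_family :: "nat list \<Rightarrow> slab \<Rightarrow> (param \<Rightarrow> real) measure set" where
  "variational_family ds sl =
     {\<Pi>\<^sub>M i\<in>params ds. measure_pmf (bernoulli_pmf (\<nu> i)) \<bind> (\<lambda>g. spike_slab g (S i)) | \<nu> S.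
        \<forall>i\<in>params ds. 0 \<le> \<nu> i \<and> \<nu> i \<le> 1 \<and> S i \<in> slab_family sl}"

text \<open>
  The divergence of \<open>Q\<close> from \<open>P\<close>. The library's \<^const>\<open>KL_divergence\<close> takes its arguments in the
  opposite order and is real-valued, returning 0 where the divergence is infinite. The negative
  part of the log density is always \<open>Q\<close>-integrable for probability measures, so
  failure of integrability means \<open>\<infinity>\<close>.
\<close>

definition kl :: "'a measure \<Rightarrow> 'a measure \<Rightarrow> ereal" where
  "kl Q P = (if absolutely_continuous P Q \<and> integrable Q (entropy_density (exp 1) P Q)
             then ereal (KL_divergence (exp 1) P Q) else \<infinity>)"

definition is_variational_posterior ::
  "nat list \<Rightarrow> nat \<Rightarrow> slab \<Rightarrow> real \<Rightarrow> nat \<Rightarrow> (nat \<Rightarrow> (nat \<Rightarrow> real) \<times> real) \<Rightarrow>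
     (param \<Rightarrow> real) measure \<Rightarrow> bool" where
  "is_variational_posterior ds s sl \<sigma> n D q \<longleftrightarrow>
     is_arg_min (\<lambda>q. kl q (posterior ds s sl \<sigma> n D)) (\<lambda>q. q \<in> variational_family ds sl) q"

text \<open>
  \<open>A n\<close> holds with \<open>P n\<close>-probability tending to one. Stated through measurable events on which
  \<open>A n\<close> holds, so that \<open>A n\<close> itself need not be measurable.
\<close>

definition with_dominating_probability ::
  "(nat \<Rightarrow> 'a measure) \<Rightarrow> (nat \<Rightarrow> 'a \<Rightarrow> bool) \<Rightarrow> bool" where
  "with_dominating_probability P A \<longleftrightarrow>
     (\<exists>E. (\<forall>n. E n \<in> sets (P n) \<and> (\<forall>D\<in>E n. A n D)) \<and> (\<lambda>n. measure (P n) (E n)) \<longlonglongrightarrow> 1)"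

definition rate_r :: "nat \<Rightarrow> real \<Rightarrow> nat \<Rightarrow> nat \<Rightarrow> nat \<Rightarrow> nat \<Rightarrow> real" where
  "rate_r p B n L N s =
     (real L * real s / real n) * ln (12 * B * real p * real N)
     + (real s / real n) * ln (real n * real L / real s)"

definition rate_eps :: "nat \<Rightarrow> real \<Rightarrow> real \<Rightarrow> nat \<Rightarrow> nat \<Rightarrow> nat \<Rightarrow> nat \<Rightarrow> real" where
  "rate_eps p M \<delta> n L N s =
     M * sqrt ((real s * ln (real n * real L / real s) + real L * real s * ln (real p * real N))
               / real n)
       * (ln (real n)) powr \<delta>"

end

theory Submission
  imports Defs "HOL-Library.Function_Algebras"
begin

text \<open>
  By the Gibbs variational principle, twice \<open>n\<close> times the Hellinger loss averaged over \<open>q\<close> is at most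
  \<open>KL(q, posterior) + ln \<integral> exp (2 n d\<^sup>2) d posterior\<close>. The minimiser \<open>q\<close> is compared with slabs
  concentrated in a tiny neighbourhood of a best bounded sparse network; the evidence then cancels, and
  there remains to bound \<open>\<integral> exp (2 n d\<^sup>2 + llr) d prior\<close>, where \<open>llr\<close> is the log likelihood ratio
  to the truth. On a sieve of networks with bounded parameters, \<open>llr / 2 + n d\<^sup>2\<close> is uniformly at most
  the log covering number of the clipped networks (Chernoff's bound at each centre of a cover); off the
  sieve the prior mass is negligible.

  The covers come from the Lipschitz dependence of the network on its parameters. Under the normal
  slab the sieve has radius \<open>n\<close>, which costs \<open>L ln n\<close> for each parameter. The rate \<open>\<epsilon>\<^sub>n\<close> pays for this
  unless \<open>p = N = 1\<close>, when \<open>ln (p N)\<close> vanishes. In that case the width is bounded and the input is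
  scalar, and the networks are distinguished instead by the signs of polynomials in the
  parameters on a grid of inputs; the number of sign patterns is bounded as in Warren's theorem.
\<close>

subsection \<open>Sign patterns of polynomials\<close>

text \<open>The factor one half comes from the Hellinger affinity: for one fixed function the
  exponential moment of half the log likelihood ratio is the mean affinity, that is, one minus the
  squared Hellinger distance. Chernoff's bound thus yields \<open>llr / 2 + n d\<^sup>2\<close>
  directly, and doubling gives the exponent in the prior integral.

  The obstacle is that networks are unbounded, while a cover has to control likelihoods at the data.
  If the noise energy is at most \<open>4 \<sigma>\<^sup>2 n\<close>, all responses lie in
  \<open>[- K, K]\<close> with \<open>K = F + 2 \<sigma> n\<close>, and clipping a network to this
  interval can only raise its likelihood. This requires a bound \<open>F\<close> for
  \<open>f0\<close>, which is not assumed: it follows as soon as the approximation error is finite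
  for some sample size, and where that error is infinite so is the right-hand side.

  Normal slabs are unbounded as well, so the competitor leaves every bounded set of parameters. The
  perturbation bound therefore holds for arbitrary perturbations, through the exponential of their
  l1 norm, whose mean factorises under a product measure.\<close>

inductive poly_fun :: "'i set \<Rightarrow> nat \<Rightarrow> (('i \<Rightarrow> real) \<Rightarrow> real) \<Rightarrow> bool" for A where
  monom: "(\<Sum>i\<in>A. e i) \<le> d \<Longrightarrow> poly_fun A d (\<lambda>x. c * (\<Prod>i\<in>A. x i ^ e i))"
| add: "poly_fun A d f \<Longrightarrow> poly_fun A d g \<Longrightarrow> poly_fun A d (\<lambda>x. f x + g x)"

lemma poly_fun_const: "poly_fun A d (\<lambda>_. c)"
  using poly_fun.monom[of "\<lambda>_. 0" A d c] by simp

lemma poly_fun_var: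
  assumes "finite A" "i \<in> A" "1 \<le> d"
  shows "poly_fun A d (\<lambda>x. x i)"
proof -
  have "(\<Prod>j\<in>A. x j ^ (if j = i then 1 else 0)) = x i" for x :: "'a \<Rightarrow> real"
  proof -
    have "(\<Prod>j\<in>A. x j ^ (if j = i then 1 else 0)) = (\<Prod>j\<in>A. if j = i then x j else 1)"
      by (rule prod.cong) auto
    then show ?thesis using assms by simp
  qed
  then show ?thesis
    using poly_fun.monom[of "\<lambda>j. if j = i then 1 else 0" A d 1] assms by simp
qed

lemma poly_fun_mono: "poly_fun A d f \<Longrightarrow> d \<le> d' \<Longrightarrow> poly_fun A d' f"
proof (induction rule: poly_fun.induct)
  case (monom e d c)
  then have "(\<Sum>i\<in>A. e i) \<le> d'" by linarith
  then show ?case by (rule poly_fun.monom)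
qed (auto intro: poly_fun.add)

lemma poly_fun_mult:
  assumes "poly_fun A d f" "poly_fun A d' g"
  shows "poly_fun A (d + d') (\<lambda>x. f x * g x)"
  using assms(1)
proof (induction rule: poly_fun.induct)
  case (monom e d c)
  have "poly_fun A (d + d') (\<lambda>x. c * (\<Prod>i\<in>A. x i ^ e i) * g x)"
    using assms(2)
  proof (induction rule: poly_fun.induct)
    case (monom e' d' c')
    have *: "(\<lambda>x. c * (\<Prod>i\<in>A. x i ^ e i) * (c' * (\<Prod>i\<in>A. x i ^ e' i)))
        = (\<lambda>x. (c * c') * (\<Prod>i\<in>A. x i ^ (e i + e' i)))"
      by (simp add: power_add prod.distrib mult_ac)
    show ?case unfolding *
      using monom \<open>sum e A \<le> d\<close> by (intro poly_fun.monom) (simp add: sum.distrib)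
  next
    case (add d' f g)
    then show ?case by (simp add: distrib_left poly_fun.add)
  qed
  then show ?case .
next
  case (add d f g)
  then show ?case by (simp add: distrib_right poly_fun.add)
qed

lemma poly_fun_cmult: "poly_fun A d f \<Longrightarrow> poly_fun A d (\<lambda>x. c * f x)"
  using poly_fun_mult[OF poly_fun_const[of A 0 c]] by fastforce

lemma poly_fun_diff: "poly_fun A d f \<Longrightarrow> poly_fun A d g \<Longrightarrow> poly_fun A d (\<lambda>x. f x - g x)"
  using poly_fun.add[of A d f "\<lambda>x. (-1) * g x"] poly_fun_cmult[of A d g "-1"] by simp

lemma poly_fun_sum:
  assumes "\<And>k. k \<in> K \<Longrightarrow> poly_fun A d (f k)"
  shows "poly_fun A d (\<lambda>x. \<Sum>k\<in>K. f k x)"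
  using assms
  by (induction K rule: infinite_finite_induct) (auto intro: poly_fun_const poly_fun.add)

lemma poly_fun_prod:
  assumes "finite K" "\<And>k. k \<in> K \<Longrightarrow> poly_fun A (d k) (f k)"
  shows "poly_fun A (\<Sum>k\<in>K. d k) (\<lambda>x. \<Prod>k\<in>K. f k x)"
  using assms
  by (induction K rule: finite_induct) (auto intro: poly_fun_const poly_fun_mult)

lemma poly_fun_power: "poly_fun A d f \<Longrightarrow> poly_fun A (d * k) (\<lambda>x. f x ^ k)"
  by (induction k) (auto intro: poly_fun_const poly_fun_mult)

lemma poly_fun_continuous: "poly_fun A d f \<Longrightarrow> continuous_on S f"
proof (induction rule: poly_fun.induct)
  case (monom e d c)
  have "continuous_on S (\<lambda>x. x i)" for i :: 'a
    by (rule continuous_on_subset[OF continuous_on_product_coordinates]) simp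
  then show ?case by (intro continuous_intros)
qed (intro continuous_intros)

text \<open>One-variable derivatives along \<open>x(i := t)\<close> are all that the critical point
  argument uses. Truncated subtraction is harmless at \<open>d = 0\<close>: then all exponents on
  \<open>A\<close> vanish and so does the derivative.\<close>

lemma poly_fun_deriv:
  assumes "finite A" "i \<in> A" "poly_fun A d f"
  shows "\<exists>f'. poly_fun A (d - 1) f' \<and>
    (\<forall>x. ((\<lambda>t. f (x(i := t))) has_real_derivative f' x) (at (x i)))"
  using assms(3)
proof (induction rule: poly_fun.induct)
  case (monom e d c)
  define f' where
    "f' = (\<lambda>x::'a \<Rightarrow> real. (c * real (e i)) * (\<Prod>j\<in>A. x j ^ (if j = i then e j - 1 else e j)))"
  have A: "A = insert i (A - {i})" "i \<notin> A - {i}" "finite (A - {i})"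
    using assms by auto
  have sume: "sum e A = e i + sum e (A - {i})"
    using assms by (simp add: sum.remove)
  have "poly_fun A (d - 1) f'"
  proof (cases "e i = 0")
    case True
    then show ?thesis by (simp add: f'_def poly_fun_const)
  next
    case False
    have "(\<Sum>j\<in>A. if j = i then e j - 1 else e j) = (e i - 1) + (\<Sum>j\<in>A - {i}. e j)"
      using assms by (subst sum.remove[of _ i]) auto
    then show ?thesis
      unfolding f'_def using False monom sume by (intro poly_fun.monom) simp
  qed
  moreover have "((\<lambda>t. c * (\<Prod>j\<in>A. (x(i := t)) j ^ e j)) has_real_derivative f' x) (at (x i))" for x
  proof -
    have 1: "(\<Prod>j\<in>A. (x(i := t)) j ^ e j) = t ^ e i * (\<Prod>j\<in>A - {i}. x j ^ e j)" for t
      using assms by (subst prod.remove[of _ i]) auto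
    have 2: "f' x = (c * real (e i)) * (x i ^ (e i - 1) * (\<Prod>j\<in>A - {i}. x j ^ e j))"
      unfolding f'_def using assms by (subst prod.remove[of _ i]) auto
    show ?thesis unfolding 1 2
      by (auto intro!: derivative_eq_intros simp: mult_ac)
  qed
  ultimately show ?case by blast
next
  case (add d f g)
  then obtain f' g' where
    "poly_fun A (d - 1) f'" "\<And>x. ((\<lambda>t. f (x(i := t))) has_real_derivative f' x) (at (x i))"
    "poly_fun A (d - 1) g'" "\<And>x. ((\<lambda>t. g (x(i := t))) has_real_derivative g' x) (at (x i))"
    by blast
  then show ?case
    by (intro exI[of _ "\<lambda>x. f' x + g' x"] conjI allI poly_fun.add DERIV_add)
qed

text \<open>The indicator functions of the points of \<open>Z\<close> are linearly independent, and
  by assumption each of them is spanned on \<open>Z\<close> by the functions \<open>b e\<close>; a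
  dimension count compares the two families.\<close>

lemma card_le_card_spanning:
  fixes Z :: "'a set" and b :: "'b \<Rightarrow> 'a \<Rightarrow> real"
  assumes "finite E"
    and "\<And>z\<^sub>0. z\<^sub>0 \<in> Z \<Longrightarrow> \<exists>c. \<forall>z\<in>Z. (if z = z\<^sub>0 then 1 else 0) = (\<Sum>e\<in>E. c e * b e z)"
    and "finite Z"
  shows "card Z \<le> card E"
proof -
  interpret V: vector_space "\<lambda>(c::real) (f::'a \<Rightarrow> real) x. c * f x"
    by unfold_locales (auto simp: fun_eq_iff algebra_simps)
  define \<delta> where "\<delta> z\<^sub>0 = (\<lambda>z. if z = z\<^sub>0 then 1 else 0 :: real)" for z\<^sub>0 :: 'a
  \<comment> \<open>The spanning identities hold on \<open>Z\<close> only; cutting the functions off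
    outside \<open>Z\<close> turns them into identities on the whole type, where the vector space
    lives.\<close>
  define b' where "b' e = (\<lambda>z. if z \<in> Z then b e z else 0)" for e
  have sum_apply: "(\<Sum>k\<in>K. g k) x = (\<Sum>k\<in>K. g k x)" for K and g :: "'c \<Rightarrow> 'a \<Rightarrow> real" and x
    by (induction K rule: infinite_finite_induct) auto
  have inj: "inj_on \<delta> Z"
    by (rule inj_onI) (metis \<delta>_def zero_neq_one)
  have "V.independent (\<delta> ` Z)"
  proof (rule V.independent_if_scalars_zero)
    show "finite (\<delta> ` Z)" using assms by simp
    fix f x assume *: "(\<Sum>x\<in>\<delta> ` Z. (\<lambda>xa. f x * x xa)) = 0" "x \<in> \<delta> ` Z"
    then obtain z where z: "z \<in> Z" "x = \<delta> z" by blast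
    have "0 = (\<Sum>x\<in>\<delta> ` Z. (\<lambda>xa. f x * x xa)) z" using *(1) by simp
    also have "\<dots> = (\<Sum>x\<in>Z. f (\<delta> x) * \<delta> x z)"
      unfolding sum_apply using inj by (simp add: sum.reindex)
    also have "\<dots> = (\<Sum>x\<in>Z. if x = z then f (\<delta> z) else 0)"
      by (rule sum.cong) (auto simp: \<delta>_def)
    also have "\<dots> = f (\<delta> z)" using z assms by simp
    finally show "f x = 0" using z by simp
  qed
  moreover have "\<delta> ` Z \<subseteq> V.span (b' ` E)"
  proof
    fix x assume "x \<in> \<delta> ` Z"
    then obtain z\<^sub>0 where z: "z\<^sub>0 \<in> Z" "x = \<delta> z\<^sub>0" by blast
    obtain c where c: "\<And>z. z \<in> Z \<Longrightarrow> (if z = z\<^sub>0 then 1 else 0) = (\<Sum>e\<in>E. c e * b e z)"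
      using assms(2)[OF z(1)] by blast
    have "x = (\<Sum>e\<in>E. (\<lambda>z. c e * b' e z))"
    proof
      fix y show "x y = (\<Sum>e\<in>E. (\<lambda>z. c e * b' e z)) y"
        using z c[of y] by (cases "y \<in> Z") (auto simp: sum_apply \<delta>_def b'_def)
    qed
    then show "x \<in> V.span (b' ` E)"
      by (simp only:) (intro V.span_sum V.span_scale V.span_base imageI)
  qed
  ultimately have "card (\<delta> ` Z) \<le> card (b' ` E)"
    using V.independent_span_bound[of "b' ` E" "\<delta> ` Z"] assms by blast
  also have "\<dots> \<le> card E" using assms by (simp add: card_image_le)
  finally show ?thesis using inj by (simp add: card_image)
qed

text \<open>
  Modulo the equations, a power \<open>x\<^sub>i\<^sup>D\<close> may be replaced by a polynomial of lower degree, so the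
  monomials with all exponents below \<open>D\<close> span the functions on the solution set.
\<close>

lemma card_common_zeros:
  fixes Z :: "('i \<Rightarrow> real) set"
  assumes A: "finite A" and Z: "finite Z" "Z \<subseteq> extensional A" and D: "D \<ge> 1"
    and q: "\<And>i. i \<in> A \<Longrightarrow> poly_fun A (D - 1) (q i)"
    and eq: "\<And>i x. i \<in> A \<Longrightarrow> x \<in> Z \<Longrightarrow> x i ^ D = q i x"
  shows "card Z \<le> D ^ card A"
proof -
  define E where "E = (A \<rightarrow>\<^sub>E {..<D})"
  define m where "m e x = (\<Prod>i\<in>A. x i ^ e i)" for e :: "'i \<Rightarrow> nat" and x :: "'i \<Rightarrow> real"
  define W where "W f \<longleftrightarrow> (\<exists>c. \<forall>z\<in>Z. f z = (\<Sum>e\<in>E. c e * m e z))" for f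
  have finE: "finite E" unfolding E_def using A by (simp add: finite_PiE)
  have Wadd: "W (\<lambda>x. f x + g x)" if "W f" "W g" for f g
  proof -
    obtain c c' where "\<And>z. z \<in> Z \<Longrightarrow> f z = (\<Sum>e\<in>E. c e * m e z)"
      "\<And>z. z \<in> Z \<Longrightarrow> g z = (\<Sum>e\<in>E. c' e * m e z)"
      using \<open>W f\<close> \<open>W g\<close> unfolding W_def by blast
    then show ?thesis unfolding W_def
      by (intro exI[of _ "\<lambda>e. c e + c' e"]) (simp add: distrib_right sum.distrib)
  qed
  have Wpoly: "W f" if "poly_fun A d f" for d f
    using that
  proof (induction d arbitrary: f rule: less_induct)
    case (less d)
    note IH = less.IH
    have "d' = d \<Longrightarrow> W f" if "poly_fun A d' f" for d' f
      using that
    proof (induction rule: poly_fun.induct)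
      case (monom e d' c)
      show ?case
      proof (cases "\<forall>i\<in>A. e i < D")
        case True
        define e' where "e' = restrict e A"
        have e': "e' \<in> E" unfolding E_def e'_def using True by auto
        have "c * (\<Prod>i\<in>A. z i ^ e i) = (\<Sum>k\<in>E. (if k = e' then c else 0) * m k z)" for z
        proof -
          have "(\<Sum>k\<in>E. (if k = e' then c else 0) * m k z) = (\<Sum>k\<in>E. if k = e' then c * m k z else 0)"
            by (rule sum.cong) auto
          also have "\<dots> = c * m e' z" using finE e' by simp
          also have "m e' z = (\<Prod>i\<in>A. z i ^ e i)" unfolding m_def e'_def by (rule prod.cong) auto
          finally show ?thesis by simp
        qed
        then show ?thesis unfolding W_def by (intro exI ballI)
      next
        case False
        then obtain i where i: "i \<in> A" "D \<le> e i" by (auto simp: not_less)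
        \<comment> \<open>Trading \<open>x i ^ D\<close> for \<open>q i\<close>, of degree at most
          \<open>D - 1\<close>, lowers the total degree by at least one, so the strong induction
          applies to what remains.\<close>
        define e' where "e' j = (if j = i then e j - D else e j)" for j
        have se: "sum e' A + D = sum e A"
          using i A by (simp add: e'_def sum.remove[of A i])
        have "poly_fun A ((D - 1) + sum e' A) (\<lambda>x. q i x * (c * (\<Prod>i\<in>A. x i ^ e' i)))"
          by (intro poly_fun_mult q i poly_fun.monom) simp
        moreover have "(D - 1) + sum e' A < d"
          using se monom D by simp
        ultimately have "W (\<lambda>x. q i x * (c * (\<Prod>i\<in>A. x i ^ e' i)))" using IH by blast
        then obtain c' where "\<And>z. z \<in> Z \<Longrightarrow>
            q i z * (c * (\<Prod>i\<in>A. z i ^ e' i)) = (\<Sum>e\<in>E. c' e * m e z)"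
          unfolding W_def by blast
        moreover have "c * (\<Prod>i\<in>A. z i ^ e i) = q i z * (c * (\<Prod>i\<in>A. z i ^ e' i))" if "z \<in> Z" for z
        proof -
          have "(\<Prod>j\<in>A. z j ^ e j) = z i ^ e i * (\<Prod>j\<in>A - {i}. z j ^ e j)"
            using i A by (simp add: prod.remove)
          also have "z i ^ e i = z i ^ D * z i ^ e' i"
            using i by (simp add: e'_def flip: power_add)
          also have "(\<Prod>j\<in>A - {i}. z j ^ e j) = (\<Prod>j\<in>A - {i}. z j ^ e' j)"
            by (rule prod.cong) (auto simp: e'_def)
          also have "z i ^ D * z i ^ e' i * \<dots> = z i ^ D * (\<Prod>j\<in>A. z j ^ e' j)"
            using i A by (simp add: prod.remove)
          finally show ?thesis using eq[OF i(1) that] by simp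
        qed
        ultimately show ?thesis unfolding W_def by (intro exI[of _ c'] ballI) presburger
      qed
    qed (auto intro: Wadd)
    then show ?case using less.prems by blast
  qed
  have "\<exists>c. \<forall>z\<in>Z. (if z = z\<^sub>0 then 1 else 0) = (\<Sum>e\<in>E. c e * m e z)" if z0: "z\<^sub>0 \<in> Z" for z\<^sub>0
  proof -
    have "\<exists>i\<in>A. z i \<noteq> z\<^sub>0 i" if "z \<in> Z - {z\<^sub>0}" for z
    proof (rule ccontr)
      assume "\<not> ?thesis"
      then have "z = z\<^sub>0" using that z0 Z(2) by (intro extensionalityI[of _ A]) auto
      then show False using that by simp
    qed
    then obtain k where k: "\<And>z. z \<in> Z - {z\<^sub>0} \<Longrightarrow> k z \<in> A \<and> z (k z) \<noteq> z\<^sub>0 (k z)" by metis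
    \<comment> \<open>Lagrange interpolation, one linear factor for each other point: every factor
      uses a coordinate in which that point differs from \<open>z\<^sub>0\<close>, so
      \<open>f\<close> is the indicator of \<open>z\<^sub>0\<close> on \<open>Z\<close>.\<close>
    define f where "f x = (\<Prod>z\<in>Z - {z\<^sub>0}. 1 / (z\<^sub>0 (k z) - z (k z)) * (x (k z) - z (k z)))" for x
    have "poly_fun A (\<Sum>z\<in>Z - {z\<^sub>0}. 1) f"
      unfolding f_def using Z k
      by (intro poly_fun_prod poly_fun_cmult poly_fun_diff poly_fun_const poly_fun_var A) auto
    then have "W f" by (rule Wpoly)
    moreover have "f z = (if z = z\<^sub>0 then 1 else 0)" if "z \<in> Z" for z
    proof (cases "z = z\<^sub>0")
      case True
      have "f z = (\<Prod>z\<in>Z - {z\<^sub>0}. 1)"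
        unfolding f_def using True k by (intro prod.cong) (auto, metis DiffI singletonD eq_iff_diff_eq_0)
      then show ?thesis using True by simp
    next
      case False
      then have "z \<in> Z - {z\<^sub>0}" using that by simp
      then have "f z = 0" unfolding f_def using Z by (auto intro!: prod_zero bexI[of _ z])
      then show ?thesis using False by simp
    qed
    ultimately show ?thesis unfolding W_def by auto
  qed
  then have "card Z \<le> card E" using card_le_card_spanning[OF finE _ Z(1)] by blast
  also have "card E = D ^ card A" unfolding E_def using A by (simp add: card_PiE)
  finally show ?thesis .
qed

text \<open>Tychonoff's theorem: an extensional function is pinned to \<open>undefined\<close> off
  \<open>A\<close>, so the set is a product over all indices of intervals and singletons.\<close>

lemma compact_PiE_interval: "compact (PiE A (\<lambda>_. {- R..R::real}))"
proof -
  have "PiE A (\<lambda>_. {- R..R}) = PiE UNIV (\<lambda>i. if i \<in> A then {- R..R} else {undefined})"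
    by (auto simp: PiE_iff extensional_def split: if_splits)
  moreover have "compactin (product_topology (\<lambda>_. euclidean) UNIV)
      (PiE UNIV (\<lambda>i. if i \<in> A then {- R..R} else {undefined}))"
    by (subst compactin_PiE) auto
  ultimately show ?thesis by (simp add: euclidean_product_topology flip: compactin_euclidean_iff)
qed

text \<open>
  On the closure of each sign cell inside the box, the squared product of all polynomials (and of
  the box constraints) minus a small multiple of \<open>\<Sum>x\<^sub>i\<^sup>2\<^sup>k\<close> attains its maximum at an inner
  point. These points are critical, and the perturbation puts the critical equations into the
  form of \<open>card_common_zeros\<close>.
\<close>

lemma card_strict_sign_patterns:
  fixes T :: "('i \<Rightarrow> real) set"
  assumes A: "finite A" and P: "finite P" "\<And>f. f \<in> P \<Longrightarrow> poly_fun A d f"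
    and T: "finite T" "\<And>x. x \<in> T \<Longrightarrow> x \<in> PiE A (\<lambda>_. {- R<..<R})"
    and nz: "\<And>f x. f \<in> P \<Longrightarrow> x \<in> T \<Longrightarrow> f x \<noteq> 0"
    and sep: "\<And>x y. x \<in> T \<Longrightarrow> y \<in> T \<Longrightarrow> x \<noteq> y \<Longrightarrow> \<exists>f\<in>P. f x * f y < 0"
  shows "card T \<le> (2 * (card P * d) + 4 * card A + 1) ^ card A"
proof (cases "T = {}")
  case False
  \<comment> \<open>The square of \<open>g\<close> has degree at most \<open>D - 1\<close>, since
    the box factors are quadratic and everything is squared. In a critical equation
    \<open>x i ^ D\<close>, the derivative of \<open>x i ^ (2 * k)\<close> up to a factor, is then
    equated with a polynomial of degree at most \<open>D - 1\<close>. The even exponent keeps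
    \<open>S\<close> nonnegative.\<close>
  define k where "k = card P * d + 2 * card A + 1"
  define D where "D = 2 * k - 1"
  have D: "D = 2 * (card P * d) + 4 * card A + 1" "2 * k = Suc D" "D \<ge> 1"
    by (auto simp: D_def k_def)
  define g where "g x = (\<Prod>f\<in>P. f x) * (\<Prod>i\<in>A. R\<^sup>2 - x i ^ 2)" for x :: "'i \<Rightarrow> real"
  define S where "S x = (\<Sum>i\<in>A. x i ^ (2 * k))" for x :: "'i \<Rightarrow> real"
  have "poly_fun A ((\<Sum>f\<in>P. d) + (\<Sum>i\<in>A. 1 * 2)) g"
    unfolding g_def using A P
    by (intro poly_fun_mult poly_fun_prod poly_fun_diff poly_fun_const poly_fun_power poly_fun_var) auto
  then have "poly_fun A ((card P * d + card A * 2) * 2) (\<lambda>x. g x ^ 2)"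
    by (intro poly_fun_power) simp
  then have g2: "poly_fun A D (\<lambda>x. g x ^ 2)" by (rule poly_fun_mono) (simp add: D)
  have S0: "S x \<ge> 0" for x unfolding S_def by (intro sum_nonneg) simp
  define \<mu> where "\<mu> = Min ((\<lambda>x. g x ^ 2) ` T)"
  define b where "b = Max (S ` T)"
  have gT: "g x \<noteq> 0" if "x \<in> T" for x
  proof -
    have "R\<^sup>2 - x i ^ 2 \<noteq> 0" if "i \<in> A" for i
    proof -
      have "\<bar>x i\<bar> < R" using T(2)[OF \<open>x \<in> T\<close>] that by (auto simp: abs_less_iff PiE_iff) 
      then have "(x i)\<^sup>2 < R\<^sup>2" using power_strict_mono[of "\<bar>x i\<bar>" R 2] by simp
      then show ?thesis by simp
    qed
    then show ?thesis using nz that A P unfolding g_def by simp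
  qed
  have \<mu>: "\<mu> > 0" "\<And>x. x \<in> T \<Longrightarrow> \<mu> \<le> g x ^ 2"
    using False T gT unfolding \<mu>_def by (auto simp: Min_gr_iff)
  have b: "b \<ge> 0" "\<And>x. x \<in> T \<Longrightarrow> S x \<le> b"
  proof -
    show "\<And>x. x \<in> T \<Longrightarrow> S x \<le> b" unfolding b_def using T by simp
    then show "b \<ge> 0" using False S0 by (meson all_not_in_conv order_trans)
  qed
  \<comment> \<open>Small enough that subtracting \<open>\<epsilon> * S\<close> leaves
    \<open>G\<close> positive at every point of \<open>T\<close>; the summand 1 keeps the
    denominator positive when \<open>b = 0\<close>.\<close>
  define \<epsilon> where "\<epsilon> = \<mu> / (b + 1)"
  have \<epsilon>: "\<epsilon> > 0" using \<mu> b by (simp add: \<epsilon>_def)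
  define G where "G x = g x ^ 2 - \<epsilon> * S x" for x
  have GT: "G x > 0" if "x \<in> T" for x
  proof -
    have "\<epsilon> * S x \<le> \<epsilon> * b" using b(2)[OF that] \<epsilon> by simp
    also have "\<dots> < \<mu>" using \<mu> b by (simp add: \<epsilon>_def field_simps)
    finally show ?thesis using \<mu>(2)[OF that] by (simp add: G_def)
  qed
  have Gcont: "continuous_on X G" for X
  proof -
    have "poly_fun A (2 * k) G" unfolding G_def S_def
      using poly_fun_power[OF poly_fun_var[OF A _ order.refl], of _ "2 * k"] D
      by (intro poly_fun_diff poly_fun_cmult poly_fun_sum poly_fun_mono[OF g2]) auto
    then show ?thesis by (rule poly_fun_continuous)
  qed
  \<comment> \<open>The closed cell of \<open>t\<close>. Weak inequalities make it compact, at the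
    price of including walls shared with other cells.\<close>
  define C where "C t = PiE A (\<lambda>_. {- R..R}) \<inter> {x. \<forall>f\<in>P. 0 \<le> f t * f x}" for t
  have "\<exists>y\<in>C t. \<forall>x\<in>C t. G x \<le> G y" if t: "t \<in> T" for t
  proof (rule continuous_attains_sup[OF _ _ Gcont])
    have "closed {x. \<forall>f\<in>P. 0 \<le> f t * f x}"
    proof -
      have "{x. \<forall>f\<in>P. 0 \<le> f t * f x} = (\<Inter>f\<in>P. {x. 0 \<le> f t * f x})" by auto
      moreover have "closed {x. 0 \<le> f t * f x}" if "f \<in> P" for f
        by (intro closed_Collect_le continuous_intros poly_fun_continuous[OF P(2)[OF that]])
      ultimately show ?thesis by auto
    qed
    then show "compact (C t)" unfolding C_def by (intro compact_Int_closed compact_PiE_interval)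
    have "t \<in> C t" unfolding C_def using T(2)[OF t] by (auto simp: PiE_iff less_imp_le)
    then show "C t \<noteq> {}" by blast
  qed
  then obtain y where y: "\<And>t. t \<in> T \<Longrightarrow> y t \<in> C t" "\<And>t x. t \<in> T \<Longrightarrow> x \<in> C t \<Longrightarrow> G x \<le> G (y t)"
    by metis
  \<comment> \<open>On a wall of the cell or of the box \<open>g\<close> vanishes and
    \<open>G\<close> is nonpositive, whereas \<open>G t\<close> is positive; so the maximiser lies
    strictly inside.\<close>
  have gy: "g (y t) \<noteq> 0" if t: "t \<in> T" for t
  proof
    assume "g (y t) = 0"
    then have "G (y t) \<le> 0" using S0 \<epsilon> by (simp add: G_def)
    moreover have "t \<in> C t" unfolding C_def using T(2)[OF t] by (auto simp: PiE_iff less_imp_le)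
    ultimately show False using y(2)[OF t] GT[OF t] by fastforce
  qed
  have fy: "0 < f t * f (y t)" if "t \<in> T" "f \<in> P" for t f
  proof -
    have "f (y t) \<noteq> 0" using gy[OF that(1)] that(2) P unfolding g_def by auto
    then show ?thesis using y(1)[OF that(1)] nz that unfolding C_def by (auto simp: less_le)
  qed
  have yR: "\<bar>y t i\<bar> < R" if "t \<in> T" "i \<in> A" for t i
  proof -
    have "R\<^sup>2 - y t i ^ 2 \<noteq> 0" using gy[OF that(1)] that(2) A unfolding g_def by auto
    then have "\<bar>y t i\<bar> \<noteq> R" by auto
    moreover have "\<bar>y t i\<bar> \<le> R" using y(1)[OF that(1)] that(2) unfolding C_def by (auto simp: abs_le_iff PiE_iff)
    ultimately show ?thesis by simp
  qed
  have yext: "y t \<in> extensional A" if "t \<in> T" for t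
    using y(1)[OF that] unfolding C_def by (auto simp: PiE_iff)
  have "\<forall>i\<in>A. \<exists>h. poly_fun A (D - 1) h \<and>
      (\<forall>x. ((\<lambda>t. g (x(i := t)) ^ 2) has_real_derivative h x) (at (x i)))"
    using poly_fun_deriv[OF A _ g2] by blast
  then obtain h where h: "\<And>i. i \<in> A \<Longrightarrow> poly_fun A (D - 1) (h i)"
    "\<And>i x. i \<in> A \<Longrightarrow> ((\<lambda>t. g (x(i := t)) ^ 2) has_real_derivative h i x) (at (x i))"
    by metis
  have crit: "y t i ^ D = 1 / (\<epsilon> * real (2 * k)) * h i (y t)" if t: "t \<in> T" and i: "i \<in> A" for t i
  proof -
    \<comment> \<open>Moving one coordinate slightly away from the maximiser keeps all signs strict
      and stays in the box. The point remains in the cell, so \<open>G\<close> has a local maximum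
      along this line.\<close>
    define z where "z v = (y t)(i := v)" for v
    have zi: "z (y t i) = y t" by (simp add: z_def)
    have "((\<lambda>v. S (z v)) has_real_derivative real (2 * k) * y t i ^ D) (at (y t i))"
    proof -
      have "S (z v) = v ^ (2 * k) + (\<Sum>j\<in>A - {i}. y t j ^ (2 * k))" for v
        unfolding S_def z_def using A i by (subst sum.remove[of _ i]) auto
      then have "S (z v) = v ^ Suc D + (\<Sum>j\<in>A - {i}. y t j ^ (2 * k))" for v
        using D(2) by simp
      moreover have "((\<lambda>v. v ^ Suc D + (\<Sum>j\<in>A - {i}. y t j ^ (2 * k))) has_real_derivative
          real (Suc D) * y t i ^ D) (at (y t i))"
        by (rule derivative_eq_intros refl | simp)+
      ultimately show ?thesis using D(2) by (simp only:)
    qed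
    then have dG: "((\<lambda>v. G (z v)) has_real_derivative h i (y t) - \<epsilon> * (real (2 * k) * y t i ^ D)) (at (y t i))"
      unfolding G_def z_def by (intro DERIV_diff h(2)[OF i] DERIV_cmult)
    have "\<forall>\<^sub>F v in at (y t i). z v \<in> C t"
    proof -
      have "\<forall>\<^sub>F v in at (y t i). \<bar>v\<bar> < R"
        using yR[OF t i] by (intro order_tendstoD(2)[OF tendsto_rabs[OF tendsto_ident_at]])
      moreover have "\<forall>\<^sub>F v in at (y t i). \<forall>f\<in>P. 0 < f t * f (z v)"
      proof (rule eventually_ball_finite[OF P(1)], rule ballI)
        fix f assume f: "f \<in> P"
        obtain f' where "((\<lambda>v. f (z v)) has_real_derivative f') (at (y t i))"
          using poly_fun_deriv[OF A i P(2)[OF f]] unfolding z_def by blast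
        then have "isCont (\<lambda>v. f (z v)) (y t i)" by (rule DERIV_isCont)
        then have "((\<lambda>v. f t * f (z v)) \<longlongrightarrow> f t * f (y t)) (at (y t i))"
          unfolding isCont_def zi by (intro tendsto_mult_left)
        then show "\<forall>\<^sub>F v in at (y t i). 0 < f t * f (z v)"
          using fy[OF t f] by (rule order_tendstoD)
      qed
      ultimately show ?thesis
      proof eventually_elim
        case (elim v)
        then show ?case using y(1)[OF t] i unfolding C_def z_def
          by (auto simp: PiE_iff extensional_def abs_less_iff less_imp_le)
      qed
    qed
    then have "\<forall>\<^sub>F v in at (y t i). G (z v) \<le> G (z (y t i))"
      by eventually_elim (use y(2)[OF t] zi in auto)
    then obtain r where r: "r > 0" "\<And>v. v \<noteq> y t i \<Longrightarrow> dist v (y t i) < r \<Longrightarrow> G (z v) \<le> G (z (y t i))"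
      unfolding eventually_at by auto
    have "h i (y t) - \<epsilon> * (real (2 * k) * y t i ^ D) = 0"
    proof (rule DERIV_local_max[OF dG r(1)], intro allI impI)
      fix v assume "\<bar>y t i - v\<bar> < r"
      then show "G (z v) \<le> G (z (y t i))"
        using r(2)[of v] by (cases "v = y t i") (auto simp: dist_real_def abs_minus_commute)
    qed
    moreover have "real (2 * k) > 0" using D(2) by simp
    ultimately show ?thesis using \<epsilon> by (simp add: field_simps)
  qed
  \<comment> \<open>Two points of \<open>T\<close> differ in the strict sign of some polynomial, and
    each maximiser has the strict signs of its own point.\<close>
  have inj: "inj_on y T"
  proof (rule inj_onI, rule ccontr)
    fix t t' assume *: "t \<in> T" "t' \<in> T" "y t = y t'" "t \<noteq> t'"
    obtain f where f: "f \<in> P" "f t * f t' < 0" using sep[OF *(1,2,4)] by blast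
    show False using fy[OF *(1) f(1)] fy[OF *(2) f(1)] f(2) *(3)
      by (auto simp: zero_less_mult_iff mult_less_0_iff)
  qed
  have "card (y ` T) \<le> D ^ card A"
  proof (rule card_common_zeros[OF A _ _ D(3)])
    show "poly_fun A (D - 1) (\<lambda>x. 1 / (\<epsilon> * real (2 * k)) * h i x)" if "i \<in> A" for i
      by (intro poly_fun_cmult h(1) that)
    show "x i ^ D = 1 / (\<epsilon> * real (2 * k)) * h i x" if "i \<in> A" "x \<in> y ` T" for i x
      using crit that by blast
  qed (use T(1) yext in auto)
  then show ?thesis using inj by (simp add: card_image D(1))
qed simp

text \<open>One representative per pattern reduces \<open>X\<close> to a finite set. Zeros are then
  removed by a shift: subtracting a \<open>\<zeta>\<close> below all positive values at the
  representatives makes nonpositive values negative and keeps positive ones positive, within the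
  same degree.\<close>

lemma card_positivity_patterns:
  fixes X :: "('i \<Rightarrow> real) set"
  assumes A: "finite A" and P: "finite P" "\<And>f. f \<in> P \<Longrightarrow> poly_fun A d f"
    and X: "X \<subseteq> PiE A (\<lambda>_. {- R..R})"
  shows "card ((\<lambda>x. {f \<in> P. 0 < f x}) ` X) \<le> (2 * (card P * d) + 4 * card A + 1) ^ card A"
proof -
  define pat where "pat x = {f \<in> P. 0 < f x}" for x :: "'i \<Rightarrow> real"
  obtain T where T: "T \<subseteq> X" "inj_on pat T" "pat ` X = pat ` T"
    using subset_image_inj[of "pat ` X" pat X] by auto
  have "finite (pat ` X)" by (rule finite_subset[of _ "Pow P"]) (use P in \<open>auto simp: pat_def\<close>)
  then have finT: "finite T" using T finite_imageD by metis
  define vals where "vals = {f x | f x. f \<in> P \<and> x \<in> T \<and> 0 < f x}"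
  have "finite vals"
    by (rule finite_subset[of _ "(\<lambda>(f, x). f x) ` (P \<times> T)"]) (use P finT in \<open>auto simp: vals_def\<close>)
  \<comment> \<open>Inserting 1 covers the case without positive values; halving makes the
    inequality in \<open>\<zeta>2\<close> strict.\<close>
  define \<zeta> where "\<zeta> = Min (insert 1 vals) / 2"
  have "Min (insert 1 vals) > 0"
    using \<open>finite vals\<close> by (auto simp: Min_gr_iff vals_def)
  then have \<zeta>: "\<zeta> > 0" by (simp add: \<zeta>_def)
  have \<zeta>2: "\<zeta> < f x" if "f \<in> P" "x \<in> T" "0 < f x" for f x
  proof -
    have "Min (insert 1 vals) \<le> f x"
      using \<open>finite vals\<close> that by (intro Min_le) (auto simp: vals_def)
    then show ?thesis using \<zeta> by (simp add: \<zeta>_def)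
  qed
  define P' where "P' = (\<lambda>f x. f x - \<zeta>) ` P"
  have P': "finite P'" "card P' \<le> card P" unfolding P'_def using P by (auto intro: card_image_le)
  have "card T \<le> (2 * (card P' * d) + 4 * card A + 1) ^ card A"
  proof (rule card_strict_sign_patterns[OF A P'(1) _ finT])
    show "poly_fun A d f" if f: "f \<in> P'" for f
    proof -
      obtain f' where f': "f' \<in> P" "f = (\<lambda>x. f' x - \<zeta>)" using f unfolding P'_def by blast
      show ?thesis unfolding f'(2) by (intro poly_fun_diff poly_fun_const P f'(1))
    qed
    \<comment> \<open>The box is enlarged because strict sign patterns are counted at points of an
      open box.\<close>
    show "x \<in> PiE A (\<lambda>_. {- (R + 1)<..<R + 1})" if "x \<in> T" for x
    proof -
      have "x \<in> PiE A (\<lambda>_. {- R..R})" using that T(1) X by blast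
      moreover have "{- R..R} \<subseteq> {- (R + 1)<..<R + 1}" by auto
      ultimately show ?thesis using PiE_mono[of A "\<lambda>_. {- R..R}" "\<lambda>_. {- (R + 1)<..<R + 1}"] by blast
    qed
    show "f x \<noteq> 0" if "f \<in> P'" "x \<in> T" for f x
    proof -
      obtain f' where f': "f' \<in> P" "f = (\<lambda>x. f' x - \<zeta>)" using \<open>f \<in> P'\<close> unfolding P'_def by blast
      show ?thesis using \<zeta> \<zeta>2[OF f'(1) \<open>x \<in> T\<close>] unfolding f'(2) by (cases "0 < f' x") auto
    qed
    fix x y assume xy: "x \<in> T" "y \<in> T" "x \<noteq> y"
    then have "pat x \<noteq> pat y" using T(2) by (auto simp: inj_on_def)
    then obtain f where f: "f \<in> P" "0 < f x \<longleftrightarrow> \<not> 0 < f y" unfolding pat_def by auto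
    then have "(f x - \<zeta>) * (f y - \<zeta>) < 0"
      using \<zeta> \<zeta>2[OF f(1) xy(1)] \<zeta>2[OF f(1) xy(2)] by (cases "0 < f x") (auto intro: mult_pos_neg mult_neg_pos)
    then show "\<exists>f\<in>P'. f x * f y < 0" using f(1) unfolding P'_def by (intro bexI[of _ "\<lambda>x. f x - \<zeta>"] imageI)
  qed
  also have "\<dots> \<le> (2 * (card P * d) + 4 * card A + 1) ^ card A"
    using P'(2) by (intro power_mono) auto
  finally show ?thesis
    using T card_image[OF T(2)] unfolding pat_def by simp
qed

subsection \<open>Perturbation of networks\<close>

definition layer_params :: "nat list \<Rightarrow> nat \<Rightarrow> param set" where
  "layer_params ds l =
     (\<lambda>(i, j). Weight l i j) ` ({..<ds ! l} \<times> {..<ds ! (l - 1)}) \<union> Bias l ` {..<ds ! l}"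

lemma finite_layer_params [simp]: "finite (layer_params ds l)"
  by (simp add: layer_params_def)

lemma params_eq_layers: "params ds = (\<Union>l\<in>{1..<length ds}. layer_params ds l)"
  by (auto simp: params_def layer_params_def image_iff)

lemma finite_params [simp]: "finite (params ds)"
  by (simp add: params_eq_layers)

lemma layer_params_disjoint: "k \<noteq> l \<Longrightarrow> layer_params ds k \<inter> layer_params ds l = {}"
  by (auto simp: layer_params_def)

lemma card_layer_params:
  assumes "ds ! l \<le> w" "ds ! (l - 1) \<le> w"
  shows "card (layer_params ds l) \<le> (w + 1)\<^sup>2"
proof -
  have "card (layer_params ds l) \<le> card ({..<ds ! l} \<times> {..<ds ! (l - 1)}) + card {..<ds ! l}"
    unfolding layer_params_def
    by (intro order.trans[OF card_Un_le] add_mono card_image_le) auto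
  also have "\<dots> = ds ! l * ds ! (l - 1) + ds ! l" by simp
  also have "\<dots> \<le> w * w + w" using assms by (intro add_mono mult_le_mono)
  also have "\<dots> \<le> (w + 1)\<^sup>2" by (simp add: power2_eq_square)
  finally show ?thesis .
qed

lemma length_equal_width: "L \<ge> 1 \<Longrightarrow> length (equal_width p L w) = L + 1"
  by (simp add: equal_width_def)

lemma equal_width_nth_le:
  assumes "L \<ge> 1" "p \<le> w" "1 \<le> w" "l \<le> L"
  shows "equal_width p L w ! l \<le> w"
  using assms by (auto simp: equal_width_def nth_Cons nth_append split: nat.splits)

lemma equal_width_0: "equal_width p L w ! 0 = p"
  by (simp add: equal_width_def)

lemma equal_width_last: "L \<ge> 1 \<Longrightarrow> equal_width p L w ! L = 1"
  by (cases L) (auto simp: equal_width_def nth_append)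

lemma card_params_equal_width:
  assumes "L \<ge> 1" "p \<le> w" "1 \<le> w"
  shows "card (params (equal_width p L w)) \<le> L * (w + 1)\<^sup>2"
proof -
  have "card (params (equal_width p L w)) \<le> (\<Sum>l\<in>{1..<L + 1}. card (layer_params (equal_width p L w) l))"
    unfolding params_eq_layers length_equal_width[OF assms(1)] by (rule card_UN_le) simp
  also have "\<dots> \<le> (\<Sum>l\<in>{1..<L + 1}. (w + 1)\<^sup>2)"
    using assms by (intro sum_mono card_layer_params equal_width_nth_le) auto
  finally show ?thesis by simp
qed

text \<open>A row is enlarged to its whole layer to make the bound independent of the unit; summed
  over the layers, perturbations then become the l1 distance of two parameter vectors.\<close>

lemma row_sum_le_layer_sum:
  fixes \<theta> :: "param \<Rightarrow> real"
  assumes "i < ds ! l"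
  shows "(\<Sum>j<ds ! (l - 1). \<bar>\<theta> (Weight l i j)\<bar>) + \<bar>\<theta> (Bias l i)\<bar> \<le> (\<Sum>q\<in>layer_params ds l. \<bar>\<theta> q\<bar>)"
proof -
  have "(\<Sum>j<ds ! (l - 1). \<bar>\<theta> (Weight l i j)\<bar>) = (\<Sum>q\<in>Weight l i ` {..<ds ! (l - 1)}. \<bar>\<theta> q\<bar>)"
    by (subst sum.reindex) (auto simp: inj_on_def)
  then have "(\<Sum>j<ds ! (l - 1). \<bar>\<theta> (Weight l i j)\<bar>) + \<bar>\<theta> (Bias l i)\<bar>
      = (\<Sum>q\<in>insert (Bias l i) (Weight l i ` {..<ds ! (l - 1)}). \<bar>\<theta> q\<bar>)"
    by (subst sum.insert) auto
  also have "\<dots> \<le> (\<Sum>q\<in>layer_params ds l. \<bar>\<theta> q\<bar>)"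
    using assms by (intro sum_mono2) (auto simp: layer_params_def)
  finally show ?thesis .
qed

text \<open>The condition \<open>M \<ge> 1\<close> lets the bias count as one more weight, on a
  constant input.\<close>

lemma affine_bound:
  fixes h :: "nat \<Rightarrow> real"
  assumes "\<And>j. j < m \<Longrightarrow> \<bar>h j\<bar> \<le> M" "M \<ge> 1"
  shows "\<bar>(\<Sum>j<m. W j * h j) - b\<bar> \<le> ((\<Sum>j<m. \<bar>W j\<bar>) + \<bar>b\<bar>) * M"
proof -
  have "\<bar>\<Sum>j<m. W j * h j\<bar> \<le> (\<Sum>j<m. \<bar>W j * h j\<bar>)" by (rule sum_abs)
  also have "\<dots> \<le> (\<Sum>j<m. \<bar>W j\<bar> * M)"
    using assms by (intro sum_mono) (auto simp: abs_mult intro!: mult_left_mono)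
  finally have "\<bar>\<Sum>j<m. W j * h j\<bar> \<le> (\<Sum>j<m. \<bar>W j\<bar>) * M" by (simp add: sum_distrib_right)
  moreover have "\<bar>b\<bar> \<le> \<bar>b\<bar> * M" using assms(2) by (simp add: mult_le_cancel_left1)
  ultimately show ?thesis by (simp add: distrib_right)
qed

text \<open>The difference is split so that the propagated error \<open>h' - h\<close> meets the
  perturbed weights, while the change of the weights meets the unperturbed activations
  \<open>h\<close>, which are the ones with an a priori bound.\<close>

lemma affine_diff_bound:
  fixes h h' :: "nat \<Rightarrow> real"
  assumes "\<And>j. j < m \<Longrightarrow> \<bar>h j\<bar> \<le> M" "M \<ge> 1" "\<And>j. j < m \<Longrightarrow> \<bar>h' j - h j\<bar> \<le> D"
  shows "\<bar>((\<Sum>j<m. W' j * h' j) - b') - ((\<Sum>j<m. W j * h j) - b)\<bar>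
    \<le> (\<Sum>j<m. \<bar>W' j\<bar>) * D + ((\<Sum>j<m. \<bar>W' j - W j\<bar>) + \<bar>b' - b\<bar>) * M"
proof -
  have "((\<Sum>j<m. W' j * h' j) - b') - ((\<Sum>j<m. W j * h j) - b)
      = (\<Sum>j<m. W' j * (h' j - h j)) + ((\<Sum>j<m. (W' j - W j) * h j) - (b' - b))"
    by (simp add: algebra_simps sum.distrib sum_subtractf)
  moreover have "\<bar>\<Sum>j<m. W' j * (h' j - h j)\<bar> \<le> (\<Sum>j<m. \<bar>W' j\<bar>) * D"
  proof -
    have "\<bar>\<Sum>j<m. W' j * (h' j - h j)\<bar> \<le> (\<Sum>j<m. \<bar>W' j * (h' j - h j)\<bar>)" by (rule sum_abs)
    also have "\<dots> \<le> (\<Sum>j<m. \<bar>W' j\<bar> * D)"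
      using assms by (intro sum_mono) (auto simp: abs_mult intro!: mult_left_mono)
    finally show ?thesis by (simp add: sum_distrib_right)
  qed
  moreover have "\<bar>(\<Sum>j<m. (W' j - W j) * h j) - (b' - b)\<bar>
      \<le> ((\<Sum>j<m. \<bar>W' j - W j\<bar>) + \<bar>b' - b\<bar>) * M"
    using assms(1,2) by (intro affine_bound)
  ultimately show ?thesis by linarith
qed

lemma relu_le_abs: "\<bar>relu x\<bar> \<le> \<bar>x\<bar>" and relu_nonexp: "\<bar>relu x - relu y\<bar> \<le> \<bar>x - y\<bar>"
  by (auto simp: relu_def)

text \<open>
  One step of the perturbation recursion: \<open>t\<close> bounds the layer sum of the weights, \<open>\<delta>\<close> that of
  their perturbation.
\<close>

lemma perturbation_step:
  fixes a :: real
  assumes "0 \<le> t" "t \<le> a - 1" "0 \<le> \<delta>" "0 \<le> U" "W \<le> t + \<delta>" "E \<le> \<delta>"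
  shows "W * (a ^ l * (exp U - 1)) + E * a ^ l \<le> a ^ Suc l * (exp (U + \<delta>) - 1)"
proof -
  have a: "a \<ge> 1" using assms by simp
  have U: "exp U \<ge> 1" using assms by simp
  have "W * (exp U - 1) + E \<le> (t + \<delta>) * (exp U - 1) + \<delta>"
    using assms U by (intro add_mono mult_right_mono) auto
  also have "\<dots> \<le> (a - 1 + \<delta>) * (exp U - 1) + \<delta>"
    using assms U by (intro add_mono mult_right_mono) auto
  also have "\<dots> = (a - 1) * (exp U - 1) + \<delta> * exp U" by (simp add: algebra_simps)
  also have "\<dots> \<le> a * (exp U - 1) + a * (\<delta> * exp U)"
    using a U assms mult_right_mono[of 1 a "\<delta> * exp U"] by (intro add_mono mult_right_mono) auto
  also have "\<dots> = a * ((1 + \<delta>) * exp U - 1)" by (simp add: algebra_simps)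
  \<comment> \<open>The inequality \<open>1 + \<delta> \<le> exp \<delta>\<close> makes the
    contributions of the layers add up in the exponent.\<close>
  also have "\<dots> \<le> a * (exp \<delta> * exp U - 1)"
    using a by (intro mult_left_mono diff_right_mono mult_right_mono exp_ge_add_one_self) auto
  finally have "W * (exp U - 1) + E \<le> a * (exp (U + \<delta>) - 1)" by (simp add: exp_add mult.commute)
  then have "a ^ l * (W * (exp U - 1) + E) \<le> a ^ l * (a * (exp (U + \<delta>) - 1))"
    using a by (intro mult_left_mono) auto
  then show ?thesis by (simp add: algebra_simps)
qed

context
  fixes ds :: "nat list" and \<theta> :: "param \<Rightarrow> real" and x :: "nat \<Rightarrow> real" and R :: real and w :: nat
  assumes R: "R \<ge> 0" and \<theta>R: "\<And>q. q \<in> params ds \<Longrightarrow> \<bar>\<theta> q\<bar> \<le> R"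
    and w: "\<And>l. l < length ds \<Longrightarrow> ds ! l \<le> w"
    and x: "\<And>i. i < ds ! 0 \<Longrightarrow> \<bar>x i\<bar> \<le> 1"
begin

lemma layer_sum_le:
  assumes "1 \<le> l" "l < length ds"
  shows "(\<Sum>q\<in>layer_params ds l. \<bar>\<theta> q\<bar>) \<le> (1 + R * (w + 1)\<^sup>2) - 1"
proof -
  have "(\<Sum>q\<in>layer_params ds l. \<bar>\<theta> q\<bar>) \<le> (\<Sum>q\<in>layer_params ds l. R)"
    using assms by (intro sum_mono \<theta>R) (auto simp: params_eq_layers)
  also have "\<dots> = R * real (card (layer_params ds l))" by simp
  also have "\<dots> \<le> R * real ((w + 1)\<^sup>2)"
    using assms w R by (intro mult_left_mono of_nat_mono card_layer_params) auto
  finally show ?thesis by simp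
qed

lemma hidden_bound:
  "l < length ds \<Longrightarrow> i < ds ! l \<Longrightarrow> \<bar>hidden ds \<theta> x l i\<bar> \<le> (1 + R * (w + 1)\<^sup>2) ^ l"
proof (induction l arbitrary: i)
  case 0
  then show ?case using x by simp
next
  case (Suc l)
  define a where "a = 1 + R * (w + 1)\<^sup>2"
  have a: "a \<ge> 1" using R by (simp add: a_def)
  have "\<bar>hidden ds \<theta> x (Suc l) i\<bar> \<le>
      \<bar>(\<Sum>j<ds ! l. \<theta> (Weight (Suc l) i j) * hidden ds \<theta> x l j) - \<theta> (Bias (Suc l) i)\<bar>"
    by (simp add: relu_le_abs)
  also have "\<dots> \<le> ((\<Sum>j<ds ! l. \<bar>\<theta> (Weight (Suc l) i j)\<bar>) + \<bar>\<theta> (Bias (Suc l) i)\<bar>) * a ^ l"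
    using Suc a by (intro affine_bound) (auto simp: a_def)
  also have "\<dots> \<le> a * a ^ l"
    using row_sum_le_layer_sum[of i ds "Suc l" \<theta>] layer_sum_le[of "Suc l"] Suc a
    by (intro mult_right_mono) (auto simp: a_def)
  finally show ?case by (simp add: a_def)
qed

text \<open>Only \<open>\<theta>\<close> is bounded; \<open>\<theta>'\<close> is arbitrary, its
  weights being estimated by those of \<open>\<theta>\<close> plus the perturbation. The price is an
  exponential instead of a linear dependence on the l1 distance.\<close>

lemma hidden_perturbation:
  fixes \<theta>' :: "param \<Rightarrow> real"
  shows "l < length ds \<Longrightarrow> i < ds ! l \<Longrightarrow> \<bar>hidden ds \<theta>' x l i - hidden ds \<theta> x l i\<bar>
    \<le> (1 + R * (w + 1)\<^sup>2) ^ l * (exp (\<Sum>k\<in>{1..l}. \<Sum>q\<in>layer_params ds k. \<bar>\<theta>' q - \<theta> q\<bar>) - 1)"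
proof (induction l arbitrary: i)
  case (Suc l)
  define a where "a = 1 + R * (w + 1)\<^sup>2"
  define t where "t = (\<Sum>q\<in>layer_params ds (Suc l). \<bar>\<theta> q\<bar>)"
  define \<delta> where "\<delta> = (\<Sum>q\<in>layer_params ds (Suc l). \<bar>\<theta>' q - \<theta> q\<bar>)"
  define U where "U = (\<Sum>k\<in>{1..l}. \<Sum>q\<in>layer_params ds k. \<bar>\<theta>' q - \<theta> q\<bar>)"
  define W where "W = (\<Sum>j<ds ! l. \<bar>\<theta>' (Weight (Suc l) i j)\<bar>)"
  define E where "E = (\<Sum>j<ds ! l. \<bar>\<theta>' (Weight (Suc l) i j) - \<theta> (Weight (Suc l) i j)\<bar>)
      + \<bar>\<theta>' (Bias (Suc l) i) - \<theta> (Bias (Suc l) i)\<bar>"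
  have a: "a \<ge> 1" using R by (simp add: a_def)
  have E: "E \<le> \<delta>"
    using row_sum_le_layer_sum[of i ds "Suc l" "\<lambda>q. \<theta>' q - \<theta> q"] Suc.prems by (simp add: E_def \<delta>_def)
  have "W \<le> (\<Sum>j<ds ! l. \<bar>\<theta> (Weight (Suc l) i j)\<bar> + \<bar>\<theta>' (Weight (Suc l) i j) - \<theta> (Weight (Suc l) i j)\<bar>)"
    unfolding W_def by (intro sum_mono) linarith
  then have W: "W \<le> t + \<delta>"
    using row_sum_le_layer_sum[of i ds "Suc l" \<theta>] E Suc.prems
    by (simp add: E_def t_def sum.distrib)
  have "\<bar>hidden ds \<theta>' x (Suc l) i - hidden ds \<theta> x (Suc l) i\<bar> \<le>
      \<bar>((\<Sum>j<ds ! l. \<theta>' (Weight (Suc l) i j) * hidden ds \<theta>' x l j) - \<theta>' (Bias (Suc l) i))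
       - ((\<Sum>j<ds ! l. \<theta> (Weight (Suc l) i j) * hidden ds \<theta> x l j) - \<theta> (Bias (Suc l) i))\<bar>"
    by (simp add: relu_nonexp)
  also have "\<dots> \<le> W * (a ^ l * (exp U - 1)) + E * a ^ l"
    unfolding W_def E_def using Suc hidden_bound a
    by (intro affine_diff_bound) (auto simp: a_def U_def)
  also have "\<dots> \<le> a ^ Suc l * (exp (U + \<delta>) - 1)"
    using W E layer_sum_le[of "Suc l"] Suc.prems
    by (intro perturbation_step[of t]) (auto simp: t_def \<delta>_def U_def a_def intro!: sum_nonneg)
  finally show ?case by (simp add: a_def U_def \<delta>_def)
qed simp

lemma net_perturbation:
  fixes \<theta>' :: "param \<Rightarrow> real"
  assumes len: "length ds = L + 1" "L \<ge> 1" and out: "ds ! L = 1"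
  shows "\<bar>net ds \<theta>' x - net ds \<theta> x\<bar>
    \<le> (1 + R * (w + 1)\<^sup>2) ^ L * (exp (\<Sum>q\<in>params ds. \<bar>\<theta>' q - \<theta> q\<bar>) - 1)"
proof -
  define l where "l = L - 1"
  have L: "L = Suc l" using len by (simp add: l_def)
  define a where "a = 1 + R * (w + 1)\<^sup>2"
  define t where "t = (\<Sum>q\<in>layer_params ds L. \<bar>\<theta> q\<bar>)"
  define \<delta> where "\<delta> = (\<Sum>q\<in>layer_params ds L. \<bar>\<theta>' q - \<theta> q\<bar>)"
  define U where "U = (\<Sum>k\<in>{1..l}. \<Sum>q\<in>layer_params ds k. \<bar>\<theta>' q - \<theta> q\<bar>)"
  define W where "W = (\<Sum>j<ds ! l. \<bar>\<theta>' (Weight L 0 j)\<bar>)"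
  define E where "E = (\<Sum>j<ds ! l. \<bar>\<theta>' (Weight L 0 j) - \<theta> (Weight L 0 j)\<bar>)
      + \<bar>\<theta>' (Bias L 0) - \<theta> (Bias L 0)\<bar>"
  have a: "a \<ge> 1" using R by (simp add: a_def)
  have E: "E \<le> \<delta>"
    using row_sum_le_layer_sum[of 0 ds L "\<lambda>q. \<theta>' q - \<theta> q"] out by (simp add: E_def \<delta>_def l_def)
  have "W \<le> (\<Sum>j<ds ! l. \<bar>\<theta> (Weight L 0 j)\<bar> + \<bar>\<theta>' (Weight L 0 j) - \<theta> (Weight L 0 j)\<bar>)"
    unfolding W_def by (intro sum_mono) linarith
  then have W: "W \<le> t + \<delta>"
    using row_sum_le_layer_sum[of 0 ds L \<theta>] E out
    by (simp add: E_def t_def sum.distrib l_def)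
  \<comment> \<open>The output bias is added while hidden biases are subtracted, so the affine
    estimate is applied with the negated bias.\<close>
  have "\<bar>net ds \<theta>' x - net ds \<theta> x\<bar> =
      \<bar>((\<Sum>j<ds ! l. \<theta>' (Weight L 0 j) * hidden ds \<theta>' x l j) - (- \<theta>' (Bias L 0)))
       - ((\<Sum>j<ds ! l. \<theta> (Weight L 0 j) * hidden ds \<theta> x l j) - (- \<theta> (Bias L 0)))\<bar>"
    using len by (simp add: net_def l_def)
  also have "\<dots> \<le> W * (a ^ l * (exp U - 1)) + ((\<Sum>j<ds ! l. \<bar>\<theta>' (Weight L 0 j) - \<theta> (Weight L 0 j)\<bar>)
      + \<bar>(- \<theta>' (Bias L 0)) - (- \<theta> (Bias L 0))\<bar>) * a ^ l"
    unfolding W_def using hidden_bound hidden_perturbation a L len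
    by (intro affine_diff_bound) (auto simp: a_def U_def)
  also have "\<dots> = W * (a ^ l * (exp U - 1)) + E * a ^ l"
    by (simp add: E_def abs_minus_commute)
  also have "\<dots> \<le> a ^ Suc l * (exp (U + \<delta>) - 1)"
    using W E layer_sum_le[of L] len
    by (intro perturbation_step[of t]) (auto simp: t_def \<delta>_def U_def a_def intro!: sum_nonneg)
  also have "U + \<delta> = (\<Sum>k\<in>{1..<length ds}. \<Sum>q\<in>layer_params ds k. \<bar>\<theta>' q - \<theta> q\<bar>)"
  proof -
    have "{1..<length ds} = insert L {1..l}" using len L by auto
    then show ?thesis using L by (simp add: U_def \<delta>_def)
  qed
  also have "\<dots> = (\<Sum>q\<in>params ds. \<bar>\<theta>' q - \<theta> q\<bar>)"
    unfolding params_eq_layers using layer_params_disjoint by (subst sum.UNION_disjoint) auto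
  finally show ?thesis by (simp add: a_def L)
qed

end

section \<open>Measurability of networks in the input and in the parameters\<close>

lemma hidden_measurable_input:
  "l < length ds \<Longrightarrow> i < ds ! l \<Longrightarrow>
    (\<lambda>x. hidden ds \<theta> x l i) \<in> borel_measurable (\<Pi>\<^sub>M i\<in>{..<ds ! 0}. borel)"
proof (induction l arbitrary: i)
  case (Suc l)
  have "(\<lambda>x. (\<Sum>j<ds ! l. \<theta> (Weight (Suc l) i j) * hidden ds \<theta> x l j) - \<theta> (Bias (Suc l) i))
      \<in> borel_measurable (\<Pi>\<^sub>M i\<in>{..<ds ! 0}. borel)"
    using Suc by (intro borel_measurable_diff borel_measurable_sum borel_measurable_times) auto
  then show ?case by (simp add: relu_def)
qed (simp add: measurable_component_singleton)

lemma net_measurable_input: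
  assumes "length ds \<ge> 2"
  shows "net ds \<theta> \<in> borel_measurable (\<Pi>\<^sub>M i\<in>{..<ds ! 0}. borel)"
  unfolding net_def Let_def
  using assms hidden_measurable_input[of "length ds - 2" ds]
  by (intro borel_measurable_add borel_measurable_sum borel_measurable_times)
     (auto intro!: hidden_measurable_input)

lemma hidden_measurable_params:
  "l < length ds \<Longrightarrow> i < ds ! l \<Longrightarrow>
    (\<lambda>\<theta>. hidden ds \<theta> x l i) \<in> borel_measurable (\<Pi>\<^sub>M q\<in>params ds. borel)"
proof (induction l arbitrary: i)
  case (Suc l)
  have "Weight (Suc l) i j \<in> params ds" if "j < ds ! l" for j
    using that Suc.prems by (auto simp: params_def)
  moreover have "Bias (Suc l) i \<in> params ds" using Suc.prems by (auto simp: params_def)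
  ultimately have "(\<lambda>\<theta>. (\<Sum>j<ds ! l. \<theta> (Weight (Suc l) i j) * hidden ds \<theta> x l j) - \<theta> (Bias (Suc l) i))
      \<in> borel_measurable (\<Pi>\<^sub>M q\<in>params ds. borel)"
    using Suc by (intro borel_measurable_diff borel_measurable_sum borel_measurable_times
        measurable_component_singleton) auto
  then show ?case by (simp add: relu_def)
qed simp

lemma net_measurable_params:
  assumes "length ds \<ge> 2" "0 < ds ! (length ds - 1)"
  shows "(\<lambda>\<theta>. net ds \<theta> x) \<in> borel_measurable (\<Pi>\<^sub>M q\<in>params ds. borel)"
proof -
  have "Weight (length ds - 1) 0 j \<in> params ds" if "j < ds ! (length ds - 1 - 1)" for j
    using that assms by (auto simp: params_def)
  moreover have "Bias (length ds - 1) 0 \<in> params ds" using assms by (auto simp: params_def)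
  ultimately show ?thesis
    unfolding net_def Let_def using assms
    by (intro borel_measurable_add borel_measurable_sum borel_measurable_times
        measurable_component_singleton hidden_measurable_params) auto
qed

text \<open>Network values may grow exponentially with the depth, whereas the responses lie in
  \<open>[- K, K]\<close> on a likely event. There clipping a network can only improve its fit, so
  it is enough to cover clipped networks.\<close>

definition clip :: "real \<Rightarrow> real \<Rightarrow> real" where
  "clip K y = max (- K) (min K y)"

lemma clip_nonexp: "\<bar>clip K y - clip K z\<bar> \<le> \<bar>y - z\<bar>"
  by (auto simp: clip_def)

lemma abs_clip_le: "K \<ge> 0 \<Longrightarrow> \<bar>clip K y\<bar> \<le> K"
  by (auto simp: clip_def)

lemma clip_measurable [measurable]: "clip K \<in> borel_measurable borel"
  unfolding clip_def[abs_def] by measurable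

lemma hidden_cong:
  assumes "\<And>q. q \<in> params ds \<Longrightarrow> \<theta> q = \<theta>' q" "\<And>i. i < ds ! 0 \<Longrightarrow> x i = x' i"
  shows "l < length ds \<Longrightarrow> i < ds ! l \<Longrightarrow> hidden ds \<theta> x l i = hidden ds \<theta>' x' l i"
proof (induction l arbitrary: i)
  case (Suc l)
  have "\<theta> (Weight (Suc l) i j) = \<theta>' (Weight (Suc l) i j)" if "j < ds ! l" for j
    using that Suc.prems by (intro assms(1)) (auto simp: params_def)
  moreover have "\<theta> (Bias (Suc l) i) = \<theta>' (Bias (Suc l) i)"
    using Suc.prems by (intro assms(1)) (auto simp: params_def)
  ultimately show ?case using Suc by simp
qed (simp add: assms(2))

lemma net_cong:
  assumes "\<And>q. q \<in> params ds \<Longrightarrow> \<theta> q = \<theta>' q" "\<And>i. i < ds ! 0 \<Longrightarrow> x i = x' i"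
    and "length ds \<ge> 2" "0 < ds ! (length ds - 1)"
  shows "net ds \<theta> x = net ds \<theta>' x'"
proof -
  have "\<theta> (Weight (length ds - 1) 0 j) = \<theta>' (Weight (length ds - 1) 0 j)" if "j < ds ! (length ds - 1 - 1)" for j
    using that assms(3,4) by (intro assms(1)) (auto simp: params_def)
  moreover have "\<theta> (Bias (length ds - 1) 0) = \<theta>' (Bias (length ds - 1) 0)"
    using assms(3,4) by (intro assms(1)) (auto simp: params_def)
  moreover have "hidden ds \<theta> x (length ds - 1 - 1) j = hidden ds \<theta>' x' (length ds - 1 - 1) j"
    if "j < ds ! (length ds - 1 - 1)" for j
    using that assms(3) by (intro hidden_cong assms(1,2)) auto
  ultimately show ?thesis by (simp add: net_def Let_def)
qed

subsection \<open>Gated networks\<close>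

text \<open>
  Fixing which units are active turns the network into a function that is polynomial in the
  parameters and affine in a scalar input.
\<close>

fun gated :: "nat list \<Rightarrow> (param \<Rightarrow> real) \<Rightarrow> (nat \<times> nat) set \<Rightarrow> real \<Rightarrow> nat \<Rightarrow> nat \<Rightarrow> real" where
  "gated ds \<theta> a z 0 i = z"
| "gated ds \<theta> a z (Suc l) i = (if (Suc l, i) \<in> a
     then (\<Sum>j<ds ! l. \<theta> (Weight (Suc l) i j) * gated ds \<theta> a z l j) - \<theta> (Bias (Suc l) i) else 0)"

definition gated_pre ::
  "nat list \<Rightarrow> (param \<Rightarrow> real) \<Rightarrow> (nat \<times> nat) set \<Rightarrow> real \<Rightarrow> nat \<times> nat \<Rightarrow> real" where
  "gated_pre ds \<theta> a z = (\<lambda>(l, i).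
     (\<Sum>j<ds ! (l - 1). \<theta> (Weight l i j) * gated ds \<theta> a z (l - 1) j) - \<theta> (Bias l i))"

definition gated_net :: "nat list \<Rightarrow> (param \<Rightarrow> real) \<Rightarrow> (nat \<times> nat) set \<Rightarrow> real \<Rightarrow> real" where
  "gated_net ds \<theta> a z = (let L = length ds - 1 in
     (\<Sum>j<ds ! (L - 1). \<theta> (Weight L 0 j) * gated ds \<theta> a z (L - 1) j) + \<theta> (Bias L 0))"

definition units :: "nat list \<Rightarrow> (nat \<times> nat) set" where
  "units ds = (SIGMA l:{1..<length ds - 1}. {..<ds ! l})"

text \<open>A scalar input \<open>z\<close> is passed to the network as the constant sequence
  \<open>\<lambda>_. z\<close>. A unit with preactivation zero counts as inactive, in agreement with
  its output zero.\<close>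

definition active :: "nat list \<Rightarrow> (param \<Rightarrow> real) \<Rightarrow> real \<Rightarrow> (nat \<times> nat) set" where
  "active ds \<theta> z = {(l, i) \<in> units ds.
     0 < (\<Sum>j<ds ! (l - 1). \<theta> (Weight l i j) * hidden ds \<theta> (\<lambda>_. z) (l - 1) j) - \<theta> (Bias l i)}"

lemma finite_units [simp]: "finite (units ds)"
  by (simp add: units_def)

lemma active_subset: "active ds \<theta> z \<subseteq> units ds"
  by (auto simp: active_def)

lemma gated_affine: "\<exists>\<alpha> \<beta>. \<forall>z. gated ds \<theta> a z l i = \<alpha> + \<beta> * z"
proof (induction l arbitrary: i)
  case 0
  show ?case by (intro exI[of _ 0] exI[of _ 1]) simp
next
  case (Suc l)
  then obtain \<alpha> \<beta> where *: "\<And>i z. gated ds \<theta> a z l i = \<alpha> i + \<beta> i * z" by metis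
  show ?case
  proof (cases "(Suc l, i) \<in> a")
    case True
    then show ?thesis
      by (intro exI[of _ "(\<Sum>j<ds ! l. \<theta> (Weight (Suc l) i j) * \<alpha> j) - \<theta> (Bias (Suc l) i)"]
          exI[of _ "\<Sum>j<ds ! l. \<theta> (Weight (Suc l) i j) * \<beta> j"])
        (simp add: * algebra_simps sum.distrib sum_distrib_left)
  next
    case False
    then show ?thesis by (intro exI[of _ 0]) simp
  qed
qed

lemma gated_pre_affine: "\<exists>\<alpha> \<beta>. \<forall>z. gated_pre ds \<theta> a z u = \<alpha> + \<beta> * z"
proof -
  obtain l i where u: "u = (l, i)" by fastforce
  obtain \<alpha> \<beta> where *: "\<And>i z. gated ds \<theta> a z (l - 1) i = \<alpha> i + \<beta> i * z"
    using gated_affine by metis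
  show ?thesis
    by (intro exI[of _ "(\<Sum>j<ds ! (l - 1). \<theta> (Weight l i j) * \<alpha> j) - \<theta> (Bias l i)"]
        exI[of _ "\<Sum>j<ds ! (l - 1). \<theta> (Weight l i j) * \<beta> j"])
      (simp add: u gated_pre_def * algebra_simps sum.distrib sum_distrib_left del: One_nat_def)
qed

lemma gated_net_affine: "\<exists>\<alpha> \<beta>. \<forall>z. gated_net ds \<theta> a z = \<alpha> + \<beta> * z"
proof -
  define L where "L = length ds - 1"
  obtain \<alpha> \<beta> where *: "\<And>i z. gated ds \<theta> a z (L - 1) i = \<alpha> i + \<beta> i * z"
    using gated_affine by metis
  show ?thesis
    by (intro exI[of _ "(\<Sum>j<ds ! (L - 1). \<theta> (Weight L 0 j) * \<alpha> j) + \<theta> (Bias L 0)"]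
        exI[of _ "\<Sum>j<ds ! (L - 1). \<theta> (Weight L 0 j) * \<beta> j"])
      (simp add: gated_net_def L_def[symmetric] Let_def * algebra_simps sum.distrib sum_distrib_left
        del: One_nat_def)
qed

lemma gated_poly_fun:
  assumes "finite A" "\<And>q. poly_fun A 1 (\<lambda>x. \<theta> x q)"
  shows "poly_fun A l (\<lambda>x. gated ds (\<theta> x) a z l i)"
proof (induction l arbitrary: i)
  case (Suc l)
  have "poly_fun A (1 + l) (\<lambda>x. (\<Sum>j<ds ! l. \<theta> x (Weight (Suc l) i j) * gated ds (\<theta> x) a z l j)
      - \<theta> x (Bias (Suc l) i))"
    using Suc assms by (intro poly_fun_diff poly_fun_sum poly_fun_mult poly_fun_mono[OF assms(2)]) auto
  then show ?case by (cases "(Suc l, i) \<in> a") (simp_all add: poly_fun_const)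
qed (simp add: poly_fun_const)

lemma gated_pre_poly_fun:
  assumes "finite A" "\<And>q. poly_fun A 1 (\<lambda>x. \<theta> x q)" "1 \<le> l"
  shows "poly_fun A l (\<lambda>x. gated_pre ds (\<theta> x) a z (l, i))"
proof -
  have "poly_fun A (1 + (l - 1)) (\<lambda>x. gated_pre ds (\<theta> x) a z (l, i))"
    unfolding gated_pre_def prod.case using assms
    by (intro poly_fun_diff poly_fun_sum poly_fun_mult gated_poly_fun poly_fun_mono[OF assms(2)]) auto
  then show ?thesis using assms(3) by simp
qed

lemma gated_net_poly_fun:
  assumes "finite A" "\<And>q. poly_fun A 1 (\<lambda>x. \<theta> x q)" "length ds \<ge> 2"
  shows "poly_fun A (length ds - 1) (\<lambda>x. gated_net ds (\<theta> x) a z)"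
proof -
  have "poly_fun A (1 + (length ds - 1 - 1)) (\<lambda>x. gated_net ds (\<theta> x) a z)"
    unfolding gated_net_def Let_def using assms
    by (intro poly_fun.add poly_fun_sum poly_fun_mult gated_poly_fun poly_fun_mono[OF assms(2)]) auto
  moreover have "1 + (length ds - 1 - 1) = length ds - 1" using assms(3) by simp
  ultimately show ?thesis by (simp only:)
qed

lemma hidden_eq_gated:
  assumes "\<And>k i. k \<le> l \<Longrightarrow> (k, i) \<in> units ds \<Longrightarrow> (k, i) \<in> a \<longleftrightarrow> (k, i) \<in> active ds \<theta> z"
    and "l < length ds - 1" "i < ds ! l"
  shows "hidden ds \<theta> (\<lambda>_. z) l i = gated ds \<theta> a z l i"
  using assms
proof (induction l arbitrary: i)
  case (Suc l)
  have IH: "hidden ds \<theta> (\<lambda>_. z) l j = gated ds \<theta> a z l j" if "j < ds ! l" for j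
    using Suc that by (intro Suc.IH) auto
  have "(Suc l, i) \<in> units ds" using Suc.prems by (simp add: units_def)
  then have "(Suc l, i) \<in> a \<longleftrightarrow>
      0 < (\<Sum>j<ds ! l. \<theta> (Weight (Suc l) i j) * hidden ds \<theta> (\<lambda>_. z) l j) - \<theta> (Bias (Suc l) i)"
    using Suc.prems(1)[of "Suc l" i] by (auto simp: active_def)
  then show ?case using IH by (auto simp: relu_def)
qed simp

text \<open>The preactivation of a unit sees only the gates of earlier layers. Agreement below layer
  \<open>l\<close> therefore decides layer \<open>l\<close>, which is what inductions over the
  layers rely on.\<close>

lemma active_iff_gated_pre:
  assumes "\<And>k i. k < l \<Longrightarrow> (k, i) \<in> units ds \<Longrightarrow> (k, i) \<in> a \<longleftrightarrow> (k, i) \<in> active ds \<theta> z"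
    and "(l, i) \<in> units ds"
  shows "(l, i) \<in> active ds \<theta> z \<longleftrightarrow> 0 < gated_pre ds \<theta> a z (l, i)"
proof -
  have l: "1 \<le> l" "l < length ds - 1" using assms(2) by (auto simp: units_def)
  then have "hidden ds \<theta> (\<lambda>_. z) (l - 1) j = gated ds \<theta> a z (l - 1) j" if "j < ds ! (l - 1)" for j
    using that by (intro hidden_eq_gated assms(1)) auto
  then show ?thesis using assms(2) by (simp add: active_def gated_pre_def)
qed

lemma net_eq_gated:
  assumes "\<And>u. u \<in> units ds \<Longrightarrow> u \<in> a \<longleftrightarrow> u \<in> active ds \<theta> z" "length ds \<ge> 2"
  shows "net ds \<theta> (\<lambda>_. z) = gated_net ds \<theta> a z"
proof -
  have "hidden ds \<theta> (\<lambda>_. z) (length ds - 1 - 1) j = gated ds \<theta> a z (length ds - 1 - 1) j"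
    if "j < ds ! (length ds - 1 - 1)" for j
    using that assms by (intro hidden_eq_gated) auto
  then show ?thesis by (simp add: net_def gated_net_def Let_def)
qed

text \<open>By induction on the layer: while the earlier gates follow the common pattern, a
  preactivation is affine in the input, and an affine function that is positive at both ends, or
  nonpositive at both ends, is so in between.\<close>

lemma active_between:
  assumes "active ds \<theta> y = active ds \<theta> y'" "y \<le> z" "z \<le> y'"
  shows "active ds \<theta> z = active ds \<theta> y"
proof -
  define a where "a = active ds \<theta> y"
  have ay: "active ds \<theta> y = a" "active ds \<theta> y' = a" using assms(1) by (simp_all add: a_def)
  have pos: "0 < \<alpha> + \<beta> * z" if "0 < \<alpha> + \<beta> * y" "0 < \<alpha> + \<beta> * y'" for \<alpha> \<beta> :: real
  proof (cases "\<beta> \<ge> 0")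
    case True
    then have "\<beta> * y \<le> \<beta> * z" using assms by (intro mult_left_mono)
    then show ?thesis using that by linarith
  next
    case False
    then have "\<beta> * y' \<le> \<beta> * z" using assms by (intro mult_left_mono_neg) auto
    then show ?thesis using that by linarith
  qed
  have npos: "\<alpha> + \<beta> * z \<le> 0" if "\<alpha> + \<beta> * y \<le> 0" "\<alpha> + \<beta> * y' \<le> 0" for \<alpha> \<beta> :: real
  proof (cases "\<beta> \<ge> 0")
    case True
    then have "\<beta> * z \<le> \<beta> * y'" using assms by (intro mult_left_mono)
    then show ?thesis using that by linarith
  next
    case False
    then have "\<beta> * z \<le> \<beta> * y" using assms by (intro mult_left_mono_neg) auto
    then show ?thesis using that by linarith
  qed
  have "\<forall>i. (l, i) \<in> units ds \<longrightarrow> ((l, i) \<in> a \<longleftrightarrow> (l, i) \<in> active ds \<theta> z)" for l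
  proof (induction l rule: less_induct)
    case (less l)
    show ?case
    proof (intro allI impI)
      fix i assume u: "(l, i) \<in> units ds"
      obtain \<alpha> \<beta> where ab: "\<And>z. gated_pre ds \<theta> a z (l, i) = \<alpha> + \<beta> * z"
        using gated_pre_affine by metis
      have "(l, i) \<in> a \<longleftrightarrow> 0 < \<alpha> + \<beta> * y" "(l, i) \<in> a \<longleftrightarrow> 0 < \<alpha> + \<beta> * y'"
        using active_iff_gated_pre[of l ds a \<theta> y i] active_iff_gated_pre[of l ds a \<theta> y' i] u
        by (simp_all add: ab ay)
      moreover have "(l, i) \<in> active ds \<theta> z \<longleftrightarrow> 0 < \<alpha> + \<beta> * z"
        using active_iff_gated_pre[of l ds a \<theta> z i] u less by (simp add: ab)
      ultimately show "(l, i) \<in> a \<longleftrightarrow> (l, i) \<in> active ds \<theta> z"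
        using pos[of \<alpha> \<beta>] npos[of \<alpha> \<beta>] by (meson not_less)
    qed
  qed
  then have "\<And>u. u \<in> units ds \<Longrightarrow> u \<in> a \<longleftrightarrow> u \<in> active ds \<theta> z" by auto
  moreover have "a \<subseteq> units ds" "active ds \<theta> z \<subseteq> units ds" unfolding a_def by (rule active_subset)+
  ultimately show ?thesis unfolding a_def by blast
qed

subsection \<open>Counting activation changes along a grid\<close>

text \<open>A change is labelled with the number of breaks before it. Two changes with the same
  label have no break from the first to the second, which \<open>once\<close> excludes, and the
  labels run from 0 to \<open>card Br\<close>.\<close>

lemma card_changes:
  fixes s :: "nat \<Rightarrow> bool"
  assumes "finite Br"
    and once: "\<And>k k'. k < k' \<Longrightarrow> k' < m \<Longrightarrow> (\<And>b. k \<le> b \<Longrightarrow> b \<le> k' \<Longrightarrow> b \<notin> Br) \<Longrightarrow>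
      s k \<noteq> s (Suc k) \<Longrightarrow> s k' \<noteq> s (Suc k') \<Longrightarrow> False"
  shows "card {k. k < m \<and> k \<notin> Br \<and> s k \<noteq> s (Suc k)} \<le> card Br + 1"
proof -
  let ?C = "{k. k < m \<and> k \<notin> Br \<and> s k \<noteq> s (Suc k)}"
  define f where "f k = card {b \<in> Br. b < k}" for k
  have less: False if kk: "k \<in> ?C" "k' \<in> ?C" "k < k'" "f k = f k'" for k k'
  proof -
    have "{b \<in> Br. b < k} \<subseteq> {b \<in> Br. b < k'}" using kk(3) by auto
    moreover have "finite {b \<in> Br. b < k'}" using assms(1) by simp
    ultimately have eq: "{b \<in> Br. b < k} = {b \<in> Br. b < k'}"
      using kk(4) by (intro card_subset_eq) (simp_all add: f_def)
    have "b \<notin> Br" if "k \<le> b" "b \<le> k'" for b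
    proof
      assume "b \<in> Br"
      moreover from this have "b \<noteq> k'" using kk(2) by blast
      ultimately have "b \<in> {b \<in> Br. b < k'}" using that by simp
      then show False using that(1) unfolding eq[symmetric] by simp
    qed
    then show False using kk by (intro once[of k k']) auto
  qed
  have "inj_on f ?C"
  proof (rule inj_onI, rule ccontr)
    fix k k' assume "k \<in> ?C" "k' \<in> ?C" "f k = f k'" "k \<noteq> k'"
    then show False using less[of k k'] less[of k' k] by (auto simp: neq_iff)
  qed
  moreover have "f ` ?C \<subseteq> {..card Br}"
    using assms(1) by (auto simp: f_def intro!: card_mono)
  ultimately show ?thesis using card_inj_on_le[of f ?C "{..card Br}"] by simp
qed

lemma affine_changes_once:
  fixes \<alpha> \<beta> :: real and z :: "nat \<Rightarrow> real"
  assumes "mono z" "k < k'"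
    and "(c < \<alpha> + \<beta> * z k) \<noteq> (c < \<alpha> + \<beta> * z (Suc k))"
    and "(c < \<alpha> + \<beta> * z k') \<noteq> (c < \<alpha> + \<beta> * z (Suc k'))"
  shows False
proof -
  have z: "z k \<le> z (Suc k)" "z (Suc k) \<le> z k'" "z k' \<le> z (Suc k')"
    using assms(1,2) by (auto intro: monoD)
  show False
  proof (cases "\<beta> \<ge> 0")
    case True
    then have "\<beta> * z k \<le> \<beta> * z (Suc k)" "\<beta> * z (Suc k) \<le> \<beta> * z k'" "\<beta> * z k' \<le> \<beta> * z (Suc k')"
      using z by (auto intro: mult_left_mono)
    then show False using assms(3,4) by linarith
  next
    case False
    then have "\<beta> * z k \<ge> \<beta> * z (Suc k)" "\<beta> * z (Suc k) \<ge> \<beta> * z k'" "\<beta> * z k' \<ge> \<beta> * z (Suc k')"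
      using z by (auto intro: mult_left_mono_neg)
    then show False using assms(3,4) by linarith
  qed
qed

lemma constant_run:
  assumes "\<And>b. k \<le> b \<Longrightarrow> b \<le> k' \<Longrightarrow> F b = F (Suc b)"
  shows "k \<le> b \<Longrightarrow> b \<le> Suc k' \<Longrightarrow> F b = F k"
proof (induction b rule: dec_induct)
  case (step b)
  then show ?case using assms[of b] by simp
qed simp

text \<open>The index \<open>k\<close> stands for the grid cell from \<open>z k\<close> to
  \<open>z (Suc k)\<close>. Cutting the patterns off at layer \<open>l\<close> allows the breaks to
  be counted layer by layer.\<close>

definition breaks :: "nat list \<Rightarrow> (param \<Rightarrow> real) \<Rightarrow> (nat \<Rightarrow> real) \<Rightarrow> nat \<Rightarrow> nat \<Rightarrow> nat set" where
  "breaks ds \<theta> z m l = {k. k < m \<and>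
     active ds \<theta> (z k) \<inter> {..l} \<times> UNIV \<noteq> active ds \<theta> (z (Suc k)) \<inter> {..l} \<times> UNIV}"

lemma finite_breaks [simp]: "finite (breaks ds \<theta> z m l)"
  by (rule finite_subset[of _ "{..<m}"]) (auto simp: breaks_def)

text \<open>Between consecutive breaks of the first \<open>l\<close> layers a preactivation of the
  next layer is one affine function along the grid, so its positivity changes at most once. The
  units of that layer, at most \<open>w\<close> of them, thus add at most \<open>w\<close> breaks
  per run, and the number of runs is multiplied by at most \<open>w + 1\<close>.\<close>

lemma card_breaks:
  assumes z: "mono z" and w: "\<And>l. l < length ds \<Longrightarrow> ds ! l \<le> w"
  shows "card (breaks ds \<theta> z m l) + 1 \<le> (w + 1) ^ l"
proof (induction l)
  case 0
  have "breaks ds \<theta> z m 0 = {}" by (auto simp: breaks_def active_def units_def)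
  then show ?case by simp
next
  case (Suc l)
  let ?B = "breaks ds \<theta> z m l"
  let ?s = "\<lambda>i k. (Suc l, i) \<in> active ds \<theta> (z k)"
  let ?I = "if Suc l < length ds then {..<ds ! Suc l} else {}"
  let ?N = "\<lambda>i. {k. k < m \<and> k \<notin> ?B \<and> ?s i k \<noteq> ?s i (Suc k)}"
  have "breaks ds \<theta> z m (Suc l) \<subseteq> ?B \<union> (\<Union>i\<in>?I. ?N i)"
  proof
    fix k assume k: "k \<in> breaks ds \<theta> z m (Suc l)"
    show "k \<in> ?B \<union> (\<Union>i\<in>?I. ?N i)"
    proof (cases "k \<in> ?B")
      case False
      have "k < m" using k by (simp add: breaks_def)
      have "active ds \<theta> (z k) \<inter> {..Suc l} \<times> UNIV \<noteq> active ds \<theta> (z (Suc k)) \<inter> {..Suc l} \<times> UNIV"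
        using k unfolding breaks_def by blast
      then obtain u where u: "u \<in> {..Suc l} \<times> UNIV"
          "(u \<in> active ds \<theta> (z k)) \<noteq> (u \<in> active ds \<theta> (z (Suc k)))"
        by blast
      obtain l' i where li: "u = (l', i)" by fastforce
      have *: "((l', i) \<in> active ds \<theta> (z k)) \<noteq> ((l', i) \<in> active ds \<theta> (z (Suc k)))"
        using u(2) li by simp
      have "active ds \<theta> (z k) \<inter> {..l} \<times> UNIV = active ds \<theta> (z (Suc k)) \<inter> {..l} \<times> UNIV"
        using False \<open>k < m\<close> unfolding breaks_def by blast
      then have "(l', i) \<notin> {..l} \<times> UNIV" using * by blast
      then have "l' = Suc l" using u(1) li by auto
      moreover have "(l', i) \<in> units ds" using * active_subset by blast
      ultimately have "i \<in> ?I" "k \<in> ?N i" using * \<open>k < m\<close> False by (auto simp: units_def)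
      then show ?thesis by blast
    qed blast
  qed
  moreover have "card (?N i) \<le> card ?B + 1" for i
  proof (cases "(Suc l, i) \<in> units ds")
    case True
    show ?thesis
    proof (rule card_changes)
      fix k k' assume k: "k < k'" "k' < m" "\<And>b. k \<le> b \<Longrightarrow> b \<le> k' \<Longrightarrow> b \<notin> ?B"
        and ch: "?s i k \<noteq> ?s i (Suc k)" "?s i k' \<noteq> ?s i (Suc k')"
      define a where "a = active ds \<theta> (z k)"
      have run: "active ds \<theta> (z b) \<inter> {..l} \<times> UNIV = a \<inter> {..l} \<times> UNIV" if "k \<le> b" "b \<le> Suc k'" for b
        unfolding a_def
      proof (rule constant_run[of k k' "\<lambda>b. active ds \<theta> (z b) \<inter> {..l} \<times> UNIV", OF _ that])
        show "active ds \<theta> (z b) \<inter> {..l} \<times> UNIV = active ds \<theta> (z (Suc b)) \<inter> {..l} \<times> UNIV"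
          if "k \<le> b" "b \<le> k'" for b
          using k(2) k(3)[OF that] that unfolding breaks_def by auto
      qed
      obtain \<alpha> \<beta> where ab: "\<And>z. gated_pre ds \<theta> a z (Suc l, i) = \<alpha> + \<beta> * z"
        using gated_pre_affine by metis
      have "?s i b \<longleftrightarrow> 0 < \<alpha> + \<beta> * z b" if "k \<le> b" "b \<le> Suc k'" for b
      proof -
        have "(l', j) \<in> a \<longleftrightarrow> (l', j) \<in> active ds \<theta> (z b)" if "l' < Suc l" for l' j
        proof -
          have "(l', j) \<in> {..l} \<times> UNIV" using that by simp
          then show ?thesis using run[OF \<open>k \<le> b\<close> \<open>b \<le> Suc k'\<close>] by blast
        qed
        then show ?thesis using active_iff_gated_pre[of "Suc l" ds a \<theta> "z b" i] True ab by simp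
      qed
      then show False
        using affine_changes_once[OF z k(1), of 0 \<alpha> \<beta>] ch k(1) by auto
    qed simp
  next
    case False
    then have "\<not> ?s i k" for k using active_subset by blast
    then show ?thesis by simp
  qed
  ultimately have 1: "breaks ds \<theta> z m (Suc l) \<subseteq> ?B \<union> (\<Union>i\<in>?I. ?N i)"
    and 2: "\<And>i. card (?N i) \<le> card ?B + 1" by blast+
  have "card (breaks ds \<theta> z m (Suc l)) \<le> card ?B + (\<Sum>i\<in>?I. card ?B + 1)"
  proof -
    have "card (breaks ds \<theta> z m (Suc l)) \<le> card (?B \<union> (\<Union>i\<in>?I. ?N i))"
      by (rule card_mono[OF _ 1]) auto
    also have "\<dots> \<le> card ?B + card (\<Union>i\<in>?I. ?N i)" by (rule card_Un_le)
    also have "card (\<Union>i\<in>?I. ?N i) \<le> (\<Sum>i\<in>?I. card (?N i))" by (rule card_UN_le) auto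
    also have "\<dots> \<le> (\<Sum>i\<in>?I. card ?B + 1)" by (intro sum_mono 2)
    finally show ?thesis by simp
  qed
  also have "\<dots> \<le> card ?B + w * (card ?B + 1)"
  proof -
    have "card ?I \<le> w" using w[of "Suc l"] by simp
    then have "card ?I * (card ?B + 1) \<le> w * (card ?B + 1)" by (rule mult_le_mono1)
    then show ?thesis by simp
  qed
  finally have "card (breaks ds \<theta> z m (Suc l)) + 1 \<le> (w + 1) * (card ?B + 1)" by simp
  also have "\<dots> \<le> (w + 1) * (w + 1) ^ l" using Suc by (intro mult_le_mono2)
  finally show ?case by simp
qed

subsection \<open>Covers of clipped networks\<close>

lemma sets_uniform_law [simp, measurable_cong]: "sets (uniform_law l u) = sets borel"
  by (simp add: uniform_law_def)

lemma prob_space_uniform_law: "prob_space (uniform_law l u)"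
  unfolding uniform_law_def by (auto intro!: prob_space_uniform_measure prob_space_return)

lemma sets_input_law [measurable_cong]: "sets (input_law p) = sets (\<Pi>\<^sub>M i\<in>{..<p}. borel)"
  unfolding input_law_def by (intro sets_PiM_cong) auto

lemma prob_space_input_law: "prob_space (input_law p)"
  unfolding input_law_def by (intro prob_space_PiM prob_space_uniform_law)

text \<open>
  \<open>N\<close> representatives, each with an exceptional set of inputs of probability at most \<open>\<beta>\<close> off
  which it is uniformly close to the clipped networks it represents.
\<close>

definition clip_cover ::
  "nat list \<Rightarrow> nat \<Rightarrow> real \<Rightarrow> real \<Rightarrow> real \<Rightarrow> (param \<Rightarrow> real) set \<Rightarrow> real \<Rightarrow> bool" where
  "clip_cover ds p K \<eta> \<beta> S N \<longleftrightarrow> (\<exists>T. finite T \<and> real (card T) \<le> N \<and>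
     (\<forall>(c, Bad)\<in>T. Bad \<in> sets (\<Pi>\<^sub>M i\<in>{..<p}. borel) \<and> measure (input_law p) Bad \<le> \<beta>) \<and>
     (\<forall>\<theta>\<in>S. \<exists>(c, Bad)\<in>T. \<forall>x\<in>cube p - Bad. \<bar>clip K (net ds \<theta> x) - clip K (net ds c x)\<bar> \<le> \<eta>))"

lemma clip_cover_UN:
  assumes "finite I" "\<And>i. i \<in> I \<Longrightarrow> clip_cover ds p K \<eta> \<beta> (S i) N" "S' \<subseteq> (\<Union>i\<in>I. S i)"
  shows "clip_cover ds p K \<eta> \<beta> S' (real (card I) * N)"
proof -
  define good where "good T \<theta> \<longleftrightarrow>
    (\<exists>(c, Bad)\<in>T. \<forall>x\<in>cube p - Bad. \<bar>clip K (net ds \<theta> x) - clip K (net ds c x)\<bar> \<le> \<eta>)" for T \<theta>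
  define small where "small T \<longleftrightarrow> (\<forall>(c::param \<Rightarrow> real, Bad)\<in>T.
    Bad \<in> sets (\<Pi>\<^sub>M i\<in>{..<p}. borel) \<and> measure (input_law p) Bad \<le> \<beta>)" for T
  have "\<And>i. i \<in> I \<Longrightarrow> \<exists>T. finite T \<and> real (card T) \<le> N \<and> small T \<and> (\<forall>\<theta>\<in>S i. good T \<theta>)"
    using assms(2) unfolding clip_cover_def good_def small_def .
  then obtain T where T: "\<And>i. i \<in> I \<Longrightarrow> finite (T i)" "\<And>i. i \<in> I \<Longrightarrow> real (card (T i)) \<le> N"
    "\<And>i. i \<in> I \<Longrightarrow> small (T i)" "\<And>i \<theta>. i \<in> I \<Longrightarrow> \<theta> \<in> S i \<Longrightarrow> good (T i) \<theta>"
    by metis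
  define T' where "T' = (\<Union>i\<in>I. T i)"
  have "finite T'" unfolding T'_def using assms(1) T(1) by blast
  moreover have "real (card T') \<le> real (card I) * N"
  proof -
    have "real (card T') \<le> real (\<Sum>i\<in>I. card (T i))"
      unfolding T'_def by (intro of_nat_mono card_UN_le assms(1))
    also have "\<dots> = (\<Sum>i\<in>I. real (card (T i)))" by simp
    also have "\<dots> \<le> (\<Sum>i\<in>I. N)" using T(2) by (intro sum_mono)
    finally show ?thesis by simp
  qed
  moreover have "small T'" using T(3) unfolding T'_def small_def by blast
  moreover have "\<forall>\<theta>\<in>S'. good T' \<theta>"
  proof
    fix \<theta> assume "\<theta> \<in> S'"
    then obtain i where i: "i \<in> I" "\<theta> \<in> S i" using assms(3) by blast
    then obtain t where "t \<in> T i" "case t of (c, Bad) \<Rightarrow>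
        \<forall>x\<in>cube p - Bad. \<bar>clip K (net ds \<theta> x) - clip K (net ds c x)\<bar> \<le> \<eta>"
      using T(4)[OF i] unfolding good_def by blast
    then show "good T' \<theta>" using i(1) unfolding good_def T'_def by (intro bexI[of _ t]) auto
  qed
  ultimately show ?thesis unfolding clip_cover_def good_def small_def by (intro exI[of _ T'] conjI)
qed

definition sieve :: "nat list \<Rightarrow> nat \<Rightarrow> real \<Rightarrow> (param \<Rightarrow> real) set" where
  "sieve ds s R = {\<theta>. card {q \<in> params ds. \<theta> q \<noteq> 0} \<le> s \<and> (\<forall>q\<in>params ds. \<bar>\<theta> q\<bar> \<le> R)}"

definition supported :: "nat list \<Rightarrow> param set \<Rightarrow> real \<Rightarrow> (param \<Rightarrow> real) set" where
  "supported ds A R = {\<theta>. \<forall>q\<in>params ds. \<bar>\<theta> q\<bar> \<le> R \<and> (q \<notin> A \<longrightarrow> \<theta> q = 0)}"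

lemma obtain_superset_card:
  assumes "finite P" "Z \<subseteq> P" "card Z \<le> s" "s \<le> card P"
  obtains A where "Z \<subseteq> A" "A \<subseteq> P" "card A = s"
proof -
  have "finite Z" using assms finite_subset by blast
  then have "s - card Z \<le> card (P - Z)"
    using assms by (simp add: card_Diff_subset)
  then obtain Y where Y: "Y \<subseteq> P - Z" "card Y = s - card Z" "finite Y"
    by (rule obtain_subset_with_card_n)
  show ?thesis
  proof (rule that[of "Z \<union> Y"])
    show "card (Z \<union> Y) = s" using Y assms \<open>finite Z\<close> by (subst card_Un_disjoint) auto
  qed (use Y assms in auto)
qed

text \<open>Smaller supports are padded to exactly \<open>s\<close> coordinates, so it is enough to
  cover the networks on each fixed support of size \<open>s\<close>.\<close>

lemma sieve_subset:
  assumes "s \<le> card (params ds)"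
  shows "sieve ds s R \<subseteq> (\<Union>A\<in>{A. A \<subseteq> params ds \<and> card A = s}. supported ds A R)"
proof
  fix \<theta> assume \<theta>: "\<theta> \<in> sieve ds s R"
  obtain A where A: "{q \<in> params ds. \<theta> q \<noteq> 0} \<subseteq> A" "A \<subseteq> params ds" "card A = s"
    using obtain_superset_card[OF finite_params _ _ assms, of "{q \<in> params ds. \<theta> q \<noteq> 0}"] \<theta>
    by (auto simp: sieve_def)
  then have "\<theta> \<in> supported ds A R" using \<theta> by (auto simp: supported_def sieve_def)
  then show "\<theta> \<in> (\<Union>A\<in>{A. A \<subseteq> params ds \<and> card A = s}. supported ds A R)" using A by blast
qed

lemma clip_cover_mono: "clip_cover ds p K \<eta> \<beta> S N \<Longrightarrow> N \<le> N' \<Longrightarrow> clip_cover ds p K \<eta> \<beta> S N'"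
  unfolding clip_cover_def by (meson order_trans)

lemma clip_cover_sieve:
  assumes s: "s \<le> card (params ds)"
    and "\<And>A. A \<subseteq> params ds \<Longrightarrow> card A = s \<Longrightarrow> clip_cover ds p K \<eta> \<beta> (supported ds A R) N"
    and "N \<ge> 0"
  shows "clip_cover ds p K \<eta> \<beta> (sieve ds s R) (real (card (params ds)) ^ s * N)"
proof -
  let ?I = "{A. A \<subseteq> params ds \<and> card A = s}"
  have "clip_cover ds p K \<eta> \<beta> (sieve ds s R) (real (card ?I) * N)"
    by (rule clip_cover_UN[OF _ _ sieve_subset[OF s]]) (use assms(2) in auto)
  moreover have "card ?I \<le> card (params ds) ^ s"
    unfolding n_subsets[OF finite_params] using s by (rule binomial_le_pow)
  then have "real (card ?I) * N \<le> real (card (params ds)) ^ s * N"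
    using assms(3) by (intro mult_right_mono) (simp_all flip: of_nat_power)
  ultimately show ?thesis by (rule clip_cover_mono)
qed

lemma exp_minus_one_le:
  fixes t :: real
  assumes "0 \<le> t" "t \<le> 1"
  shows "exp t - 1 \<le> 2 * t"
  using exp_bound[OF assms] assms mult_left_mono[OF assms(2) assms(1)]
  by (simp add: power2_eq_square)

text \<open>Rounding the coordinates in \<open>A\<close> down to a grid of width
  \<open>\<delta>\<close> moves the parameter vector by at most \<open>s * \<delta>\<close> in l1,
  which the perturbation bound turns into a uniform error. The exceptional sets are empty.\<close>

lemma lipschitz_cover:
  assumes len: "length ds = L + 1" "L \<ge> 1" and out: "ds ! L = 1" and inp: "ds ! 0 = p"
    and w: "\<And>l. l < length ds \<Longrightarrow> ds ! l \<le> w" and R: "R \<ge> 0"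
    and A: "A \<subseteq> params ds" "card A = s" "s \<ge> 1"
    and a: "a = 1 + R * real ((w + 1)\<^sup>2)" and \<eta>: "0 < \<eta>" "\<eta> \<le> 1" and "\<beta> \<ge> 0"
  shows "clip_cover ds p K \<eta> \<beta> (supported ds A R) ((4 * R * s * a ^ L / \<eta> + 2) ^ s)"
proof -
  have finA: "finite A" using finite_subset[OF A(1) finite_params] .
  have a1: "a \<ge> 1" using R by (simp add: a)
  \<comment> \<open>Makes the final error \<open>a ^ L * (2 * (s * \<delta>))\<close> equal to
    \<open>\<eta>\<close>; the 2 comes from \<open>exp t - 1 \<le> 2 * t\<close> on the unit
    interval.\<close>
  define \<delta> where "\<delta> = \<eta> / (2 * s * a ^ L)"
  have aL: "a ^ L \<ge> 1" using a1 by simp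
  have \<delta>: "\<delta> > 0" "s * \<delta> * (2 * a ^ L) = \<eta>" using A \<eta> a1 by (auto simp: \<delta>_def field_simps)
  have "s * \<delta> * 1 \<le> s * \<delta> * (2 * a ^ L)" using \<delta>(1) aL by (intro mult_left_mono) auto
  then have s\<delta>: "s * \<delta> \<le> 1" using \<delta>(2) \<eta> by simp
  define T0 where "T0 = A \<rightarrow>\<^sub>E {\<lfloor>- R / \<delta>\<rfloor>..\<lfloor>R / \<delta>\<rfloor>}"
  define c where "c g q = (if q \<in> A then \<delta> * real_of_int (g q) else 0)" for g :: "param \<Rightarrow> int" and q
  define T where "T = (\<lambda>g. (c g, {} :: (nat \<Rightarrow> real) set)) ` T0"
  have finT0: "finite T0" unfolding T0_def using finA by (intro finite_PiE) auto
  have "real (card T) \<le> real (card T0)" unfolding T_def using finT0 by (simp add: card_image_le)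
  also have "\<dots> = real (nat (\<lfloor>R / \<delta>\<rfloor> - \<lfloor>- R / \<delta>\<rfloor> + 1)) ^ s"
    unfolding T0_def using finA A by (simp add: card_PiE)
  also have "\<dots> \<le> (2 * R / \<delta> + 2) ^ s"
  proof (rule power_mono)
    have "\<lfloor>R / \<delta>\<rfloor> \<ge> \<lfloor>- R / \<delta>\<rfloor>" using R \<delta> by (intro floor_mono) (simp add: divide_right_mono)
    then have "real (nat (\<lfloor>R / \<delta>\<rfloor> - \<lfloor>- R / \<delta>\<rfloor> + 1)) = of_int \<lfloor>R / \<delta>\<rfloor> - of_int \<lfloor>- R / \<delta>\<rfloor> + 1" by simp
    also have "\<dots> \<le> R / \<delta> - (- R / \<delta> - 1) + 1" by linarith
    finally show "real (nat (\<lfloor>R / \<delta>\<rfloor> - \<lfloor>- R / \<delta>\<rfloor> + 1)) \<le> 2 * R / \<delta> + 2" by simp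
  qed simp
  also have "2 * R / \<delta> = 4 * R * s * a ^ L / \<eta>" by (simp add: \<delta>_def)
  finally have cardT: "real (card T) \<le> (4 * R * s * a ^ L / \<eta> + 2) ^ s" .
  have "\<exists>g\<in>T0. \<forall>x\<in>cube p. \<bar>clip K (net ds \<theta> x) - clip K (net ds (c g) x)\<bar> \<le> \<eta>"
    if \<theta>: "\<theta> \<in> supported ds A R" for \<theta>
  proof (intro bexI ballI)
    define g where "g = (\<lambda>q\<in>A. \<lfloor>\<theta> q / \<delta>\<rfloor>)"
    show "g \<in> T0" unfolding g_def T0_def
    proof (rule restrict_PiE_iff[THEN iffD2], rule ballI)
      fix q assume "q \<in> A"
      then have "\<bar>\<theta> q\<bar> \<le> R" using \<theta> A by (auto simp: supported_def)
      then show "\<lfloor>\<theta> q / \<delta>\<rfloor> \<in> {\<lfloor>- R / \<delta>\<rfloor>..\<lfloor>R / \<delta>\<rfloor>}"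
        using \<delta>(1) divide_right_mono[of "- R" "\<theta> q" \<delta>] divide_right_mono[of "\<theta> q" R \<delta>]
        by (auto intro!: floor_mono simp: abs_le_iff)
    qed
    fix x assume x: "x \<in> cube p"
    have "(\<Sum>q\<in>params ds. \<bar>c g q - \<theta> q\<bar>) = (\<Sum>q\<in>A. \<bar>c g q - \<theta> q\<bar>)"
      using A(1) \<theta> by (intro sum.mono_neutral_right) (auto simp: c_def supported_def)
    also have "\<dots> \<le> (\<Sum>q\<in>A. \<delta>)"
    proof (rule sum_mono)
      fix q assume q: "q \<in> A"
      have "\<delta> * of_int \<lfloor>\<theta> q / \<delta>\<rfloor> \<le> \<delta> * (\<theta> q / \<delta>)"
        using \<delta>(1) by (intro mult_left_mono of_int_floor_le) auto
      moreover have "\<delta> * (\<theta> q / \<delta>) \<le> \<delta> * (of_int \<lfloor>\<theta> q / \<delta>\<rfloor> + 1)"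
        using \<delta>(1) by (intro mult_left_mono) (linarith, simp)
      ultimately have "\<delta> * of_int \<lfloor>\<theta> q / \<delta>\<rfloor> \<le> \<theta> q" "\<theta> q \<le> \<delta> * of_int \<lfloor>\<theta> q / \<delta>\<rfloor> + \<delta>"
        using \<delta>(1) by (simp_all add: distrib_left)
      then show "\<bar>c g q - \<theta> q\<bar> \<le> \<delta>" using q by (simp add: c_def g_def abs_le_iff)
    qed
    also have "\<dots> = s * \<delta>" using A by simp
    finally have U: "(\<Sum>q\<in>params ds. \<bar>c g q - \<theta> q\<bar>) \<le> s * \<delta>" .
    have "\<bar>net ds (c g) x - net ds \<theta> x\<bar> \<le> a ^ L * (exp (\<Sum>q\<in>params ds. \<bar>c g q - \<theta> q\<bar>) - 1)"
      unfolding a using \<theta> w R x len out inp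
      by (intro net_perturbation) (auto simp: supported_def cube_def PiE_iff abs_le_iff)
    also have "\<dots> \<le> a ^ L * (exp (s * \<delta>) - 1)"
      using U aL by (intro mult_left_mono) auto
    also have "\<dots> \<le> a ^ L * (2 * (s * \<delta>))"
      using s\<delta> \<delta>(1) aL by (intro mult_left_mono exp_minus_one_le) auto
    also have "\<dots> = \<eta>" using \<delta>(2) by (simp add: mult_ac)
    finally show "\<bar>clip K (net ds \<theta> x) - clip K (net ds (c g) x)\<bar> \<le> \<eta>"
      using clip_nonexp[of K "net ds \<theta> x" "net ds (c g) x"] by (simp add: abs_minus_commute)
  qed
  then show ?thesis unfolding clip_cover_def
    using cardT finT0 \<open>\<beta> \<ge> 0\<close> by (intro exI[of _ T]) (auto simp: T_def)
qed

subsection \<open>Covers from sign patterns, for a scalar input\<close>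

text \<open>The actual pattern depends on the parameters, so preactivations are only piecewise
  polynomial in them. Asking for equal signs under every gate pattern \<open>a\<close> replaces them
  by finitely many genuine polynomials; the induction over the layers uses the pattern of
  \<open>\<theta>\<close>.\<close>

lemma active_eq_if_same_signs:
  assumes "\<And>a u. a \<subseteq> units ds \<Longrightarrow> u \<in> units ds \<Longrightarrow> 0 < gated_pre ds \<theta> a z u \<longleftrightarrow> 0 < gated_pre ds \<theta>' a z u"
  shows "active ds \<theta> z = active ds \<theta>' z"
proof -
  define a where "a = active ds \<theta> z"
  have sub: "a \<subseteq> units ds" "active ds \<theta>' z \<subseteq> units ds" unfolding a_def by (rule active_subset)+
  have "\<forall>i. (l, i) \<in> units ds \<longrightarrow> ((l, i) \<in> a \<longleftrightarrow> (l, i) \<in> active ds \<theta>' z)" for l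
  proof (induction l rule: less_induct)
    case (less l)
    show ?case
    proof (intro allI impI)
      fix i assume u: "(l, i) \<in> units ds"
      have "(l, i) \<in> a \<longleftrightarrow> 0 < gated_pre ds \<theta> a z (l, i)"
        using active_iff_gated_pre[of l ds a \<theta> z i] u by (simp add: a_def)
      moreover have "(l, i) \<in> active ds \<theta>' z \<longleftrightarrow> 0 < gated_pre ds \<theta>' a z (l, i)"
        using active_iff_gated_pre[of l ds a \<theta>' z i] u less by simp
      ultimately show "(l, i) \<in> a \<longleftrightarrow> (l, i) \<in> active ds \<theta>' z" using assms[OF sub(1) u] by simp
    qed
  qed
  then show ?thesis using sub unfolding a_def by auto
qed

text \<open>The smallest level at or above \<open>v\<close> lies below \<open>v + \<eta>\<close>. As
  \<open>v\<close> does not exceed this level, neither does \<open>v'\<close>.\<close>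

lemma quantization:
  fixes K \<eta> v v' :: real
  assumes \<eta>: "\<eta> > 0" and J: "real J * \<eta> = 2 * K" and v: "- K < v" "v \<le> K"
    and same: "\<And>j. j \<le> J \<Longrightarrow> - K + real j * \<eta> < v \<longleftrightarrow> - K + real j * \<eta> < v'"
  shows "v' \<le> v + \<eta>"
proof (rule ccontr)
  assume "\<not> ?thesis"
  then have v': "v + \<eta> < v'" by simp
  define j where "j = nat \<lceil>(v + K) / \<eta>\<rceil>"
  have pos: "(v + K) / \<eta> > 0" using v \<eta> by simp
  have "(v + K) / \<eta> \<le> real J" using v J \<eta> by (simp add: field_simps)
  then have "j \<le> J" unfolding j_def by linarith
  have "real j = of_int \<lceil>(v + K) / \<eta>\<rceil>" using pos by (simp add: j_def)
  then have "(v + K) / \<eta> \<le> real j" "real j < (v + K) / \<eta> + 1" by linarith+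
  then have "v + K \<le> real j * \<eta>" "real j * \<eta> < v + K + \<eta>" using \<eta> by (simp_all add: field_simps)
  then show False using same[OF \<open>j \<le> J\<close>] v' by linarith
qed

lemma affine_between:
  fixes \<alpha> \<beta> c :: real
  assumes "y \<le> z" "z \<le> y'"
  shows "\<alpha> + \<beta> * y \<le> c \<Longrightarrow> \<alpha> + \<beta> * y' \<le> c \<Longrightarrow> \<alpha> + \<beta> * z \<le> c"
    and "c < \<alpha> + \<beta> * y \<Longrightarrow> c < \<alpha> + \<beta> * y' \<Longrightarrow> c < \<alpha> + \<beta> * z"
proof -
  have "(\<beta> * y \<le> \<beta> * z \<and> \<beta> * z \<le> \<beta> * y') \<or> (\<beta> * y' \<le> \<beta> * z \<and> \<beta> * z \<le> \<beta> * y)"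
    using assms by (cases "\<beta> \<ge> 0") (auto intro: mult_left_mono mult_left_mono_neg)
  then show "\<alpha> + \<beta> * y \<le> c \<Longrightarrow> \<alpha> + \<beta> * y' \<le> c \<Longrightarrow> \<alpha> + \<beta> * z \<le> c"
    and "c < \<alpha> + \<beta> * y \<Longrightarrow> c < \<alpha> + \<beta> * y' \<Longrightarrow> c < \<alpha> + \<beta> * z" by linarith+
qed

text \<open>Both networks are affine on the interval. If \<open>\<theta>\<close> is above
  \<open>K\<close> at both ends, or not above \<open>- K\<close> at both ends, then so is
  \<open>\<theta>'\<close>, and both clip to the same constant throughout. Otherwise the levels make
  the two networks \<open>\<eta>\<close>-close at both ends and, by affinity, in between.\<close>

lemma clip_close_on_interval:
  assumes ds: "length ds \<ge> 2" and yz: "y \<le> z" "z \<le> y'"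
    and act: "active ds \<theta> y = a" "active ds \<theta> y' = a" "active ds \<theta>' y = a" "active ds \<theta>' y' = a"
    and \<eta>: "\<eta> > 0" and J: "real J * \<eta> = 2 * K"
    and same: "\<And>j t. j \<le> J \<Longrightarrow> t \<in> {y, y'} \<Longrightarrow>
       - K + real j * \<eta> < net ds \<theta> (\<lambda>_. t) \<longleftrightarrow> - K + real j * \<eta> < net ds \<theta>' (\<lambda>_. t)"
    and cross: "K < net ds \<theta> (\<lambda>_. y) \<longleftrightarrow> K < net ds \<theta> (\<lambda>_. y')"
      "- K < net ds \<theta> (\<lambda>_. y) \<longleftrightarrow> - K < net ds \<theta> (\<lambda>_. y')"
  shows "\<bar>clip K (net ds \<theta> (\<lambda>_. z)) - clip K (net ds \<theta>' (\<lambda>_. z))\<bar> \<le> \<eta>"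
proof -
  obtain \<alpha> \<beta> where 1: "\<And>z. gated_net ds \<theta> a z = \<alpha> + \<beta> * z" using gated_net_affine by metis
  obtain \<alpha>' \<beta>' where 2: "\<And>z. gated_net ds \<theta>' a z = \<alpha>' + \<beta>' * z" using gated_net_affine by metis
  have actt: "active ds \<theta> t = a" "active ds \<theta>' t = a" if "t \<in> {y, z, y'}" for t
    using that act active_between[OF _ yz, of ds \<theta>] active_between[OF _ yz, of ds \<theta>'] by auto
  have n: "net ds \<theta> (\<lambda>_. t) = \<alpha> + \<beta> * t" "net ds \<theta>' (\<lambda>_. t) = \<alpha>' + \<beta>' * t" if "t \<in> {y, z, y'}" for t
    using net_eq_gated[of ds a \<theta> t] net_eq_gated[of ds a \<theta>' t] actt[OF that] ds by (simp_all add: 1 2)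
  have K0: "K \<ge> 0" using J \<eta> by (metis mult_nonneg_nonneg of_nat_0_le_iff less_imp_le zero_le_mult_iff zero_less_numeral not_le)
  have J0: "- K + real 0 * \<eta> = - K" "- K + real J * \<eta> = K" using J by simp_all
  have sK: "K < net ds \<theta> (\<lambda>_. t) \<longleftrightarrow> K < net ds \<theta>' (\<lambda>_. t)"
    "- K < net ds \<theta> (\<lambda>_. t) \<longleftrightarrow> - K < net ds \<theta>' (\<lambda>_. t)" if "t \<in> {y, y'}" for t
    using same[of J t] same[of 0 t] J0 that by auto
  consider "K < net ds \<theta> (\<lambda>_. y)" | "net ds \<theta> (\<lambda>_. y) \<le> - K"
    | "- K < net ds \<theta> (\<lambda>_. y)" "net ds \<theta> (\<lambda>_. y) \<le> K" by linarith
  then show ?thesis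
  proof cases
    case 1
    then have "K < \<alpha> + \<beta> * z" "K < \<alpha>' + \<beta>' * z"
      using sK(1)[of y] sK(1)[of y'] cross(1) n[of y] n[of y']
      by (auto intro!: affine_between(2)[OF yz])
    then show ?thesis using n \<eta> K0 by (simp add: clip_def)
  next
    case 2
    then have "\<alpha> + \<beta> * z \<le> - K" "\<alpha>' + \<beta>' * z \<le> - K"
      using sK(2)[of y] sK(2)[of y'] cross(2) n[of y] n[of y']
      by (auto intro!: affine_between(1)[OF yz])
    then show ?thesis using n \<eta> K0 by (simp add: clip_def)
  next
    case 3
    have near: "\<bar>net ds \<theta> (\<lambda>_. t) - net ds \<theta>' (\<lambda>_. t)\<bar> \<le> \<eta>" if t: "t \<in> {y, y'}" for t
    proof -
      have v: "- K < net ds \<theta> (\<lambda>_. t)" "net ds \<theta> (\<lambda>_. t) \<le> K" using 3 cross t by auto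
      then have v': "- K < net ds \<theta>' (\<lambda>_. t)" "net ds \<theta>' (\<lambda>_. t) \<le> K" using sK[OF t] by auto
      have "net ds \<theta>' (\<lambda>_. t) \<le> net ds \<theta> (\<lambda>_. t) + \<eta>"
        by (rule quantization[OF \<eta> J v]) (use same t in auto)
      moreover have "net ds \<theta> (\<lambda>_. t) \<le> net ds \<theta>' (\<lambda>_. t) + \<eta>"
        by (rule quantization[OF \<eta> J v']) (use same t in auto)
      ultimately show ?thesis by linarith
    qed
    have "(\<alpha> - \<alpha>') + (\<beta> - \<beta>') * y \<le> \<eta>" "(\<alpha> - \<alpha>') + (\<beta> - \<beta>') * y' \<le> \<eta>"
      "(\<alpha>' - \<alpha>) + (\<beta>' - \<beta>) * y \<le> \<eta>" "(\<alpha>' - \<alpha>) + (\<beta>' - \<beta>) * y' \<le> \<eta>"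
      using near[of y] near[of y'] n by (auto simp: algebra_simps abs_le_iff)
    then have "(\<alpha> - \<alpha>') + (\<beta> - \<beta>') * z \<le> \<eta>" "(\<alpha>' - \<alpha>) + (\<beta>' - \<beta>) * z \<le> \<eta>"
      using affine_between(1)[OF yz] by blast+
    then have "\<bar>net ds \<theta> (\<lambda>_. z) - net ds \<theta>' (\<lambda>_. z)\<bar> \<le> \<eta>"
      using n by (simp add: algebra_simps abs_le_iff)
    then show ?thesis using clip_nonexp order_trans by blast
  qed
qed

lemma card_units:
  assumes "length ds = L + 1" "\<And>l. l < length ds \<Longrightarrow> ds ! l \<le> w"
  shows "card (units ds) \<le> L * w"
proof -
  have "card (units ds) = (\<Sum>l\<in>{1..<L}. ds ! l)" using assms(1) by (simp add: units_def)
  also have "\<dots> \<le> (\<Sum>l\<in>{1..<L}. w)" using assms by (intro sum_mono) auto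
  also have "\<dots> \<le> L * w" by simp
  finally show ?thesis .
qed

lemma measure_input_law_slab:
  assumes "- 1 \<le> a" "a \<le> b" "b \<le> 1"
  shows "measure (input_law 1) {x \<in> space (\<Pi>\<^sub>M i\<in>{..<1}. borel). x 0 \<in> {a..b}} = (b - a) / 2"
proof -
  have "measure (uniform_law (-1) 1) {a..b} = (b - a) / 2"
  proof -
    have "emeasure (uniform_law (-1) 1) {a..b} = emeasure lborel ({-1..1} \<inter> {a..b}) / emeasure lborel {-1..1::real}"
      unfolding uniform_law_def by (simp add: emeasure_uniform_measure)
    also have "{-1..1} \<inter> {a..b} = {a..b}" using assms by auto
    also have "emeasure lborel {a..b} / emeasure lborel {-1..1::real} = ennreal ((b - a) / 2)"
      using assms by (simp add: divide_ennreal[of "b - a" 2, simplified])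
    finally show ?thesis using assms by (simp add: measure_def)
  qed
  moreover have "distr (input_law 1) (uniform_law (-1) 1) (\<lambda>x. x 0) = uniform_law (-1) 1"
    unfolding input_law_def
    by (rule distr_PiM_component[where M = "\<lambda>_. uniform_law (-1) 1"]) (auto intro: prob_space_uniform_law)
  moreover have "measure (distr (input_law 1) (uniform_law (-1) 1) (\<lambda>x. x 0)) {a..b}
      = measure (input_law 1) ((\<lambda>x. x 0) -` {a..b} \<inter> space (input_law 1))"
    by (rule measure_distr) (auto simp: input_law_def)
  moreover have "(\<lambda>x. x 0) -` {a..b} \<inter> space (input_law 1) = {x \<in> space (\<Pi>\<^sub>M i\<in>{..<1}. borel). x 0 \<in> {a..b}}"
    using sets_eq_imp_space_eq[OF sets_input_law[of 1]] by auto
  ultimately show ?thesis by simp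
qed

text \<open>One representative is kept for each sign pattern, at the grid points, of the gated
  preactivations and of the gated outputs minus the levels \<open>- K + j * \<eta>\<close>. Its
  exceptional set consists of the grid cells in which its own activation pattern changes or its
  output crosses \<open>K\<close> or \<open>- K\<close>: three families of at most
  \<open>(w + 1) ^ L\<close> cells, each cell of probability \<open>1 / m\<close>. The count is free
  of \<open>R\<close>, which is the gain over the Lipschitz cover.\<close>

lemma sign_pattern_cover:
  assumes len: "length ds = L + 1" "L \<ge> 1" and out: "ds ! L = 1" and inp: "ds ! 0 = 1"
    and w: "\<And>l. l < length ds \<Longrightarrow> ds ! l \<le> w"
    and A: "A \<subseteq> params ds" "card A = s"
    and K: "K > 0" and J: "J \<ge> 1" and m: "m \<ge> 1"
  shows "clip_cover ds 1 K (2 * K / J) (3 * (w + 1) ^ L / m) (supported ds A R)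
    (real ((2 * (2 ^ (L * w) * ((m + 1) * (L * w + J + 1)) * L) + 4 * s + 1) ^ s))"
  (is "clip_cover _ _ _ _ ?\<beta> _ _")
proof -
  have finA: "finite A" using finite_subset[OF A(1) finite_params] .
  have len2: "length ds \<ge> 2" using len by simp
  define \<eta> where "\<eta> = 2 * K / J"
  have \<eta>: "\<eta> > 0" "real J * \<eta> = 2 * K" using K J by (simp_all add: \<eta>_def)
  define z where "z k = -1 + 2 * real k / real m" for k
  have z: "mono z" using m by (auto simp: z_def intro!: monoI divide_right_mono)
  \<comment> \<open>Parameters off \<open>A\<close> are zero, so that gated networks become
    polynomials in the coordinates of \<open>A\<close> alone.\<close>
  define ext where "ext x q = (if q \<in> A then x q else 0)" for x :: "param \<Rightarrow> real" and q
  have ext: "poly_fun A 1 (\<lambda>x. ext x q)" for q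
    using finA by (cases "q \<in> A") (auto simp: ext_def poly_fun_const intro: poly_fun_var)
  define U where "U = units ds"
  have U: "finite U" "card U \<le> L * w" using card_units[OF len(1) w] by (auto simp: U_def)
  define f1 where "f1 = (\<lambda>(a, k, u) x. gated_pre ds (ext x) a (z k) u)"
  define f2 where "f2 = (\<lambda>(a, k, j) x. gated_net ds (ext x) a (z k) - (- K + real j * \<eta>))"
  define D1 where "D1 = Pow U \<times> {..m} \<times> U"
  define D2 where "D2 = Pow U \<times> {..m} \<times> {..J}"
  define P where "P = f1 ` D1 \<union> f2 ` D2"
  have finP: "finite P" using U by (auto simp: P_def D1_def D2_def)
  have cardP: "card P \<le> 2 ^ (L * w) * ((m + 1) * (L * w + J + 1))"
  proof -
    have "card P \<le> card D1 + card D2"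
      unfolding P_def using U
      by (intro order.trans[OF card_Un_le] add_mono card_image_le) (auto simp: D1_def D2_def)
    also have "\<dots> = 2 ^ card U * ((m + 1) * (card U + (J + 1)))"
      using U by (simp add: D1_def D2_def card_cartesian_product card_Pow algebra_simps)
    also have "\<dots> \<le> 2 ^ (L * w) * ((m + 1) * (L * w + (J + 1)))"
      using U by (intro mult_le_mono power_increasing add_mono) auto
    finally show ?thesis by (simp add: add.assoc)
  qed
  have polyP: "poly_fun A L f" if f: "f \<in> P" for f
  proof -
    consider a k u where "f = f1 (a, k, u)" "u \<in> U" | a k j where "f = f2 (a, k, j)"
      using f unfolding P_def D1_def D2_def by blast
    then show ?thesis
    proof cases
      case 1
      obtain l i where u: "u = (l, i)" by fastforce
      have l: "1 \<le> l" "l \<le> L" using 1(2) len by (auto simp: u U_def units_def)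
      have "poly_fun A l f"
        using gated_pre_poly_fun[where \<theta> = ext, OF finA ext l(1)] by (simp add: 1(1) f1_def u)
      then show ?thesis using l(2) by (rule poly_fun_mono)
    next
      case 2
      have "poly_fun A L (\<lambda>x. gated_net ds (ext x) a (z k))"
        using gated_net_poly_fun[where \<theta> = ext, OF finA ext len2] len by simp
      then show ?thesis unfolding 2 f2_def prod.case by (intro poly_fun_diff poly_fun_const)
    qed
  qed
  define X where "X = PiE A (\<lambda>_. {- R..R})"
  define pat where "pat x = {f \<in> P. 0 < f x}" for x :: "param \<Rightarrow> real"
  obtain T0 where T0: "T0 \<subseteq> X" "inj_on pat T0" "pat ` X = pat ` T0"
    using subset_image_inj[of "pat ` X" pat X] by auto
  have "card (pat ` X) \<le> (2 * (card P * L) + 4 * card A + 1) ^ card A"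
    unfolding pat_def by (rule card_positivity_patterns[OF finA finP polyP, where R = R]) (simp_all add: X_def)
  also have "\<dots> \<le> (2 * (2 ^ (L * w) * ((m + 1) * (L * w + J + 1)) * L) + 4 * s + 1) ^ s"
    unfolding A(2) using cardP by (intro power_mono add_mono mult_le_mono) auto
  finally have cardT0: "card T0 \<le> (2 * (2 ^ (L * w) * ((m + 1) * (L * w + J + 1)) * L) + 4 * s + 1) ^ s"
    using card_image[OF T0(2)] T0(3) by simp
  have "finite (pat ` X)" by (rule finite_subset[of _ "Pow P"]) (use finP in \<open>auto simp: pat_def\<close>)
  then have finT0: "finite T0" using finite_imageD[OF _ T0(2)] T0(3) by simp
  define N where "N x k = net ds (ext x) (\<lambda>_. z k)" for x k
  define bad where "bad x = breaks ds (ext x) z m L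
      \<union> {k. k < m \<and> k \<notin> breaks ds (ext x) z m L \<and> (K < N x k) \<noteq> (K < N x (Suc k))}
      \<union> {k. k < m \<and> k \<notin> breaks ds (ext x) z m L \<and> (- K < N x k) \<noteq> (- K < N x (Suc k))}" for x
  have badm: "k < m" if "k \<in> bad x" for k x using that by (auto simp: bad_def breaks_def)
  have finbad: "finite (bad x)" for x by (rule finite_subset[of _ "{..<m}"]) (use badm in auto)
  have act_all: "active ds \<theta> y \<inter> {..L} \<times> UNIV = active ds \<theta> y" for \<theta> y
    using active_subset[of ds \<theta> y] len by (auto simp: units_def)
  have Br: "breaks ds \<theta> z m L = {k. k < m \<and> active ds \<theta> (z k) \<noteq> active ds \<theta> (z (Suc k))}" for \<theta>
    by (simp add: breaks_def act_all)
  have cardbad: "card (bad x) \<le> 3 * (w + 1) ^ L" for x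
  proof -
    let ?B = "breaks ds (ext x) z m L"
    have ch: "card {k. k < m \<and> k \<notin> ?B \<and> (c < N x k) \<noteq> (c < N x (Suc k))} \<le> card ?B + 1" for c
    proof (rule card_changes)
      fix k k' assume k: "k < k'" "k' < m" "\<And>b. k \<le> b \<Longrightarrow> b \<le> k' \<Longrightarrow> b \<notin> ?B"
        and ne: "(c < N x k) \<noteq> (c < N x (Suc k))" "(c < N x k') \<noteq> (c < N x (Suc k'))"
      define a where "a = active ds (ext x) (z k)"
      have run: "active ds (ext x) (z b) = a" if "k \<le> b" "b \<le> Suc k'" for b
        unfolding a_def
      proof (rule constant_run[of k k' "\<lambda>b. active ds (ext x) (z b)", OF _ that])
        show "active ds (ext x) (z b) = active ds (ext x) (z (Suc b))" if "k \<le> b" "b \<le> k'" for b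
          using k(2) k(3)[OF that] that unfolding Br by auto
      qed
      obtain \<alpha> \<beta> where ab: "\<And>z. gated_net ds (ext x) a z = \<alpha> + \<beta> * z"
        using gated_net_affine by metis
      have "N x b = \<alpha> + \<beta> * z b" if "k \<le> b" "b \<le> Suc k'" for b
        using net_eq_gated[of ds a "ext x" "z b"] run[OF that] len2 by (simp add: N_def ab)
      then show False using affine_changes_once[OF z k(1), of c \<alpha> \<beta>] ne k(1) by auto
    qed simp
    have "card (bad x) \<le> card ?B + (card ?B + 1) + (card ?B + 1)"
      unfolding bad_def
      by (intro order.trans[OF card_Un_le] add_mono ch order.refl)
    also have "\<dots> \<le> 3 * (card ?B + 1)" by simp
    also have "\<dots> \<le> 3 * (w + 1) ^ L" using card_breaks[OF z w, where l = L] by (intro mult_le_mono2)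
    finally show ?thesis .
  qed
  define cell where "cell k = {v \<in> space (\<Pi>\<^sub>M i\<in>{..<1::nat}. borel :: real measure). v 0 \<in> {z k..z (Suc k)}}" for k
  have cell: "cell k \<in> sets (\<Pi>\<^sub>M i\<in>{..<1::nat}. borel)" for k
    unfolding cell_def by measurable
  have mcell: "measure (input_law 1) (cell k) = 1 / real m" if "k < m" for k
  proof -
    have "real (Suc k) \<le> real m" using that by linarith
    then have "- 1 \<le> z k" "z k \<le> z (Suc k)" "z (Suc k) \<le> 1"
      using m by (simp_all add: z_def field_simps)
    then have "measure (input_law 1) (cell k) = (z (Suc k) - z k) / 2"
      unfolding cell_def by (rule measure_input_law_slab)
    then show ?thesis by (simp add: z_def add_divide_distrib)
  qed
  define Bad where "Bad x = (\<Union>k\<in>bad x. cell k)" for x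
  have Badm: "Bad x \<in> sets (\<Pi>\<^sub>M i\<in>{..<1::nat}. borel)" for x
    unfolding Bad_def using finbad cell by blast
  have Badle: "measure (input_law 1) (Bad x) \<le> ?\<beta>" for x
  proof -
    interpret prob_space "input_law 1" by (rule prob_space_input_law)
    have "measure (input_law 1) (Bad x) \<le> (\<Sum>k\<in>bad x. measure (input_law 1) (cell k))"
      unfolding Bad_def
      by (rule finite_measure_subadditive_finite) (use finbad cell in \<open>auto simp: sets_input_law\<close>)
    also have "\<dots> = (\<Sum>k\<in>bad x. 1 / real m)" using badm mcell by (intro sum.cong) auto
    also have "\<dots> = real (card (bad x)) * (1 / real m)" by simp
    also have "\<dots> \<le> real (3 * (w + 1) ^ L) * (1 / real m)"
      using cardbad by (intro mult_right_mono of_nat_mono) auto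
    finally show ?thesis by (simp add: add.commute)
  qed
  \<comment> \<open>The exceptional set is that of the representative \<open>x'\<close>. Equality of
    the sign patterns transfers the absence of changes in a cell from \<open>x'\<close> to
    \<open>x\<close>.\<close>
  have close: "\<bar>clip K (net ds (ext x) v) - clip K (net ds (ext x') v)\<bar> \<le> \<eta>"
    if pat: "pat x = pat x'" and v: "v \<in> cube 1 - Bad x'" for x x' v
  proof -
    have iff: "0 < f x \<longleftrightarrow> 0 < f x'" if "f \<in> P" for f using pat that unfolding pat_def by blast
    have act: "active ds (ext x) (z k) = active ds (ext x') (z k)" if "k \<le> m" for k
    proof (rule active_eq_if_same_signs)
      fix a u assume "a \<subseteq> units ds" "u \<in> units ds"
      then have "f1 (a, k, u) \<in> P" using that by (auto simp: P_def D1_def U_def)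
      then show "0 < gated_pre ds (ext x) a (z k) u \<longleftrightarrow> 0 < gated_pre ds (ext x') a (z k) u"
        using iff by (simp add: f1_def)
    qed
    have lev: "- K + real j * \<eta> < N x k \<longleftrightarrow> - K + real j * \<eta> < N x' k" if "k \<le> m" "j \<le> J" for k j
    proof -
      define a where "a = active ds (ext x) (z k)"
      have "f2 (a, k, j) \<in> P"
        using that active_subset[of ds "ext x" "z k"] by (auto simp: P_def D2_def U_def a_def)
      then have "0 < f2 (a, k, j) x \<longleftrightarrow> 0 < f2 (a, k, j) x'" by (rule iff)
      moreover have "gated_net ds (ext x) a (z k) = N x k" "gated_net ds (ext x') a (z k) = N x' k"
        using net_eq_gated[of ds a "ext x" "z k"] net_eq_gated[of ds a "ext x'" "z k"] act[OF that(1)] len2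
        by (simp_all add: N_def a_def)
      ultimately show ?thesis by (simp add: f2_def)
    qed
    define t where "t = v 0"
    have t: "- 1 \<le> t" "t \<le> 1" using v by (auto simp: cube_def PiE_iff t_def)
    \<comment> \<open>The minimum assigns the right end point \<open>t = 1\<close> to the last
      cell.\<close>
    define k where "k = min (m - 1) (nat \<lfloor>(t + 1) * m / 2\<rfloor>)"
    have k: "k < m" using m by (auto simp: k_def)
    have zk: "z k \<le> t" "t \<le> z (Suc k)"
    proof -
      have pos: "(t + 1) * m / 2 \<ge> 0" using t by simp
      have "real k \<le> real (nat \<lfloor>(t + 1) * m / 2\<rfloor>)" by (simp add: k_def)
      also have "\<dots> \<le> (t + 1) * m / 2" using pos by (rule of_nat_floor)
      finally show "z k \<le> t" using m by (simp add: z_def field_simps)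
      have "(t + 1) * m / 2 \<le> real (Suc k)"
      proof (cases "nat \<lfloor>(t + 1) * m / 2\<rfloor> \<le> m - 1")
        case True
        then have "real (Suc k) = of_int \<lfloor>(t + 1) * m / 2\<rfloor> + 1" using pos by (simp add: k_def)
        then show ?thesis by linarith
      next
        case False
        then have "Suc k = m" using m by (simp add: k_def)
        moreover have "(t + 1) * real m \<le> 2 * real m" using t by (intro mult_right_mono) auto
        ultimately show ?thesis by simp
      qed
      then show "t \<le> z (Suc k)" using m by (simp add: z_def field_simps)
    qed
    have "v \<in> space (\<Pi>\<^sub>M i\<in>{..<1::nat}. borel :: real measure)"
      using v by (auto simp: space_PiM cube_def PiE_iff)
    then have "v \<in> cell k" using zk by (simp add: cell_def t_def)
    then have nb: "k \<notin> bad x'" using v by (auto simp: Bad_def)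
    then have nbr: "active ds (ext x') (z k) = active ds (ext x') (z (Suc k))"
      using k by (auto simp: bad_def Br)
    have cross: "K < N x' k \<longleftrightarrow> K < N x' (Suc k)" "- K < N x' k \<longleftrightarrow> - K < N x' (Suc k)"
      using nb k by (auto simp: bad_def)
    have "\<bar>clip K (net ds (ext x') (\<lambda>_. t)) - clip K (net ds (ext x) (\<lambda>_. t))\<bar> \<le> \<eta>"
    proof (rule clip_close_on_interval[OF len2 zk _ _ _ _ \<eta>])
      show "active ds (ext x') (z k) = active ds (ext x') (z k)" ..
      show "active ds (ext x') (z (Suc k)) = active ds (ext x') (z k)" using nbr by simp
      show "active ds (ext x) (z k) = active ds (ext x') (z k)" using act k by simp
      show "active ds (ext x) (z (Suc k)) = active ds (ext x') (z k)" using act[of "Suc k"] k nbr by simp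
      show "- K + real j * \<eta> < net ds (ext x') (\<lambda>_. t) \<longleftrightarrow> - K + real j * \<eta> < net ds (ext x) (\<lambda>_. t)"
        if "j \<le> J" "t \<in> {z k, z (Suc k)}" for j t
        using that lev[of k j] lev[of "Suc k" j] k by (auto simp: N_def)
    qed (use cross in \<open>auto simp: N_def\<close>)
    moreover have "net ds \<theta> v = net ds \<theta> (\<lambda>_. t)" for \<theta>
      using len out inp by (intro net_cong) (auto simp: t_def)
    ultimately show ?thesis by (simp add: abs_minus_commute)
  qed
  define T where "T = (\<lambda>x. (ext x, Bad x)) ` T0"
  have "real (card T) \<le> real (card T0)" unfolding T_def using finT0 by (simp add: card_image_le)
  also have "\<dots> \<le> real ((2 * (2 ^ (L * w) * ((m + 1) * (L * w + J + 1)) * L) + 4 * s + 1) ^ s)"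
    using cardT0 by (rule of_nat_mono)
  finally have cardT: "real (card T) \<le> \<dots>" .
  have cov: "\<exists>x'\<in>T0. \<forall>v\<in>cube 1 - Bad x'. \<bar>clip K (net ds \<theta> v) - clip K (net ds (ext x') v)\<bar> \<le> \<eta>"
    if \<theta>: "\<theta> \<in> supported ds A R" for \<theta>
  proof -
    define x where "x = restrict \<theta> A"
    have "x \<in> X" using \<theta> A
      by (auto simp: x_def X_def supported_def abs_le_iff subset_eq minus_le_iff)
    then obtain x' where x': "x' \<in> T0" "pat x = pat x'" using T0(3) by blast
    have "net ds \<theta> v = net ds (ext x) v" for v
      using \<theta> len out by (intro net_cong) (auto simp: ext_def x_def supported_def)
    then show ?thesis using close[OF x'(2)] x'(1) by auto
  qed
  show ?thesis unfolding clip_cover_def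
  proof (intro exI[of _ T] conjI)
    show "\<forall>\<theta>\<in>supported ds A R. \<exists>(c, Bad)\<in>T. \<forall>x\<in>cube 1 - Bad.
        \<bar>clip K (net ds \<theta> x) - clip K (net ds c x)\<bar> \<le> 2 * K / real J"
    proof
      fix \<theta> assume "\<theta> \<in> supported ds A R"
      then obtain x' where x': "x' \<in> T0" "\<forall>v\<in>cube 1 - Bad x'.
          \<bar>clip K (net ds \<theta> v) - clip K (net ds (ext x') v)\<bar> \<le> \<eta>"
        using cov by blast
      then show "\<exists>(c, Bad)\<in>T. \<forall>x\<in>cube 1 - Bad.
          \<bar>clip K (net ds \<theta> x) - clip K (net ds c x)\<bar> \<le> 2 * K / real J"
        unfolding T_def \<eta>_def by (intro bexI[of _ "(ext x', Bad x')"] imageI) auto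
    qed
    show "\<forall>(c, Bad)\<in>T. Bad \<in> sets (\<Pi>\<^sub>M i\<in>{..<1}. borel) \<and>
        measure (input_law 1) Bad \<le> ?\<beta>"
      unfolding T_def by (intro ballI) (elim imageE, simp only: prod.case, intro conjI Badm Badle)
    show "finite T" using finT0 by (simp add: T_def)
  qed (rule cardT)
qed

subsection \<open>Divergence\<close>

lemma kl_real_density:
  assumes P: "prob_space P" and Q: "prob_space Q" and sets: "sets Q = sets P"
    and ac: "absolutely_continuous P Q"
  obtains g where "g \<in> borel_measurable P" "\<And>x. 0 \<le> g x" "AE x in Q. 0 < g x"
    "Q = density P (\<lambda>x. ennreal (g x))" "AE x in Q. entropy_density (exp 1) P Q x = ln (g x)"
proof -
  interpret P: prob_space P by fact
  interpret Q: prob_space Q by fact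
  obtain g where g: "g \<in> borel_measurable P" "AE x in P. RN_deriv P Q x = ennreal (g x)"
    "AE x in Q. 0 < g x" "\<And>x. 0 \<le> g x"
    using P.real_RN_deriv[OF _ ac sets] Q.finite_measure_axioms by blast
  have "Q = density P (RN_deriv P Q)" using P.density_RN_deriv[OF ac sets] by simp
  also have "\<dots> = density P (\<lambda>x. ennreal (g x))"
    using g by (intro density_cong) auto
  finally have Qd: "Q = density P (\<lambda>x. ennreal (g x))" .
  have "AE x in Q. RN_deriv P Q x = ennreal (g x)"
    using absolutely_continuous_AE[OF sets ac g(2)] .
  then have "AE x in Q. entropy_density (exp 1) P Q x = ln (g x)"
    by eventually_elim (simp add: entropy_density_def g(4) log_def)
  with g Qd show ?thesis using that by blast
qed

text \<open>With \<open>g\<close> the density of \<open>Q\<close>, the ratio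
  \<open>r = exp h / (g * c)\<close> has \<open>Q\<close>-mean at most one, and integrating
  \<open>ln r \<le> r - 1\<close> gives the bound. An infinite divergence makes it trivial.\<close>

lemma donsker_varadhan:
  fixes h :: "'a \<Rightarrow> real"
  assumes P: "prob_space P" and Q: "prob_space Q" and sets: "sets Q = sets P"
    and h: "h \<in> borel_measurable P" "\<And>x. \<bar>h x\<bar> \<le> b"
    and c: "(\<integral>\<^sup>+x. ennreal (exp (h x)) \<partial>P) \<le> ennreal c" "c > 0"
  shows "ereal (\<integral>x. h x \<partial>Q) \<le> kl Q P + ereal (ln c)"
proof (cases "absolutely_continuous P Q \<and> integrable Q (entropy_density (exp 1) P Q)")
  case False
  then show ?thesis by (simp only: kl_def) simp
next
  case True
  interpret P: prob_space P by fact
  interpret Q: prob_space Q by fact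
  obtain g where g: "g \<in> borel_measurable P" "\<And>x. 0 \<le> g x" "AE x in Q. 0 < g x"
    "Q = density P (\<lambda>x. ennreal (g x))" "AE x in Q. entropy_density (exp 1) P Q x = ln (g x)"
    using kl_real_density[OF P Q sets] True by blast
  note [measurable] = g(1) h(1)
  have hQ: "h \<in> borel_measurable Q" using h(1) sets by (simp cong: measurable_cong_sets)
  have gQ: "g \<in> borel_measurable Q" using g(1) sets by (simp cong: measurable_cong_sets)
  define r where "r x = exp (h x) / (g x * c)" for x
  have rQ: "r \<in> borel_measurable Q" unfolding r_def using hQ gQ by measurable
  have r0: "0 \<le> r x" for x using g(2) c(2) by (simp add: r_def)
  have "(\<integral>\<^sup>+x. ennreal (r x) \<partial>Q) = (\<integral>\<^sup>+x. ennreal (g x) * ennreal (r x) \<partial>P)"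
    unfolding g(4) using rQ sets by (subst nn_integral_density) (auto cong: measurable_cong_sets)
  also have "\<dots> \<le> (\<integral>\<^sup>+x. ennreal (1 / c) * ennreal (exp (h x)) \<partial>P)"
  proof (rule nn_integral_mono)
    fix x
    have "g x * r x \<le> 1 / c * exp (h x)" using c(2) g(2)[of x] by (cases "g x = 0") (auto simp: r_def)
    then show "ennreal (g x) * ennreal (r x) \<le> ennreal (1 / c) * ennreal (exp (h x))"
      using g(2) r0 c(2) by (simp flip: ennreal_mult add: ennreal_leI)
  qed
  also have "\<dots> = ennreal (1 / c) * (\<integral>\<^sup>+x. ennreal (exp (h x)) \<partial>P)" by (rule nn_integral_cmult) simp
  also have "\<dots> \<le> ennreal (1 / c) * ennreal c" using c(1) by (rule mult_left_mono) simp
  also have "\<dots> = 1" using c(2) by (simp flip: ennreal_mult)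
  finally have r1: "(\<integral>\<^sup>+x. ennreal (r x) \<partial>Q) \<le> 1" .
  then have rint: "integrable Q r"
    using rQ r0 by (intro integrableI_nonneg) (auto simp: order.strict_trans1)
  have "ennreal (\<integral>x. r x \<partial>Q) \<le> ennreal 1" using nn_integral_eq_integral[OF rint] r0 r1 by simp
  then have r1': "(\<integral>x. r x \<partial>Q) \<le> 1" by (subst (asm) ennreal_le_iff) auto
  have hint: "integrable Q h"
    using hQ h(2) by (intro Q.integrable_const_bound[of _ b]) auto
  have "(\<integral>x. h x - entropy_density (exp 1) P Q x - ln c \<partial>Q) \<le> (\<integral>x. r x - 1 \<partial>Q)"
  proof (rule integral_mono_AE)
    show "AE x in Q. h x - entropy_density (exp 1) P Q x - ln c \<le> r x - 1"
      using g(3,5)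
    proof eventually_elim
      case (elim x)
      have "ln (r x) \<le> r x - 1" using elim c(2) by (intro ln_le_minus_one) (simp add: r_def)
      moreover have "ln (r x) = h x - ln (g x) - ln c"
        using elim c(2) by (simp add: r_def ln_div ln_mult)
      ultimately show ?case using elim by simp
    qed
  qed (use True hint rint in auto)
  also have "\<dots> \<le> 0" using r1' rint by (simp add: Q.prob_space)
  finally have "(\<integral>x. h x \<partial>Q) \<le> KL_divergence (exp 1) P Q + ln c"
    using True hint by (simp add: KL_divergence_def Q.prob_space)
  then show ?thesis using True by (simp add: kl_def)
qed

text \<open>The domination hypothesis says that \<open>Q\<close> has density at most
  \<open>exp u\<close> with respect to \<open>P\<close>, without exhibiting a density. This is the
  form in which comparing one mixture component with the whole prior delivers the bound for the
  competitor.\<close>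

lemma kl_le_integral:
  fixes u :: "'a \<Rightarrow> real"
  assumes P: "prob_space P" and Q: "prob_space Q" and sets: "sets Q = sets P"
    and u: "u \<in> borel_measurable P" "integrable Q u"
    and dom: "\<And>X. X \<in> sets P \<Longrightarrow> emeasure Q X \<le> (\<integral>\<^sup>+x\<in>X. ennreal (exp (u x)) \<partial>P)"
  shows "kl Q P \<le> ereal (\<integral>x. u x \<partial>Q)"
proof -
  interpret P: prob_space P by fact
  interpret Q: prob_space Q by fact
  have ac: "absolutely_continuous P Q"
    unfolding absolutely_continuous_def
  proof
    fix X assume X: "X \<in> null_sets P"
    then have "AE x in P. x \<notin> X" by (rule AE_not_in)
    then have "(\<integral>\<^sup>+x\<in>X. ennreal (exp (u x)) \<partial>P) = (\<integral>\<^sup>+x. 0 \<partial>P)"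
      by (intro nn_integral_cong_AE) (auto simp: indicator_def)
    then have "emeasure Q X = 0" using dom[of X] X by auto
    then show "X \<in> null_sets Q" using X sets by auto
  qed
  obtain g where g: "g \<in> borel_measurable P" "\<And>x. 0 \<le> g x" "AE x in Q. 0 < g x"
    "Q = density P (\<lambda>x. ennreal (g x))" "AE x in Q. entropy_density (exp 1) P Q x = ln (g x)"
    using kl_real_density[OF P Q sets ac] by blast
  note [measurable] = g(1) u(1)
  have gQ: "g \<in> borel_measurable Q" using g(1) sets by (simp cong: measurable_cong_sets)
  \<comment> \<open>Testing the domination on the set where the density exceeds \<open>exp u\<close>
    forces the excess \<open>d\<close> to have integral zero.\<close>
  define X where "X = {x \<in> space P. exp (u x) < g x}"
  have [measurable]: "X \<in> sets P" unfolding X_def by measurable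
  have QX: "emeasure Q X = (\<integral>\<^sup>+x. ennreal (g x) * indicator X x \<partial>P)"
    by (subst g(4)) (simp add: emeasure_density)
  define d where "d x = ennreal (g x - exp (u x)) * indicator X x" for x
  have dm: "d \<in> borel_measurable P" unfolding d_def[abs_def] by measurable
  have "(\<integral>\<^sup>+x. ennreal (g x) * indicator X x \<partial>P)
      = (\<integral>\<^sup>+x. ennreal (exp (u x)) * indicator X x + d x \<partial>P)"
    by (intro nn_integral_cong) (auto simp: d_def X_def indicator_def simp flip: ennreal_plus)
  also have "\<dots> = (\<integral>\<^sup>+x. ennreal (exp (u x)) * indicator X x \<partial>P) + (\<integral>\<^sup>+x. d x \<partial>P)"
    unfolding d_def by (rule nn_integral_add) auto
  finally have split: "emeasure Q X = (\<integral>\<^sup>+x\<in>X. ennreal (exp (u x)) \<partial>P) + (\<integral>\<^sup>+x. d x \<partial>P)"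
    using QX by simp
  have "(\<integral>\<^sup>+x\<in>X. ennreal (exp (u x)) \<partial>P) \<le> emeasure Q X" unfolding split by simp
  also have "\<dots> < \<infinity>" by (simp add: Q.emeasure_eq_measure)
  finally have fin: "(\<integral>\<^sup>+x\<in>X. ennreal (exp (u x)) \<partial>P) < \<infinity>" .
  have "(\<integral>\<^sup>+x\<in>X. ennreal (exp (u x)) \<partial>P) + (\<integral>\<^sup>+x. d x \<partial>P)
      \<le> (\<integral>\<^sup>+x\<in>X. ennreal (exp (u x)) \<partial>P) + 0"
    using dom[OF \<open>X \<in> sets P\<close>] split by simp
  then have "(\<integral>\<^sup>+x. d x \<partial>P) = 0"
    using fin by (subst (asm) ennreal_add_left_cancel_le) auto
  then have "AE x in P. d x = 0"
    using dm by (subst (asm) nn_integral_0_iff_AE) auto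
  then have "AE x in P. g x \<le> exp (u x)"
    using AE_space by eventually_elim (auto simp: d_def X_def indicator_def ennreal_eq_0_iff split: if_splits)
  then have gu: "AE x in Q. g x \<le> exp (u x)"
    by (rule absolutely_continuous_AE[OF sets ac])
  have "(\<integral>\<^sup>+x. ennreal (1 / g x) \<partial>Q) = (\<integral>\<^sup>+x. ennreal (g x) * ennreal (1 / g x) \<partial>P)"
    by (subst g(4)) (simp add: nn_integral_density)
  also have "\<dots> \<le> (\<integral>\<^sup>+x. 1 \<partial>P)"
    using g(2) by (intro nn_integral_mono) (auto simp flip: ennreal_mult)
  finally have "(\<integral>\<^sup>+x. ennreal (1 / g x) \<partial>Q) \<le> 1" using P.emeasure_space_1 by simp
  then have inv: "integrable Q (\<lambda>x. 1 / g x)"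
    using gQ g(2) by (intro integrableI_nonneg) (auto simp: order.strict_trans1)
  have ent: "entropy_density (exp 1) P Q \<in> borel_measurable Q"
    using measurable_entropy_density[of "exp 1" P Q] sets by (simp cong: measurable_cong_sets)
  \<comment> \<open>The lower bound is integrable because \<open>1 / g\<close> has
    \<open>Q\<close>-mean at most one. Together with the integrable upper bound \<open>u\<close> it
    makes the log density integrable, so that \<open>kl\<close> takes its finite branch.\<close>
  have bounds: "AE x in Q. 1 - 1 / g x \<le> entropy_density (exp 1) P Q x \<and> entropy_density (exp 1) P Q x \<le> u x"
    using g(3,5) gu
  proof eventually_elim
    case (elim x)
    have "ln (1 / g x) \<le> 1 / g x - 1" using elim by (intro ln_le_minus_one) simp
    then have "1 - 1 / g x \<le> ln (g x)" using elim by (simp add: ln_div)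
    moreover have "ln (g x) \<le> u x" using elim by (metis ln_exp ln_mono exp_gt_zero)
    ultimately show ?case using elim by simp
  qed
  have int: "integrable Q (entropy_density (exp 1) P Q)"
  proof (rule Bochner_Integration.integrable_bound)
    show "integrable Q (\<lambda>x. \<bar>u x\<bar> + (1 + 1 / g x))"
      using u(2) inv by (intro Bochner_Integration.integrable_add) auto
    show "AE x in Q. norm (entropy_density (exp 1) P Q x) \<le> norm (\<bar>u x\<bar> + (1 + 1 / g x))"
      using bounds
    proof eventually_elim
      case (elim x)
      have "1 / g x \<ge> 0" using g(2) by simp
      then show ?case unfolding real_norm_def using elim by linarith
    qed
  qed (rule ent)
  have "KL_divergence (exp 1) P Q \<le> (\<integral>x. u x \<partial>Q)"
    unfolding KL_divergence_def using bounds by (intro integral_mono_AE int u(2)) auto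
  then show ?thesis using ac int by (simp add: kl_def)
qed

subsection \<open>Gaussian integrals\<close>

lemma sets_normal_law [simp, measurable_cong]: "sets (normal_law \<mu> \<sigma>) = sets borel"
  by (simp add: normal_law_def)

lemma prob_space_normal_law: "\<sigma> > 0 \<Longrightarrow> prob_space (normal_law \<mu> \<sigma>)"
  unfolding normal_law_def by (rule prob_space_normal_density)

lemma nn_integral_normal_law:
  assumes [measurable]: "f \<in> borel_measurable borel"
  shows "(\<integral>\<^sup>+x. f x \<partial>normal_law \<mu> \<sigma>) = (\<integral>\<^sup>+x. ennreal (normal_density \<mu> \<sigma> x) * f x \<partial>lborel)"
  unfolding normal_law_def by (simp add: nn_integral_density)

lemma nn_integral_normal_density: "\<sigma> > 0 \<Longrightarrow> (\<integral>\<^sup>+x. ennreal (normal_density \<mu> \<sigma> x) \<partial>lborel) = 1"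
  using prob_space.emeasure_space_1[OF prob_space_normal_law[of \<sigma> \<mu>]]
  by (simp add: normal_law_def emeasure_density)

lemma nn_integral_normal_shift_mgf:
  assumes "\<sigma> > 0"
  shows "(\<integral>\<^sup>+e. ennreal (exp (c * (e - \<mu>))) \<partial>normal_law \<mu> \<sigma>) = ennreal (exp (c\<^sup>2 * \<sigma>\<^sup>2 / 2))"
proof -
  have *: "normal_density \<mu> \<sigma> e * exp (c * (e - \<mu>))
      = exp (c\<^sup>2 * \<sigma>\<^sup>2 / 2) * normal_density (\<mu> + c * \<sigma>\<^sup>2) \<sigma> e" for e
  proof -
    have "- (e - \<mu>)\<^sup>2 / (2 * \<sigma>\<^sup>2) + c * (e - \<mu>)
        = c\<^sup>2 * \<sigma>\<^sup>2 / 2 + (- (e - (\<mu> + c * \<sigma>\<^sup>2))\<^sup>2 / (2 * \<sigma>\<^sup>2))"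
      using assms by (simp add: field_simps power2_eq_square)
    then show ?thesis by (simp add: normal_density_def flip: exp_add)
  qed
  have "(\<integral>\<^sup>+e. ennreal (exp (c * (e - \<mu>))) \<partial>normal_law \<mu> \<sigma>)
      = (\<integral>\<^sup>+e. ennreal (normal_density \<mu> \<sigma> e * exp (c * (e - \<mu>))) \<partial>lborel)"
    by (subst nn_integral_normal_law) (auto simp: ennreal_mult)
  also have "\<dots> = (\<integral>\<^sup>+e. ennreal (exp (c\<^sup>2 * \<sigma>\<^sup>2 / 2)) * ennreal (normal_density (\<mu> + c * \<sigma>\<^sup>2) \<sigma> e) \<partial>lborel)"
    unfolding * by (simp add: ennreal_mult)
  also have "\<dots> = ennreal (exp (c\<^sup>2 * \<sigma>\<^sup>2 / 2)) * (\<integral>\<^sup>+e. ennreal (normal_density (\<mu> + c * \<sigma>\<^sup>2) \<sigma> e) \<partial>lborel)"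
    by (rule nn_integral_cmult) simp
  finally show ?thesis using nn_integral_normal_density[OF assms] by simp
qed

lemma gaussian_mgf:
  assumes "\<sigma> > 0"
  shows "(\<integral>\<^sup>+e. ennreal (exp (c * e)) \<partial>normal_law 0 \<sigma>) = ennreal (exp (c\<^sup>2 * \<sigma>\<^sup>2 / 2))"
  using nn_integral_normal_shift_mgf[OF assms, where c = c and \<mu> = 0] by simp

text \<open>The factor \<open>exp (e\<^sup>2 / (4 * \<sigma>\<^sup>2))\<close> halves the Gaussian
  exponent, which leaves \<open>sqrt 2\<close> times the normal density of variance
  \<open>2 * \<sigma>\<^sup>2\<close>.\<close>

lemma gaussian_exp_square:
  assumes "\<sigma> > 0"
  shows "(\<integral>\<^sup>+e. ennreal (exp (e\<^sup>2 / (4 * \<sigma>\<^sup>2))) \<partial>normal_law 0 \<sigma>) = ennreal (sqrt 2)"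
proof -
  have *: "normal_density 0 \<sigma> e * exp (e\<^sup>2 / (4 * \<sigma>\<^sup>2)) = sqrt 2 * normal_density 0 (sqrt 2 * \<sigma>) e" for e
  proof -
    have "- e\<^sup>2 / (2 * \<sigma>\<^sup>2) + e\<^sup>2 / (4 * \<sigma>\<^sup>2) = - e\<^sup>2 / (4 * \<sigma>\<^sup>2)"
      using assms by (simp add: field_simps)
    moreover have "sqrt (2 * pi * (2 * \<sigma>\<^sup>2)) = sqrt 2 * sqrt (2 * pi * \<sigma>\<^sup>2)"
      by (simp flip: real_sqrt_mult add: mult_ac)
    ultimately show ?thesis by (simp add: normal_density_def power_mult_distrib flip: exp_add)
  qed
  have "(\<integral>\<^sup>+e. ennreal (exp (e\<^sup>2 / (4 * \<sigma>\<^sup>2))) \<partial>normal_law 0 \<sigma>)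
      = (\<integral>\<^sup>+e. ennreal (normal_density 0 \<sigma> e * exp (e\<^sup>2 / (4 * \<sigma>\<^sup>2))) \<partial>lborel)"
    by (subst nn_integral_normal_law) (auto simp: ennreal_mult)
  also have "\<dots> = (\<integral>\<^sup>+e. ennreal (sqrt 2) * ennreal (normal_density 0 (sqrt 2 * \<sigma>) e) \<partial>lborel)"
    unfolding * by (simp add: ennreal_mult)
  also have "\<dots> = ennreal (sqrt 2) * (\<integral>\<^sup>+e. ennreal (normal_density 0 (sqrt 2 * \<sigma>) e) \<partial>lborel)"
    by (rule nn_integral_cmult) simp
  finally show ?thesis using nn_integral_normal_density[of "sqrt 2 * \<sigma>"] assms by simp
qed

subsection \<open>The data\<close>

abbreviation obs_space :: "nat \<Rightarrow> ((nat \<Rightarrow> real) \<times> real) measure" where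
  "obs_space p \<equiv> (\<Pi>\<^sub>M i\<in>{..<p}. borel) \<Otimes>\<^sub>M borel"

lemma obs_map_measurable:
  assumes "f \<in> borel_measurable (\<Pi>\<^sub>M i\<in>{..<p}. borel)"
  shows "(\<lambda>(x, e). (x, f x + e)) \<in> measurable (input_law p \<Otimes>\<^sub>M normal_law 0 \<sigma>) (obs_space p)"
proof -
  have "(\<lambda>(x, e). (x, f x + e)) \<in> measurable (obs_space p) (obs_space p)"
    using assms by measurable
  also have "measurable (obs_space p) (obs_space p)
      = measurable (input_law p \<Otimes>\<^sub>M normal_law 0 \<sigma>) (obs_space p)"
    by (intro measurable_cong_sets sets_pair_measure_cong) (simp_all add: sets_input_law)
  finally show ?thesis .
qed

lemma sets_obs_law [measurable_cong]: "sets (obs_law p \<sigma> f) = sets (obs_space p)"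
  by (simp add: obs_law_def)

lemma prob_space_obs_law:
  assumes "f \<in> borel_measurable (\<Pi>\<^sub>M i\<in>{..<p}. borel)" "\<sigma> > 0"
  shows "prob_space (obs_law p \<sigma> f)"
proof -
  interpret X: prob_space "input_law p" by (rule prob_space_input_law)
  interpret N: prob_space "normal_law 0 \<sigma>" by (rule prob_space_normal_law[OF assms(2)])
  interpret pair_prob_space "input_law p" "normal_law 0 \<sigma>" ..
  show ?thesis unfolding obs_law_def by (intro prob_space_distr obs_map_measurable assms)
qed

lemma nn_integral_obs_law:
  assumes f: "f \<in> borel_measurable (\<Pi>\<^sub>M i\<in>{..<p}. borel)" and "\<sigma> > 0"
    and u: "u \<in> borel_measurable (obs_space p)"
  shows "(\<integral>\<^sup>+z. u z \<partial>obs_law p \<sigma> f) = (\<integral>\<^sup>+x. \<integral>\<^sup>+e. u (x, f x + e) \<partial>normal_law 0 \<sigma> \<partial>input_law p)"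
proof -
  interpret N: prob_space "normal_law 0 \<sigma>" by (rule prob_space_normal_law[OF assms(2)])
  have "(\<integral>\<^sup>+z. u z \<partial>obs_law p \<sigma> f)
      = (\<integral>\<^sup>+z. u (case z of (x, e) \<Rightarrow> (x, f x + e)) \<partial>(input_law p \<Otimes>\<^sub>M normal_law 0 \<sigma>))"
    unfolding obs_law_def using obs_map_measurable[OF f, of \<sigma>] u by (simp add: nn_integral_distr)
  also have "\<dots> = (\<integral>\<^sup>+x. \<integral>\<^sup>+e. u (case (x, e) of (x, e) \<Rightarrow> (x, f x + e)) \<partial>normal_law 0 \<sigma> \<partial>input_law p)"
    using measurable_compose[OF obs_map_measurable[OF f] u] by (subst N.nn_integral_fst) auto
  finally show ?thesis by simp
qed

lemma sets_data_law: "sets (data_law p \<sigma> f n) = sets (\<Pi>\<^sub>M i\<in>{..<n}. obs_space p)"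
  unfolding data_law_def by (intro sets_PiM_cong) (auto simp: sets_obs_law)

lemma prob_space_data_law:
  assumes "f \<in> borel_measurable (\<Pi>\<^sub>M i\<in>{..<p}. borel)" "\<sigma> > 0"
  shows "prob_space (data_law p \<sigma> f n)"
  unfolding data_law_def using prob_space_obs_law[OF assms] by (intro prob_space_PiM)

text \<open>Markov's inequality at exponent one, since any scaling is already part of
  \<open>v\<close>; independence turns the exponential moment of the sum into a power.\<close>

lemma chernoff:
  fixes v :: "(nat \<Rightarrow> real) \<times> real \<Rightarrow> real" and t :: real and n :: nat
  assumes f: "f \<in> borel_measurable (\<Pi>\<^sub>M i\<in>{..<p}. borel)" and \<sigma>: "\<sigma> > 0"
    and v: "v \<in> borel_measurable (obs_space p)"
    and mgf: "(\<integral>\<^sup>+z. ennreal (exp (v z)) \<partial>obs_law p \<sigma> f) \<le> ennreal (exp b)"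
  defines "X \<equiv> {D \<in> space (data_law p \<sigma> f n). real n * b + t < (\<Sum>i<n. v (D i))}"
  shows "X \<in> sets (data_law p \<sigma> f n)" "measure (data_law p \<sigma> f n) X \<le> exp (- t)"
proof -
  let ?P = "data_law p \<sigma> f n"
  interpret O: prob_space "obs_law p \<sigma> f" by (rule prob_space_obs_law[OF f \<sigma>])
  interpret PS: product_sigma_finite "\<lambda>_. obs_law p \<sigma> f" ..
  interpret P: prob_space ?P by (rule prob_space_data_law[OF f \<sigma>])
  have vi: "(\<lambda>D. v (D i)) \<in> borel_measurable ?P" if "i < n" for i
  proof -
    have "(\<lambda>D. D i) \<in> measurable ?P (obs_space p)"
      using that measurable_component_singleton[of i "{..<n}" "\<lambda>_. obs_space p"]
      by (simp cong: measurable_cong_sets add: sets_data_law)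
    then show ?thesis using v by (rule measurable_compose)
  qed
  then have s: "(\<lambda>D. \<Sum>i<n. v (D i)) \<in> borel_measurable ?P" by (intro borel_measurable_sum) auto
  show X: "X \<in> sets ?P" unfolding X_def using s by measurable
  have vo: "v \<in> borel_measurable (obs_law p \<sigma> f)" using v by (simp cong: measurable_cong_sets add: sets_obs_law)
  have "(\<integral>\<^sup>+D. ennreal (exp (\<Sum>i<n. v (D i))) \<partial>?P) = (\<integral>\<^sup>+D. (\<Prod>i<n. ennreal (exp (v (D i)))) \<partial>?P)"
    by (simp add: exp_sum prod_ennreal)
  also have "\<dots> = (\<Prod>i<n. \<integral>\<^sup>+z. ennreal (exp (v z)) \<partial>obs_law p \<sigma> f)"
    unfolding data_law_def using vo by (intro PS.product_nn_integral_prod) auto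
  also have "\<dots> \<le> (\<Prod>i<n. ennreal (exp b))"
    using mgf by (induction n) (auto intro: mult_mono)
  also have "\<dots> = ennreal (exp (real n * b))" by (simp add: ennreal_power exp_of_nat_mult)
  finally have mgfn: "(\<integral>\<^sup>+D. ennreal (exp (\<Sum>i<n. v (D i))) \<partial>?P) \<le> ennreal (exp (real n * b))" .
  have "emeasure ?P X = (\<integral>\<^sup>+D. indicator X D \<partial>?P)" using X by simp
  also have "\<dots> \<le> (\<integral>\<^sup>+D. ennreal (exp (- (real n * b + t))) * ennreal (exp (\<Sum>i<n. v (D i))) \<partial>?P)"
  proof (rule nn_integral_mono)
    fix D
    show "indicator X D \<le> ennreal (exp (- (real n * b + t))) * ennreal (exp (\<Sum>i<n. v (D i)))"
    proof (cases "D \<in> X")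
      case True
      then have "1 \<le> exp (- (real n * b + t)) * exp (\<Sum>i<n. v (D i))"
        unfolding X_def by (simp flip: exp_add)
      then show ?thesis using True by (simp flip: ennreal_mult add: ennreal_1[symmetric] del: ennreal_1)
    qed simp
  qed
  also have "\<dots> = ennreal (exp (- (real n * b + t))) * (\<integral>\<^sup>+D. ennreal (exp (\<Sum>i<n. v (D i))) \<partial>?P)"
    using measurable_compose[OF s, of "\<lambda>y. ennreal (exp y)" borel] by (intro nn_integral_cmult) simp
  also have "\<dots> \<le> ennreal (exp (- (real n * b + t))) * ennreal (exp (real n * b))"
    using mgfn by (rule mult_left_mono) simp
  also have "\<dots> = ennreal (exp (- t))" by (simp flip: ennreal_mult exp_add)
  finally show "measure ?P X \<le> exp (- t)" by (simp add: P.emeasure_eq_measure)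
qed

subsection \<open>Hellinger distances\<close>

lemma AE_input_law_cube: "AE x in input_law p. x \<in> cube p"
proof -
  have "AE t in uniform_law (-1) 1. t \<in> {-1..1}"
    unfolding uniform_law_def by (simp add: AE_uniform_measureI)
  then have "AE x in input_law p. x i \<in> {-1..1}" if "i < p" for i
    unfolding input_law_def using that by (intro AE_PiM_component prob_space_uniform_law) auto
  then have "AE x in input_law p. \<forall>i\<in>{..<p}. x i \<in> {-1..1}"
    by (intro AE_finite_allI) auto
  then show ?thesis
    using AE_space
  proof eventually_elim
    case (elim x)
    then show ?case by (auto simp: cube_def input_law_def space_PiM PiE_iff)
  qed
qed

lemma exp_neg_square_lipschitz: "\<bar>exp (- u\<^sup>2) - exp (- v\<^sup>2)\<bar> \<le> \<bar>u - v\<bar>" for u v :: real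
proof -
  have "norm (exp (- u\<^sup>2) - exp (- v\<^sup>2)) \<le> 1 * norm (u - v)"
  proof (rule field_differentiable_bound[of UNIV "\<lambda>u. exp (- u\<^sup>2)" "\<lambda>u. - 2 * u * exp (- u\<^sup>2)"])
    fix z :: real
    show "((\<lambda>u. exp (- u\<^sup>2)) has_field_derivative - 2 * z * exp (- z\<^sup>2)) (at z within UNIV)"
      by (auto intro!: derivative_eq_intros)
    have "0 \<le> (1 - \<bar>z\<bar>)\<^sup>2" by simp
    then have "2 * \<bar>z\<bar> \<le> 1 + z\<^sup>2" by (simp add: power2_diff)
    also have "\<dots> \<le> exp (z\<^sup>2)" by (rule exp_ge_add_one_self)
    finally have "2 * \<bar>z\<bar> * exp (- z\<^sup>2) \<le> exp (z\<^sup>2) * exp (- z\<^sup>2)" by (intro mult_right_mono) auto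
    then show "norm (- 2 * z * exp (- z\<^sup>2)) \<le> 1" by (simp add: abs_mult flip: exp_add)
  qed auto
  then show ?thesis by simp
qed

text \<open>The Hellinger affinity of two normal laws of standard deviation \<open>\<sigma>\<close>
  whose means differ by \<open>a\<close>.\<close>

definition affinity :: "real \<Rightarrow> real \<Rightarrow> real" where
  "affinity \<sigma> a = exp (- (a\<^sup>2 / (8 * \<sigma>\<^sup>2)))"

lemma affinity_bounds: "0 < affinity \<sigma> a" "affinity \<sigma> a \<le> 1"
  by (auto simp: affinity_def)

lemma affinity_lipschitz:
  assumes "\<sigma> > 0"
  shows "\<bar>affinity \<sigma> a - affinity \<sigma> b\<bar> \<le> \<bar>a - b\<bar> / \<sigma>"
proof -
  have r: "(sqrt 8 * \<sigma>)\<^sup>2 = 8 * \<sigma>\<^sup>2" by (simp add: power_mult_distrib)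
  have "\<bar>affinity \<sigma> a - affinity \<sigma> b\<bar> = \<bar>exp (- (a / (sqrt 8 * \<sigma>))\<^sup>2) - exp (- (b / (sqrt 8 * \<sigma>))\<^sup>2)\<bar>"
    by (simp add: affinity_def power_divide r)
  also have "\<dots> \<le> \<bar>a / (sqrt 8 * \<sigma>) - b / (sqrt 8 * \<sigma>)\<bar>" by (rule exp_neg_square_lipschitz)
  also have "\<dots> = \<bar>a - b\<bar> / (sqrt 8 * \<sigma>)"
    using assms by (simp add: diff_divide_distrib[symmetric] abs_mult)
  also have "\<dots> \<le> \<bar>a - b\<bar> / \<sigma>"
    using assms by (intro divide_left_mono) (auto simp: mult_le_cancel_right1)
  finally show ?thesis .
qed

lemma hellinger_sq_affinity: "hellinger_sq p \<sigma> f g = (\<integral>x. 1 - affinity \<sigma> (f x - g x) \<partial>input_law p)"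
  by (simp add: hellinger_sq_def affinity_def)

lemma affinity_measurable [measurable]: "affinity \<sigma> \<in> borel_measurable borel"
  unfolding affinity_def[abs_def] by measurable

lemma integrable_affinity:
  assumes "f \<in> borel_measurable (\<Pi>\<^sub>M i\<in>{..<p}. borel)" "g \<in> borel_measurable (\<Pi>\<^sub>M i\<in>{..<p}. borel)"
  shows "integrable (input_law p) (\<lambda>x. affinity \<sigma> (f x - g x))"
proof -
  interpret prob_space "input_law p" by (rule prob_space_input_law)
  have "(\<lambda>x. affinity \<sigma> (f x - g x)) \<in> borel_measurable (\<Pi>\<^sub>M i\<in>{..<p}. borel)"
    using assms by measurable
  then have "(\<lambda>x. affinity \<sigma> (f x - g x)) \<in> borel_measurable (input_law p)"
    by (simp cong: measurable_cong_sets add: sets_input_law)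
  then show ?thesis
    using affinity_bounds by (intro integrable_const_bound[of _ 1]) (auto simp: less_imp_le)
qed

text \<open>Measurability is not at issue here: a non-integrable integrand has integral 0, which
  satisfies both bounds.\<close>

lemma hellinger_sq_bounds: "0 \<le> hellinger_sq p \<sigma> f g" "hellinger_sq p \<sigma> f g \<le> 1"
proof -
  interpret prob_space "input_law p" by (rule prob_space_input_law)
  show "0 \<le> hellinger_sq p \<sigma> f g"
    unfolding hellinger_sq_affinity using affinity_bounds
    by (intro Bochner_Integration.integral_nonneg) auto
  show "hellinger_sq p \<sigma> f g \<le> 1"
  proof (cases "integrable (input_law p) (\<lambda>x. 1 - affinity \<sigma> (f x - g x))")
    case True
    then have "hellinger_sq p \<sigma> f g \<le> (\<integral>x. 1 \<partial>input_law p)"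
      unfolding hellinger_sq_affinity using affinity_bounds by (intro integral_mono) (auto simp: less_imp_le)
    then show ?thesis by (simp add: prob_space)
  qed (simp add: hellinger_sq_affinity not_integrable_integral_eq)
qed

subsection \<open>Likelihood ratios over a cover\<close>

text \<open>The log likelihood ratio of \<open>f\<close> to the truth \<open>f0\<close>; the
  Gaussian normalising constants cancel.\<close>

definition llr ::
  "real \<Rightarrow> ((nat \<Rightarrow> real) \<Rightarrow> real) \<Rightarrow> nat \<Rightarrow> (nat \<Rightarrow> (nat \<Rightarrow> real) \<times> real) \<Rightarrow> ((nat \<Rightarrow> real) \<Rightarrow> real) \<Rightarrow> real"
where
  "llr \<sigma> f0 n D f =
     (\<Sum>i<n. (snd (D i) - f0 (fst (D i)))\<^sup>2 - (snd (D i) - f (fst (D i)))\<^sup>2) / (2 * \<sigma>\<^sup>2)"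

lemma likelihood_pos: "\<sigma> > 0 \<Longrightarrow> 0 < likelihood \<sigma> n D f"
  unfolding likelihood_def obs_density_def case_prod_beta
  by (intro prod_pos divide_pos_pos normal_density_pos) auto

lemma likelihood_eq_exp_llr:
  assumes "\<sigma> > 0"
  shows "likelihood \<sigma> n D f = likelihood \<sigma> n D f0 * exp (llr \<sigma> f0 n D f)"
proof -
  have "obs_density \<sigma> f z = obs_density \<sigma> f0 z
      * exp (((snd z - f0 (fst z))\<^sup>2 - (snd z - f (fst z))\<^sup>2) / (2 * \<sigma>\<^sup>2))" for z
  proof -
    have *: "- (a / \<sigma>)\<^sup>2 / 2 = - (b / \<sigma>)\<^sup>2 / 2 + (b\<^sup>2 - a\<^sup>2) / (2 * \<sigma>\<^sup>2)" for a b
      using assms by (simp add: power_divide diff_divide_distrib)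
    have "- ((snd z - f (fst z)) / \<sigma>)\<^sup>2 / 2 = - ((snd z - f0 (fst z)) / \<sigma>)\<^sup>2 / 2
        + ((snd z - f0 (fst z))\<^sup>2 - (snd z - f (fst z))\<^sup>2) / (2 * \<sigma>\<^sup>2)"
      by (rule *)
    then show ?thesis
      by (simp add: obs_density_def case_prod_beta std_normal_density_def flip: exp_add)
  qed
  then show ?thesis
    unfolding likelihood_def llr_def sum_divide_distrib
    by (simp add: exp_sum prod.distrib)
qed

text \<open>Clipping is the projection onto an interval that contains \<open>y\<close>, and
  projecting cannot increase the distance to a point of the interval.\<close>

lemma clip_le_imp: "\<bar>y\<bar> \<le> K \<Longrightarrow> (y - clip K f)\<^sup>2 \<le> (y - f)\<^sup>2" for y :: real
  by (subst abs_le_square_iff[symmetric]) (auto simp: clip_def)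

text \<open>Each centre is handled through half its log likelihood ratio to the truth, with
  exponential moment an affinity; Chernoff's bound and a union over the cover give the event.
  Passing from a centre to \<open>\<theta>\<close> costs 1 in the likelihood and 3 in the Hellinger
  term, for the clipping, the accuracy \<open>\<eta>\<close> and the exceptional set; the latter
  also costs 2 in the exponential moment. These add up to 6.\<close>

lemma cover_event:
  assumes f0: "f0 \<in> borel_measurable (\<Pi>\<^sub>M i\<in>{..<p}. borel)" and \<sigma>: "\<sigma> > 0"
    and F: "\<And>x. x \<in> cube p \<Longrightarrow> \<bar>f0 x\<bar> \<le> F" "F \<ge> 0"
    and ds: "length ds \<ge> 2" "ds ! 0 = p" and n: "n \<ge> 1"
    and K: "K = F + 2 * \<sigma> * n"
    and cover: "clip_cover ds p K \<eta> \<beta> S N" and N: "N > 0"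
    and \<eta>: "0 < \<eta>" "\<eta> * (n * K) \<le> \<sigma>\<^sup>2" "\<eta> * n \<le> \<sigma>" and \<beta>: "\<beta> * n \<le> 1"
  shows "\<exists>E \<in> sets (data_law p \<sigma> f0 n). 1 - exp (- t) \<le> measure (data_law p \<sigma> f0 n) E \<and>
    (\<forall>D\<in>E. (\<forall>i<n. fst (D i) \<in> cube p) \<longrightarrow> (\<Sum>i<n. (snd (D i) - f0 (fst (D i)))\<^sup>2) \<le> 4 * \<sigma>\<^sup>2 * n \<longrightarrow>
      (\<forall>\<theta>\<in>S. llr \<sigma> f0 n D (net ds \<theta>) / 2 + n * hellinger_sq p \<sigma> (net ds \<theta>) f0 \<le> ln N + t + 6))"
proof -
  let ?P = "data_law p \<sigma> f0 n"
  interpret P: prob_space ?P by (rule prob_space_data_law[OF f0 \<sigma>])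
  interpret I: prob_space "input_law p" by (rule prob_space_input_law)
  have K0: "K > 0" using F(2) \<sigma> n by (simp add: K add_nonneg_pos)
  obtain T where T: "finite T" "real (card T) \<le> N"
    and T': "\<forall>(c, Bad)\<in>T. Bad \<in> sets (\<Pi>\<^sub>M i\<in>{..<p}. borel) \<and> measure (input_law p) Bad \<le> \<beta>"
    "\<forall>\<theta>\<in>S. \<exists>(c, Bad)\<in>T. \<forall>x\<in>cube p - Bad. \<bar>clip K (net ds \<theta> x) - clip K (net ds c x)\<bar> \<le> \<eta>"
    using cover unfolding clip_cover_def by (elim exE conjE)
  have T3: "Bad \<in> sets (\<Pi>\<^sub>M i\<in>{..<p}. borel)" "measure (input_law p) Bad \<le> \<beta>" if "(c, Bad) \<in> T" for c Bad
    using T'(1) that by auto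
  define g where "g c x = clip K (net ds c x)" for c x
  have gm: "g c \<in> borel_measurable (\<Pi>\<^sub>M i\<in>{..<p}. borel)" for c
  proof -
    have "net ds c \<in> borel_measurable (\<Pi>\<^sub>M i\<in>{..<p}. borel)"
      using net_measurable_input[OF ds(1)] ds(2) by simp
    from measurable_compose[OF this clip_measurable] show ?thesis unfolding g_def[abs_def] .
  qed
  define h where "h c = hellinger_sq p \<sigma> (g c) f0" for c
  \<comment> \<open>On exceptional inputs nothing is known about the centre. There the half log
    likelihood ratio is replaced by the upper bound that drops the squared residual of the network,
    which serves all networks at once.\<close>
  define v where "v c Bad = (\<lambda>(x, y). if x \<in> Bad then (y - f0 x)\<^sup>2 / (4 * \<sigma>\<^sup>2)
      else ((y - f0 x)\<^sup>2 - (y - g c x)\<^sup>2) / (4 * \<sigma>\<^sup>2))" for c Bad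
  have vm: "v c Bad \<in> borel_measurable (obs_space p)" if "Bad \<in> sets (\<Pi>\<^sub>M i\<in>{..<p}. borel)" for c Bad
    unfolding v_def using that gm f0 by measurable
  define b where "b c = - h c + 2 * \<beta>" for c
  have mgf: "(\<integral>\<^sup>+z. ennreal (exp (v c Bad z)) \<partial>obs_law p \<sigma> f0) \<le> ennreal (exp (b c))"
    if c: "(c, Bad) \<in> T" for c Bad
  proof -
    have Bad: "Bad \<in> sets (\<Pi>\<^sub>M i\<in>{..<p}. borel)" "measure (input_law p) Bad \<le> \<beta>" using T3[OF c] by auto
    have "(\<integral>\<^sup>+z. ennreal (exp (v c Bad z)) \<partial>obs_law p \<sigma> f0)
        = (\<integral>\<^sup>+x. \<integral>\<^sup>+e. ennreal (exp (v c Bad (x, f0 x + e))) \<partial>normal_law 0 \<sigma> \<partial>input_law p)"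
      by (rule nn_integral_obs_law[OF f0 \<sigma>])
        (use measurable_compose[OF vm[OF Bad(1), of c], of "\<lambda>y. ennreal (exp y)" borel] in simp)
    also have "\<dots> \<le> (\<integral>\<^sup>+x. ennreal (affinity \<sigma> (g c x - f0 x)) + ennreal (sqrt 2) * indicator Bad x \<partial>input_law p)"
    proof (rule nn_integral_mono)
      fix x
      show "(\<integral>\<^sup>+e. ennreal (exp (v c Bad (x, f0 x + e))) \<partial>normal_law 0 \<sigma>)
          \<le> ennreal (affinity \<sigma> (g c x - f0 x)) + ennreal (sqrt 2) * indicator Bad x"
      proof (cases "x \<in> Bad")
        case True
        then show ?thesis using gaussian_exp_square[OF \<sigma>] by (simp add: v_def)
      next
        case False
        define d where "d = g c x - f0 x"
        have "exp (v c Bad (x, f0 x + e)) = exp (- d\<^sup>2 / (4 * \<sigma>\<^sup>2)) * exp (d / (2 * \<sigma>\<^sup>2) * e)" for e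
        proof -
          have "e\<^sup>2 - (e - d)\<^sup>2 = 2 * d * e - d\<^sup>2" by (simp add: power2_diff)
          then have "v c Bad (x, f0 x + e) = (2 * d * e - d\<^sup>2) / (4 * \<sigma>\<^sup>2)"
            using False by (simp add: v_def d_def algebra_simps)
          also have "\<dots> = - d\<^sup>2 / (4 * \<sigma>\<^sup>2) + d / (2 * \<sigma>\<^sup>2) * e"
            using \<sigma> by (simp add: field_simps)
          finally show ?thesis by (simp flip: exp_add)
        qed
        then have "(\<integral>\<^sup>+e. ennreal (exp (v c Bad (x, f0 x + e))) \<partial>normal_law 0 \<sigma>)
            = (\<integral>\<^sup>+e. ennreal (exp (- d\<^sup>2 / (4 * \<sigma>\<^sup>2))) * ennreal (exp (d / (2 * \<sigma>\<^sup>2) * e)) \<partial>normal_law 0 \<sigma>)"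
          by (simp add: ennreal_mult)
        also have "\<dots> = ennreal (exp (- d\<^sup>2 / (4 * \<sigma>\<^sup>2))) * ennreal (exp ((d / (2 * \<sigma>\<^sup>2))\<^sup>2 * \<sigma>\<^sup>2 / 2))"
          using gaussian_mgf[OF \<sigma>, of "d / (2 * \<sigma>\<^sup>2)"] by (subst nn_integral_cmult) auto
        also have "\<dots> = ennreal (affinity \<sigma> d)"
        proof -
          have "- d\<^sup>2 / (4 * \<sigma>\<^sup>2) + (d / (2 * \<sigma>\<^sup>2))\<^sup>2 * \<sigma>\<^sup>2 / 2 = - (d\<^sup>2 / (8 * \<sigma>\<^sup>2))"
            using \<sigma> by (simp add: field_simps power2_eq_square)
          then show ?thesis by (simp add: affinity_def flip: ennreal_mult exp_add)
        qed
        finally show ?thesis using False by (simp add: d_def)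
      qed
    qed
    also have "\<dots> = (\<integral>\<^sup>+x. ennreal (affinity \<sigma> (g c x - f0 x)) \<partial>input_law p) + ennreal (sqrt 2) * emeasure (input_law p) Bad"
    proof -
      have "(\<lambda>x. affinity \<sigma> (g c x - f0 x)) \<in> borel_measurable (input_law p)"
        using borel_measurable_integrable[OF integrable_affinity[OF gm f0]] .
      then show ?thesis using Bad(1) by (subst nn_integral_add) (auto simp: nn_integral_cmult_indicator sets_input_law)
    qed
    also have "(\<integral>\<^sup>+x. ennreal (affinity \<sigma> (g c x - f0 x)) \<partial>input_law p) = ennreal (1 - h c)"
    proof -
      have "h c = 1 - (\<integral>x. affinity \<sigma> (g c x - f0 x) \<partial>input_law p)"
        unfolding h_def hellinger_sq_affinity using integrable_affinity[OF gm f0]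
        by (subst Bochner_Integration.integral_diff) (auto simp: I.prob_space)
      then show ?thesis
        using integrable_affinity[OF gm f0] affinity_bounds
        by (subst nn_integral_eq_integral) (auto simp: less_imp_le)
    qed
    also have "ennreal (1 - h c) + ennreal (sqrt 2) * emeasure (input_law p) Bad
        = ennreal (1 - h c + sqrt 2 * measure (input_law p) Bad)"
      using hellinger_sq_bounds(2)[of p \<sigma> "g c" f0]
      by (simp add: I.emeasure_eq_measure h_def flip: ennreal_mult ennreal_plus)
    also have "\<dots> \<le> ennreal (exp (b c))"
    proof (rule ennreal_leI)
      have "sqrt 2 * measure (input_law p) Bad \<le> 2 * \<beta>"
        using Bad(2) sqrt2_less_2 by (intro mult_mono) auto
      then have "1 - h c + sqrt 2 * measure (input_law p) Bad \<le> 1 + b c" by (simp add: b_def)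
      also have "\<dots> \<le> exp (b c)" by (rule exp_ge_add_one_self)
      finally show "1 - h c + sqrt 2 * measure (input_law p) Bad \<le> exp (b c)" .
    qed
    finally show ?thesis .
  qed
  define t' where "t' = ln N + t"
  define X where "X = (\<lambda>(c, Bad). {D \<in> space ?P. real n * b c + t' < (\<Sum>i<n. v c Bad (D i))})"
  have X: "X cB \<in> sets ?P" "measure ?P (X cB) \<le> exp (- t')" if cB: "cB \<in> T" for cB
  proof -
    obtain c Bad where cB': "cB = (c, Bad)" by fastforce
    then have "(c, Bad) \<in> T" using cB by simp
    then show "X cB \<in> sets ?P" "measure ?P (X cB) \<le> exp (- t')"
      using chernoff[OF f0 \<sigma> vm[OF T3(1)] mgf] unfolding cB' X_def by auto
  qed
  define E where "E = space ?P - (\<Union>cB\<in>T. X cB)"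
  have UX: "(\<Union>cB\<in>T. X cB) \<in> sets ?P" using X(1) T(1) by blast
  then have E: "E \<in> sets ?P" unfolding E_def by blast
  have "measure ?P (\<Union>cB\<in>T. X cB) \<le> (\<Sum>cB\<in>T. measure ?P (X cB))"
    by (rule P.finite_measure_subadditive_finite) (use X(1) T(1) in auto)
  also have "\<dots> \<le> (\<Sum>cB\<in>T. exp (- t'))" using X(2) by (rule sum_mono)
  also have "\<dots> = real (card T) * exp (- t')" by simp
  also have "\<dots> \<le> N * exp (- t')" using T(2) by (intro mult_right_mono) auto
  also have "\<dots> = exp (- t)"
  proof -
    have "exp (- t') = exp (- t - ln N)" by (simp add: t'_def)
    also have "\<dots> = exp (- t) / N" using N by (simp only: exp_diff exp_ln)
    finally show ?thesis using N by simp
  qed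
  finally have PE: "1 - exp (- t) \<le> measure ?P E"
    unfolding E_def using P.prob_compl[OF UX] by simp
  have "llr \<sigma> f0 n D (net ds \<theta>) / 2 + n * hellinger_sq p \<sigma> (net ds \<theta>) f0 \<le> ln N + t + 6"
    if D: "D \<in> E" and cube: "\<And>i. i < n \<Longrightarrow> fst (D i) \<in> cube p"
      and small: "(\<Sum>i<n. (snd (D i) - f0 (fst (D i)))\<^sup>2) \<le> 4 * \<sigma>\<^sup>2 * n" and \<theta>: "\<theta> \<in> S" for D \<theta>
  proof -
    obtain c Bad where c: "(c, Bad) \<in> T"
      and close: "\<And>x. x \<in> cube p - Bad \<Longrightarrow> \<bar>clip K (net ds \<theta> x) - g c x\<bar> \<le> \<eta>"
      using T'(2) \<theta> unfolding g_def by blast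
    have Bad: "Bad \<in> sets (\<Pi>\<^sub>M i\<in>{..<p}. borel)" "measure (input_law p) Bad \<le> \<beta>" using T3[OF c] by auto
    have "D \<in> space ?P" "D \<notin> X (c, Bad)" using D c unfolding E_def by auto
    then have sumv: "(\<Sum>i<n. v c Bad (D i)) \<le> real n * b c + t'" unfolding X_def by auto
    \<comment> \<open>Bounding one residual by the total noise energy is crude, but affordable: the
      size of \<open>K\<close> will enter the covering numbers only through logarithms.\<close>
    have yK: "\<bar>snd (D i)\<bar> \<le> K" if i: "i < n" for i
    proof -
      have "(snd (D i) - f0 (fst (D i)))\<^sup>2 \<le> (\<Sum>i<n. (snd (D i) - f0 (fst (D i)))\<^sup>2)"
        using i by (intro member_le_sum) auto
      also have "\<dots> \<le> 4 * \<sigma>\<^sup>2 * n" by (rule small)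
      also have "\<dots> \<le> 4 * \<sigma>\<^sup>2 * (n * n)" using n by (intro mult_left_mono) auto
      also have "\<dots> = (2 * \<sigma> * n)\<^sup>2" by (simp add: power2_eq_square)
      finally have "\<bar>snd (D i) - f0 (fst (D i))\<bar> \<le> 2 * \<sigma> * n"
        using \<sigma> by (simp add: power2_le_iff_abs_le abs_le_square_iff[symmetric])
      then show ?thesis using F(1)[OF cube[OF i]] by (simp add: K)
    qed
    have each: "((snd (D i) - f0 (fst (D i)))\<^sup>2 - (snd (D i) - net ds \<theta> (fst (D i)))\<^sup>2) / (4 * \<sigma>\<^sup>2)
        \<le> v c Bad (D i) + \<eta> * K / \<sigma>\<^sup>2" if i: "i < n" for i
    proof -
      obtain x y where xy: "D i = (x, y)" by fastforce
      show ?thesis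
      proof (cases "x \<in> Bad")
        case True
        have "((y - f0 x)\<^sup>2 - (y - net ds \<theta> x)\<^sup>2) / (4 * \<sigma>\<^sup>2) \<le> (y - f0 x)\<^sup>2 / (4 * \<sigma>\<^sup>2)"
          by (intro divide_right_mono) auto
        moreover have "\<eta> * K / \<sigma>\<^sup>2 \<ge> 0" using \<eta> K0 by simp
        ultimately show ?thesis using True by (simp add: xy v_def)
      next
        case False
        define a where "a = clip K (net ds \<theta> x)"
        have x: "x \<in> cube p - Bad" using cube[OF i] False xy by simp
        have y: "\<bar>y\<bar> \<le> K" using yK[OF i] xy by simp
        have "\<bar>a\<bar> \<le> K" "\<bar>g c x\<bar> \<le> K" using abs_clip_le K0 by (simp_all add: a_def g_def)
        then have "\<bar>2 * y - a - g c x\<bar> \<le> 4 * K" using y by linarith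
        moreover have "\<bar>a - g c x\<bar> \<le> \<eta>" using close[OF x] by (simp add: a_def)
        ultimately have "\<bar>2 * y - a - g c x\<bar> * \<bar>a - g c x\<bar> \<le> 4 * K * \<eta>"
          using K0 by (intro mult_mono) auto
        then have "(2 * y - a - g c x) * (a - g c x) \<le> 4 * K * \<eta>"
          unfolding abs_mult[symmetric] by linarith
        moreover have "(y - g c x)\<^sup>2 - (y - a)\<^sup>2 = (2 * y - a - g c x) * (a - g c x)"
          by (simp add: power2_eq_square algebra_simps)
        ultimately have "(y - g c x)\<^sup>2 \<le> (y - a)\<^sup>2 + 4 * K * \<eta>" by simp
        also have "(y - a)\<^sup>2 \<le> (y - net ds \<theta> x)\<^sup>2" unfolding a_def by (rule clip_le_imp[OF y])
        finally have "((y - f0 x)\<^sup>2 - (y - net ds \<theta> x)\<^sup>2) / (4 * \<sigma>\<^sup>2)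
            \<le> ((y - f0 x)\<^sup>2 - (y - g c x)\<^sup>2 + 4 * K * \<eta>) / (4 * \<sigma>\<^sup>2)"
          by (intro divide_right_mono) auto
        also have "\<dots> = ((y - f0 x)\<^sup>2 - (y - g c x)\<^sup>2) / (4 * \<sigma>\<^sup>2) + \<eta> * K / \<sigma>\<^sup>2"
          by (simp add: add_divide_distrib mult_ac)
        finally show ?thesis using False by (simp add: xy v_def)
      qed
    qed
    have "llr \<sigma> f0 n D (net ds \<theta>) / 2
        = (\<Sum>i<n. ((snd (D i) - f0 (fst (D i)))\<^sup>2 - (snd (D i) - net ds \<theta> (fst (D i)))\<^sup>2) / (4 * \<sigma>\<^sup>2))"
      by (simp add: llr_def sum_divide_distrib)
    also have "\<dots> \<le> (\<Sum>i<n. v c Bad (D i) + \<eta> * K / \<sigma>\<^sup>2)" using each by (intro sum_mono) simp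
    also have "\<dots> = (\<Sum>i<n. v c Bad (D i)) + \<eta> * (n * K) / \<sigma>\<^sup>2" by (simp add: sum.distrib)
    also have "\<eta> * (n * K) / \<sigma>\<^sup>2 \<le> 1" using \<eta>(2) \<sigma> by simp
    finally have 1: "llr \<sigma> f0 n D (net ds \<theta>) / 2 \<le> real n * b c + t' + 1" using sumv by simp
    have netm: "net ds \<theta> \<in> borel_measurable (\<Pi>\<^sub>M i\<in>{..<p}. borel)"
      using net_measurable_input[OF ds(1)] ds(2) by simp
    have pointwise: "AE x in input_law p. (1 - affinity \<sigma> (net ds \<theta> x - f0 x))
        \<le> (1 - affinity \<sigma> (g c x - f0 x)) + (exp (- (n\<^sup>2 / 2)) + \<eta> / \<sigma> + indicator Bad x)"
      using AE_input_law_cube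
    proof eventually_elim
      case (elim x)
      define a where "a = clip K (net ds \<theta> x)"
      \<comment> \<open>Where clipping takes effect the clipped value has modulus \<open>K\<close>,
        at distance at least \<open>2 * \<sigma> * n\<close> from \<open>f0\<close>, and its
        affinity is at most \<open>exp (- (n\<^sup>2 / 2))\<close>. This is why \<open>K\<close>
        exceeds \<open>F\<close> by \<open>2 * \<sigma> * n\<close>.\<close>
      have "affinity \<sigma> (a - f0 x) \<le> affinity \<sigma> (net ds \<theta> x - f0 x) + exp (- (n\<^sup>2 / 2))"
      proof (cases "\<bar>net ds \<theta> x\<bar> \<le> K")
        case True
        then have "a = net ds \<theta> x" by (auto simp: a_def clip_def)
        then show ?thesis by simp
      next
        case False
        then have "\<bar>a\<bar> = K" using K0 by (auto simp: a_def clip_def)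
        then have "2 * \<sigma> * n \<le> \<bar>a - f0 x\<bar>" using F(1)[OF elim] by (auto simp: K abs_if split: if_splits)
        then have "(2 * \<sigma> * n)\<^sup>2 \<le> (a - f0 x)\<^sup>2"
          using \<sigma> by (subst abs_le_square_iff[symmetric]) simp
        then have "(2 * \<sigma> * n)\<^sup>2 / (8 * \<sigma>\<^sup>2) \<le> (a - f0 x)\<^sup>2 / (8 * \<sigma>\<^sup>2)" by (intro divide_right_mono) auto
        also have "(2 * \<sigma> * n)\<^sup>2 / (8 * \<sigma>\<^sup>2) = n\<^sup>2 / 2"
          using \<sigma> by (simp add: field_simps power2_eq_square)
        finally have "affinity \<sigma> (a - f0 x) \<le> exp (- (n\<^sup>2 / 2))" by (simp add: affinity_def)
        then show ?thesis using affinity_bounds(1)[of \<sigma> "net ds \<theta> x - f0 x"] by linarith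
      qed
      moreover have "affinity \<sigma> (g c x - f0 x) \<le> affinity \<sigma> (a - f0 x) + (\<eta> / \<sigma> + indicator Bad x)"
      proof (cases "x \<in> Bad")
        case True
        then show ?thesis
          using affinity_bounds(1)[of \<sigma> "a - f0 x"] affinity_bounds(2)[of \<sigma> "g c x - f0 x"] \<eta>(1) \<sigma>
          by (simp add: add_nonneg_nonneg) (smt (verit) divide_nonneg_nonneg)
      next
        case False
        have "\<bar>affinity \<sigma> (g c x - f0 x) - affinity \<sigma> (a - f0 x)\<bar> \<le> \<bar>(g c x - f0 x) - (a - f0 x)\<bar> / \<sigma>"
          by (rule affinity_lipschitz[OF \<sigma>])
        also have "\<dots> \<le> \<eta> / \<sigma>"
          using close[of x] elim False \<sigma> by (intro divide_right_mono) (auto simp: a_def abs_minus_commute)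
        finally show ?thesis using False by (simp add: abs_le_iff)
      qed
      ultimately show ?case by linarith
    qed
    have "hellinger_sq p \<sigma> (net ds \<theta>) f0 \<le> (\<integral>x. (1 - affinity \<sigma> (g c x - f0 x))
        + (exp (- (n\<^sup>2 / 2)) + \<eta> / \<sigma> + indicator Bad x) \<partial>input_law p)"
      unfolding hellinger_sq_affinity using pointwise integrable_affinity[OF netm f0] integrable_affinity[OF gm f0] Bad(1)
      by (intro integral_mono_AE) (auto simp: sets_input_law I.emeasure_eq_measure)
    also have "\<dots> = h c + (exp (- (n\<^sup>2 / 2)) + \<eta> / \<sigma> + measure (input_law p) Bad)"
      unfolding h_def hellinger_sq_affinity using integrable_affinity[OF gm f0] Bad(1)
      by (simp add: sets_input_law I.emeasure_eq_measure I.prob_space)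
    finally have "n * hellinger_sq p \<sigma> (net ds \<theta>) f0
        \<le> n * (h c + (exp (- (n\<^sup>2 / 2)) + \<eta> / \<sigma> + \<beta>))"
      using Bad(2) by (intro mult_left_mono) auto
    also have "\<dots> = n * h c + n * exp (- (n\<^sup>2 / 2)) + \<eta> * n / \<sigma> + \<beta> * n"
      by (simp add: algebra_simps)
    also have "\<eta> * n / \<sigma> \<le> 1" using \<eta>(3) \<sigma> by simp
    also have "n * exp (- (n\<^sup>2 / 2)) \<le> 1"
    proof -
      have "real n \<le> 1 + n\<^sup>2 / 2"
      proof -
        have "0 \<le> (real n - 1)\<^sup>2" by simp
        then show ?thesis by (simp add: power2_diff)
      qed
      also have "\<dots> \<le> exp (n\<^sup>2 / 2)" by (rule exp_ge_add_one_self)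
      finally show ?thesis by (simp add: exp_minus field_simps)
    qed
    also note \<beta>
    finally have 2: "n * hellinger_sq p \<sigma> (net ds \<theta>) f0 \<le> n * h c + 3" by simp
    have "real n * b c = - (n * h c) + 2 * (\<beta> * n)" by (simp add: b_def algebra_simps)
    then show ?thesis using 1 2 \<beta> by (simp add: t'_def)
  qed
  then show ?thesis using E PE by blast
qed

lemma cube_measurable: "cube p \<in> sets (\<Pi>\<^sub>M i\<in>{..<p}. borel)"
  unfolding cube_def by (rule sets_PiM_I_finite) auto

text \<open>Three Chernoff bounds, one for each property. The linear term is the noise against a
  fixed function \<open>g\<close>, so that, given the inputs, it is Gaussian with variance at most
  \<open>\<sigma>\<^sup>2 * \<xi>\<close> per observation.\<close>

lemma data_event:
  assumes f0: "f0 \<in> borel_measurable (\<Pi>\<^sub>M i\<in>{..<p}. borel)" and \<sigma>: "\<sigma> > 0"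
    and g: "g \<in> borel_measurable (\<Pi>\<^sub>M i\<in>{..<p}. borel)" "\<And>x. x \<in> cube p \<Longrightarrow> (g x)\<^sup>2 \<le> \<xi>"
    and t: "0 \<le> t" "2 * t \<le> n"
  shows "\<exists>E \<in> sets (data_law p \<sigma> f0 n). 1 - 3 * exp (- t) \<le> measure (data_law p \<sigma> f0 n) E \<and>
    (\<forall>D\<in>E. (\<forall>i<n. fst (D i) \<in> cube p) \<and> (\<Sum>i<n. (snd (D i) - f0 (fst (D i)))\<^sup>2) \<le> 4 * \<sigma>\<^sup>2 * n \<and>
      - (\<Sum>i<n. (snd (D i) - f0 (fst (D i))) * g (fst (D i))) \<le> n * (\<sigma>\<^sup>2 * \<xi> / 2) + t)"
proof -
  let ?P = "data_law p \<sigma> f0 n"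
  interpret P: prob_space ?P by (rule prob_space_data_law[OF f0 \<sigma>])
  interpret I: prob_space "input_law p" by (rule prob_space_input_law)
  interpret N: prob_space "normal_law 0 \<sigma>" by (rule prob_space_normal_law[OF \<sigma>])
  note [measurable] = f0 g(1) cube_measurable
  \<comment> \<open>Inputs lie in the cube almost surely. A statistic that passes the threshold
    \<open>t\<close> as soon as a single input leaves the cube brings this property under the same
    exponential bound.\<close>
  define v1 where "v1 = (\<lambda>(x::nat \<Rightarrow> real, y::real). if x \<in> cube p then 0 else t + 1)"
  define v2 where "v2 = (\<lambda>(x, y). (y - f0 x)\<^sup>2 / (4 * \<sigma>\<^sup>2))"
  define v3 where "v3 = (\<lambda>(x, y). - ((y - f0 x) * g x))"
  have v1m: "v1 \<in> borel_measurable (obs_space p)" unfolding v1_def by measurable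
  have v2m: "v2 \<in> borel_measurable (obs_space p)" unfolding v2_def by measurable
  have v3m: "v3 \<in> borel_measurable (obs_space p)" unfolding v3_def by measurable
  have mgf: "(\<integral>\<^sup>+z. ennreal (exp (v z)) \<partial>obs_law p \<sigma> f0)
      = (\<integral>\<^sup>+x. \<integral>\<^sup>+e. ennreal (exp (v (x, f0 x + e))) \<partial>normal_law 0 \<sigma> \<partial>input_law p)"
    if "v \<in> borel_measurable (obs_space p)" for v
    by (rule nn_integral_obs_law[OF f0 \<sigma>])
      (use measurable_compose[OF that, of "\<lambda>y. ennreal (exp y)" borel] in simp)
  have m1: "(\<integral>\<^sup>+z. ennreal (exp (v1 z)) \<partial>obs_law p \<sigma> f0) \<le> ennreal (exp 0)"
  proof -
    have "(\<integral>\<^sup>+z. ennreal (exp (v1 z)) \<partial>obs_law p \<sigma> f0) = (\<integral>\<^sup>+x. 1 \<partial>input_law p)"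
      unfolding mgf[OF v1m]
    proof (rule nn_integral_cong_AE)
      show "AE x in input_law p. (\<integral>\<^sup>+e. ennreal (exp (v1 (x, f0 x + e))) \<partial>normal_law 0 \<sigma>) = 1"
        using AE_input_law_cube
        by eventually_elim (use N.emeasure_space_1 in \<open>simp add: v1_def\<close>)
    qed
    then show ?thesis using I.emeasure_space_1 by simp
  qed
  have m2: "(\<integral>\<^sup>+z. ennreal (exp (v2 z)) \<partial>obs_law p \<sigma> f0) \<le> ennreal (exp (ln 2 / 2))"
  proof -
    have "exp (ln 2 / 2) = sqrt (2::real)"
      using powr_half_sqrt[of 2] by (simp add: powr_def)
    moreover have "(\<integral>\<^sup>+z. ennreal (exp (v2 z)) \<partial>obs_law p \<sigma> f0) = ennreal (sqrt 2)"
      unfolding mgf[OF v2m] using gaussian_exp_square[OF \<sigma>] I.emeasure_space_1 by (simp add: v2_def)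
    ultimately show ?thesis by simp
  qed
  have m3: "(\<integral>\<^sup>+z. ennreal (exp (v3 z)) \<partial>obs_law p \<sigma> f0) \<le> ennreal (exp (\<sigma>\<^sup>2 * \<xi> / 2))"
  proof -
    have "(\<integral>\<^sup>+z. ennreal (exp (v3 z)) \<partial>obs_law p \<sigma> f0) \<le> (\<integral>\<^sup>+x. ennreal (exp (\<sigma>\<^sup>2 * \<xi> / 2)) \<partial>input_law p)"
      unfolding mgf[OF v3m]
    proof (rule nn_integral_mono_AE)
      show "AE x in input_law p. (\<integral>\<^sup>+e. ennreal (exp (v3 (x, f0 x + e))) \<partial>normal_law 0 \<sigma>)
          \<le> ennreal (exp (\<sigma>\<^sup>2 * \<xi> / 2))"
        using AE_input_law_cube
      proof eventually_elim
        case (elim x)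
        have "(\<integral>\<^sup>+e. ennreal (exp (v3 (x, f0 x + e))) \<partial>normal_law 0 \<sigma>) = ennreal (exp ((g x)\<^sup>2 * \<sigma>\<^sup>2 / 2))"
          using gaussian_mgf[OF \<sigma>, of "- g x"] by (simp add: v3_def mult.commute)
        also have "\<dots> \<le> ennreal (exp (\<sigma>\<^sup>2 * \<xi> / 2))"
          using g(2)[OF elim] \<sigma> by (intro ennreal_leI) (simp add: mult.commute mult_left_mono)
        finally show ?case .
      qed
    qed
    then show ?thesis using I.emeasure_space_1 by simp
  qed
  define X where "X v b = {D \<in> space ?P. real n * b + t < (\<Sum>i<n. v (D i))}" for v b
  note ch1 = chernoff[OF f0 \<sigma> v1m m1, of n t, folded X_def]
  note ch2 = chernoff[OF f0 \<sigma> v2m m2, of n t, folded X_def]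
  note ch3 = chernoff[OF f0 \<sigma> v3m m3, of n t, folded X_def]
  define Y where "Y = X v1 0 \<union> X v2 (ln 2 / 2) \<union> X v3 (\<sigma>\<^sup>2 * \<xi> / 2)"
  have Y: "Y \<in> sets ?P" unfolding Y_def using ch1(1) ch2(1) ch3(1) by blast
  have "measure ?P Y \<le> measure ?P (X v1 0) + measure ?P (X v2 (ln 2 / 2)) + measure ?P (X v3 (\<sigma>\<^sup>2 * \<xi> / 2))"
    unfolding Y_def using ch1(1) ch2(1) ch3(1)
    by (intro order.trans[OF measure_Un_le] add_right_mono measure_Un_le) auto
  then have PY: "measure ?P Y \<le> 3 * exp (- t)" using ch1(2) ch2(2) ch3(2) by simp
  show ?thesis
  proof (intro bexI conjI ballI)
    show "space ?P - Y \<in> sets ?P" using Y by blast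
    show "1 - 3 * exp (- t) \<le> measure ?P (space ?P - Y)" using P.prob_compl[OF Y] PY by simp
    fix D assume D: "D \<in> space ?P - Y"
    then have s1: "(\<Sum>i<n. v1 (D i)) \<le> t" and s2: "(\<Sum>i<n. v2 (D i)) \<le> real n * (ln 2 / 2) + t"
      and s3: "(\<Sum>i<n. v3 (D i)) \<le> real n * (\<sigma>\<^sup>2 * \<xi> / 2) + t"
      unfolding Y_def X_def by (auto simp: not_less)
    show "\<forall>i<n. fst (D i) \<in> cube p"
    proof (intro allI impI, rule ccontr)
      fix i assume i: "i < n" "fst (D i) \<notin> cube p"
      have "v1 (D i) \<le> (\<Sum>i<n. v1 (D i))"
        using i t(1) by (intro member_le_sum) (auto simp: v1_def case_prod_beta)
      then show False using s1 i by (simp add: v1_def case_prod_beta)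
    qed
    have "(\<Sum>i<n. (snd (D i) - f0 (fst (D i)))\<^sup>2) = 4 * \<sigma>\<^sup>2 * (\<Sum>i<n. v2 (D i))"
      using \<sigma> by (simp add: v2_def case_prod_beta sum_divide_distrib[symmetric])
    also have "\<dots> \<le> 4 * \<sigma>\<^sup>2 * n"
    proof (rule mult_left_mono)
      \<comment> \<open>Here \<open>2 * t \<le> n\<close> enters: \<open>n * (ln 2 / 2)\<close> and
        \<open>t\<close> are each at most \<open>n / 2\<close>.\<close>
      have "ln 2 \<le> (1::real)" using ln_2_less_1 by simp
      then have "real n * (ln 2 / 2) \<le> real n * (1 / 2)" by (intro mult_left_mono) auto
      then show "(\<Sum>i<n. v2 (D i)) \<le> real n" using s2 t by simp
    qed simp
    finally show "(\<Sum>i<n. (snd (D i) - f0 (fst (D i)))\<^sup>2) \<le> 4 * \<sigma>\<^sup>2 * n" .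
    show "- (\<Sum>i<n. (snd (D i) - f0 (fst (D i))) * g (fst (D i))) \<le> n * (\<sigma>\<^sup>2 * \<xi> / 2) + t"
      using s3 by (simp add: v3_def case_prod_beta sum_negf)
  qed
qed

subsection \<open>Narrow slabs\<close>

lemma exp_mult_le:
  fixes \<tau> a :: real
  assumes "0 \<le> \<tau>" "\<tau> \<le> 1"
  shows "exp (\<tau> * a) \<le> (1 - \<tau>) + \<tau> * exp a"
  using convex_onD[OF exp_convex, of \<tau> 0 a] assms by simp

lemma exp_2_le: "exp (2::real) \<le> 8"
proof -
  have "exp (2::real) = exp 1 * exp 1" by (simp flip: exp_add)
  also have "\<dots> \<le> (272 / 100) * (272 / 100)" using e_less_272 by (intro mult_mono) auto
  finally show ?thesis by simp
qed

definition valid_slab :: "slab \<Rightarrow> real \<Rightarrow> bool" where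
  "valid_slab sl B \<longleftrightarrow> (case sl of Uniform_slab B0 \<Rightarrow> B0 > 1 \<and> B = B0 | Normal_slab \<sigma>0 \<Rightarrow> \<sigma>0 > 0 \<and> B \<ge> 2)"

text \<open>A slab concentrated around \<open>c\<close> at scale \<open>\<tau>\<close>. Its density
  relative to the prior slab costs \<open>ln (1 / \<tau>)\<close> and a \<open>\<kappa>\<close>-term
  whose growth in \<open>t\<close> accommodates a ratio of normal densities. The exponential moment
  is the one in which network perturbations are measured; its 15 comes from the normal case.\<close>

definition narrow_slab :: "slab \<Rightarrow> real \<Rightarrow> real \<Rightarrow> real \<Rightarrow> real measure \<Rightarrow> bool" where
  "narrow_slab sl \<kappa> c \<tau> S \<longleftrightarrow> S \<in> slab_family sl \<and>
     (\<exists>g. g \<in> borel_measurable borel \<and> S = density (slab_law sl) (\<lambda>t. ennreal (g t)) \<and>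
       (\<forall>t. 0 \<le> g t \<and> g t \<le> exp (ln (1 / \<tau>) + \<kappa> * (1 + exp (2 * \<bar>t - c\<bar>))))) \<and>
     (\<integral>\<^sup>+t. ennreal (exp (2 * \<bar>t - c\<bar>)) \<partial>S) \<le> ennreal (1 + 15 * \<tau>)"

text \<open>The interval of radius \<open>\<tau>\<close> around \<open>c\<close>, cut to the support
  of the prior slab, keeps length at least \<open>\<tau>\<close> even if \<open>c\<close> is an end
  point, because \<open>\<tau> \<le> 1 < B0\<close>.\<close>

lemma narrow_slab_uniform:
  assumes B0: "B0 > 1" and \<tau>: "0 < \<tau>" "\<tau> \<le> 1" and c: "\<bar>c\<bar> \<le> B0"
  shows "\<exists>S. narrow_slab (Uniform_slab B0) (ln (2 * B0)) c \<tau> S"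
proof -
  define l where "l = max (- B0) (c - \<tau>)"
  define u where "u = min B0 (c + \<tau>)"
  have lu: "u - l \<ge> \<tau>" "- B0 \<le> l" "u \<le> B0" "l < u" using c \<tau> B0 by (auto simp: l_def u_def abs_le_iff)
  define g where "g t = (if t \<in> {l..u} then 2 * B0 / (u - l) else 0)" for t
  have gm [measurable]: "g \<in> borel_measurable borel" unfolding g_def[abs_def] by measurable
  have slab: "slab_law (Uniform_slab B0) = density lborel (\<lambda>t. indicator {- B0..B0} t / ennreal (2 * B0))"
    using B0 by (simp add: uniform_law_def uniform_measure_def)
  have Sd: "uniform_law l u = density lborel (\<lambda>t. indicator {l..u} t / ennreal (u - l))"
    using lu by (simp add: uniform_law_def uniform_measure_def)
  have "uniform_law l u = density (slab_law (Uniform_slab B0)) (\<lambda>t. ennreal (g t))"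
    unfolding slab Sd
  proof (subst density_density_eq)
    show "density lborel (\<lambda>t. indicator {l..u} t / ennreal (u - l))
        = density lborel (\<lambda>t. indicator {- B0..B0} t / ennreal (2 * B0) * ennreal (g t))"
    proof (rule arg_cong[where f = "density lborel"], rule ext)
      fix t
      have "1 / ennreal (u - l) = 1 / ennreal (2 * B0) * ennreal (2 * B0 / (u - l))"
        using lu B0 by (simp add: divide_ennreal flip: ennreal_1 ennreal_mult)
      then show "indicator {l..u} t / ennreal (u - l) = indicator {- B0..B0} t / ennreal (2 * B0) * ennreal (g t)"
        using lu by (auto simp: g_def indicator_def)
    qed
  qed auto
  moreover have "0 \<le> g t \<and> g t \<le> exp (ln (1 / \<tau>) + ln (2 * B0) * (1 + exp (2 * \<bar>t - c\<bar>)))" for t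
  proof
    show "0 \<le> g t" using lu B0 by (simp add: g_def)
    have "g t \<le> 2 * B0 / \<tau>" using lu B0 \<tau> by (auto simp: g_def intro!: divide_left_mono)
    also have "\<dots> = exp (ln (1 / \<tau>) + ln (2 * B0))" using B0 \<tau> by (simp add: exp_add)
    also have "\<dots> \<le> exp (ln (1 / \<tau>) + ln (2 * B0) * (1 + exp (2 * \<bar>t - c\<bar>)))"
      using B0 by (simp add: mult_le_cancel_left1)
    finally show "g t \<le> exp (ln (1 / \<tau>) + ln (2 * B0) * (1 + exp (2 * \<bar>t - c\<bar>)))" .
  qed
  moreover have "(\<integral>\<^sup>+t. ennreal (exp (2 * \<bar>t - c\<bar>)) \<partial>uniform_law l u) \<le> ennreal (1 + 15 * \<tau>)"
  proof -
    interpret S: prob_space "uniform_law l u" by (rule prob_space_uniform_law)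
    have "AE t in uniform_law l u. t \<in> {l..u}"
      unfolding uniform_law_def using lu by (simp add: AE_uniform_measureI)
    then have "(\<integral>\<^sup>+t. ennreal (exp (2 * \<bar>t - c\<bar>)) \<partial>uniform_law l u) \<le> (\<integral>\<^sup>+t. ennreal (exp (\<tau> * 2)) \<partial>uniform_law l u)"
    proof (intro nn_integral_mono_AE, eventually_elim)
      case (elim t)
      then have "\<bar>t - c\<bar> \<le> \<tau>" by (auto simp: l_def u_def)
      then show ?case by (intro ennreal_leI) simp
    qed
    also have "\<dots> = ennreal (exp (\<tau> * 2))" using S.emeasure_space_1 by simp
    also have "\<dots> \<le> ennreal (1 + 15 * \<tau>)"
    proof (rule ennreal_leI)
      have "exp (\<tau> * 2) \<le> (1 - \<tau>) + \<tau> * exp 2" using \<tau> by (intro exp_mult_le) auto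
      also have "\<dots> \<le> (1 - \<tau>) + \<tau> * 8" using exp_2_le \<tau> by (intro add_left_mono mult_left_mono) auto
      finally show "exp (\<tau> * 2) \<le> 1 + 15 * \<tau>" using \<tau> by simp
    qed
    finally show ?thesis .
  qed
  moreover have "uniform_law l u \<in> slab_family (Uniform_slab B0)"
    using lu unfolding slab_family.simps by (intro CollectI exI[of _ l] exI[of _ u]) auto
  ultimately show ?thesis unfolding narrow_slab_def using gm by blast
qed

text \<open>The slab is normal with mean \<open>c\<close> and standard deviation
  \<open>\<tau>\<close>. Convexity bounds \<open>exp (2 * \<bar>t - c\<bar>)\<close> by
  \<open>(1 - \<tau>) + \<tau> * exp (2 / \<tau> * \<bar>t - c\<bar>)\<close>. The two one-sided
  moments of slope \<open>2 / \<tau>\<close> equal \<open>exp 2\<close>, hence are at most 8 each,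
  and \<open>1 - \<tau> + 16 * \<tau>\<close> results.\<close>

lemma narrow_slab_normal:
  assumes \<sigma>0: "\<sigma>0 > 0" and \<tau>: "0 < \<tau>" "\<tau> \<le> 1" and c: "\<bar>c\<bar> \<le> B"
  shows "\<exists>S. narrow_slab (Normal_slab \<sigma>0) (\<bar>ln \<sigma>0\<bar> + (B\<^sup>2 + 1) / \<sigma>0\<^sup>2) c \<tau> S"
proof -
  define \<kappa> where "\<kappa> = \<bar>ln \<sigma>0\<bar> + (B\<^sup>2 + 1) / \<sigma>0\<^sup>2"
  define g where "g t = normal_density c \<tau> t / normal_density 0 \<sigma>0 t" for t
  have gm [measurable]: "g \<in> borel_measurable borel" unfolding g_def[abs_def] by measurable
  have pos: "normal_density 0 \<sigma>0 t > 0" for t using \<sigma>0 by (rule normal_density_pos)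
  have g0: "0 \<le> g t" for t using pos[of t] by (simp add: g_def)
  have "normal_law c \<tau> = density (slab_law (Normal_slab \<sigma>0)) (\<lambda>t. ennreal (g t))"
    unfolding normal_law_def slab_law.simps
  proof (subst density_density_eq)
    show "density lborel (\<lambda>x. ennreal (normal_density c \<tau> x))
        = density lborel (\<lambda>x. ennreal (normal_density 0 \<sigma>0 x) * ennreal (g x))"
    proof (rule arg_cong[where f = "density lborel"], rule ext)
      fix x
      show "ennreal (normal_density c \<tau> x) = ennreal (normal_density 0 \<sigma>0 x) * ennreal (g x)"
        using pos[of x] g0 by (simp add: g_def flip: ennreal_mult)
    qed
  qed auto
  moreover have "g t \<le> exp (ln (1 / \<tau>) + \<kappa> * (1 + exp (2 * \<bar>t - c\<bar>)))" for t
  proof -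
    have "normal_density c \<tau> t \<le> 1 / (sqrt (2 * pi) * \<tau>)"
      using \<tau> by (simp add: normal_density_def real_sqrt_mult mult_le_cancel_left1 field_simps)
    then have "g t \<le> 1 / (sqrt (2 * pi) * \<tau>) / normal_density 0 \<sigma>0 t"
      unfolding g_def using pos[of t] by (intro divide_right_mono) auto
    also have "\<dots> = \<sigma>0 / \<tau> * exp (t\<^sup>2 / (2 * \<sigma>0\<^sup>2))"
      using \<sigma>0 \<tau> by (simp add: normal_density_def real_sqrt_mult exp_minus field_simps)
    also have "\<dots> = exp (ln (1 / \<tau>) + (ln \<sigma>0 + t\<^sup>2 / (2 * \<sigma>0\<^sup>2)))"
      using \<sigma>0 \<tau> by (simp add: exp_add)
    also have "\<dots> \<le> exp (ln (1 / \<tau>) + \<kappa> * (1 + exp (2 * \<bar>t - c\<bar>)))"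
    proof -
      let ?e = "exp (2 * \<bar>t - c\<bar>)"
      \<comment> \<open>The quadratic exponent of the density ratio is split into a part in
        \<open>c\<close>, bounded through \<open>B\<close>, and \<open>(t - c)\<^sup>2\<close>,
        which the allowed exponential dominates.\<close>
      have "0 \<le> (t - 2 * c)\<^sup>2" by simp
      then have "t\<^sup>2 \<le> 2 * c\<^sup>2 + 2 * (t - c)\<^sup>2" by (simp add: power2_eq_square algebra_simps)
      moreover have "c\<^sup>2 \<le> B\<^sup>2" using c by (simp add: abs_le_square_iff[symmetric])
      moreover have "(t - c)\<^sup>2 \<le> ?e"
      proof -
        have "\<bar>t - c\<bar> \<le> exp \<bar>t - c\<bar>" using exp_ge_add_one_self[of "\<bar>t - c\<bar>"] by linarith
        then have "\<bar>t - c\<bar> ^ 2 \<le> exp \<bar>t - c\<bar> ^ 2" by (intro power_mono) auto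
        then show ?thesis by (simp add: exp_double)
      qed
      ultimately have t2: "t\<^sup>2 / (2 * \<sigma>0\<^sup>2) \<le> (B\<^sup>2 + ?e) / \<sigma>0\<^sup>2"
        using \<sigma>0 by (simp add: field_simps)
      have "?e \<ge> 1" by simp
      have "(B\<^sup>2 + ?e) / \<sigma>0\<^sup>2 \<le> (B\<^sup>2 + 1) / \<sigma>0\<^sup>2 * (1 + ?e)"
      proof -
        have "B\<^sup>2 + ?e \<le> (B\<^sup>2 + 1) * (1 + ?e)" by (simp add: algebra_simps)
        then show ?thesis using \<sigma>0 by (simp add: divide_right_mono)
      qed
      moreover have "ln \<sigma>0 \<le> \<bar>ln \<sigma>0\<bar> * (1 + ?e)"
        by (rule order.trans[OF abs_ge_self]) (simp add: mult_le_cancel_left1)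
      ultimately show ?thesis using t2 by (simp add: \<kappa>_def distrib_right)
    qed
    finally show ?thesis .
  qed
  moreover have "(\<integral>\<^sup>+t. ennreal (exp (2 * \<bar>t - c\<bar>)) \<partial>normal_law c \<tau>) \<le> ennreal (1 + 15 * \<tau>)"
  proof -
    interpret S: prob_space "normal_law c \<tau>" by (rule prob_space_normal_law[OF \<tau>(1)])
    let ?p = "\<lambda>s t. exp (s * (2 / \<tau>) * (t - c))"
    have "(\<integral>\<^sup>+t. ennreal (exp (2 * \<bar>t - c\<bar>)) \<partial>normal_law c \<tau>)
        \<le> (\<integral>\<^sup>+t. ennreal (1 - \<tau>) + (ennreal \<tau> * ennreal (?p 1 t) + ennreal \<tau> * ennreal (?p (-1) t)) \<partial>normal_law c \<tau>)"
    proof (rule nn_integral_mono)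
      fix t
      have "exp (2 * \<bar>t - c\<bar>) = exp (\<tau> * (2 / \<tau> * \<bar>t - c\<bar>))" using \<tau> by simp
      also have "\<dots> \<le> (1 - \<tau>) + \<tau> * exp (2 / \<tau> * \<bar>t - c\<bar>)" using \<tau> by (intro exp_mult_le) auto
      also have "\<dots> \<le> (1 - \<tau>) + \<tau> * (?p 1 t + ?p (-1) t)"
      proof (intro add_left_mono mult_left_mono)
        have "2 / \<tau> * \<bar>t - c\<bar> = 1 * (2 / \<tau>) * (t - c) \<or> 2 / \<tau> * \<bar>t - c\<bar> = - 1 * (2 / \<tau>) * (t - c)"
        proof -
          have "\<bar>t - c\<bar> = 1 * (t - c) \<or> \<bar>t - c\<bar> = - 1 * (t - c)" by (auto simp: abs_if)
          then show ?thesis by (elim disjE) (simp_all only: mult_ac simp_thms)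
        qed
        then show "exp (2 / \<tau> * \<bar>t - c\<bar>) \<le> ?p 1 t + ?p (- 1) t"
          using exp_ge_zero[of "1 * (2 / \<tau>) * (t - c)"] exp_ge_zero[of "- 1 * (2 / \<tau>) * (t - c)"]
          by (elim disjE) (simp_all only: le_add_same_cancel1 le_add_same_cancel2)
      qed (use \<tau> in auto)
      finally show "ennreal (exp (2 * \<bar>t - c\<bar>))
          \<le> ennreal (1 - \<tau>) + (ennreal \<tau> * ennreal (?p 1 t) + ennreal \<tau> * ennreal (?p (-1) t))"
        using \<tau> by (simp add: distrib_left ennreal_leI flip: ennreal_mult ennreal_plus)
    qed
    also have "\<dots> = ennreal (1 - \<tau>) + (ennreal \<tau> * ennreal (exp 2) + ennreal \<tau> * ennreal (exp 2))"
    proof -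
      have two: "(s * (2 / \<tau>))\<^sup>2 * \<tau>\<^sup>2 / 2 = 2" if "s \<in> {1, -1}" for s :: real
        using that \<tau> by (auto simp: field_simps power2_eq_square)
      have mg: "(\<integral>\<^sup>+t. ennreal (?p s t) \<partial>normal_law c \<tau>) = ennreal (exp 2)" if "s \<in> {1, -1}" for s
        by (simp only: nn_integral_normal_shift_mgf[OF \<tau>(1)] two[OF that])
      show ?thesis
        using mg[of 1] mg[of "-1"] S.emeasure_space_1
        by (simp add: nn_integral_add nn_integral_cmult)
    qed
    also have "\<dots> = ennreal ((1 - \<tau>) + (\<tau> * exp 2 + \<tau> * exp 2))"
      using \<tau> by (simp flip: ennreal_mult ennreal_plus)
    also have "\<dots> \<le> ennreal (1 + 15 * \<tau>)"
    proof (rule ennreal_leI)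
      have "\<tau> * exp 2 \<le> \<tau> * 8" using exp_2_le \<tau> by (intro mult_left_mono) auto
      then show "(1 - \<tau>) + (\<tau> * exp 2 + \<tau> * exp 2) \<le> 1 + 15 * \<tau>" by linarith
    qed
    finally show ?thesis .
  qed
  moreover have "normal_law c \<tau> \<in> slab_family (Normal_slab \<sigma>0)"
    using \<tau> unfolding slab_family.simps by (intro CollectI exI[of _ c] exI[of _ \<tau>]) auto
  ultimately show ?thesis unfolding narrow_slab_def \<kappa>_def[symmetric] using gm g0 by blast
qed

lemma narrow_slab_exists:
  assumes "valid_slab sl B"
  shows "\<exists>\<kappa>\<ge>0. \<forall>c \<tau>. 0 < \<tau> \<longrightarrow> \<tau> \<le> 1 \<longrightarrow> \<bar>c\<bar> \<le> B \<longrightarrow> (\<exists>S. narrow_slab sl \<kappa> c \<tau> S)"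
proof (cases sl)
  case (Uniform_slab B0)
  then show ?thesis
    using assms narrow_slab_uniform[of B0] unfolding valid_slab_def
    by (intro exI[of _ "ln (2 * B0)"]) auto
next
  case (Normal_slab \<sigma>0)
  then show ?thesis
    using assms narrow_slab_normal[of \<sigma>0] unfolding valid_slab_def
    by (intro exI[of _ "\<bar>ln \<sigma>0\<bar> + (B\<^sup>2 + 1) / \<sigma>0\<^sup>2"]) auto
qed

subsection \<open>Products of densities\<close>

lemma PiM_density:
  fixes M :: "'i \<Rightarrow> 'a measure" and g :: "'i \<Rightarrow> 'a \<Rightarrow> ennreal"
  assumes I: "finite I" and M: "\<And>i. prob_space (M i)" "\<And>i. prob_space (density (M i) (g i))"
    and g: "\<And>i. g i \<in> borel_measurable (M i)"
  shows "PiM I (\<lambda>i. density (M i) (g i)) = density (PiM I M) (\<lambda>x. \<Prod>i\<in>I. g i (x i))"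
proof -
  interpret M: product_sigma_finite M
    unfolding product_sigma_finite_def using M(1) prob_space_imp_sigma_finite by blast
  interpret N: product_sigma_finite "\<lambda>i. density (M i) (g i)"
    unfolding product_sigma_finite_def using M(2) prob_space_imp_sigma_finite by blast
  have gm: "(\<lambda>x. \<Prod>i\<in>I. g i (x i)) \<in> borel_measurable (PiM I M)"
    using g by (intro borel_measurable_prod_ennreal measurable_compose[OF measurable_component_singleton]) auto
  show ?thesis
  proof (rule N.PiM_eqI[OF I, symmetric])
    show "sets (density (PiM I M) (\<lambda>x. \<Prod>i\<in>I. g i (x i))) = sets (PiM I (\<lambda>i. density (M i) (g i)))"
      by (simp cong: sets_PiM_cong)
    fix A assume A: "\<And>i. i \<in> I \<Longrightarrow> A i \<in> sets (density (M i) (g i))"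
    then have A': "A i \<in> sets (M i)" if "i \<in> I" for i using that by simp
    have "emeasure (density (PiM I M) (\<lambda>x. \<Prod>i\<in>I. g i (x i))) (Pi\<^sub>E I A)
        = (\<integral>\<^sup>+x. (\<Prod>i\<in>I. g i (x i)) * indicator (Pi\<^sub>E I A) x \<partial>PiM I M)"
      using gm A' I by (intro emeasure_density sets_PiM_I_finite) auto
    also have "\<dots> = (\<integral>\<^sup>+x. (\<Prod>i\<in>I. g i (x i) * indicator (A i) (x i)) \<partial>PiM I M)"
    proof (rule nn_integral_cong)
      fix x assume "x \<in> space (PiM I M)"
      then have "indicator (Pi\<^sub>E I A) x = (\<Prod>i\<in>I. indicator (A i) (x i) :: ennreal)"
        using I by (auto simp: indicator_def space_PiM PiE_iff prod_zero_iff)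
      then show "(\<Prod>i\<in>I. g i (x i)) * indicator (Pi\<^sub>E I A) x = (\<Prod>i\<in>I. g i (x i) * indicator (A i) (x i))"
        by (simp add: prod.distrib)
    qed
    also have "\<dots> = (\<Prod>i\<in>I. \<integral>\<^sup>+y. g i y * indicator (A i) y \<partial>M i)"
      using I g A' by (intro M.product_nn_integral_prod) auto
    also have "\<dots> = (\<Prod>i\<in>I. emeasure (density (M i) (g i)) (A i))"
      using g A' by (intro prod.cong) (auto simp: emeasure_density)
    finally show "emeasure (density (PiM I M) (\<lambda>x. \<Prod>i\<in>I. g i (x i))) (Pi\<^sub>E I A)
        = (\<Prod>i\<in>I. emeasure (density (M i) (g i)) (A i))" .
  qed
qed

subsection \<open>Prior, posterior and variational family\<close>

abbreviation par_space :: "nat list \<Rightarrow> (param \<Rightarrow> real) measure" where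
  "par_space ds \<equiv> (\<Pi>\<^sub>M i\<in>params ds. borel)"

definition spike_slab_prod :: "nat list \<Rightarrow> slab \<Rightarrow> (param \<Rightarrow> bool) \<Rightarrow> (param \<Rightarrow> real) measure" where
  "spike_slab_prod ds sl \<gamma> = (\<Pi>\<^sub>M i\<in>params ds. spike_slab (\<gamma> i) (slab_law sl))"

definition supports :: "nat list \<Rightarrow> nat \<Rightarrow> (param \<Rightarrow> bool) set" where
  "supports ds s = {\<gamma> \<in> params ds \<rightarrow>\<^sub>E UNIV. card {i \<in> params ds. \<gamma> i} = s}"

lemma sets_slab_law [simp]: "sets (slab_law sl) = sets borel"
  by (cases sl) auto

lemma prob_space_slab_law: "valid_slab sl B \<Longrightarrow> prob_space (slab_law sl)"
  by (cases sl) (auto simp: valid_slab_def intro: prob_space_uniform_law prob_space_normal_law)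

lemma sets_slab_family: "S \<in> slab_family sl \<Longrightarrow> sets S = sets borel"
  by (cases sl) auto

lemma prob_space_slab_family: "S \<in> slab_family sl \<Longrightarrow> prob_space S"
  by (cases sl) (auto intro: prob_space_uniform_law prob_space_normal_law)

lemma sets_spike_slab: "sets M = sets borel \<Longrightarrow> sets (spike_slab g M) = sets borel"
  by (simp add: spike_slab_def)

lemma prob_space_spike_slab: "prob_space M \<Longrightarrow> prob_space (spike_slab g M)"
  by (auto simp: spike_slab_def intro: prob_space_return)

lemma sets_spike_slab_prod: "sets (spike_slab_prod ds sl \<gamma>) = sets (par_space ds)"
  unfolding spike_slab_prod_def by (intro sets_PiM_cong) (auto simp: sets_spike_slab)

lemma prob_space_spike_slab_prod: "valid_slab sl B \<Longrightarrow> prob_space (spike_slab_prod ds sl \<gamma>)"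
  unfolding spike_slab_prod_def
  by (rule prob_space_PiM, rule prob_space_spike_slab, rule prob_space_slab_law)

lemma finite_supports: "finite (supports ds s)"
proof (rule finite_subset)
  show "supports ds s \<subseteq> params ds \<rightarrow>\<^sub>E UNIV" by (auto simp: supports_def)
  show "finite (params ds \<rightarrow>\<^sub>E (UNIV :: bool set))" by (intro finite_PiE) auto
qed

lemma supports_restrict: "A \<subseteq> params ds \<Longrightarrow> card A = s \<Longrightarrow> (\<lambda>i\<in>params ds. i \<in> A) \<in> supports ds s"
proof -
  assume A: "A \<subseteq> params ds" "card A = s"
  then have "{i \<in> params ds. restrict (\<lambda>i. i \<in> A) (params ds) i} = A" by auto
  then show ?thesis using A by (auto simp: supports_def)
qed

lemma supports_nonempty:
  assumes "s \<le> card (params ds)"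
  shows "supports ds s \<noteq> {}"
proof -
  obtain A where "A \<subseteq> params ds" "card A = s"
    using obtain_subset_with_card_n[OF assms] by blast
  then show ?thesis using supports_restrict[of A ds s] by auto
qed

lemma card_supports:
  assumes "s \<le> card (params ds)"
  shows "card (supports ds s) \<le> card (params ds) ^ s"
proof -
  let ?f = "\<lambda>\<gamma>. {i \<in> params ds. \<gamma> i}"
  have "inj_on ?f (supports ds s)"
  proof (rule inj_onI)
    fix \<gamma> \<gamma>' assume *: "\<gamma> \<in> supports ds s" "\<gamma>' \<in> supports ds s" "?f \<gamma> = ?f \<gamma>'"
    show "\<gamma> = \<gamma>'"
      using * by (intro extensionalityI[of _ "params ds"]) (auto simp: supports_def PiE_iff)
  qed
  moreover have "?f ` supports ds s \<subseteq> {A. A \<subseteq> params ds \<and> card A = s}"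
    by (auto simp: supports_def)
  ultimately have "card (supports ds s) \<le> card {A. A \<subseteq> params ds \<and> card A = s}"
    by (intro card_inj_on_le[of ?f]) auto
  also have "\<dots> \<le> card (params ds) ^ s"
    unfolding n_subsets[OF finite_params] using assms by (rule binomial_le_pow)
  finally show ?thesis .
qed

context
  fixes ds :: "nat list" and s :: nat and sl :: slab and B :: real
  assumes sl: "valid_slab sl B" and s: "s \<le> card (params ds)"
begin

lemma prior_kernel:
  "spike_slab_prod ds sl \<in> measurable (measure_pmf (pmf_of_set (supports ds s))) (subprob_algebra (par_space ds))"
  using prob_space_spike_slab_prod[OF sl] sets_spike_slab_prod
  by (auto simp: space_subprob_algebra prob_space_imp_subprob_space)

lemma prior_eq: "prior ds s sl = measure_pmf (pmf_of_set (supports ds s)) \<bind> spike_slab_prod ds sl"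
  by (simp add: prior_def supports_def spike_slab_prod_def[abs_def])

lemma sets_prior: "sets (prior ds s sl) = sets (par_space ds)"
  unfolding prior_eq by (rule sets_bind) (auto simp: sets_spike_slab_prod)

lemma prob_space_prior: "prob_space (prior ds s sl)"
  unfolding prior_eq
  by (rule measure_pmf.prob_space_bind[OF _ prior_kernel]) (simp add: prob_space_spike_slab_prod[OF sl])

lemma nn_integral_prior:
  assumes "f \<in> borel_measurable (par_space ds)"
  shows "(\<integral>\<^sup>+\<theta>. f \<theta> \<partial>prior ds s sl)
    = (\<Sum>\<gamma>\<in>supports ds s. \<integral>\<^sup>+\<theta>. f \<theta> \<partial>spike_slab_prod ds sl \<gamma>) / card (supports ds s)"
  unfolding prior_eq nn_integral_bind[OF assms prior_kernel]
  by (rule nn_integral_pmf_of_set) (use supports_nonempty[OF s] finite_supports in auto)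

text \<open>The prior is a uniform mixture over supports, so a single component is at most the
  number of supports times the prior. This is the origin of the term
  \<open>s * ln (card (params ds))\<close>.\<close>

lemma nn_integral_spike_slab_prod_le:
  assumes f: "f \<in> borel_measurable (par_space ds)" and \<gamma>: "\<gamma> \<in> supports ds s"
  shows "(\<integral>\<^sup>+\<theta>. f \<theta> \<partial>spike_slab_prod ds sl \<gamma>) \<le> of_nat (card (supports ds s)) * (\<integral>\<^sup>+\<theta>. f \<theta> \<partial>prior ds s sl)"
proof -
  have pos: "card (supports ds s) > 0" using \<gamma> finite_supports by (auto simp: card_gt_0_iff)
  have "(\<integral>\<^sup>+\<theta>. f \<theta> \<partial>spike_slab_prod ds sl \<gamma>) \<le> (\<Sum>\<gamma>\<in>supports ds s. \<integral>\<^sup>+\<theta>. f \<theta> \<partial>spike_slab_prod ds sl \<gamma>)"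
    using \<gamma> finite_supports by (intro member_le_sum) auto
  also have "\<dots> = of_nat (card (supports ds s)) * (\<integral>\<^sup>+\<theta>. f \<theta> \<partial>prior ds s sl)"
    unfolding nn_integral_prior[OF f] using pos
    by (simp add: ennreal_times_divide mult.commute[of "of_nat _"] ennreal_mult_divide_eq)
  finally show ?thesis .
qed

lemma emeasure_prior_le:
  assumes X: "X \<in> sets (par_space ds)"
    and "\<And>\<gamma>. \<gamma> \<in> supports ds s \<Longrightarrow> emeasure (spike_slab_prod ds sl \<gamma>) X \<le> c"
  shows "emeasure (prior ds s sl) X \<le> c"
proof -
  have "emeasure (prior ds s sl) X
      = (\<integral>\<^sup>+\<gamma>. emeasure (spike_slab_prod ds sl \<gamma>) X \<partial>measure_pmf (pmf_of_set (supports ds s)))"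
    unfolding prior_eq by (rule emeasure_bind[OF _ prior_kernel X]) simp
  also have "\<dots> \<le> (\<integral>\<^sup>+\<gamma>. c \<partial>measure_pmf (pmf_of_set (supports ds s)))"
    using supports_nonempty[OF s] finite_supports assms(2)
    by (intro nn_integral_mono_AE) (auto simp: AE_measure_pmf_iff)
  finally show ?thesis by (simp add: measure_pmf.emeasure_space_1[simplified])
qed

lemma AE_spike_slab_prod_zero:
  "AE \<theta> in spike_slab_prod ds sl \<gamma>. \<forall>i\<in>{i \<in> params ds. \<not> \<gamma> i}. \<theta> i = 0"
proof (rule AE_finite_allI)
  fix i assume i: "i \<in> {i \<in> params ds. \<not> \<gamma> i}"
  have r: "spike_slab (\<gamma> i) (slab_law sl) = return borel 0" using i by (simp add: spike_slab_def)
  have "AE t in spike_slab (\<gamma> i) (slab_law sl). t = 0"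
    unfolding r by (subst AE_return) auto
  then show "AE \<theta> in spike_slab_prod ds sl \<gamma>. \<theta> i = 0"
    unfolding spike_slab_prod_def using i
    by (intro AE_PiM_component prob_space_spike_slab prob_space_slab_law[OF sl]) auto
qed simp

definition oversized :: "(param \<Rightarrow> real) set" where
  "oversized = {\<theta> \<in> space (par_space ds). card {q \<in> params ds. \<theta> q \<noteq> 0} > s}"

lemma oversized_measurable: "oversized \<in> sets (par_space ds)"
proof -
  have "(\<lambda>\<theta>. \<Sum>q\<in>params ds. if \<theta> q \<noteq> 0 then 1 else 0 :: real) \<in> borel_measurable (par_space ds)"
    by (intro borel_measurable_sum) measurable
  then have "{\<theta> \<in> space (par_space ds). real s < (\<Sum>q\<in>params ds. if \<theta> q \<noteq> 0 then 1 else 0)} \<in> sets (par_space ds)"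
    by measurable
  moreover have "(\<Sum>q\<in>params ds. if \<theta> q \<noteq> 0 then 1 else 0) = real (card {q \<in> params ds. \<theta> q \<noteq> 0})"
    for \<theta> :: "param \<Rightarrow> real"
    by (subst sum.If_cases) (auto simp: Int_def)
  ultimately show ?thesis unfolding oversized_def by simp
qed

lemma AE_prior_sparse: "AE \<theta> in prior ds s sl. card {q \<in> params ds. \<theta> q \<noteq> 0} \<le> s"
proof -
  have "emeasure (prior ds s sl) oversized \<le> 0"
  proof (rule emeasure_prior_le[OF oversized_measurable])
    fix \<gamma> assume \<gamma>: "\<gamma> \<in> supports ds s"
    have "AE \<theta> in spike_slab_prod ds sl \<gamma>. \<theta> \<notin> oversized"
      using AE_spike_slab_prod_zero[of \<gamma>]
    proof eventually_elim
      case (elim \<theta>)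
      have "card {q \<in> params ds. \<theta> q \<noteq> 0} \<le> card {q \<in> params ds. \<gamma> q}"
        using elim by (intro card_mono) auto
      then show ?case using \<gamma> by (simp add: oversized_def supports_def)
    qed
    then show "emeasure (spike_slab_prod ds sl \<gamma>) oversized \<le> 0"
      using oversized_measurable AE_iff_measurable[of oversized "spike_slab_prod ds sl \<gamma>" "\<lambda>\<theta>. \<theta> \<notin> oversized"]
        sets_spike_slab_prod sets.sets_into_space[of oversized "spike_slab_prod ds sl \<gamma>"]
      by (auto simp: sets_spike_slab_prod)
  qed
  then have "oversized \<in> null_sets (prior ds s sl)"
    using oversized_measurable by (auto simp: sets_prior)
  then have "AE \<theta> in prior ds s sl. \<theta> \<notin> oversized" by (rule AE_not_in)
  then show ?thesis
    using AE_space
  proof eventually_elim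
    case (elim \<theta>)
    then show ?case
      using sets_eq_imp_space_eq[OF sets_prior] by (simp add: oversized_def)
  qed
qed

definition large_params :: "real \<Rightarrow> (param \<Rightarrow> real) set" where
  "large_params R = {\<theta> \<in> space (par_space ds). \<exists>q\<in>params ds. R < \<bar>\<theta> q\<bar>}"

lemma large_params_measurable: "large_params R \<in> sets (par_space ds)"
proof -
  have "large_params R = (\<Union>q\<in>params ds. {\<theta> \<in> space (par_space ds). R < \<bar>\<theta> q\<bar>})"
    by (auto simp: large_params_def)
  moreover have "{\<theta> \<in> space (par_space ds). R < \<bar>\<theta> q\<bar>} \<in> sets (par_space ds)" if "q \<in> params ds" for q
    using that by measurable
  ultimately show ?thesis by auto
qed

text \<open>A union bound over the \<open>s\<close> slab coordinates; spikes sit at zero and never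
  exceed \<open>R\<close>.\<close>

lemma emeasure_prior_large_params:
  assumes R: "R \<ge> 0" and tail: "emeasure (slab_law sl) {t. R < \<bar>t\<bar>} \<le> ennreal \<delta>" and "\<delta> \<ge> 0"
  shows "emeasure (prior ds s sl) (large_params R) \<le> ennreal (real s * \<delta>)"
proof (rule emeasure_prior_le[OF large_params_measurable])
  fix \<gamma> assume \<gamma>: "\<gamma> \<in> supports ds s"
  let ?M = "spike_slab_prod ds sl \<gamma>"
  let ?X = "\<lambda>q. {\<theta> \<in> space (par_space ds). R < \<bar>\<theta> q\<bar>}"
  have sp: "space ?M = space (par_space ds)" by (rule sets_eq_imp_space_eq[OF sets_spike_slab_prod])
  have X: "?X q \<in> sets ?M" if "q \<in> params ds" for q
    unfolding sets_spike_slab_prod using that by measurable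
  have comp: "emeasure ?M (?X q) = emeasure (spike_slab (\<gamma> q) (slab_law sl)) {t. R < \<bar>t\<bar>}"
    if q: "q \<in> params ds" for q
  proof -
    have d: "distr ?M (spike_slab (\<gamma> q) (slab_law sl)) (\<lambda>\<theta>. \<theta> q) = spike_slab (\<gamma> q) (slab_law sl)"
      unfolding spike_slab_prod_def using q
      by (intro distr_PiM_component prob_space_spike_slab prob_space_slab_law[OF sl])
    have "{t. R < \<bar>t\<bar>} \<in> sets (spike_slab (\<gamma> q) (slab_law sl))"
    proof -
      have "{t::real. R < \<bar>t\<bar>} \<in> sets borel" by measurable
      then show ?thesis by (simp add: sets_spike_slab)
    qed
    then have "emeasure (distr ?M (spike_slab (\<gamma> q) (slab_law sl)) (\<lambda>\<theta>. \<theta> q)) {t. R < \<bar>t\<bar>}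
        = emeasure ?M ((\<lambda>\<theta>. \<theta> q) -` {t. R < \<bar>t\<bar>} \<inter> space ?M)"
      unfolding spike_slab_prod_def using q by (intro emeasure_distr measurable_component_singleton)
    also have "(\<lambda>\<theta>. \<theta> q) -` {t. R < \<bar>t\<bar>} \<inter> space ?M = ?X q" unfolding sp by auto
    finally show ?thesis using d by simp
  qed
  have "emeasure ?M (large_params R) \<le> (\<Sum>q\<in>params ds. emeasure ?M (?X q))"
  proof -
    have "large_params R = (\<Union>q\<in>params ds. ?X q)" by (auto simp: large_params_def)
    then show ?thesis using X by (auto intro: emeasure_subadditive_finite)
  qed
  also have "\<dots> \<le> (\<Sum>q\<in>params ds. if \<gamma> q then ennreal \<delta> else 0)"
  proof (rule sum_mono)
    fix q assume q: "q \<in> params ds"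
    show "emeasure ?M (?X q) \<le> (if \<gamma> q then ennreal \<delta> else 0)"
      unfolding comp[OF q] using tail R by (auto simp: spike_slab_def)
  qed
  also have "\<dots> = (\<Sum>q\<in>{q \<in> params ds. \<gamma> q}. ennreal \<delta>)"
    by (rule sum.mono_neutral_cong_right) auto
  also have "\<dots> = of_nat s * ennreal \<delta>" using \<gamma> by (simp add: supports_def)
  also have "\<dots> = ennreal (real s * \<delta>)" using \<open>\<delta> \<ge> 0\<close> by (simp add: ennreal_mult ennreal_of_nat_eq_real_of_nat)
  finally show "emeasure ?M (large_params R) \<le> ennreal (real s * \<delta>)" .
qed

end

section \<open>The posterior in terms of the log likelihood ratio to the truth\<close>

lemma llr_measurable_params:
  assumes "length ds \<ge> 2" "0 < ds ! (length ds - 1)"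
  shows "(\<lambda>\<theta>. llr \<sigma> f0 n D (net ds \<theta>)) \<in> borel_measurable (par_space ds)"
  unfolding llr_def
  by (intro borel_measurable_divide borel_measurable_sum borel_measurable_diff borel_measurable_power
      borel_measurable_const net_measurable_params assms)

lemma llr_le: "llr \<sigma> f0 n D f \<le> (\<Sum>i<n. (snd (D i) - f0 (fst (D i)))\<^sup>2) / (2 * \<sigma>\<^sup>2)"
  unfolding llr_def by (intro divide_right_mono sum_mono) auto

context
  fixes ds :: "nat list" and s :: nat and sl :: slab and B :: real and \<sigma> :: real and n :: nat
    and D :: "nat \<Rightarrow> (nat \<Rightarrow> real) \<times> real" and f0 :: "(nat \<Rightarrow> real) \<Rightarrow> real"
  assumes sl: "valid_slab sl B" and s: "s \<le> card (params ds)"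
    and \<sigma>: "\<sigma> > 0" and ds: "length ds \<ge> 2" "0 < ds ! (length ds - 1)"
begin

text \<open>The evidence relative to the density of the truth. It enters the divergence of the
  competitor and the posterior integral with opposite signs and cancels.\<close>

definition evidence :: real where
  "evidence = enn2real (\<integral>\<^sup>+\<theta>. ennreal (exp (llr \<sigma> f0 n D (net ds \<theta>))) \<partial>prior ds s sl)"

lemma llr_measurable_prior:
  "(\<lambda>\<theta>. llr \<sigma> f0 n D (net ds \<theta>)) \<in> borel_measurable (prior ds s sl)"
  using llr_measurable_params[OF ds] sets_prior[OF sl s] by (simp cong: measurable_cong_sets)

lemma shows evidence_eq: "(\<integral>\<^sup>+\<theta>. ennreal (exp (llr \<sigma> f0 n D (net ds \<theta>))) \<partial>prior ds s sl) = ennreal evidence"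
    and evidence_pos: "evidence > 0"
proof -
  interpret P: prob_space "prior ds s sl" by (rule prob_space_prior[OF sl s])
  note [measurable] = llr_measurable_prior
  let ?I = "\<integral>\<^sup>+\<theta>. ennreal (exp (llr \<sigma> f0 n D (net ds \<theta>))) \<partial>prior ds s sl"
  have "?I \<le> (\<integral>\<^sup>+\<theta>. ennreal (exp ((\<Sum>i<n. (snd (D i) - f0 (fst (D i)))\<^sup>2) / (2 * \<sigma>\<^sup>2))) \<partial>prior ds s sl)"
    using llr_le by (intro nn_integral_mono ennreal_leI) simp
  then have "?I < \<infinity>" using P.emeasure_space_1 by (auto simp: order.strict_trans1)
  then show eq: "?I = ennreal evidence" by (simp add: evidence_def)
  have "?I \<noteq> 0"
  proof
    assume "?I = 0"
    then have "AE \<theta> in prior ds s sl. ennreal (exp (llr \<sigma> f0 n D (net ds \<theta>))) = 0"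
      by (subst (asm) nn_integral_0_iff_AE) auto
    then show False using P.AE_False by (simp add: ennreal_eq_0_iff)
  qed
  then show "evidence > 0" using eq by (metis ennreal_0 ennreal_eq_0_iff not_le)
qed

lemma posterior_eq:
  "posterior ds s sl \<sigma> n D = density (prior ds s sl) (\<lambda>\<theta>. ennreal (exp (llr \<sigma> f0 n D (net ds \<theta>)) / evidence))"
proof -
  let ?l = "likelihood \<sigma> n D f0"
  have l: "?l > 0" by (rule likelihood_pos[OF \<sigma>])
  note [measurable] = llr_measurable_prior
  have le: "likelihood \<sigma> n D (net ds \<theta>) = ?l * exp (llr \<sigma> f0 n D (net ds \<theta>))" for \<theta>
    by (rule likelihood_eq_exp_llr[OF \<sigma>])
  have "(\<integral>\<^sup>+\<theta>. ennreal (likelihood \<sigma> n D (net ds \<theta>)) \<partial>prior ds s sl)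
      = (\<integral>\<^sup>+\<theta>. ennreal ?l * ennreal (exp (llr \<sigma> f0 n D (net ds \<theta>))) \<partial>prior ds s sl)"
    using l by (intro nn_integral_cong) (simp add: le ennreal_mult)
  also have "\<dots> = ennreal ?l * ennreal evidence"
    unfolding evidence_eq[symmetric] by (rule nn_integral_cmult) simp
  also have "\<dots> = ennreal (?l * evidence)" using l evidence_pos by (simp add: ennreal_mult)
  finally have Z: "(\<integral>\<^sup>+\<theta>. ennreal (likelihood \<sigma> n D (net ds \<theta>)) \<partial>prior ds s sl) = ennreal (?l * evidence)" .
  have "ennreal (likelihood \<sigma> n D (net ds \<theta>)) / ennreal (?l * evidence)
      = ennreal (exp (llr \<sigma> f0 n D (net ds \<theta>)) / evidence)" for \<theta>
    using l evidence_pos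
    by (subst divide_ennreal) (auto simp: le)
  then show ?thesis unfolding posterior_def Z by simp
qed

lemma sets_posterior: "sets (posterior ds s sl \<sigma> n D) = sets (par_space ds)"
  by (simp add: posterior_def sets_prior[OF sl s])

lemma nn_integral_posterior:
  assumes "f \<in> borel_measurable (par_space ds)"
  shows "(\<integral>\<^sup>+\<theta>. f \<theta> \<partial>posterior ds s sl \<sigma> n D)
    = (\<integral>\<^sup>+\<theta>. ennreal (exp (llr \<sigma> f0 n D (net ds \<theta>)) / evidence) * f \<theta> \<partial>prior ds s sl)"
proof -
  note [measurable] = llr_measurable_prior
  have "f \<in> borel_measurable (prior ds s sl)"
    using assms sets_prior[OF sl s] by (simp cong: measurable_cong_sets)
  then show ?thesis unfolding posterior_eq by (subst nn_integral_density) auto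
qed

lemma prob_space_posterior: "prob_space (posterior ds s sl \<sigma> n D)"
proof
  note [measurable] = llr_measurable_prior
  have "emeasure (posterior ds s sl \<sigma> n D) (space (posterior ds s sl \<sigma> n D))
      = (\<integral>\<^sup>+\<theta>. 1 \<partial>posterior ds s sl \<sigma> n D)" by simp
  also have "\<dots> = (\<integral>\<^sup>+\<theta>. ennreal (1 / evidence) * ennreal (exp (llr \<sigma> f0 n D (net ds \<theta>))) \<partial>prior ds s sl)"
    using evidence_pos by (subst nn_integral_posterior) (auto simp flip: ennreal_mult)
  also have "\<dots> = ennreal (1 / evidence) * ennreal evidence"
    unfolding evidence_eq[symmetric] by (rule nn_integral_cmult) simp
  also have "\<dots> = 1" using evidence_pos by (simp flip: ennreal_mult)
  finally show "emeasure (posterior ds s sl \<sigma> n D) (space (posterior ds s sl \<sigma> n D)) = 1" .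
qed

text \<open>The Gibbs variational inequality applied to \<open>d\<close>: the divergence contributes
  \<open>ln evidence\<close>, the posterior integral \<open>- ln evidence\<close>. The set
  \<open>X\<close> is meant for the parameters off the sieve. If \<open>d\<close> is not integrable
  its integral is 0, and \<open>pos\<close> covers this case.\<close>

lemma posterior_integral_bound:
  fixes d :: "(param \<Rightarrow> real) \<Rightarrow> real"
  assumes q: "prob_space q" "sets q = sets (par_space ds)"
    and kl: "kl q (posterior ds s sl \<sigma> n D) \<le> ereal (W + ln evidence)"
    and d: "\<And>\<theta>. 0 \<le> d \<theta>" "\<And>\<theta>. d \<theta> \<le> b"
    and X: "X \<in> sets (par_space ds)" "emeasure (prior ds s sl) X \<le> ennreal \<delta>" "\<delta> \<ge> 0"
    and C: "C1 > 0" "C2 \<ge> 0"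
    and dom: "AE \<theta> in prior ds s sl. exp (d \<theta> + llr \<sigma> f0 n D (net ds \<theta>)) \<le> C1 + C2 * indicator X \<theta>"
    and pos: "W + ln (C1 + C2 * \<delta>) \<ge> 0"
  shows "(\<integral>\<theta>. d \<theta> \<partial>q) \<le> W + ln (C1 + C2 * \<delta>)"
proof (cases "integrable q d")
  case False
  then show ?thesis using pos by (simp add: not_integrable_integral_eq)
next
  case True
  have dm: "d \<in> borel_measurable (par_space ds)"
    using borel_measurable_integrable[OF True] q(2) by (simp cong: measurable_cong_sets)
  have dpost: "d \<in> borel_measurable (posterior ds s sl \<sigma> n D)"
    using dm sets_posterior by (simp cong: measurable_cong_sets)
  let ?C = "C1 + C2 * \<delta>"
  have C0: "?C > 0" using C X(3) by (simp add: add_pos_nonneg)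
  interpret P: prob_space "prior ds s sl" by (rule prob_space_prior[OF sl s])
  have Xp: "X \<in> sets (prior ds s sl)" using X(1) sets_prior[OF sl s] by simp
  have "(\<integral>\<^sup>+\<theta>. ennreal (exp (d \<theta>)) \<partial>posterior ds s sl \<sigma> n D)
      = (\<integral>\<^sup>+\<theta>. ennreal (exp (llr \<sigma> f0 n D (net ds \<theta>)) / evidence) * ennreal (exp (d \<theta>)) \<partial>prior ds s sl)"
    by (rule nn_integral_posterior) (use dm in measurable)
  also have "\<dots> \<le> (\<integral>\<^sup>+\<theta>. ennreal (1 / evidence) * (ennreal C1 + ennreal C2 * indicator X \<theta>) \<partial>prior ds s sl)"
  proof (rule nn_integral_mono_AE)
    show "AE \<theta> in prior ds s sl. ennreal (exp (llr \<sigma> f0 n D (net ds \<theta>)) / evidence) * ennreal (exp (d \<theta>))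
        \<le> ennreal (1 / evidence) * (ennreal C1 + ennreal C2 * indicator X \<theta>)"
      using dom
    proof eventually_elim
      case (elim \<theta>)
      have "exp (llr \<sigma> f0 n D (net ds \<theta>)) / evidence * exp (d \<theta>)
          = 1 / evidence * exp (d \<theta> + llr \<sigma> f0 n D (net ds \<theta>))"
        by (simp add: exp_add)
      also have "\<dots> \<le> 1 / evidence * (C1 + C2 * indicator X \<theta>)"
        using elim evidence_pos by (intro mult_left_mono) auto
      finally have "ennreal (exp (llr \<sigma> f0 n D (net ds \<theta>)) / evidence * exp (d \<theta>))
          \<le> ennreal (1 / evidence * (C1 + C2 * indicator X \<theta>))" by (rule ennreal_leI)
      moreover have "ennreal (1 / evidence * (C1 + C2 * indicator X \<theta>))
          = ennreal (1 / evidence) * (ennreal C1 + ennreal C2 * indicator X \<theta>)"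
        using evidence_pos C by (cases "\<theta> \<in> X") (simp_all flip: ennreal_mult ennreal_plus)
      ultimately show ?case using evidence_pos by (simp add: ennreal_mult[symmetric])
    qed
  qed
  also have "\<dots> = ennreal (1 / evidence) * (ennreal C1 + ennreal C2 * emeasure (prior ds s sl) X)"
    using Xp P.emeasure_space_1 by (simp add: nn_integral_cmult nn_integral_add nn_integral_cmult_indicator)
  also have "\<dots> \<le> ennreal (1 / evidence) * (ennreal C1 + ennreal C2 * ennreal \<delta>)"
    using X(2) by (intro mult_left_mono add_left_mono) auto
  also have "\<dots> = ennreal (?C / evidence)"
    using evidence_pos C X(3) by (simp flip: ennreal_mult ennreal_plus)
  finally have "ereal (\<integral>\<theta>. d \<theta> \<partial>q) \<le> kl q (posterior ds s sl \<sigma> n D) + ereal (ln (?C / evidence))"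
    using d C0 evidence_pos q(2) sets_posterior
    by (intro donsker_varadhan[where b = b] prob_space_posterior q(1) dpost) (auto simp: abs_le_iff intro: order.trans)
  also have "\<dots> \<le> ereal (W + ln evidence) + ereal (ln (?C / evidence))"
    by (intro add_right_mono kl)
  also have "\<dots> = ereal (W + ln ?C)" using C0 evidence_pos by (simp add: ln_div)
  finally show ?thesis by simp
qed

end

subsection \<open>A competitor in the variational family\<close>

text \<open>Inclusion probabilities 0 and 1 are admissible in the variational family, so a
  competitor can have a deterministic support.\<close>

lemma bind_bernoulli_spike:
  assumes "sets S = sets borel" "prob_space S" "\<nu> = (if b then 1 else 0)"
  shows "measure_pmf (bernoulli_pmf \<nu>) \<bind> (\<lambda>g. spike_slab g S) = spike_slab b S"
proof -
  have k: "(\<lambda>g. spike_slab g S) \<in> measurable (count_space UNIV) (subprob_algebra borel)"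
    using assms(1,2) prob_space_spike_slab[OF assms(2)] sets_spike_slab[OF assms(1)]
    by (auto simp: space_subprob_algebra prob_space_imp_subprob_space)
  have "bernoulli_pmf \<nu> = return_pmf b"
    using assms(3) by (auto intro!: pmf_eqI simp: indicator_def split: if_splits)
  then have "measure_pmf (bernoulli_pmf \<nu>) = return (count_space UNIV) b"
    by (simp add: return_pmf.rep_eq)
  then show ?thesis using bind_return[OF k] by simp
qed

lemma variational_family_sets:
  assumes "q \<in> variational_family ds sl"
  shows "sets q = sets (par_space ds)" "prob_space q"
proof -
  obtain \<nu> S where q: "q = (\<Pi>\<^sub>M i\<in>params ds. measure_pmf (bernoulli_pmf (\<nu> i)) \<bind> (\<lambda>g. spike_slab g (S i)))"
    and S: "\<And>i. i \<in> params ds \<Longrightarrow> S i \<in> slab_family sl"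
    using assms by (auto simp: variational_family_def)
  have k: "(\<lambda>g. spike_slab g (S i)) \<in> measurable (measure_pmf (bernoulli_pmf (\<nu> i))) (subprob_algebra borel)"
    if "i \<in> params ds" for i
    using sets_slab_family[OF S[OF that]] prob_space_slab_family[OF S[OF that]]
      prob_space_spike_slab sets_spike_slab
    by (auto simp: space_subprob_algebra prob_space_imp_subprob_space)
  have sets: "sets (measure_pmf (bernoulli_pmf (\<nu> i)) \<bind> (\<lambda>g. spike_slab g (S i))) = sets borel"
    if "i \<in> params ds" for i
    by (rule sets_bind) (auto simp: sets_spike_slab sets_slab_family[OF S[OF that]])
  show "sets q = sets (par_space ds)" unfolding q by (intro sets_PiM_cong sets) auto
  define q' where "q' i = (if i \<in> params ds then measure_pmf (bernoulli_pmf (\<nu> i)) \<bind> (\<lambda>g. spike_slab g (S i))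
      else return borel 0)" for i
  have "prob_space (q' i)" for i
  proof (cases "i \<in> params ds")
    case True
    have "prob_space (measure_pmf (bernoulli_pmf (\<nu> i)) \<bind> (\<lambda>g. spike_slab g (S i)))"
      by (rule measure_pmf.prob_space_bind[OF _ k[OF True]])
        (simp add: prob_space_spike_slab prob_space_slab_family[OF S[OF True]])
    then show ?thesis using True by (simp add: q'_def)
  qed (simp add: q'_def prob_space_return)
  moreover have "q = PiM (params ds) q'" unfolding q by (rule PiM_cong) (auto simp: q'_def)
  ultimately show "prob_space q" by (auto intro: prob_space_PiM)
qed

text \<open>The competitor has narrow slabs around \<open>\<theta>s\<close> on a support of exactly
  \<open>s\<close> coordinates and spikes elsewhere. Its density relative to the posterior is at
  most \<open>exp u\<close> with \<open>u\<close> affine in \<open>exp (2 * U)\<close>, whose mean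
  factorises over the coordinates. Noise against the fixed bias \<open>net ds \<theta>s - f0\<close>
  enters through the hypothesis on \<open>G\<close>, as a single function is concerned; noise
  against the perturbation is bounded in absolute value, which the tiny \<open>\<tau>\<close> makes
  affordable.\<close>

lemma variational_competitor:
  fixes D :: "nat \<Rightarrow> (nat \<Rightarrow> real) \<times> real" and f0 :: "(nat \<Rightarrow> real) \<Rightarrow> real"
  assumes sl: "valid_slab sl B" and B: "B > 0" and \<kappa>: "\<kappa> \<ge> 0"
    "\<And>c \<tau>. 0 < \<tau> \<Longrightarrow> \<tau> \<le> 1 \<Longrightarrow> \<bar>c\<bar> \<le> B \<Longrightarrow> \<exists>S. narrow_slab sl \<kappa> c \<tau> S"
    and len: "length ds = L + 1" "L \<ge> 1" and out: "ds ! L = 1" and inp: "ds ! 0 = p"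
    and w: "\<And>l. l < length ds \<Longrightarrow> ds ! l \<le> w"
    and s: "1 \<le> s" "s \<le> card (params ds)" and \<theta>s: "\<theta>s \<in> bounded_sparse_params ds s B"
    and \<sigma>: "\<sigma> > 0" and n: "n \<ge> 1"
    and a: "a = 1 + B * real ((w + 1)\<^sup>2)" and \<tau>: "\<tau> = 1 / (30 * s * n\<^sup>2 * a ^ (2 * L))"
    and cube: "\<And>i. i < n \<Longrightarrow> fst (D i) \<in> cube p"
    and small: "(\<Sum>i<n. (snd (D i) - f0 (fst (D i)))\<^sup>2) \<le> 4 * \<sigma>\<^sup>2 * n"
    and \<xi>: "\<And>x. x \<in> cube p \<Longrightarrow> (net ds \<theta>s x - f0 x)\<^sup>2 \<le> \<xi>"
    and G: "- (\<Sum>i<n. (snd (D i) - f0 (fst (D i))) * (net ds \<theta>s (fst (D i)) - f0 (fst (D i)))) \<le> G"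
  shows "\<exists>q \<in> variational_family ds sl. kl q (posterior ds s sl \<sigma> n D) \<le>
    ereal ((s * ln (card (params ds)) + s * ln (1 / \<tau>) + 4 * \<kappa> * s + (2 + 4 * \<sigma> + 2 * n * \<xi> + 2 * G) / (2 * \<sigma>\<^sup>2))
      + ln (evidence ds s sl \<sigma> n D f0))"
proof -
  let ?P = "params ds"
  let ?post = "posterior ds s sl \<sigma> n D"
  have ds: "length ds \<ge> 2" "0 < ds ! (length ds - 1)" using len out by auto
  have a1: "a \<ge> 1" using B by (simp add: a)
  have aL: "a ^ (2 * L) \<ge> 1" "a ^ L \<ge> 1" using a1 by simp_all
  have sn: "real s \<ge> 1" "real n \<ge> 1" "(real n)\<^sup>2 \<ge> 1" using s n by (simp_all add: one_le_power)
  have big: "30 * s * n\<^sup>2 * a ^ (2 * L) \<ge> 1"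
  proof -
    have "1 * 1 * 1 * 1 \<le> (30 * real s) * 1 * (real n)\<^sup>2 * a ^ (2 * L)"
      using sn aL by (intro mult_mono) auto
    then show ?thesis by simp
  qed
  have \<tau>0: "0 < \<tau>" "\<tau> \<le> 1" using big by (simp_all add: \<tau>)
  obtain A where A: "{q \<in> ?P. \<theta>s q \<noteq> 0} \<subseteq> A" "A \<subseteq> ?P" "card A = s"
    using obtain_superset_card[OF finite_params _ _ s(2), of "{q \<in> ?P. \<theta>s q \<noteq> 0}"] \<theta>s
    by (auto simp: bounded_sparse_params_def sparse_params_def)
  have finA: "finite A" using finite_subset[OF A(2) finite_params] .
  \<comment> \<open>Extended by zero, so that the narrow slabs can be chosen for all indices at
    once.\<close>
  define c where "c i = (if i \<in> ?P then \<theta>s i else 0)" for i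
  have cB: "\<bar>c i\<bar> \<le> B" for i using \<theta>s B by (auto simp: c_def bounded_sparse_params_def)
  obtain S where S: "\<And>i. narrow_slab sl \<kappa> (c i) \<tau> (S i)" using \<kappa>(2)[OF \<tau>0 cB] by metis
  then have Sfam: "S i \<in> slab_family sl" for i by (simp add: narrow_slab_def)
  obtain g where g: "\<And>i. g i \<in> borel_measurable borel"
    "\<And>i. S i = density (slab_law sl) (\<lambda>t. ennreal (g i t))" "\<And>i t. 0 \<le> g i t"
    "\<And>i t. g i t \<le> exp (ln (1 / \<tau>) + \<kappa> * (1 + exp (2 * \<bar>t - c i\<bar>)))"
    using S unfolding narrow_slab_def by metis
  define Q where "Q i = spike_slab (i \<in> A) (S i)" for i
  define q where "q = PiM ?P Q"
  have Qprob: "prob_space (Q i)" for i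
    unfolding Q_def by (rule prob_space_spike_slab[OF prob_space_slab_family[OF Sfam]])
  have Qsets: "sets (Q i) = sets borel" for i
    unfolding Q_def by (rule sets_spike_slab[OF sets_slab_family[OF Sfam]])
  have qsets: "sets q = sets (par_space ds)" unfolding q_def by (intro sets_PiM_cong) (auto simp: Qsets)
  have qprob: "prob_space q" unfolding q_def by (rule prob_space_PiM[OF Qprob])
  interpret q: prob_space q by (rule qprob)
  have qfam: "q \<in> variational_family ds sl"
  proof -
    have "q = (\<Pi>\<^sub>M i\<in>?P. measure_pmf (bernoulli_pmf (if i \<in> A then 1 else 0)) \<bind> (\<lambda>g. spike_slab g (S i)))"
      unfolding q_def Q_def
      by (rule PiM_cong) (auto simp: bind_bernoulli_spike[OF sets_slab_family[OF Sfam] prob_space_slab_family[OF Sfam] refl])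
    then show ?thesis unfolding variational_family_def using Sfam
      by (intro CollectI exI[of _ "\<lambda>i. if i \<in> A then 1 else 0"] exI[of _ S]) auto
  qed
  define \<gamma> where "\<gamma> = (\<lambda>i\<in>?P. i \<in> A)"
  have \<gamma>: "\<gamma> \<in> supports ds s" unfolding \<gamma>_def by (rule supports_restrict[OF A(2,3)])
  define gA where "gA i t = (if i \<in> A then ennreal (g i t) else 1)" for i t
  have gAm: "gA i \<in> borel_measurable borel" for i
    using g(1)[of i] by (cases "i \<in> A") (simp_all add: gA_def[abs_def])
  have Qd: "Q i = density (spike_slab (i \<in> A) (slab_law sl)) (gA i)" for i
    using g(2)[of i] by (cases "i \<in> A") (simp_all add: Q_def spike_slab_def gA_def[abs_def] density_1)
  have qd: "q = density (spike_slab_prod ds sl \<gamma>) (\<lambda>\<theta>. \<Prod>i\<in>?P. gA i (\<theta> i))"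
  proof -
    have "q = PiM ?P (\<lambda>i. density (spike_slab (i \<in> A) (slab_law sl)) (gA i))"
      unfolding q_def by (simp add: Qd[symmetric])
    also have "\<dots> = density (PiM ?P (\<lambda>i. spike_slab (i \<in> A) (slab_law sl))) (\<lambda>\<theta>. \<Prod>i\<in>?P. gA i (\<theta> i))"
      using Qprob gAm prob_space_slab_law[OF sl]
      by (intro PiM_density) (auto simp: Qd[symmetric] prob_space_spike_slab sets_spike_slab cong: measurable_cong_sets)
    also have "PiM ?P (\<lambda>i. spike_slab (i \<in> A) (slab_law sl)) = spike_slab_prod ds sl \<gamma>"
      unfolding spike_slab_prod_def by (rule PiM_cong) (auto simp: \<gamma>_def)
    finally show ?thesis .
  qed
  define U where "U \<theta> = (\<Sum>i\<in>?P. \<bar>\<theta> i - \<theta>s i\<bar>)" for \<theta>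
  have U0: "U \<theta> \<ge> 0" for \<theta> unfolding U_def by (intro sum_nonneg) simp
  have Um: "U \<in> borel_measurable (par_space ds)"
    unfolding U_def[abs_def] by (intro borel_measurable_sum borel_measurable_abs borel_measurable_diff
      measurable_component_singleton borel_measurable_const)
  \<comment> \<open>The 2 absorbs the summand 1 in the density bound of a narrow slab, since
    \<open>exp (2 * U \<theta>)\<close> is at least 1.\<close>
  define V where "V \<theta> = real s * ln (1 / \<tau>) + 2 * \<kappa> * s * exp (2 * U \<theta>)" for \<theta>
  have gV: "(\<Prod>i\<in>?P. gA i (\<theta> i)) \<le> ennreal (exp (V \<theta>))" for \<theta>
  proof -
    have "(\<Prod>i\<in>?P. gA i (\<theta> i)) = (\<Prod>i\<in>A. gA i (\<theta> i))"
      using A(2) by (intro prod.mono_neutral_right) (auto simp: gA_def)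
    also have "\<dots> = ennreal (\<Prod>i\<in>A. g i (\<theta> i))"
      using g(3) by (subst prod_ennreal[symmetric]) (auto simp: gA_def)
    also have "\<dots> \<le> ennreal (exp (V \<theta>))"
    proof (rule ennreal_leI)
      have "(\<Prod>i\<in>A. g i (\<theta> i)) \<le> (\<Prod>i\<in>A. exp (ln (1 / \<tau>) + 2 * \<kappa> * exp (2 * U \<theta>)))"
      proof (rule prod_mono, intro conjI)
        fix i assume i: "i \<in> A"
        show "0 \<le> g i (\<theta> i)" by (rule g(3))
        have "\<bar>\<theta> i - c i\<bar> \<le> U \<theta>"
          unfolding U_def using i A(2) by (intro member_le_sum[of i ?P "\<lambda>i. \<bar>\<theta> i - \<theta>s i\<bar>", THEN order.trans[rotated]]) (auto simp: c_def)
        then have "exp (2 * \<bar>\<theta> i - c i\<bar>) \<le> exp (2 * U \<theta>)" by simp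
        moreover have "1 \<le> exp (2 * U \<theta>)" using U0[of \<theta>] by simp
        ultimately have "1 + exp (2 * \<bar>\<theta> i - c i\<bar>) \<le> 2 * exp (2 * U \<theta>)" by linarith
        then have "\<kappa> * (1 + exp (2 * \<bar>\<theta> i - c i\<bar>)) \<le> \<kappa> * (2 * exp (2 * U \<theta>))"
          using \<kappa>(1) by (rule mult_left_mono)
        then show "g i (\<theta> i) \<le> exp (ln (1 / \<tau>) + 2 * \<kappa> * exp (2 * U \<theta>))"
          by (intro order.trans[OF g(4)]) simp
      qed
      also have "\<dots> = exp (real s * (ln (1 / \<tau>) + 2 * \<kappa> * exp (2 * U \<theta>)))"
        using A(3) by (simp add: exp_of_nat_mult)
      also have "real s * (ln (1 / \<tau>) + 2 * \<kappa> * exp (2 * U \<theta>)) = V \<theta>" by (simp add: V_def algebra_simps)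
      finally show "(\<Prod>i\<in>A. g i (\<theta> i)) \<le> exp (V \<theta>)" .
    qed
    finally show ?thesis .
  qed
  define \<epsilon> where "\<epsilon> i = snd (D i) - f0 (fst (D i))" for i
  define E where "E = (\<Sum>i<n. \<bar>\<epsilon> i\<bar>)"
  have E: "0 \<le> E" "E \<le> 2 * \<sigma> * n\<^sup>2"
  proof -
    show "0 \<le> E" unfolding E_def by (intro sum_nonneg) simp
    have "\<bar>\<epsilon> i\<bar> \<le> 2 * \<sigma> * n" if i: "i < n" for i
    proof -
      have "(\<epsilon> i)\<^sup>2 \<le> (\<Sum>i<n. (\<epsilon> i)\<^sup>2)" using i by (intro member_le_sum) auto
      also have "\<dots> \<le> 4 * \<sigma>\<^sup>2 * n" using small by (simp add: \<epsilon>_def)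
      also have "\<dots> \<le> 4 * \<sigma>\<^sup>2 * (real n * real n)"
        using n by (intro mult_left_mono) auto
      also have "\<dots> = (2 * \<sigma> * n)\<^sup>2" by (simp add: power2_eq_square)
      finally show ?thesis using \<sigma> by (subst (asm) abs_le_square_iff[symmetric]) simp
    qed
    then have "E \<le> (\<Sum>i<n. 2 * \<sigma> * n)" unfolding E_def by (intro sum_mono) simp
    then show "E \<le> 2 * \<sigma> * n\<^sup>2" by (simp add: power2_eq_square mult_ac)
  qed
  define r where "r = a ^ L"
  define llr' where "llr' \<theta> = llr \<sigma> f0 n D (net ds \<theta>)" for \<theta>
  \<comment> \<open>Coefficients of the bound on \<open>- llr'\<close> as an affine function of
    \<open>exp (2 * U \<theta>) - 1\<close>: \<open>c1\<close> collects what is due to the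
    perturbation, \<open>c0\<close> the bias and the linear noise term.\<close>
  define c1 where "c1 = (2 * n * r\<^sup>2 + 2 * r * E) / (2 * \<sigma>\<^sup>2)"
  define c0 where "c0 = (2 * n * \<xi> + 2 * G) / (2 * \<sigma>\<^sup>2)"
  have r1: "r \<ge> 1" using aL by (simp add: r_def)
  have c1: "c1 \<ge> 0" unfolding c1_def using E(1) r1 by simp
  have llr_ge: "- llr' \<theta> \<le> c1 * (exp (2 * U \<theta>) - 1) + c0" for \<theta>
  proof -
    define e where "e = exp (2 * U \<theta>) - 1"
    define h where "h i = net ds \<theta>s (fst (D i)) - f0 (fst (D i))" for i
    define d where "d i = net ds \<theta> (fst (D i)) - net ds \<theta>s (fst (D i))" for i
    have eU: "exp (2 * U \<theta>) = exp (U \<theta>) * exp (U \<theta>)" by (simp flip: exp_add)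
    have u1: "exp (U \<theta>) \<ge> 1" using U0[of \<theta>] by simp
    then have "exp (U \<theta>) * 1 \<le> exp (U \<theta>) * exp (U \<theta>)" by (intro mult_left_mono) auto
    then have ue: "exp (U \<theta>) - 1 \<le> e" by (simp add: e_def eU)
    have ue2: "(exp (U \<theta>) - 1)\<^sup>2 \<le> e"
    proof -
      have "(x - 1)\<^sup>2 = x * x - 2 * x + 1" for x :: real by (simp add: power2_eq_square algebra_simps)
      then show ?thesis unfolding e_def eU using u1 by simp
    qed
    have d: "\<bar>d i\<bar> \<le> r * (exp (U \<theta>) - 1)" if i: "i < n" for i
      unfolding d_def r_def a U_def
    proof (rule net_perturbation[OF _ _ w _ len out])
      show "0 \<le> B" using B by simp
      show "\<And>q. q \<in> params ds \<Longrightarrow> \<bar>\<theta>s q\<bar> \<le> B" using \<theta>s by (auto simp: bounded_sparse_params_def)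
      show "\<And>j. j < ds ! 0 \<Longrightarrow> \<bar>fst (D i) j\<bar> \<le> 1"
        using cube[OF i] inp by (auto simp: cube_def PiE_iff abs_le_iff minus_le_iff)
    qed
    have each: "(snd (D i) - net ds \<theta> (fst (D i)))\<^sup>2 - (\<epsilon> i)\<^sup>2
        \<le> (2 * r\<^sup>2 * e + 2 * \<xi>) + (2 * r * e) * \<bar>\<epsilon> i\<bar> - 2 * (\<epsilon> i * h i)" if i: "i < n" for i
    proof -
      have "(snd (D i) - net ds \<theta> (fst (D i)))\<^sup>2 - (\<epsilon> i)\<^sup>2 = (d i + h i)\<^sup>2 - 2 * (\<epsilon> i * d i) - 2 * (\<epsilon> i * h i)"
        by (simp add: \<epsilon>_def d_def h_def power2_eq_square algebra_simps)
      moreover have "(d i + h i)\<^sup>2 \<le> 2 * r\<^sup>2 * e + 2 * \<xi>"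
      proof -
        have "0 \<le> (d i - h i)\<^sup>2" by simp
        then have "(d i + h i)\<^sup>2 \<le> 2 * (d i)\<^sup>2 + 2 * (h i)\<^sup>2" by (simp add: power2_eq_square algebra_simps)
        moreover have "(d i)\<^sup>2 \<le> r\<^sup>2 * e"
        proof -
          have "\<bar>d i\<bar>\<^sup>2 \<le> (r * (exp (U \<theta>) - 1))\<^sup>2" using d[OF i] by (intro power_mono) auto
          also have "\<dots> \<le> r\<^sup>2 * e" using ue2 by (simp add: power_mult_distrib mult_left_mono)
          finally show ?thesis by simp
        qed
        moreover have "(h i)\<^sup>2 \<le> \<xi>" unfolding h_def by (rule \<xi>[OF cube[OF i]])
        ultimately show ?thesis by linarith
      qed
      moreover have "- 2 * (\<epsilon> i * d i) \<le> (2 * r * e) * \<bar>\<epsilon> i\<bar>"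
      proof -
        have "- (\<epsilon> i * d i) \<le> \<bar>\<epsilon> i\<bar> * \<bar>d i\<bar>" by (simp flip: abs_mult)
        also have "\<dots> \<le> \<bar>\<epsilon> i\<bar> * (r * e)"
          using d[OF i] ue r1 by (intro mult_left_mono) (auto intro: order.trans mult_left_mono)
        finally show ?thesis by (simp add: mult_ac)
      qed
      ultimately show ?thesis by linarith
    qed
    have "- llr' \<theta> = (\<Sum>i<n. (snd (D i) - net ds \<theta> (fst (D i)))\<^sup>2 - (\<epsilon> i)\<^sup>2) / (2 * \<sigma>\<^sup>2)"
      by (simp add: llr'_def llr_def \<epsilon>_def sum_subtractf minus_divide_left)
    also have "\<dots> \<le> (\<Sum>i<n. (2 * r\<^sup>2 * e + 2 * \<xi>) + (2 * r * e) * \<bar>\<epsilon> i\<bar> - 2 * (\<epsilon> i * h i)) / (2 * \<sigma>\<^sup>2)"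
      using each by (intro divide_right_mono sum_mono) auto
    also have "(\<Sum>i<n. (2 * r\<^sup>2 * e + 2 * \<xi>) + (2 * r * e) * \<bar>\<epsilon> i\<bar> - 2 * (\<epsilon> i * h i))
        = n * (2 * r\<^sup>2 * e + 2 * \<xi>) + (2 * r * e) * E + 2 * (- (\<Sum>i<n. \<epsilon> i * h i))"
      by (simp add: sum.distrib sum_subtractf sum_distrib_left E_def)
    also have "\<dots> \<le> n * (2 * r\<^sup>2 * e + 2 * \<xi>) + (2 * r * e) * E + 2 * G"
      using G by (simp add: \<epsilon>_def h_def)
    also have "\<dots> = (2 * n * r\<^sup>2 + 2 * r * E) * e + (2 * n * \<xi> + 2 * G)" by (simp add: algebra_simps)
    finally have "- llr' \<theta> \<le> ((2 * n * r\<^sup>2 + 2 * r * E) * e + (2 * n * \<xi> + 2 * G)) / (2 * \<sigma>\<^sup>2)"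
      by (simp add: divide_right_mono)
    also have "\<dots> = c1 * e + c0"
    proof -
      have "(x * e + y) / z = x / z * e + y / z" for x y z :: real by (simp add: add_divide_distrib)
      then show ?thesis unfolding c1_def c0_def by blast
    qed
    finally show ?thesis by (simp only: e_def)
  qed
  let ?Z = "evidence ds s sl \<sigma> n D f0"
  have Z: "?Z > 0" by (rule evidence_pos[OF sl s(2) \<sigma> ds])
  define NS where "NS = real (card (supports ds s))"
  have NS: "NS \<ge> 1" "ln NS \<le> s * ln (card ?P)"
  proof -
    show NS1: "NS \<ge> 1" using \<gamma> finite_supports[of ds s] by (auto simp: NS_def Suc_le_eq card_gt_0_iff)
    have "NS \<le> real (card ?P) ^ s" using card_supports[OF s(2)] by (simp add: NS_def flip: of_nat_power)
    then have "ln NS \<le> ln (real (card ?P) ^ s)" using NS1 by (intro ln_mono) auto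
    then show "ln NS \<le> s * ln (card ?P)" using s by (simp add: ln_realpow)
  qed
  \<comment> \<open>The logarithms of four factors: the number of supports, the slab ratios, the
    evidence, and the inverse likelihood ratio.\<close>
  define u where "u \<theta> = (ln NS + real s * ln (1 / \<tau>) + ln ?Z + c0 - c1) + (2 * \<kappa> * s + c1) * exp (2 * U \<theta>)" for \<theta>
  have u_ge: "NS * exp (V \<theta>) \<le> exp (llr' \<theta>) / ?Z * exp (u \<theta>)" for \<theta>
  proof -
    have "ln NS + V \<theta> + ln ?Z - llr' \<theta> \<le> u \<theta>"
      using llr_ge[of \<theta>] by (simp add: u_def V_def algebra_simps)
    then have "exp (ln NS + V \<theta>) \<le> exp (llr' \<theta> - ln ?Z + u \<theta>)" by simp
    then show ?thesis using NS(1) Z by (simp add: exp_add exp_diff)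
  qed
  have um: "u \<in> borel_measurable (par_space ds)" unfolding u_def[abs_def] using Um by measurable
  have um_post: "u \<in> borel_measurable ?post"
    using um sets_posterior[OF sl s(2) \<sigma> ds] by (simp cong: measurable_cong_sets)
  have Vm: "V \<in> borel_measurable (par_space ds)" unfolding V_def[abs_def] using Um by measurable
  have dom: "emeasure q X \<le> (\<integral>\<^sup>+\<theta>\<in>X. ennreal (exp (u \<theta>)) \<partial>?post)" if "X \<in> sets ?post" for X
  proof -
    have X: "X \<in> sets (par_space ds)" using that sets_posterior[OF sl s(2) \<sigma> ds] by simp
    have gm: "(\<lambda>\<theta>. \<Prod>i\<in>?P. gA i (\<theta> i)) \<in> borel_measurable (spike_slab_prod ds sl \<gamma>)"
    proof -
      have "(\<lambda>\<theta>. \<Prod>i\<in>?P. gA i (\<theta> i)) \<in> borel_measurable (par_space ds)"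
        using gAm by (intro borel_measurable_prod_ennreal measurable_compose[OF measurable_component_singleton]) auto
      then show ?thesis using sets_spike_slab_prod by (simp cong: measurable_cong_sets)
    qed
    have fm: "(\<lambda>\<theta>. ennreal (exp (V \<theta>)) * indicator X \<theta>) \<in> borel_measurable (par_space ds)"
      using Vm X by measurable
    have "emeasure q X = (\<integral>\<^sup>+\<theta>. (\<Prod>i\<in>?P. gA i (\<theta> i)) * indicator X \<theta> \<partial>spike_slab_prod ds sl \<gamma>)"
      unfolding qd using gm X by (intro emeasure_density) (auto simp: sets_spike_slab_prod)
    also have "\<dots> \<le> (\<integral>\<^sup>+\<theta>. ennreal (exp (V \<theta>)) * indicator X \<theta> \<partial>spike_slab_prod ds sl \<gamma>)"
      using gV by (intro nn_integral_mono mult_right_mono) auto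
    also have "\<dots> \<le> of_nat (card (supports ds s)) * (\<integral>\<^sup>+\<theta>. ennreal (exp (V \<theta>)) * indicator X \<theta> \<partial>prior ds s sl)"
      by (rule nn_integral_spike_slab_prod_le[OF sl s(2) fm \<gamma>])
    also have "\<dots> = (\<integral>\<^sup>+\<theta>. ennreal NS * (ennreal (exp (V \<theta>)) * indicator X \<theta>) \<partial>prior ds s sl)"
      using fm sets_prior[OF sl s(2)]
      by (subst nn_integral_cmult) (auto simp: NS_def ennreal_of_nat_eq_real_of_nat cong: measurable_cong_sets)
    also have "\<dots> \<le> (\<integral>\<^sup>+\<theta>. ennreal (exp (llr' \<theta>) / ?Z) * (ennreal (exp (u \<theta>)) * indicator X \<theta>) \<partial>prior ds s sl)"
    proof (rule nn_integral_mono)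
      fix \<theta>
      have "ennreal NS * ennreal (exp (V \<theta>)) \<le> ennreal (exp (llr' \<theta>) / ?Z) * ennreal (exp (u \<theta>))"
        using u_ge[of \<theta>] NS(1) Z by (simp add: ennreal_leI flip: ennreal_mult)
      then show "ennreal NS * (ennreal (exp (V \<theta>)) * indicator X \<theta>)
          \<le> ennreal (exp (llr' \<theta>) / ?Z) * (ennreal (exp (u \<theta>)) * indicator X \<theta>)"
        by (simp add: mult.assoc[symmetric] mult_right_mono)
    qed
    also have "\<dots> = (\<integral>\<^sup>+\<theta>\<in>X. ennreal (exp (u \<theta>)) \<partial>?post)"
      unfolding llr'_def using um X
      by (subst nn_integral_posterior[OF sl s(2) \<sigma> ds, where ?f0.0 = f0]) auto
    finally show ?thesis .
  qed
  have expU: "(\<integral>\<^sup>+\<theta>. ennreal (exp (2 * U \<theta>)) \<partial>q) \<le> ennreal ((1 + 15 * \<tau>) ^ s)"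
  proof -
    interpret Q: product_sigma_finite Q
      unfolding product_sigma_finite_def using Qprob prob_space_imp_sigma_finite by blast
    have "(\<integral>\<^sup>+\<theta>. ennreal (exp (2 * U \<theta>)) \<partial>q) = (\<integral>\<^sup>+\<theta>. (\<Prod>i\<in>?P. ennreal (exp (2 * \<bar>\<theta> i - \<theta>s i\<bar>))) \<partial>q)"
      by (simp add: U_def sum_distrib_left exp_sum prod_ennreal)
    also have "\<dots> = (\<Prod>i\<in>?P. \<integral>\<^sup>+t. ennreal (exp (2 * \<bar>t - \<theta>s i\<bar>)) \<partial>Q i)"
      unfolding q_def using Qsets
      by (intro Q.product_nn_integral_prod) (auto cong: measurable_cong_sets)
    also have "\<dots> \<le> (\<Prod>i\<in>?P. if i \<in> A then ennreal (1 + 15 * \<tau>) else 1)"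
    proof -
      have le: "(\<integral>\<^sup>+t. ennreal (exp (2 * \<bar>t - \<theta>s i\<bar>)) \<partial>Q i) \<le> (if i \<in> A then ennreal (1 + 15 * \<tau>) else 1)"
        if i: "i \<in> ?P" for i
      proof (cases "i \<in> A")
        case True
        then show ?thesis using S[of i] i by (simp add: narrow_slab_def Q_def spike_slab_def c_def)
      next
        case False
        then have "\<theta>s i = 0" using A(1) i by auto
        then show ?thesis using False by (simp add: Q_def spike_slab_def nn_integral_return)
      qed
      have "(\<Prod>i\<in>I. \<integral>\<^sup>+t. ennreal (exp (2 * \<bar>t - \<theta>s i\<bar>)) \<partial>Q i)
          \<le> (\<Prod>i\<in>I. if i \<in> A then ennreal (1 + 15 * \<tau>) else 1)" if "finite I" "I \<subseteq> ?P" for I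
        using that
      proof (induction I rule: finite_induct)
        case (insert i I)
        then show ?case unfolding prod.insert[OF insert.hyps] by (intro mult_mono le) auto
      qed simp
      then show ?thesis by simp
    qed
    also have "\<dots> = (\<Prod>i\<in>A. ennreal (1 + 15 * \<tau>))"
      using A(2) by (intro prod.mono_neutral_cong_right) auto
    also have "\<dots> = ennreal ((1 + 15 * \<tau>) ^ s)"
      unfolding prod_constant A(3) using \<tau>0 by (intro ennreal_power) simp
    finally show ?thesis .
  qed
  define T where "T = (\<integral>\<theta>. exp (2 * U \<theta>) \<partial>q)"
  have Umq: "(\<lambda>\<theta>. exp (2 * U \<theta>)) \<in> borel_measurable q"
    using Um qsets by (simp cong: measurable_cong_sets)
  have Uint: "integrable q (\<lambda>\<theta>. exp (2 * U \<theta>))"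
    using Umq expU by (intro integrableI_nonneg) (auto simp: order.strict_trans1)
  have T: "T \<le> 1 + 1 / (n\<^sup>2 * r\<^sup>2)"
  proof -
    have "ennreal T \<le> ennreal ((1 + 15 * \<tau>) ^ s)"
      using expU nn_integral_eq_integral[OF Uint] by (simp add: T_def)
    then have "T \<le> (1 + 15 * \<tau>) ^ s" using \<tau>0 by (subst (asm) ennreal_le_iff) auto
    also have "\<dots> \<le> exp (15 * \<tau>) ^ s" using \<tau>0 by (intro power_mono exp_ge_add_one_self) auto
    also have "\<dots> = exp (s * (15 * \<tau>))" by (simp add: exp_of_nat_mult)
    finally have 1: "T - 1 \<le> exp (s * (15 * \<tau>)) - 1" by simp
    \<comment> \<open>The 30 in \<open>\<tau>\<close> is twice the 15 of the narrow slabs: with the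
      exponent \<open>1 / (2 * (n\<^sup>2 * r\<^sup>2))\<close> the excess \<open>T - 1\<close> is
      at most \<open>1 / (n\<^sup>2 * r\<^sup>2)\<close>, which keeps \<open>c1 * (T - 1)\<close>
      bounded.\<close>
    have e: "s * (15 * \<tau>) = 1 / (2 * (n\<^sup>2 * r\<^sup>2))"
    proof -
      have "r\<^sup>2 = a ^ (2 * L)" by (simp add: r_def power_even_eq)
      then show ?thesis using sn by (simp add: \<tau> field_simps)
    qed
    have nr: "real (n\<^sup>2) * r\<^sup>2 \<ge> 1"
      using sn(3) r1 mult_mono[of 1 "(real n)\<^sup>2" 1 "r\<^sup>2"] by (simp add: one_le_power)
    have "exp (s * (15 * \<tau>)) - 1 \<le> 2 * (s * (15 * \<tau>))"
    proof (rule exp_minus_one_le)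
      show "0 \<le> s * (15 * \<tau>)" using \<tau>0 by simp
      show "s * (15 * \<tau>) \<le> 1"
        unfolding e using nr by (subst divide_le_eq_1_pos) linarith+
    qed
    then show ?thesis using 1 unfolding e by simp
  qed
  have nr1: "real (n\<^sup>2) * r\<^sup>2 \<ge> 1"
    using sn(3) r1 mult_mono[of 1 "(real n)\<^sup>2" 1 "r\<^sup>2"] by (simp add: one_le_power)
  have uint: "integrable q u" unfolding u_def using Uint by simp
  have "(\<integral>\<theta>. u \<theta> \<partial>q) = (ln NS + real s * ln (1 / \<tau>) + ln ?Z + c0 - c1) + (2 * \<kappa> * s + c1) * T"
    unfolding u_def T_def using Uint by (simp add: q.prob_space)
  also have "\<dots> = ln NS + real s * ln (1 / \<tau>) + ln ?Z + c0 + 2 * \<kappa> * s * T + c1 * (T - 1)"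
    by (simp add: algebra_simps)
  also have "\<dots> \<le> s * ln (card ?P) + real s * ln (1 / \<tau>) + ln ?Z + c0 + 2 * \<kappa> * s * 2 + (2 + 4 * \<sigma>) / (2 * \<sigma>\<^sup>2)"
  proof -
    have "1 / (real (n\<^sup>2) * r\<^sup>2) \<le> 1" using nr1 by simp
    then have "T \<le> 2" using T by simp
    then have "2 * \<kappa> * s * T \<le> 2 * \<kappa> * s * 2" using \<kappa>(1) by (intro mult_left_mono) auto
    moreover have "c1 * (T - 1) \<le> (2 + 4 * \<sigma>) / (2 * \<sigma>\<^sup>2)"
    proof -
      have "c1 * (T - 1) \<le> c1 * (1 / (n\<^sup>2 * r\<^sup>2))" using T c1 by (intro mult_left_mono) auto
      also have "\<dots> = (2 * n * r\<^sup>2 + 2 * r * E) / (n\<^sup>2 * r\<^sup>2) / (2 * \<sigma>\<^sup>2)" by (simp add: c1_def)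
      also have "\<dots> \<le> (2 + 4 * \<sigma>) / (2 * \<sigma>\<^sup>2)"
      proof (rule divide_right_mono)
        have "2 * n * r\<^sup>2 \<le> 2 * (n\<^sup>2 * r\<^sup>2)"
        proof -
          have "real n * 1 \<le> real n * real n" using n by (intro mult_left_mono) auto
          then have "real n * r\<^sup>2 \<le> real (n\<^sup>2) * r\<^sup>2"
            by (intro mult_right_mono) (simp_all add: power2_eq_square)
          then show ?thesis by simp
        qed
        moreover have "2 * r * E \<le> 2 * r\<^sup>2 * (2 * \<sigma> * n\<^sup>2)"
          using E r1 \<sigma> by (intro mult_mono) (auto simp: power2_eq_square)
        ultimately have "2 * n * r\<^sup>2 + 2 * r * E \<le> (2 + 4 * \<sigma>) * (n\<^sup>2 * r\<^sup>2)" by (simp add: algebra_simps)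
        then show "(2 * n * r\<^sup>2 + 2 * r * E) / (n\<^sup>2 * r\<^sup>2) \<le> 2 + 4 * \<sigma>"
          using nr1 by (simp add: divide_le_eq)
      qed simp
      finally show ?thesis .
    qed
    ultimately show ?thesis using NS(2) by linarith
  qed
  also have "\<dots> = (s * ln (card ?P) + s * ln (1 / \<tau>) + 4 * \<kappa> * s
      + (2 + 4 * \<sigma> + 2 * n * \<xi> + 2 * G) / (2 * \<sigma>\<^sup>2)) + ln ?Z"
    by (simp add: c0_def add_divide_distrib)
  finally have le: "(\<integral>\<theta>. u \<theta> \<partial>q) \<le> \<dots>" .
  have "kl q ?post \<le> ereal (\<integral>\<theta>. u \<theta> \<partial>q)"
    by (rule kl_le_integral[OF prob_space_posterior[OF sl s(2) \<sigma> ds] qprob _ um_post uint dom])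
      (simp_all add: qsets sets_posterior[OF sl s(2) \<sigma> ds])
  then show ?thesis using qfam le by (intro bexI[of _ q]) (auto intro: order.trans)
qed

text \<open>On the sieve the inequality of the cover event is doubled. Off the sieve the log
  likelihood ratio is at most \<open>2 * n\<close> by the noise energy, and \<open>2 * n\<close>
  times the loss is at most \<open>2 * n\<close>, so the prior mass there has to outweigh
  \<open>exp (4 * n)\<close>. The exceptional probabilities are \<open>3 * exp (- t)\<close> for the
  data and \<open>exp (- t)\<close> for the cover.\<close>

lemma hellinger_event:
  fixes f0 :: "(nat \<Rightarrow> real) \<Rightarrow> real" and \<delta> :: real
  assumes f0: "f0 \<in> borel_measurable (\<Pi>\<^sub>M i\<in>{..<p}. borel)"
    and F: "\<And>x. x \<in> cube p \<Longrightarrow> \<bar>f0 x\<bar> \<le> F" "F \<ge> 0"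
    and sl: "valid_slab sl B" and B: "B > 0" and \<kappa>: "\<kappa> \<ge> 0"
    "\<And>c \<tau>. 0 < \<tau> \<Longrightarrow> \<tau> \<le> 1 \<Longrightarrow> \<bar>c\<bar> \<le> B \<Longrightarrow> \<exists>S. narrow_slab sl \<kappa> c \<tau> S"
    and len: "length ds = L + 1" "L \<ge> 1" and out: "ds ! L = 1" and inp: "ds ! 0 = p"
    and w: "\<And>l. l < length ds \<Longrightarrow> ds ! l \<le> w"
    and s: "1 \<le> s" "s \<le> card (params ds)" and \<theta>s: "\<theta>s \<in> bounded_sparse_params ds s B"
    and \<sigma>: "\<sigma> > 0" and n: "n \<ge> 1"
    and a: "a = 1 + B * real ((w + 1)\<^sup>2)" and \<tau>: "\<tau> = 1 / (30 * s * n\<^sup>2 * a ^ (2 * L))"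
    and \<xi>: "\<And>x. x \<in> cube p \<Longrightarrow> (net ds \<theta>s x - f0 x)\<^sup>2 \<le> \<xi>" "\<xi> \<ge> 0"
    and R: "R \<ge> 0" and K: "K = F + 2 * \<sigma> * n"
    and cover: "clip_cover ds p K \<eta> \<beta> (sieve ds s R) N" and N: "N \<ge> 1"
    and \<eta>: "0 < \<eta>" "\<eta> * (n * K) \<le> \<sigma>\<^sup>2" "\<eta> * n \<le> \<sigma>" and \<beta>: "\<beta> * n \<le> 1"
    and tail: "emeasure (slab_law sl) {t. R < \<bar>t\<bar>} \<le> ennreal \<delta>" "\<delta> \<ge> 0" "exp (4 * real n) * (real s * \<delta>) \<le> 1"
    and t: "0 \<le> t" "2 * t \<le> n"
    and W: "W = s * ln (card (params ds)) + s * ln (1 / \<tau>) + 4 * \<kappa> * s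
      + (2 + 4 * \<sigma> + 2 * n * \<xi> + 2 * (n * (\<sigma>\<^sup>2 * \<xi> / 2) + t)) / (2 * \<sigma>\<^sup>2)"
  shows "\<exists>E \<in> sets (data_law p \<sigma> f0 n). 1 - 4 * exp (- t) \<le> measure (data_law p \<sigma> f0 n) E \<and>
    (\<forall>D\<in>E. \<forall>q. is_variational_posterior ds s sl \<sigma> n D q \<longrightarrow>
      2 * real n * (\<integral>\<theta>. hellinger_sq p \<sigma> (net ds \<theta>) f0 \<partial>q) \<le> W + 2 * (ln N + t + 6) + ln 2)"
proof -
  let ?P = "data_law p \<sigma> f0 n"
  interpret P: prob_space ?P by (rule prob_space_data_law[OF f0 \<sigma>])
  have ds: "length ds \<ge> 2" "0 < ds ! (length ds - 1)" using len out by auto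
  define g where "g x = net ds \<theta>s x - f0 x" for x
  have gm: "g \<in> borel_measurable (\<Pi>\<^sub>M i\<in>{..<p}. borel)"
    unfolding g_def[abs_def] using net_measurable_input[OF ds(1), of \<theta>s] f0 inp by (intro borel_measurable_diff) auto
  obtain E1 where E1: "E1 \<in> sets ?P" "1 - 3 * exp (- t) \<le> measure ?P E1"
    and D1: "\<And>D. D \<in> E1 \<Longrightarrow> (\<forall>i<n. fst (D i) \<in> cube p) \<and> (\<Sum>i<n. (snd (D i) - f0 (fst (D i)))\<^sup>2) \<le> 4 * \<sigma>\<^sup>2 * n \<and>
      - (\<Sum>i<n. (snd (D i) - f0 (fst (D i))) * g (fst (D i))) \<le> n * (\<sigma>\<^sup>2 * \<xi> / 2) + t"
    using data_event[OF f0 \<sigma> gm _ t, of \<xi>] \<xi>(1) unfolding g_def by blast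
  obtain E2 where E2: "E2 \<in> sets ?P" "1 - exp (- t) \<le> measure ?P E2"
    and D2: "\<And>D. D \<in> E2 \<Longrightarrow> (\<forall>i<n. fst (D i) \<in> cube p) \<Longrightarrow> (\<Sum>i<n. (snd (D i) - f0 (fst (D i)))\<^sup>2) \<le> 4 * \<sigma>\<^sup>2 * n \<Longrightarrow>
      (\<forall>\<theta>\<in>sieve ds s R. llr \<sigma> f0 n D (net ds \<theta>) / 2 + real n * hellinger_sq p \<sigma> (net ds \<theta>) f0 \<le> ln N + t + 6)"
    using cover_event[OF f0 \<sigma> F ds(1) inp n K cover _ \<eta> \<beta>, of t] N by (meson less_le_trans zero_less_one)
  have E: "E1 \<inter> E2 \<in> sets ?P" using E1(1) E2(1) by blast
  have PE: "1 - 4 * exp (- t) \<le> measure ?P (E1 \<inter> E2)"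
  proof -
    have "measure ?P (space ?P - (E1 \<inter> E2)) \<le> measure ?P (space ?P - E1) + measure ?P (space ?P - E2)"
      unfolding Diff_Int using E1(1) E2(1) by (intro measure_Un_le) auto
    then show ?thesis
      using P.prob_compl[OF E] P.prob_compl[OF E1(1)] P.prob_compl[OF E2(1)] E1(2) E2(2) by simp
  qed
  define H where "H = card (params ds)"
  have H1: "1 \<le> H" using s by (simp add: H_def)
  have "2 * real n * (\<integral>\<theta>. hellinger_sq p \<sigma> (net ds \<theta>) f0 \<partial>q) \<le> W + 2 * (ln N + t + 6) + ln 2"
    if D: "D \<in> E1 \<inter> E2" and q: "is_variational_posterior ds s sl \<sigma> n D q" for D q
  proof -
    define V where "V = ln N + t + 6"
    have V0: "V \<ge> 0" using N t by (simp add: V_def)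
    have cube: "\<And>i. i < n \<Longrightarrow> fst (D i) \<in> cube p" and small: "(\<Sum>i<n. (snd (D i) - f0 (fst (D i)))\<^sup>2) \<le> 4 * \<sigma>\<^sup>2 * n"
      and lin: "- (\<Sum>i<n. (snd (D i) - f0 (fst (D i))) * (net ds \<theta>s (fst (D i)) - f0 (fst (D i))))
        \<le> n * (\<sigma>\<^sup>2 * \<xi> / 2) + t"
      using D1[of D] D unfolding g_def by auto
    have onsieve: "llr \<sigma> f0 n D (net ds \<theta>) / 2 + real n * hellinger_sq p \<sigma> (net ds \<theta>) f0 \<le> V"
      if "\<theta> \<in> sieve ds s R" for \<theta>
      using D2[of D] D cube small that unfolding V_def by blast
    obtain q' where q': "q' \<in> variational_family ds sl"
      "kl q' (posterior ds s sl \<sigma> n D) \<le> ereal (W + ln (evidence ds s sl \<sigma> n D f0))"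
      using variational_competitor[OF sl B \<kappa> len out inp w s \<theta>s \<sigma> n a \<tau> cube small \<xi>(1) lin] unfolding W by blast
    have qfam: "q \<in> variational_family ds sl"
      and "\<not> (kl q' (posterior ds s sl \<sigma> n D) < kl q (posterior ds s sl \<sigma> n D))"
      using q q'(1) by (auto simp: is_variational_posterior_def is_arg_min_def)
    then have kl: "kl q (posterior ds s sl \<sigma> n D) \<le> ereal (W + ln (evidence ds s sl \<sigma> n D f0))"
      using q'(2) by (meson not_less order.trans)
    have W0: "W \<ge> 0"
    proof -
      have "a \<ge> 1" using B by (simp add: a)
      then have "1 \<le> 30 * real s * (real n)\<^sup>2 * a ^ (2 * L)"
        using mult_mono[of 1 "30 * real s * (real n)\<^sup>2" 1 "a ^ (2 * L)"] mult_mono[of 1 "30 * real s" 1 "(real n)\<^sup>2"] s n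
        by (simp add: one_le_power)
      then have "ln (1 / \<tau>) \<ge> 0" by (simp add: \<tau>)
      then show ?thesis unfolding W using \<kappa>(1) \<sigma> \<xi>(2) t H1 by (simp add: H_def)
    qed
    have "(\<integral>\<theta>. 2 * real n * hellinger_sq p \<sigma> (net ds \<theta>) f0 \<partial>q) \<le> W + ln (exp (2 * V) + exp (4 * real n) * (real s * \<delta>))"
    proof (rule posterior_integral_bound[OF sl s(2) \<sigma> ds variational_family_sets(2,1)[OF qfam] kl,
          where X = "large_params ds R" and b = "2 * real n" and \<delta> = "real s * \<delta>"])
      show "0 \<le> 2 * real n * hellinger_sq p \<sigma> (net ds \<theta>) f0" for \<theta>
        using hellinger_sq_bounds(1) by simp
      show "2 * real n * hellinger_sq p \<sigma> (net ds \<theta>) f0 \<le> 2 * real n" for \<theta>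
        using mult_left_mono[OF hellinger_sq_bounds(2), of "2 * real n"] by simp
      show "large_params ds R \<in> sets (par_space ds)" by (rule large_params_measurable[OF sl s(2)])
      show "emeasure (prior ds s sl) (large_params ds R) \<le> ennreal (real s * \<delta>)"
        by (rule emeasure_prior_large_params[OF sl s(2) R tail(1,2)])
      show "AE \<theta> in prior ds s sl. exp (2 * real n * hellinger_sq p \<sigma> (net ds \<theta>) f0 + llr \<sigma> f0 n D (net ds \<theta>))
          \<le> exp (2 * V) + exp (4 * real n) * indicator (large_params ds R) \<theta>"
        using AE_prior_sparse[OF sl s(2)] AE_space
      proof eventually_elim
        case (elim \<theta>)
        have sp: "\<theta> \<in> space (par_space ds)"
          using elim(2) sets_eq_imp_space_eq[OF sets_prior[OF sl s(2)]] by simp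
        show ?case
        proof (cases "\<theta> \<in> large_params ds R")
          case True
          have "llr \<sigma> f0 n D (net ds \<theta>) \<le> (4 * \<sigma>\<^sup>2 * n) / (2 * \<sigma>\<^sup>2)"
            using small by (intro order.trans[OF llr_le] divide_right_mono) auto
          then have "llr \<sigma> f0 n D (net ds \<theta>) \<le> 2 * real n" using \<sigma> by simp
          moreover have "2 * real n * hellinger_sq p \<sigma> (net ds \<theta>) f0 \<le> 2 * real n"
            using mult_left_mono[OF hellinger_sq_bounds(2), of "2 * real n"] by simp
          ultimately have "exp (2 * real n * hellinger_sq p \<sigma> (net ds \<theta>) f0 + llr \<sigma> f0 n D (net ds \<theta>)) \<le> exp (4 * real n)"
            by simp
          then show ?thesis using True by (simp add: add_increasing)
        next
          case False
          then have "\<theta> \<in> sieve ds s R"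
            using elim(1) sp by (auto simp: sieve_def large_params_def[OF sl s(2)] not_less)
          from onsieve[OF this] show ?thesis using False by simp
        qed
      qed
      have "ln (exp (2 * V) + exp (4 * real n) * (real s * \<delta>)) \<ge> ln (exp (2 * V))"
        using tail(2) by (intro ln_mono) (auto intro: add_pos_nonneg)
      then show "0 \<le> W + ln (exp (2 * V) + exp (4 * real n) * (real s * \<delta>))" using W0 V0 by simp
    qed (use tail(2) in auto)
    \<comment> \<open>The contribution off the sieve is at most 1, hence at most
      \<open>exp (2 * V)\<close>, and costs only the summand \<open>ln 2\<close>.\<close>
    also have "ln (exp (2 * V) + exp (4 * real n) * (real s * \<delta>)) \<le> ln (2 * exp (2 * V))"
    proof (rule ln_mono)
      have "1 \<le> exp (2 * V)" using V0 by simp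
      then show "exp (2 * V) + exp (4 * real n) * (real s * \<delta>) \<le> 2 * exp (2 * V)" using tail(3) by linarith
    qed (use tail(2) in \<open>auto intro: add_pos_nonneg\<close>)
    also have "\<dots> = ln 2 + 2 * V" by (simp add: ln_mult)
    finally show ?thesis unfolding V_def by simp
  qed
  then show ?thesis using E PE by blast
qed

section \<open>Prior mass of large parameters\<close>

lemma uniform_slab_tail:
  assumes "B0 > 1"
  shows "emeasure (slab_law (Uniform_slab B0)) {t. B0 < \<bar>t\<bar>} \<le> ennreal 0"
proof -
  have "{t::real. B0 < \<bar>t\<bar>} \<in> sets borel" by measurable
  moreover have "{- B0..B0} \<inter> {t. B0 < \<bar>t\<bar>} = {}" by auto
  ultimately show ?thesis using assms by (simp add: uniform_law_def emeasure_uniform_measure)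
qed

text \<open>Markov's inequality for \<open>exp (t\<^sup>2 / (4 * \<sigma>0\<^sup>2))\<close>, which
  has mean \<open>sqrt 2\<close>.\<close>

lemma normal_slab_tail:
  assumes "\<sigma>0 > 0" "R \<ge> 0"
  shows "emeasure (slab_law (Normal_slab \<sigma>0)) {t. R < \<bar>t\<bar>} \<le> ennreal (sqrt 2 * exp (- (R\<^sup>2 / (4 * \<sigma>0\<^sup>2))))"
proof -
  have [measurable]: "{t::real. R < \<bar>t\<bar>} \<in> sets borel" by measurable
  have "emeasure (normal_law 0 \<sigma>0) {t. R < \<bar>t\<bar>} = (\<integral>\<^sup>+t. indicator {t. R < \<bar>t\<bar>} t \<partial>normal_law 0 \<sigma>0)"
    by simp
  also have "\<dots> \<le> (\<integral>\<^sup>+t. ennreal (exp (- (R\<^sup>2 / (4 * \<sigma>0\<^sup>2)))) * ennreal (exp (t\<^sup>2 / (4 * \<sigma>0\<^sup>2))) \<partial>normal_law 0 \<sigma>0)"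
  proof (rule nn_integral_mono)
    fix t
    show "indicator {t. R < \<bar>t\<bar>} t \<le> ennreal (exp (- (R\<^sup>2 / (4 * \<sigma>0\<^sup>2)))) * ennreal (exp (t\<^sup>2 / (4 * \<sigma>0\<^sup>2)))"
    proof (cases "R < \<bar>t\<bar>")
      case True
      then have "R\<^sup>2 \<le> t\<^sup>2" using assms by (simp add: abs_le_square_iff[symmetric])
      then have "0 \<le> - (R\<^sup>2 / (4 * \<sigma>0\<^sup>2)) + t\<^sup>2 / (4 * \<sigma>0\<^sup>2)" by (simp add: divide_right_mono)
      then have "1 \<le> exp (- (R\<^sup>2 / (4 * \<sigma>0\<^sup>2)) + t\<^sup>2 / (4 * \<sigma>0\<^sup>2))" by simp
      then have "ennreal 1 \<le> ennreal (exp (- (R\<^sup>2 / (4 * \<sigma>0\<^sup>2))) * exp (t\<^sup>2 / (4 * \<sigma>0\<^sup>2)))"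
        unfolding exp_add by (rule ennreal_leI)
      then show ?thesis using True by (simp add: ennreal_mult)
    qed simp
  qed
  also have "\<dots> = ennreal (exp (- (R\<^sup>2 / (4 * \<sigma>0\<^sup>2)))) * ennreal (sqrt 2)"
    using gaussian_exp_square[OF assms(1)] by (subst nn_integral_cmult) auto
  finally show ?thesis by (simp add: mult.commute flip: ennreal_mult)
qed

subsection \<open>Covers of the sieve under either slab\<close>

text \<open>Everything is compared with powers of \<open>y = 12 * B * p * N\<close>, which is at
  least 12: \<open>w \<le> y\<close> and
  \<open>(w + 1)\<^sup>2 \<le> 4 * y\<^sup>2 \<le> y ^ 3\<close>, and a further factor
  \<open>B\<close> or summand 1 raises the power to 4 at most. Its logarithm \<open>\<rho>\<close>
  stays at least 1 even for \<open>p = N = 1\<close>, where \<open>ln (p * N)\<close>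
  vanishes.\<close>

lemma log_rate_bounds:
  fixes p N L s :: nat and B \<rho> :: real
  assumes p: "p \<ge> 1" and N: "N \<ge> 1" and L: "L \<ge> 1" and B: "B \<ge> 1"
    and w: "w = 12 * p * N" and H: "H \<le> L * (w + 1)\<^sup>2" and s: "1 \<le> s" "s \<le> H"
    and \<rho>: "\<rho> = ln (12 * B * real p * real N)"
  shows "\<rho> \<ge> 1" "L * \<rho> \<ge> 1" "ln H \<le> ln L + 3 * \<rho>" "ln H \<le> 4 * (L * \<rho>)" "ln s \<le> ln H"
    "ln (1 + B * real ((w + 1)\<^sup>2)) \<le> 4 * \<rho>" "ln (1 + real ((w + 1)\<^sup>2)) \<le> 4 * \<rho>"
proof -
  define y where "y = 12 * B * real p * real N"
  have pN: "real p * real N \<ge> 1" using p N by (metis mult_mono' mult_1 of_nat_1 of_nat_mono zero_le_one)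
  have wy: "real w \<le> y" "B \<le> y" "12 \<le> y"
  proof -
    have "1 * (real p * real N) \<le> B * (real p * real N)" using B pN by (intro mult_right_mono) auto
    then show "real w \<le> y" by (simp add: w y_def mult_ac)
    have *: "B * 1 \<le> B * (real p * real N)" using B pN by (intro mult_left_mono) auto
    moreover have "1 \<le> B * (real p * real N)" using * B by linarith
    ultimately show "B \<le> y" "12 \<le> y" using B by (simp_all add: y_def mult_ac)
  qed
  have "exp 1 \<le> (3::real)" using e_less_272 by simp
  then have "exp 1 \<le> y" using wy(3) by linarith
  then show l1: "\<rho> \<ge> 1" using wy(3) by (simp add: \<rho> y_def[symmetric] ln_ge_iff)
  have L1: "real L \<ge> 1" using L by simp
  show Ll: "L * \<rho> \<ge> 1" using mult_mono[of 1 "real L" 1 \<rho>] L1 l1 by simp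
  have ly: "ln (y ^ k) = k * \<rho>" for k using wy(3) by (simp add: ln_realpow \<rho> y_def[symmetric])
  have w1: "real ((w + 1)\<^sup>2) \<le> 4 * y\<^sup>2"
  proof -
    have "(real w + 1)\<^sup>2 \<le> (2 * y)\<^sup>2" using wy by (intro power_mono) auto
    then show ?thesis by (simp add: power_mult_distrib add.commute)
  qed
  have y4: "1 + 4 * y ^ 3 \<le> y ^ 4"
  proof -
    have "1 \<le> y ^ 3" using wy(3) by (intro one_le_power) simp
    moreover have "12 * y ^ 3 \<le> y * y ^ 3" using wy(3) by (intro mult_right_mono) auto
    moreover have "y * y ^ 3 = y ^ 4" by (simp add: numeral_eq_Suc)
    ultimately show ?thesis by linarith
  qed
  have y23: "4 * y\<^sup>2 \<le> y ^ 3"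
  proof -
    have "4 * y\<^sup>2 \<le> y * y\<^sup>2" using wy(3) by (intro mult_right_mono) auto
    then show ?thesis by (simp add: numeral_eq_Suc)
  qed
  have Hy: "real H \<le> L * y ^ 3"
  proof -
    have "real H \<le> real (L * (w + 1)\<^sup>2)" using H by (rule of_nat_mono)
    also have "\<dots> \<le> L * (4 * y\<^sup>2)" using w1 by (simp add: mult_left_mono)
    also have "\<dots> \<le> L * y ^ 3" using y23 by (intro mult_left_mono) auto
    finally show ?thesis .
  qed
  have H1: "real H \<ge> 1" using s by simp
  show lH: "ln H \<le> ln L + 3 * \<rho>"
  proof -
    have "ln (real H) \<le> ln (L * y ^ 3)" using Hy H1 by (intro ln_mono) auto
    also have "\<dots> = ln L + ln (y ^ 3)" using L1 wy(3) by (intro ln_mult_pos) auto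
    finally show ?thesis using ly[of 3] by simp
  qed
  have "ln (real L) \<le> L" using ln_le_minus_one[of "real L"] L1 by simp
  also have "real L * 1 \<le> L * \<rho>" using l1 by (intro mult_left_mono) auto
  finally have "ln L \<le> L * \<rho>" by simp
  moreover have "1 * \<rho> \<le> L * \<rho>" using L1 l1 by (intro mult_right_mono) auto
  ultimately show "ln H \<le> 4 * (L * \<rho>)" using lH by simp
  show "ln s \<le> ln H" using s by (intro ln_mono) auto
  have "1 + B * real ((w + 1)\<^sup>2) \<le> y ^ 4"
  proof -
    have "B * real ((w + 1)\<^sup>2) \<le> y * (4 * y\<^sup>2)" using wy w1 by (intro mult_mono) auto
    also have "\<dots> = 4 * y ^ 3" by (simp add: numeral_eq_Suc)
    finally show ?thesis using y4 by simp
  qed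
  then have "ln (1 + B * real ((w + 1)\<^sup>2)) \<le> ln (y ^ 4)" using B by (intro ln_mono) (auto intro: add_pos_nonneg)
  then show "ln (1 + B * real ((w + 1)\<^sup>2)) \<le> 4 * \<rho>" using ly[of 4] by simp
  have "1 + real ((w + 1)\<^sup>2) \<le> y ^ 4"
  proof -
    have "y ^ 3 \<ge> 0" using wy(3) by simp
    then show ?thesis using w1 y23 y4 by linarith
  qed
  then have "ln (1 + real ((w + 1)\<^sup>2)) \<le> ln (y ^ 4)" by (intro ln_mono) (auto intro: add_pos_nonneg)
  then show "ln (1 + real ((w + 1)\<^sup>2)) \<le> 4 * \<rho>" using ly[of 4] by simp
qed

lemma equal_width_arch:
  assumes "L \<ge> 1" "p \<ge> 1" "N \<ge> 1" "w = 12 * p * N" "ds = equal_width p L w"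
  shows "length ds = L + 1" "ds ! L = 1" "ds ! 0 = p" "\<And>l. l < length ds \<Longrightarrow> ds ! l \<le> w"
    "card (params ds) \<le> L * (w + 1)\<^sup>2"
proof -
  have "12 * p * N \<ge> 12 * p * 1" using assms(3) by (intro mult_le_mono2)
  then have pw: "p \<le> w" "1 \<le> w" using assms(2,4) by auto
  show "length ds = L + 1" "ds ! L = 1" "ds ! 0 = p"
    using assms(1,5) by (simp_all add: length_equal_width equal_width_last equal_width_0)
  show "ds ! l \<le> w" if "l < length ds" for l
    using that assms(1,5) pw by (simp add: length_equal_width equal_width_nth_le)
  show "card (params ds) \<le> L * (w + 1)\<^sup>2" using assms(1,5) pw card_params_equal_width by simp
qed

text \<open>Bundles what \<open>hellinger_event\<close> asks of the cover, its accuracy and the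
  sieve radius, so that all constructions of covers share one interface; the rate then depends on
  \<open>ln N\<close>.\<close>

definition usable_cover ::
  "nat list \<Rightarrow> nat \<Rightarrow> nat \<Rightarrow> slab \<Rightarrow> real \<Rightarrow> real \<Rightarrow> nat \<Rightarrow> real \<Rightarrow> bool" where
  "usable_cover ds p s sl F \<sigma> n N \<longleftrightarrow> (\<exists>R \<eta> \<beta> \<delta>. R \<ge> 0 \<and>
     clip_cover ds p (F + 2 * \<sigma> * n) \<eta> \<beta> (sieve ds s R) N \<and> N \<ge> 1 \<and>
     0 < \<eta> \<and> \<eta> * (n * (F + 2 * \<sigma> * n)) \<le> \<sigma>\<^sup>2 \<and> \<eta> * n \<le> \<sigma> \<and> \<beta> * n \<le> 1 \<and>
     emeasure (slab_law sl) {t. R < \<bar>t\<bar>} \<le> ennreal \<delta> \<and> \<delta> \<ge> 0 \<and> exp (4 * real n) * (real s * \<delta>) \<le> 1)"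

text \<open>Accuracies up to \<open>mesh F \<sigma> / n\<^sup>2\<close> are admissible. The square
  is needed because the clipping level grows linearly in \<open>n\<close> and is summed over
  \<open>n\<close> observations.\<close>

definition mesh :: "real \<Rightarrow> real \<Rightarrow> real" where
  "mesh F \<sigma> = min 1 (min \<sigma> (\<sigma>\<^sup>2 / (F + 2 * \<sigma>)))"

lemma mesh_bounds:
  assumes "F \<ge> 0" "\<sigma> > 0" "n \<ge> (1::nat)" "0 < \<eta>" "\<eta> \<le> mesh F \<sigma> / (real n)\<^sup>2"
  shows "0 < mesh F \<sigma>" "mesh F \<sigma> \<le> 1" "\<eta> \<le> 1" "\<eta> * (n * (F + 2 * \<sigma> * n)) \<le> \<sigma>\<^sup>2" "\<eta> * n \<le> \<sigma>"
proof -
  have pos: "F + 2 * \<sigma> > 0" using assms by simp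
  show m: "0 < mesh F \<sigma>" "mesh F \<sigma> \<le> 1" using assms pos by (auto simp: mesh_def)
  have n1: "real n \<ge> 1" using assms by simp
  have e: "\<eta> * (real n)\<^sup>2 \<le> mesh F \<sigma>" using assms(5) n1 by (simp add: field_simps)
  have "real n * 1 \<le> real n * real n" using n1 by (intro mult_left_mono) auto
  then have nn1: "real n \<le> (real n)\<^sup>2" by (simp add: power2_eq_square)
  have nn: "real n \<le> (real n)\<^sup>2" "1 \<le> (real n)\<^sup>2" using nn1 n1 by linarith+
  have "\<eta> * n \<le> \<eta> * (real n)\<^sup>2" using assms(4) nn(1) by (intro mult_left_mono) auto
  also have "\<dots> \<le> \<sigma>" using e by (simp add: mesh_def)
  finally show "\<eta> * n \<le> \<sigma>" .
  have "\<eta> * 1 \<le> \<eta> * (real n)\<^sup>2" using assms(4) nn(2) by (intro mult_left_mono) auto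
  then show "\<eta> \<le> 1" using e m(2) by simp
  have "F * 1 \<le> F * real n" using assms(1) n1 by (intro mult_left_mono) auto
  then have "real n * (F + 2 * \<sigma> * n) \<le> real n * (real n * (F + 2 * \<sigma>))"
    by (intro mult_left_mono) (auto simp: algebra_simps)
  then have "\<eta> * (n * (F + 2 * \<sigma> * n)) \<le> \<eta> * (real n * (real n * (F + 2 * \<sigma>)))"
    by (rule mult_left_mono) (simp add: assms(4) less_imp_le)
  also have "\<dots> = (\<eta> * (real n)\<^sup>2) * (F + 2 * \<sigma>)" by (simp add: power2_eq_square)
  also have "\<dots> \<le> \<sigma>\<^sup>2 / (F + 2 * \<sigma>) * (F + 2 * \<sigma>)"
    using e pos by (intro mult_right_mono) (auto simp: mesh_def)
  finally show "\<eta> * (n * (F + 2 * \<sigma> * n)) \<le> \<sigma>\<^sup>2" using pos by simp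
qed

lemma lipschitz_sieve_cover:
  fixes n :: nat and R F \<sigma> :: real
  assumes n: "n \<ge> 1" and F: "F \<ge> 0" and \<sigma>: "\<sigma> > 0" and R: "R > 0"
    and arch: "length ds = L + 1" "L \<ge> 1" "ds ! L = 1" "ds ! 0 = p" "\<And>l. l < length ds \<Longrightarrow> ds ! l \<le> w"
    and s: "1 \<le> s" "s \<le> card (params ds)" and a: "a = 1 + R * real ((w + 1)\<^sup>2)"
  shows "\<exists>N. clip_cover ds p K (mesh F \<sigma> / (real n)\<^sup>2) 0 (sieve ds s R) N \<and> N \<ge> 1 \<and>
    ln N \<le> s * (ln (card (params ds)) + ln (4 * R + 2) + ln s + L * ln a + 2 * ln n + ln (1 / mesh F \<sigma>))"
proof -
  let ?H = "real (card (params ds))"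
  define \<eta> where "\<eta> = mesh F \<sigma> / (real n)\<^sup>2"
  have "mesh F \<sigma> > 0" using F \<sigma> by (auto simp: mesh_def)
  then have \<eta>: "0 < \<eta>" using n by (simp add: \<eta>_def)
  note m = mesh_bounds[OF F \<sigma> n \<eta>, unfolded \<eta>_def, OF order.refl, folded \<eta>_def]
  define X where "X = s * a ^ L * (real n)\<^sup>2 * (1 / mesh F \<sigma>)"
  define N where "N = ?H ^ s * (4 * R * s * a ^ L / \<eta> + 2) ^ s"
  have a1: "a \<ge> 1" using R by (simp add: a)
  have H1: "?H \<ge> 1" using s by simp
  have X1: "X \<ge> 1"
  proof -
    have "1 * 1 * 1 * 1 \<le> real s * a ^ L * (real n)\<^sup>2 * (1 / mesh F \<sigma>)"
      using s a1 n m by (intro mult_mono) (auto simp: one_le_power)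
    then show ?thesis by (simp add: X_def)
  qed
  have X: "4 * R * s * a ^ L / \<eta> = 4 * R * X" by (simp add: X_def \<eta>_def)
  have up: "4 * R * X + 2 \<le> (4 * R + 2) * X" using X1 by (simp add: distrib_right)
  have low: "1 \<le> 4 * R * X + 2" using R X1 by (simp add: add_nonneg_nonneg)
  have "clip_cover ds p K \<eta> 0 (sieve ds s R) N"
    unfolding N_def
  proof (rule clip_cover_sieve[OF s(2)])
    show "clip_cover ds p K \<eta> 0 (supported ds A R) ((4 * R * s * a ^ L / \<eta> + 2) ^ s)"
      if "A \<subseteq> params ds" "card A = s" for A
      using that R s m(3) \<eta> by (intro lipschitz_cover[OF arch(1-5) _ _ _ _ a]) auto
    show "0 \<le> (4 * R * s * a ^ L / \<eta> + 2) ^ s" unfolding X using low by simp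
  qed
  moreover have N1: "N \<ge> 1"
    unfolding N_def X using H1 low mult_mono[of 1 "?H ^ s" 1 "(4 * R * X + 2) ^ s"] by (simp add: one_le_power)
  moreover have "ln N \<le> s * (ln ?H + ln (4 * R + 2) + ln s + L * ln a + 2 * ln n + ln (1 / mesh F \<sigma>))"
  proof -
    have "ln N = s * ln ?H + s * ln (4 * R * X + 2)"
      unfolding N_def X using H1 low by (subst ln_mult_pos) (auto simp: ln_realpow)
    also have "\<dots> \<le> s * ln ?H + s * ln ((4 * R + 2) * X)"
      using low up by (intro add_left_mono mult_left_mono ln_mono) auto
    also have "ln ((4 * R + 2) * X) = ln (4 * R + 2) + ln X" using R X1 by (intro ln_mult_pos) auto
    also have "ln X = ln s + L * ln a + 2 * ln n + ln (1 / mesh F \<sigma>)"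
    proof -
      have p: "real s > 0" "a ^ L > 0" "(real n)\<^sup>2 > 0" "1 / mesh F \<sigma> > 0" using s a1 n m by auto
      have "ln X = ln (real s) + ln (a ^ L) + ln ((real n)\<^sup>2) + ln (1 / mesh F \<sigma>)"
        unfolding X_def using p by (simp only: ln_mult_pos mult_pos_pos)
      then show ?thesis using a1 n by (simp add: ln_realpow)
    qed
    finally show ?thesis by (simp add: algebra_simps)
  qed
  ultimately show ?thesis unfolding \<eta>_def by blast
qed

text \<open>The sieve of radius \<open>B0\<close> carries the whole prior, so the tail is zero. With
  a fixed radius the layer factor has logarithm at most \<open>4 * \<rho>\<close>, and
  \<open>ln n\<close> enters for each parameter through the accuracy, without the factor
  \<open>L\<close>.\<close>

lemma usable_cover_uniform:
  fixes F \<sigma> B0 :: real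
  assumes F: "F \<ge> 0" and \<sigma>: "\<sigma> > 0" and B0: "B0 > 1" and p: "p \<ge> 1"
  shows "\<exists>C\<ge>0. \<forall>n L N s. \<forall>\<rho>::real. 1 \<le> n \<longrightarrow> 1 \<le> L \<longrightarrow> 1 \<le> N \<longrightarrow> 1 \<le> s \<longrightarrow>
    s \<le> card (params (equal_width p L (12 * p * N))) \<longrightarrow> \<rho> = ln (12 * B0 * real p * real N) \<longrightarrow>
    (\<exists>Nc. usable_cover (equal_width p L (12 * p * N)) p s (Uniform_slab B0) F \<sigma> n Nc \<and>
      ln Nc \<le> C * (s * (L * \<rho> + ln (real n))))"
proof -
  have m0: "0 < mesh F \<sigma>" "mesh F \<sigma> \<le> 1" using F \<sigma> by (auto simp: mesh_def)
  define c where "c = ln (4 * B0 + 2) + ln (1 / mesh F \<sigma>)"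
  have c0: "c \<ge> 0" using B0 m0 by (simp add: c_def)
  show ?thesis
  proof (rule exI[of _ "14 + c"], intro conjI allI impI)
    show "0 \<le> 14 + c" using c0 by simp
    fix n L N s :: nat and \<rho> :: real
    assume *: "1 \<le> n" "1 \<le> L" "1 \<le> N" "1 \<le> s"
      and s: "s \<le> card (params (equal_width p L (12 * p * N)))" and \<rho>: "\<rho> = ln (12 * B0 * real p * real N)"
    define w where "w = 12 * p * N"
    define ds where "ds = equal_width p L w"
    note arch = equal_width_arch[OF *(2) p *(3) w_def ds_def]
    note lb = log_rate_bounds[OF p *(3,2) less_imp_le[OF B0] w_def arch(5) *(4) s[folded w_def ds_def] \<rho>]
    obtain Nc where Nc: "clip_cover ds p (F + 2 * \<sigma> * n) (mesh F \<sigma> / (real n)\<^sup>2) 0 (sieve ds s B0) Nc" "Nc \<ge> 1"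
      "ln Nc \<le> s * (ln (card (params ds)) + ln (4 * B0 + 2) + ln s + L * ln (1 + B0 * real ((w + 1)\<^sup>2)) + 2 * ln n + ln (1 / mesh F \<sigma>))"
      using lipschitz_sieve_cover[OF *(1) F \<sigma> _ arch(1) *(2) arch(2-4) *(4) s[folded w_def ds_def] refl, of B0 "F + 2 * \<sigma> * n"] B0
      by auto
    have "0 < mesh F \<sigma> / (real n)\<^sup>2" using m0 *(1) by simp
    note m = mesh_bounds[OF F \<sigma> *(1) this order.refl]
    have us: "usable_cover ds p s (Uniform_slab B0) F \<sigma> n Nc"
      unfolding usable_cover_def
      by (rule exI[of _ B0], rule exI[of _ "mesh F \<sigma> / (real n)\<^sup>2"], rule exI[of _ 0], rule exI[of _ 0])
        (use Nc(1,2) B0 m m0 *(1) uniform_slab_tail[OF B0] in auto)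
    have "L * ln (1 + B0 * real ((w + 1)\<^sup>2)) \<le> L * (4 * \<rho>)" using lb(6) by (intro mult_left_mono) auto
    then have "ln (card (params ds)) + ln (4 * B0 + 2) + ln s + L * ln (1 + B0 * real ((w + 1)\<^sup>2)) + 2 * ln n + ln (1 / mesh F \<sigma>)
        \<le> 12 * (L * \<rho>) + 2 * ln n + c"
      using lb(4,5) by (simp add: c_def)
    also have "\<dots> \<le> (14 + c) * (L * \<rho> + ln n)"
    proof -
      have ln0: "ln (real n) \<ge> 0" using *(1) by simp
      have "c * 1 \<le> c * (L * \<rho> + ln n)" using c0 lb(2) ln0 by (intro mult_left_mono) auto
      moreover have "(14 + c) * (L * \<rho> + ln n) = 14 * (L * \<rho>) + 14 * ln n + c * (L * \<rho> + ln n)" by (simp add: algebra_simps)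
      ultimately show ?thesis using lb(2) ln0 by linarith
    qed
    finally have "ln Nc \<le> s * ((14 + c) * (L * \<rho> + ln n))"
      by (intro order.trans[OF Nc(3)] mult_left_mono) auto
    then show "\<exists>Nc. usable_cover (equal_width p L (12 * p * N)) p s (Uniform_slab B0) F \<sigma> n Nc \<and>
        ln Nc \<le> (14 + c) * (s * (L * \<rho> + ln (real n)))"
      using us unfolding ds_def w_def by (intro exI[of _ Nc]) (simp add: mult_ac)
  qed
qed

text \<open>For \<open>n \<ge> 24 * \<sigma>0\<^sup>2\<close> the Gaussian exponent at radius
  \<open>n\<close> is at least \<open>6 * n\<close>: of this \<open>4 * n\<close> pays for
  likelihood and loss off the sieve, and \<open>2 * n\<close> for the factor
  \<open>s * sqrt 2\<close>.\<close>

lemma normal_tail_negligible: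
  fixes n s :: nat and \<sigma>0 :: real
  assumes "\<sigma>0 > 0" "1 \<le> n" "s \<le> n" "24 * \<sigma>0\<^sup>2 \<le> n"
  shows "exp (4 * real n) * (real s * (sqrt 2 * exp (- ((real n)\<^sup>2 / (4 * \<sigma>0\<^sup>2))))) \<le> 1"
proof -
  have "6 * real n * (4 * \<sigma>0\<^sup>2) \<le> real n * real n"
    using mult_left_mono[OF assms(4), of "real n"] by (simp add: mult_ac)
  then have e: "6 * real n \<le> (real n)\<^sup>2 / (4 * \<sigma>0\<^sup>2)"
    using assms(1) by (simp add: power2_eq_square field_simps)
  have "real s * sqrt 2 \<le> real n * 2" using assms(3) sqrt2_less_2 by (intro mult_mono) auto
  also have "\<dots> \<le> exp (2 * real n)" using exp_ge_add_one_self[of "2 * real n"] by linarith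
  finally have s2: "real s * sqrt 2 \<le> exp (2 * real n)" .
  have "exp (4 * real n) * (real s * (sqrt 2 * exp (- ((real n)\<^sup>2 / (4 * \<sigma>0\<^sup>2)))))
      = exp (4 * real n) * ((real s * sqrt 2) * exp (- ((real n)\<^sup>2 / (4 * \<sigma>0\<^sup>2))))" by (simp add: mult_ac)
  also have "\<dots> \<le> exp (4 * real n) * (exp (2 * real n) * exp (- (6 * real n)))"
    using s2 e by (intro mult_left_mono mult_mono) auto
  also have "\<dots> = 1" by (simp flip: exp_add)
  finally show ?thesis .
qed

lemma usable_cover_normal_wide:
  fixes F \<sigma> \<sigma>0 B :: real
  assumes F: "F \<ge> 0" and \<sigma>: "\<sigma> > 0" and \<sigma>0: "\<sigma>0 > 0" and B: "B \<ge> 2" and p: "p \<ge> 1"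
  shows "\<exists>C\<ge>0. \<forall>n L N s. \<forall>\<rho>::real. 1 \<le> n \<longrightarrow> 24 * \<sigma>0\<^sup>2 \<le> n \<longrightarrow> s \<le> n \<longrightarrow> 1 \<le> L \<longrightarrow> 1 \<le> N \<longrightarrow> 1 \<le> s \<longrightarrow>
    s \<le> card (params (equal_width p L (12 * p * N))) \<longrightarrow> \<rho> = ln (12 * B * real p * real N) \<longrightarrow>
    (\<exists>Nc. usable_cover (equal_width p L (12 * p * N)) p s (Normal_slab \<sigma>0) F \<sigma> n Nc \<and>
      ln Nc \<le> C * (s * (L * \<rho> + ln (real n)) + s * (L * ln (real n))))"
proof -
  have m0: "0 < mesh F \<sigma>" "mesh F \<sigma> \<le> 1" using F \<sigma> by (auto simp: mesh_def)
  define c where "c = ln (1 / mesh F \<sigma>)"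
  have c0: "c \<ge> 0" using m0 by (simp add: c_def)
  show ?thesis
  proof (rule exI[of _ "20 + c"], intro conjI allI impI)
    show "0 \<le> 20 + c" using c0 by simp
    fix n L N s :: nat and \<rho> :: real
    assume *: "1 \<le> n" "1 \<le> L" "1 \<le> N" "1 \<le> s" and big: "24 * \<sigma>0\<^sup>2 \<le> n" and sn: "s \<le> n"
      and s: "s \<le> card (params (equal_width p L (12 * p * N)))" and \<rho>: "\<rho> = ln (12 * B * real p * real N)"
    define w where "w = 12 * p * N"
    define ds where "ds = equal_width p L w"
    note arch = equal_width_arch[OF *(2) p *(3) w_def ds_def]
    have B1: "B \<ge> 1" using B by simp
    note lb = log_rate_bounds[OF p *(3,2) B1 w_def arch(5) *(4) s[folded w_def ds_def] \<rho>]
    obtain Nc where Nc: "clip_cover ds p (F + 2 * \<sigma> * n) (mesh F \<sigma> / (real n)\<^sup>2) 0 (sieve ds s n) Nc" "Nc \<ge> 1"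
      "ln Nc \<le> s * (ln (card (params ds)) + ln (4 * real n + 2) + ln s + L * ln (1 + real n * real ((w + 1)\<^sup>2)) + 2 * ln n + ln (1 / mesh F \<sigma>))"
      using lipschitz_sieve_cover[OF *(1) F \<sigma> _ arch(1) *(2) arch(2-4) *(4) s[folded w_def ds_def] refl, of "real n" "F + 2 * \<sigma> * n"] *(1)
      by auto
    have "0 < mesh F \<sigma> / (real n)\<^sup>2" using m0 *(1) by simp
    note m = mesh_bounds[OF F \<sigma> *(1) this order.refl]
    have us: "usable_cover ds p s (Normal_slab \<sigma>0) F \<sigma> n Nc"
      unfolding usable_cover_def
      by (rule exI[of _ "real n"], rule exI[of _ "mesh F \<sigma> / (real n)\<^sup>2"], rule exI[of _ 0],
          rule exI[of _ "sqrt 2 * exp (- ((real n)\<^sup>2 / (4 * \<sigma>0\<^sup>2)))"], intro conjI)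
        (use Nc(1,2) m m0 *(1) normal_slab_tail[OF \<sigma>0, of "real n"] normal_tail_negligible[OF \<sigma>0 *(1) sn big] in auto)
    have n1: "real n \<ge> 1" using *(1) by simp
    have ln0: "ln (real n) \<ge> 0" using n1 by simp
    have "ln (4 * real n + 2) \<le> ln (6 * real n)" using n1 by (intro ln_mono) auto
    also have "\<dots> = ln 6 + ln n" using n1 by (intro ln_mult_pos) auto
    finally have l1: "ln (4 * real n + 2) \<le> 5 + ln n" using ln_le_minus_one[of "6::real"] by simp
    have "ln (1 + real n * real ((w + 1)\<^sup>2)) \<le> ln (real n * (1 + real ((w + 1)\<^sup>2)))"
      using n1 by (intro ln_mono) (auto simp: distrib_left intro: add_pos_nonneg)
    also have "\<dots> = ln n + ln (1 + real ((w + 1)\<^sup>2))" using n1 by (intro ln_mult_pos) (auto intro: add_pos_nonneg)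
    also have "\<dots> \<le> ln n + 4 * \<rho>" using lb(7) by simp
    finally have "L * ln (1 + real n * real ((w + 1)\<^sup>2)) \<le> L * (ln n + 4 * \<rho>)" by (intro mult_left_mono) auto
    then have "ln (card (params ds)) + ln (4 * real n + 2) + ln s + L * ln (1 + real n * real ((w + 1)\<^sup>2)) + 2 * ln n + ln (1 / mesh F \<sigma>)
        \<le> 12 * (L * \<rho>) + 5 + 3 * ln n + L * ln n + c"
      using lb(4,5) l1 by (simp add: c_def distrib_left)
    also have "\<dots> \<le> (20 + c) * ((L * \<rho> + ln n) + L * ln n)"
    proof -
      have Ln0: "L * ln (real n) \<ge> 0" using ln0 by simp
      have "c * 1 \<le> c * ((L * \<rho> + ln n) + L * ln n)" using c0 lb(2) ln0 Ln0 by (intro mult_left_mono) linarith+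
      moreover have "(20 + c) * ((L * \<rho> + ln n) + L * ln n)
          = 20 * (L * \<rho>) + 20 * ln n + 20 * (L * ln n) + c * ((L * \<rho> + ln n) + L * ln n)" by (simp add: algebra_simps)
      ultimately show ?thesis using lb(2) ln0 Ln0 by linarith
    qed
    finally have "ln Nc \<le> s * ((20 + c) * ((L * \<rho> + ln n) + L * ln n))"
      by (intro order.trans[OF Nc(3)] mult_left_mono) auto
    then show "\<exists>Nc. usable_cover (equal_width p L (12 * p * N)) p s (Normal_slab \<sigma>0) F \<sigma> n Nc \<and>
        ln Nc \<le> (20 + c) * (s * (L * \<rho> + ln (real n)) + s * (L * ln (real n)))"
      using us unfolding ds_def w_def by (intro exI[of _ Nc]) (simp add: algebra_simps)
  qed
qed

text \<open>Here \<open>p = N = 1\<close> and the width is 12. The number of sign patterns is the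
  \<open>s\<close>-th power of a quantity exponential in \<open>L\<close> but polynomial in
  \<open>n\<close>, so that \<open>ln n\<close> appears without the factor \<open>L\<close>. The
  exponentially fine grid demanded by up to \<open>13 ^ L\<close> breaks is paid for by
  \<open>L * \<rho>\<close>.\<close>

lemma usable_cover_normal_thin:
  fixes F \<sigma> \<sigma>0 B :: real
  assumes F: "F \<ge> 0" and \<sigma>: "\<sigma> > 0" and \<sigma>0: "\<sigma>0 > 0" and B: "B \<ge> 2"
  shows "\<exists>C\<ge>0. \<forall>n L s. \<forall>\<rho>::real. 1 \<le> n \<longrightarrow> 24 * \<sigma>0\<^sup>2 \<le> n \<longrightarrow> s \<le> n \<longrightarrow> 1 \<le> L \<longrightarrow> 1 \<le> s \<longrightarrow>
    s \<le> card (params (equal_width 1 L 12)) \<longrightarrow> \<rho> = ln (12 * B) \<longrightarrow>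
    (\<exists>Nc. usable_cover (equal_width 1 L 12) 1 s (Normal_slab \<sigma>0) F \<sigma> n Nc \<and>
      ln Nc \<le> C * (s * (L * \<rho> + ln (real n))))"
proof -
  have m0: "0 < mesh F \<sigma>" "mesh F \<sigma> \<le> 1" using F \<sigma> by (auto simp: mesh_def)
  define CJ where "CJ = 2 * (F + 2 * \<sigma>) / mesh F \<sigma> + 1"
  have CJ1: "CJ \<ge> 1" using F \<sigma> m0 by (simp add: CJ_def)
  define C2 where "C2 = 8 * (13 + CJ) + 677"
  define c where "c = ln C2 + ln 53248"
  have c0: "c \<ge> 0" using CJ1 by (simp add: c_def C2_def)
  show ?thesis
  proof (rule exI[of _ "10 + c"], intro conjI allI impI)
    show "0 \<le> 10 + c" using c0 by simp
    fix n L s :: nat and \<rho> :: real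
    assume *: "1 \<le> n" "1 \<le> L" "1 \<le> s" and big: "24 * \<sigma>0\<^sup>2 \<le> n" and sn: "s \<le> n"
      and s: "s \<le> card (params (equal_width 1 L 12))" and \<rho>: "\<rho> = ln (12 * B)"
    define ds where "ds = equal_width 1 L 12"
    let ?H = "real (card (params ds))"
    have arch: "length ds = L + 1" "ds ! L = 1" "ds ! 0 = 1" "\<And>l. l < length ds \<Longrightarrow> ds ! l \<le> 12"
      "card (params ds) \<le> L * (12 + 1)\<^sup>2"
      using equal_width_arch[OF *(2), of 1 1 12 ds] by (simp_all add: ds_def)
    have B1: "B \<ge> 1" using B by simp
    have lb: "L * \<rho> \<ge> 1" "ln (card (params ds)) \<le> 4 * (L * \<rho>)" "\<rho> \<ge> 1"
      using log_rate_bounds[of 1 1 L B 12 "card (params ds)" s \<rho>] *(2,3) B1 arch(5) s \<rho>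
      by (simp_all add: ds_def)
    define K where "K = F + 2 * \<sigma> * n"
    have n1: "real n \<ge> 1" and L1: "real L \<ge> 1" using * by simp_all
    have K0: "K > 0" using F \<sigma> n1 by (simp add: K_def add_nonneg_pos)
    \<comment> \<open>Enough levels to bring their spacing \<open>2 * K / J\<close> down to the
      admissible accuracy.\<close>
    define J where "J = nat \<lceil>2 * K * (real n)\<^sup>2 / mesh F \<sigma>\<rceil>"
    \<comment> \<open>Makes the exceptional probability \<open>3 * 13 ^ L / m\<close> equal to
      \<open>1 / n\<close>.\<close>
    define m where "m = 3 * 13 ^ L * n"
    have pos: "2 * K * (real n)\<^sup>2 / mesh F \<sigma> > 0" using K0 n1 m0 by simp
    have J: "2 * K * (real n)\<^sup>2 / mesh F \<sigma> \<le> real J" "real J \<le> 2 * K * (real n)\<^sup>2 / mesh F \<sigma> + 1"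
      using pos unfolding J_def by linarith+
    have J1: "J \<ge> 1" using J(1) pos by linarith
    have m1: "m \<ge> 1" using *(1) by (simp add: m_def)
    define \<eta> where "\<eta> = 2 * K / real J"
    have \<eta>: "0 < \<eta>" "\<eta> \<le> mesh F \<sigma> / (real n)\<^sup>2"
    proof -
      show "0 < \<eta>" using K0 J1 by (simp add: \<eta>_def)
      have "real J > 0" using J1 by simp
      then show "\<eta> \<le> mesh F \<sigma> / (real n)\<^sup>2"
        using J(1) m0 n1 by (simp add: \<eta>_def field_simps)
    qed
    note mm = mesh_bounds[OF F \<sigma> *(1) \<eta>]
    define D where "D = 2 * (2 ^ (L * 12) * ((m + 1) * (L * 12 + J + 1)) * L) + 4 * s + 1"
    define Nc where "Nc = ?H ^ s * real (D ^ s)"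
    have H1: "?H \<ge> 1" using *(3) s by (simp add: ds_def)
    have D1: "real D \<ge> 1" by (simp add: D_def)
    have cover: "clip_cover ds 1 K \<eta> (3 * (12 + 1) ^ L / m) (sieve ds s n) Nc"
      unfolding Nc_def
    proof (rule clip_cover_sieve)
      show "s \<le> card (params ds)" using s by (simp add: ds_def)
      fix A assume A: "A \<subseteq> params ds" "card A = s"
      show "clip_cover ds 1 K \<eta> (3 * (12 + 1) ^ L / m) (supported ds A n) (real (D ^ s))"
        using sign_pattern_cover[OF arch(1) *(2) arch(2-4) A K0 J1 m1, of "real n"] unfolding D_def \<eta>_def by simp
    qed simp
    have N1: "Nc \<ge> 1"
      unfolding Nc_def using H1 D1 mult_mono[of 1 "?H ^ s" 1 "real D ^ s"] by (simp add: one_le_power)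
    have \<beta>: "3 * (12 + 1) ^ L / real m * real n \<le> 1" using *(1) by (simp add: m_def)
    have us: "usable_cover ds 1 s (Normal_slab \<sigma>0) F \<sigma> n Nc"
      unfolding usable_cover_def K_def[symmetric]
      by (rule exI[of _ "real n"], rule exI[of _ \<eta>], rule exI[of _ "3 * (12 + 1) ^ L / real m"],
          rule exI[of _ "sqrt 2 * exp (- ((real n)\<^sup>2 / (4 * \<sigma>0\<^sup>2)))"], intro conjI)
        (use cover N1 \<eta>(1) mm(4,5) \<beta> n1 normal_slab_tail[OF \<sigma>0, of "real n"]
          normal_tail_negligible[OF \<sigma>0 *(1) sn big] in \<open>auto simp: K_def\<close>)
    \<comment> \<open>53248 is 4096 times 13: the factor \<open>2 ^ 12\<close> per layer from the
      gate patterns and the factor 13 per layer from the grid size.\<close>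
    have Dle: "real D \<le> C2 * 53248 ^ L * (real L)\<^sup>2 * (real n) ^ 4"
    proof -
      define Q where "Q = 53248 ^ L * (real L)\<^sup>2 * (real n) ^ 4"
      have p13: "(13::real) ^ L \<ge> 1" by (simp add: one_le_power)
      have n3: "1 \<le> real n ^ 3" using n1 by (rule one_le_power)
      have "1 * 1 \<le> 13 ^ L * real n" using p13 n1 by (intro mult_mono) auto
      then have a: "real m + 1 \<le> 4 * 13 ^ L * real n" by (simp add: m_def mult.commute)
      have b: "real (L * 12 + J + 1) \<le> (13 + CJ) * L * real n ^ 3"
      proof -
        have "F * 1 \<le> F * real n" using F n1 by (intro mult_left_mono) auto
        then have "K \<le> (F + 2 * \<sigma>) * n" by (simp add: K_def algebra_simps)
        then have "2 * K * (real n)\<^sup>2 / mesh F \<sigma> \<le> 2 * ((F + 2 * \<sigma>) * n) * (real n)\<^sup>2 / mesh F \<sigma>"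
          using m0 by (intro divide_right_mono mult_right_mono mult_left_mono) auto
        also have "\<dots> = (CJ - 1) * real n ^ 3" by (simp add: CJ_def power2_eq_square numeral_eq_Suc)
        finally have "real J \<le> (CJ - 1) * real n ^ 3 + 1" using J(2) by simp
        also have "\<dots> \<le> CJ * real n ^ 3" using n3 by (simp add: algebra_simps)
        also have "CJ * real n ^ 3 * 1 \<le> CJ * real n ^ 3 * L" using CJ1 L1 by (intro mult_left_mono) auto
        finally have 1: "real J \<le> CJ * L * real n ^ 3" by (simp add: mult_ac)
        have Ln: "real L * 1 \<le> real L * real n ^ 3" using n3 by (intro mult_left_mono) auto
        have "real (L * 12 + J + 1) = 12 * real L + real J + 1" by simp
        then have "real (L * 12 + J + 1) \<le> 13 * (real L * real n ^ 3) + CJ * L * real n ^ 3"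
          using 1 L1 Ln by linarith
        then show ?thesis by (simp add: algebra_simps)
      qed
      have "real (2 ^ (L * 12) * ((m + 1) * (L * 12 + J + 1)) * L)
          = 4096 ^ L * ((real m + 1) * real (L * 12 + J + 1)) * L"
      proof -
        have "(2::real) ^ (L * 12) = (2 ^ 12) ^ L" by (simp only: mult.commute[of L] power_mult)
        then have p2: "(2::real) ^ (L * 12) = 4096 ^ L" by simp
        have "real (2 ^ (L * 12) * ((m + 1) * X) * L) = 4096 ^ L * ((real m + 1) * real X) * L" for X
          by (simp only: of_nat_mult of_nat_power of_nat_add of_nat_1 of_nat_numeral p2)
        then show ?thesis .
      qed
      also have "\<dots> \<le> 4096 ^ L * ((4 * 13 ^ L * real n) * ((13 + CJ) * L * real n ^ 3)) * L"
        using a b by (intro mult_right_mono mult_left_mono mult_mono) auto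
      also have "\<dots> = 4 * (13 + CJ) * Q"
      proof -
        have n4: "real n ^ 4 = real n * real n ^ 3" by (simp add: numeral_eq_Suc)
        have "(53248::real) ^ L = (4096 * 13) ^ L" by simp
        then have "(53248::real) ^ L = 4096 ^ L * 13 ^ L" by (simp only: power_mult_distrib)
        then show ?thesis by (simp only: Q_def n4 power2_eq_square mult_ac)
      qed
      finally have 1: "real (2 ^ (L * 12) * ((m + 1) * (L * 12 + J + 1)) * L) \<le> 4 * (13 + CJ) * Q" .
      have Q1: "real L \<le> Q"
      proof -
        have "1 * real L * 1 \<le> 53248 ^ L * (real L)\<^sup>2 * (real n) ^ 4"
          using L1 n1 self_le_power[of "real L" 2] by (intro mult_mono) (auto simp: one_le_power)
        then show ?thesis by (simp add: Q_def)
      qed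
      \<comment> \<open>A layer has at most 169, the square of 13, parameters; 677 is
        \<open>4 * 169 + 1\<close>.\<close>
      have "real s \<le> 169 * real L"
        using order.trans[OF s[folded ds_def] arch(5)] by simp
      then have "real (4 * s + 1) \<le> 677 * Q" using Q1 L1 by simp
      then have "real D \<le> (2 * (4 * (13 + CJ)) + 677) * Q" using 1 by (simp add: D_def algebra_simps)
      then show ?thesis by (simp add: C2_def Q_def mult_ac)
    qed
    have C20: "C2 \<ge> 1" using CJ1 by (simp add: C2_def)
    have lnD: "ln (real D) \<le> ln C2 + L * ln 53248 + 2 * ln L + 4 * ln n"
    proof -
      have "ln (real D) \<le> ln (C2 * 53248 ^ L * (real L)\<^sup>2 * (real n) ^ 4)"
        using Dle D1 by (intro ln_mono) auto
      also have "\<dots> = ln C2 + ln (53248 ^ L) + ln ((real L)\<^sup>2) + ln (real n ^ 4)"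
        using C20 L1 n1 by (simp only: ln_mult_pos mult_pos_pos zero_less_power zero_less_numeral
            less_le_trans[OF zero_less_one])
      finally show ?thesis using L1 n1 by (simp add: ln_realpow)
    qed
    have lnL: "ln (real L) \<le> L * \<rho>"
    proof -
      have "ln (real L) \<le> real L * 1" using ln_le_minus_one[of "real L"] L1 by simp
      also have "\<dots> \<le> L * \<rho>" using lb(3) by (intro mult_left_mono) auto
      finally show ?thesis .
    qed
    have ln0: "ln (real n) \<ge> 0" using n1 by simp
    have "ln Nc = s * (ln ?H + ln (real D))"
    proof -
      have "ln Nc = ln (?H ^ s) + ln (real D ^ s)"
        unfolding Nc_def of_nat_power using H1 D1 by (intro ln_mult_pos) auto
      then show ?thesis using H1 D1 by (simp add: ln_realpow distrib_left)
    qed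
    also have "\<dots> \<le> s * ((10 + c) * (L * \<rho> + ln n))"
    proof (rule mult_left_mono)
      have "ln C2 \<ge> 0" using C20 by simp
      then have "ln C2 * 1 \<le> ln C2 * (L * \<rho> + ln n)" using lb(1) ln0 by (intro mult_left_mono) auto
      moreover have "L * ln 53248 \<le> ln 53248 * (L * \<rho> + ln n)"
      proof -
        have "real L * 1 \<le> L * \<rho>" using lb(3) by (intro mult_left_mono) auto
        then have "real L \<le> L * \<rho> + ln n" using ln0 by simp
        then have "ln 53248 * real L \<le> ln 53248 * (L * \<rho> + ln n)" by (intro mult_left_mono) auto
        then show ?thesis by (simp add: mult.commute)
      qed
      ultimately have "ln C2 + L * ln 53248 \<le> c * (L * \<rho> + ln n)"
        unfolding c_def distrib_right[of "ln C2"] by linarith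
      moreover have "(10 + c) * (L * \<rho> + ln n) = 10 * (L * \<rho>) + 10 * ln n + c * (L * \<rho> + ln n)"
        by (simp add: algebra_simps)
      ultimately show "ln ?H + ln (real D) \<le> (10 + c) * (L * \<rho> + ln n)"
        using lnD lnL lb(1,2) ln0 by linarith
    qed simp
    finally have "ln Nc \<le> (10 + c) * (s * (L * \<rho> + ln (real n)))" by (simp add: mult_ac)
    then show "\<exists>Nc. usable_cover (equal_width 1 L 12) 1 s (Normal_slab \<sigma>0) F \<sigma> n Nc \<and>
        ln Nc \<le> (10 + c) * (s * (L * \<rho> + ln (real n)))"
      using us unfolding ds_def by (intro exI[of _ Nc]) simp
  qed
qed

subsection \<open>Rates\<close>

lemma valid_slab_ge_1: "valid_slab sl B \<Longrightarrow> B \<ge> 1"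
  by (cases sl) (auto simp: valid_slab_def)

text \<open>The extra term \<open>s * (L * ln n)\<close> is confined to
  \<open>p * N \<ge> 2\<close>, where \<open>ln (p * N)\<close> is bounded away from zero and
  \<open>rate_eps\<close> can absorb it. The threshold on \<open>n\<close> makes the tail of a
  normal slab negligible.\<close>

lemma usable_cover_exists:
  fixes F \<sigma> B :: real and p :: nat
  assumes F: "F \<ge> 0" and \<sigma>: "\<sigma> > 0" and sl: "valid_slab sl B" and p: "p \<ge> 1"
  shows "\<exists>C\<ge>0. \<exists>n0. \<forall>n\<ge>n0. \<forall>L N s. \<forall>\<rho>::real. 1 \<le> n \<longrightarrow> s \<le> n \<longrightarrow> 1 \<le> L \<longrightarrow> 1 \<le> N \<longrightarrow> 1 \<le> s \<longrightarrow>
    s \<le> card (params (equal_width p L (12 * p * N))) \<longrightarrow> \<rho> = ln (12 * B * real p * real N) \<longrightarrow>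
    (\<exists>Nc. usable_cover (equal_width p L (12 * p * N)) p s sl F \<sigma> n Nc \<and>
      ln Nc \<le> C * (s * (L * \<rho> + ln (real n)) + (if p * N \<ge> 2 then s * (L * ln (real n)) else 0)))"
proof (cases sl)
  case (Uniform_slab B0)
  then have B: "B0 > 1" "B = B0" using sl by (auto simp: valid_slab_def)
  obtain C where C: "C \<ge> 0" and cov: "\<forall>n L N s. \<forall>\<rho>::real. 1 \<le> n \<longrightarrow> 1 \<le> L \<longrightarrow> 1 \<le> N \<longrightarrow> 1 \<le> s \<longrightarrow>
    s \<le> card (params (equal_width p L (12 * p * N))) \<longrightarrow> \<rho> = ln (12 * B0 * real p * real N) \<longrightarrow>
    (\<exists>Nc. usable_cover (equal_width p L (12 * p * N)) p s (Uniform_slab B0) F \<sigma> n Nc \<and>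
      ln Nc \<le> C * (s * (L * \<rho> + ln (real n))))"
    using usable_cover_uniform[OF F \<sigma> B(1) p] by blast
  show ?thesis
  proof (rule exI[of _ C], intro conjI, rule C, rule exI[of _ 0], intro allI impI)
    fix n L N s :: nat and \<rho> :: real
    assume n: "1 \<le> n" and *: "1 \<le> L" "1 \<le> N" "1 \<le> s" "s \<le> card (params (equal_width p L (12 * p * N)))"
      "\<rho> = ln (12 * B * real p * real N)"
    obtain Nc where Nc: "usable_cover (equal_width p L (12 * p * N)) p s (Uniform_slab B0) F \<sigma> n Nc"
      "ln Nc \<le> C * (s * (L * \<rho> + ln (real n)))"
      using cov n * unfolding B(2) by blast
    have "C * (s * (L * \<rho> + ln (real n)))
        \<le> C * (s * (L * \<rho> + ln (real n)) + (if p * N \<ge> 2 then s * (L * ln (real n)) else 0))"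
      using C n by (intro mult_left_mono) auto
    then show "\<exists>Nc. usable_cover (equal_width p L (12 * p * N)) p s sl F \<sigma> n Nc \<and>
        ln Nc \<le> C * (s * (L * \<rho> + ln (real n)) + (if p * N \<ge> 2 then s * (L * ln (real n)) else 0))"
      using Nc Uniform_slab by (intro exI[of _ Nc]) auto
  qed
next
  case (Normal_slab \<sigma>0)
  then have B: "\<sigma>0 > 0" "B \<ge> 2" using sl by (auto simp: valid_slab_def)
  obtain C1 where C1: "C1 \<ge> 0" and wide: "\<forall>n L N s. \<forall>\<rho>::real. 1 \<le> n \<longrightarrow> 24 * \<sigma>0\<^sup>2 \<le> n \<longrightarrow> s \<le> n \<longrightarrow> 1 \<le> L \<longrightarrow> 1 \<le> N \<longrightarrow> 1 \<le> s \<longrightarrow>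
    s \<le> card (params (equal_width p L (12 * p * N))) \<longrightarrow> \<rho> = ln (12 * B * real p * real N) \<longrightarrow>
    (\<exists>Nc. usable_cover (equal_width p L (12 * p * N)) p s (Normal_slab \<sigma>0) F \<sigma> n Nc \<and>
      ln Nc \<le> C1 * (s * (L * \<rho> + ln (real n)) + s * (L * ln (real n))))"
    using usable_cover_normal_wide[OF F \<sigma> B p] by blast
  obtain C2 where C2: "C2 \<ge> 0" and thin: "\<forall>n L s. \<forall>\<rho>::real. 1 \<le> n \<longrightarrow> 24 * \<sigma>0\<^sup>2 \<le> n \<longrightarrow> s \<le> n \<longrightarrow> 1 \<le> L \<longrightarrow> 1 \<le> s \<longrightarrow>
    s \<le> card (params (equal_width 1 L 12)) \<longrightarrow> \<rho> = ln (12 * B) \<longrightarrow>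
    (\<exists>Nc. usable_cover (equal_width 1 L 12) 1 s (Normal_slab \<sigma>0) F \<sigma> n Nc \<and>
      ln Nc \<le> C2 * (s * (L * \<rho> + ln (real n))))"
    using usable_cover_normal_thin[OF F \<sigma> B] by blast
  show ?thesis
  proof (rule exI[of _ "C1 + C2"], intro conjI)
    show "0 \<le> C1 + C2" using C1 C2 by simp
    show "\<exists>n0. \<forall>n\<ge>n0. \<forall>L N s. \<forall>\<rho>::real. 1 \<le> n \<longrightarrow> s \<le> n \<longrightarrow> 1 \<le> L \<longrightarrow> 1 \<le> N \<longrightarrow> 1 \<le> s \<longrightarrow>
      s \<le> card (params (equal_width p L (12 * p * N))) \<longrightarrow> \<rho> = ln (12 * B * real p * real N) \<longrightarrow>
      (\<exists>Nc. usable_cover (equal_width p L (12 * p * N)) p s sl F \<sigma> n Nc \<and>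
        ln Nc \<le> (C1 + C2) * (s * (L * \<rho> + ln (real n)) + (if p * N \<ge> 2 then s * (L * ln (real n)) else 0)))"
    proof (rule exI[of _ "nat \<lceil>24 * \<sigma>0\<^sup>2\<rceil>"], intro allI impI)
      fix n L N s :: nat and \<rho> :: real
      assume n0: "nat \<lceil>24 * \<sigma>0\<^sup>2\<rceil> \<le> n" and n: "1 \<le> n" and sn: "s \<le> n"
        and *: "1 \<le> L" "1 \<le> N" "1 \<le> s" "s \<le> card (params (equal_width p L (12 * p * N)))"
        and \<rho>: "\<rho> = ln (12 * B * real p * real N)"
      have big: "24 * \<sigma>0\<^sup>2 \<le> real n" using n0 by linarith
      have pN: "real p * real N \<ge> 1" using p *(2) by (metis mult_mono' mult_1 of_nat_1 of_nat_mono zero_le_one)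
      have "12 * B * (real p * real N) \<ge> 1"
        using mult_mono[of 1 "12 * B" 1 "real p * real N"] B(2) pN by simp
      then have \<rho>0: "\<rho> \<ge> 0" unfolding \<rho> by (simp add: mult.assoc)
      have ln0: "ln (real n) \<ge> 0" using n by simp
      have w0: "s * (L * \<rho> + ln (real n)) \<ge> 0" "s * (L * ln (real n)) \<ge> 0" using \<rho>0 ln0 by simp_all
      show "\<exists>Nc. usable_cover (equal_width p L (12 * p * N)) p s sl F \<sigma> n Nc \<and>
        ln Nc \<le> (C1 + C2) * (s * (L * \<rho> + ln (real n)) + (if p * N \<ge> 2 then s * (L * ln (real n)) else 0))"
      proof (cases "p * N \<ge> 2")
        case True
        obtain Nc where Nc: "usable_cover (equal_width p L (12 * p * N)) p s (Normal_slab \<sigma>0) F \<sigma> n Nc"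
          "ln Nc \<le> C1 * (s * (L * \<rho> + ln (real n)) + s * (L * ln (real n)))"
          using wide n big sn * \<rho> by blast
        have "C1 * (s * (L * \<rho> + ln (real n)) + s * (L * ln (real n)))
            \<le> (C1 + C2) * (s * (L * \<rho> + ln (real n)) + s * (L * ln (real n)))"
          using C2 w0 by (intro mult_right_mono) auto
        then show ?thesis using True Nc Normal_slab by (intro exI[of _ Nc]) auto
      next
        case False
        then have "p = 1" "N = 1" using p *(2) by (auto simp: not_le less_Suc_eq numeral_2_eq_2 mult_eq_1_iff)
        then obtain Nc where Nc: "usable_cover (equal_width p L (12 * p * N)) p s (Normal_slab \<sigma>0) F \<sigma> n Nc"
          "ln Nc \<le> C2 * (s * (L * \<rho> + ln (real n)))"
          using thin[rule_format, OF n big sn *(1,3), of \<rho>] *(4) \<rho> by auto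
        have "C2 * (s * (L * \<rho> + ln (real n))) \<le> (C1 + C2) * (s * (L * \<rho> + ln (real n)))"
          using C1 w0 by (intro mult_right_mono) auto
        then show ?thesis using False Nc Normal_slab by (intro exI[of _ Nc]) auto
      qed
    qed
  qed
qed

text \<open>The deviation level is \<open>t = ln n\<close>, whence the probability
  \<open>1 - 4 / n\<close>. Constants are collected in the unit
  \<open>s * (L * \<rho> + ln n)\<close>, which dominates \<open>s\<close>, \<open>ln n\<close> and
  1; \<open>x\<close> stands for the extra term of the normal sieve.\<close>

lemma rate_event:
  fixes p N L s n w :: nat and B \<sigma> \<kappa> C x \<xi> \<rho> :: real
  assumes p: "p \<ge> 1" and N: "N \<ge> 1" and L: "L \<ge> 1" and w: "w = 12 * p * N" and ds: "ds = equal_width p L w"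
    and s: "1 \<le> s" "s \<le> card (params ds)" and n: "n \<ge> 1" "2 * ln n \<le> n"
    and f0: "f0 \<in> borel_measurable (\<Pi>\<^sub>M i\<in>{..<p}. borel)"
    and F: "\<And>x. x \<in> cube p \<Longrightarrow> \<bar>f0 x\<bar> \<le> F" "F \<ge> 0"
    and sl: "valid_slab sl B" and \<kappa>: "\<kappa> \<ge> 0"
    "\<And>c \<tau>. 0 < \<tau> \<Longrightarrow> \<tau> \<le> 1 \<Longrightarrow> \<bar>c\<bar> \<le> B \<Longrightarrow> \<exists>S. narrow_slab sl \<kappa> c \<tau> S"
    and \<sigma>: "\<sigma> > 0" and \<theta>s: "\<theta>s \<in> bounded_sparse_params ds s B"
    and \<xi>: "\<And>x. x \<in> cube p \<Longrightarrow> (net ds \<theta>s x - f0 x)\<^sup>2 \<le> \<xi>" "\<xi> \<ge> 0"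
    and \<rho>: "\<rho> = ln (12 * B * real p * real N)"
    and Nc: "usable_cover ds p s sl F \<sigma> n Nc" and C: "C \<ge> 0" and x: "x \<ge> 0"
    and lnNc: "ln Nc \<le> C * (s * (L * \<rho> + ln (real n)) + x)"
  shows "\<exists>E \<in> sets (data_law p \<sigma> f0 n). 1 - 4 / n \<le> measure (data_law p \<sigma> f0 n) E \<and>
    (\<forall>D\<in>E. \<forall>q. is_variational_posterior ds s sl \<sigma> n D q \<longrightarrow>
      2 * real n * (\<integral>\<theta>. hellinger_sq p \<sigma> (net ds \<theta>) f0 \<partial>q)
        \<le> (62 + 4 * \<kappa> + (3 + 2 * \<sigma>) / \<sigma>\<^sup>2 + 2 * C) * (s * (L * \<rho> + ln (real n)) + x + n * \<xi>))"
proof -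
  note arch = equal_width_arch[OF L p N w ds]
  have B1: "B \<ge> 1" by (rule valid_slab_ge_1[OF sl])
  note lb = log_rate_bounds[OF p N L B1 w arch(5) s \<rho>]
  define a where "a = 1 + B * real ((w + 1)\<^sup>2)"
  define \<tau> where "\<tau> = 1 / (30 * s * n\<^sup>2 * a ^ (2 * L))"
  define W where "W = s * ln (card (params ds)) + s * ln (1 / \<tau>) + 4 * \<kappa> * s
      + (2 + 4 * \<sigma> + 2 * real n * \<xi> + 2 * (n * (\<sigma>\<^sup>2 * \<xi> / 2) + ln n)) / (2 * \<sigma>\<^sup>2)"
  define \<omega> where "\<omega> = s * (L * \<rho> + ln (real n))"
  have n1: "real n \<ge> 1" and s1: "real s \<ge> 1" and ln0: "ln (real n) \<ge> 0" using n s by simp_all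
  have \<omega>: "\<omega> \<ge> s * (L * \<rho>)" "\<omega> \<ge> s" "\<omega> \<ge> ln n" "\<omega> \<ge> 1"
  proof -
    show "\<omega> \<ge> s * (L * \<rho>)" unfolding \<omega>_def using ln0 by (intro mult_left_mono) auto
    have "real s * 1 \<le> \<omega>" unfolding \<omega>_def using ln0 lb(2) by (intro mult_left_mono) auto
    then show "\<omega> \<ge> s" "\<omega> \<ge> 1" using s1 by simp_all
    have "1 * ln (real n) \<le> \<omega>" unfolding \<omega>_def using ln0 lb(2) s1 by (intro mult_mono) auto
    then show "\<omega> \<ge> ln n" by simp
  qed
  have W: "W \<le> (45 + 4 * \<kappa> + (3 + 2 * \<sigma>) / \<sigma>\<^sup>2 + 1) * (\<omega> + n * \<xi>)"
  proof -
    have "s * ln (card (params ds)) \<le> s * (4 * (L * \<rho>))" using lb(4) by (intro mult_left_mono) auto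
    then have 1: "s * ln (card (params ds)) \<le> 4 * \<omega>" using \<omega>(1) by simp
    have a1: "a \<ge> 1" using B1 by (simp add: a_def)
    have "ln (1 / \<tau>) = ln (30 * real s * (real n)\<^sup>2 * a ^ (2 * L))" by (simp add: \<tau>_def)
    also have "\<dots> = ln 30 + ln s + ln ((real n)\<^sup>2) + ln (a ^ (2 * L))"
    proof -
      have "a ^ (2 * L) > 0" "(real n)\<^sup>2 > 0" "real s > 0" using a1 n1 s1 by auto
      then show ?thesis by (simp only: ln_mult_pos mult_pos_pos zero_less_numeral)
    qed
    also have "\<dots> = ln 30 + ln s + 2 * ln n + 2 * (L * ln a)" using a1 n1 by (simp add: ln_realpow)
    also have "\<dots> \<le> 29 + 4 * (L * \<rho>) + 2 * ln n + 2 * (L * (4 * \<rho>))"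
      using lb(4,5) lb(6) ln_le_minus_one[of "30::real"] unfolding a_def
      by (intro add_mono mult_left_mono) auto
    also have "\<dots> \<le> 41 * (L * \<rho> + ln n)"
      using lb(2) ln0 by (simp only: distrib_left mult.assoc mult.left_commute[of "real L" 4 \<rho>])
    finally have "s * ln (1 / \<tau>) \<le> s * (41 * (L * \<rho> + ln n))" by (intro mult_left_mono) auto
    then have 2: "s * ln (1 / \<tau>) \<le> 41 * \<omega>" by (simp only: \<omega>_def mult.left_commute)
    have 3: "4 * \<kappa> * s \<le> 4 * \<kappa> * \<omega>" using \<kappa>(1) \<omega>(2) by (intro mult_left_mono) auto
    have nx: "n * \<xi> \<ge> 0" using \<xi>(2) by simp
    have "(2 + 4 * \<sigma> + 2 * real n * \<xi> + 2 * (n * (\<sigma>\<^sup>2 * \<xi> / 2) + ln n)) / (2 * \<sigma>\<^sup>2)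
        = ((1 + 2 * \<sigma>) + n * \<xi> + ln n) / \<sigma>\<^sup>2 + n * \<xi> / 2"
      using \<sigma> by (simp add: field_simps)
    also have "\<dots> \<le> ((3 + 2 * \<sigma>) * (\<omega> + n * \<xi>)) / \<sigma>\<^sup>2 + n * \<xi>"
    proof (intro add_mono divide_right_mono)
      have "(1 + 2 * \<sigma>) * 1 \<le> (1 + 2 * \<sigma>) * (\<omega> + n * \<xi>)" using \<sigma> \<omega>(4) nx by (intro mult_left_mono) auto
      moreover have "n * \<xi> + ln n \<le> 2 * (\<omega> + n * \<xi>)"
        using \<omega>(3,4) nx unfolding distrib_left by linarith
      ultimately have "(1 + 2 * \<sigma>) * 1 + (n * \<xi> + ln n)
          \<le> (1 + 2 * \<sigma>) * (\<omega> + n * \<xi>) + 2 * (\<omega> + n * \<xi>)"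
        by (rule add_mono)
      also have "\<dots> = (3 + 2 * \<sigma>) * (\<omega> + n * \<xi>)" by (simp add: algebra_simps)
      finally show "(1 + 2 * \<sigma>) + n * \<xi> + ln n \<le> (3 + 2 * \<sigma>) * (\<omega> + n * \<xi>)" by simp
    qed (use nx \<xi>(2) in auto)
    finally have 4: "(2 + 4 * \<sigma> + 2 * real n * \<xi> + 2 * (n * (\<sigma>\<^sup>2 * \<xi> / 2) + ln n)) / (2 * \<sigma>\<^sup>2)
        \<le> (3 + 2 * \<sigma>) / \<sigma>\<^sup>2 * (\<omega> + n * \<xi>) + n * \<xi>" by simp
    define y where "y = \<omega> + n * \<xi>"
    have y: "\<omega> \<le> y" "n * \<xi> \<le> y" using nx \<omega>(4) by (simp_all add: y_def)
    have "4 * \<kappa> * \<omega> \<le> 4 * \<kappa> * y" using \<kappa>(1) y by (intro mult_left_mono) auto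
    then have "W \<le> 45 * y + 4 * \<kappa> * y + (3 + 2 * \<sigma>) / \<sigma>\<^sup>2 * y + 1 * y"
      unfolding W_def using 1 2 3 4[folded y_def] y by linarith
    then show ?thesis unfolding y_def by (simp only: distrib_right)
  qed
  obtain R \<eta> \<beta> \<delta> :: real where cov: "R \<ge> 0" "clip_cover ds p (F + 2 * \<sigma> * n) \<eta> \<beta> (sieve ds s R) Nc" "Nc \<ge> 1"
     "0 < \<eta>" "\<eta> * (n * (F + 2 * \<sigma> * n)) \<le> \<sigma>\<^sup>2" "\<eta> * n \<le> \<sigma>" "\<beta> * n \<le> 1"
     "emeasure (slab_law sl) {t. R < \<bar>t\<bar>} \<le> ennreal \<delta>" "\<delta> \<ge> 0" "exp (4 * real n) * (real s * \<delta>) \<le> 1"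
    using Nc unfolding usable_cover_def by blast
  have B0: "B > 0" using B1 by simp
  obtain E where E: "E \<in> sets (data_law p \<sigma> f0 n)" "1 - 4 * exp (- ln (real n)) \<le> measure (data_law p \<sigma> f0 n) E"
    and main: "\<And>D q. D \<in> E \<Longrightarrow> is_variational_posterior ds s sl \<sigma> n D q \<Longrightarrow>
      2 * real n * (\<integral>\<theta>. hellinger_sq p \<sigma> (net ds \<theta>) f0 \<partial>q) \<le> W + 2 * (ln Nc + ln n + 6) + ln 2"
    using hellinger_event[OF f0 F sl B0 \<kappa> arch(1) L arch(2-4) s \<theta>s \<sigma> n(1) a_def \<tau>_def \<xi> cov(1) refl cov(2-10) ln0 n(2) W_def]
    by blast
  have "W + 2 * (ln Nc + ln n + 6) + ln 2
      \<le> (62 + 4 * \<kappa> + (3 + 2 * \<sigma>) / \<sigma>\<^sup>2 + 2 * C) * (\<omega> + x + n * \<xi>)"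
  proof -
    define c where "c = 45 + 4 * \<kappa> + (3 + 2 * \<sigma>) / \<sigma>\<^sup>2 + 1"
    have nx: "n * \<xi> \<ge> 0" using \<xi>(2) by simp
    have c0: "c \<ge> 0" using \<kappa>(1) \<sigma> by (simp add: c_def)
    define y where "y = \<omega> + x + n * \<xi>"
    have y: "\<omega> \<le> y" "\<omega> + x \<le> y" "\<omega> + n * \<xi> \<le> y" using nx x by (simp_all add: y_def)
    have "ln (2::real) \<le> 1" using ln_2_less_1 by simp
    moreover have "ln Nc \<le> C * y" using lnNc mult_left_mono[OF y(2) C] by (simp add: \<omega>_def)
    moreover have "W \<le> c * y" using c0 y(3) by (intro order.trans[OF W[folded c_def]] mult_left_mono) auto
    ultimately have "W + 2 * (ln Nc + ln n + 6) + ln 2 \<le> c * y + 2 * (C * y) + 15 * y"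
      using \<omega>(3,4) y(1) unfolding distrib_left by linarith
    also have "\<dots> = (c + 2 * C + 15) * y" by (simp only: distrib_right mult.assoc)
    also have "\<dots> \<le> (62 + 4 * \<kappa> + (3 + 2 * \<sigma>) / \<sigma>\<^sup>2 + 2 * C) * y"
      using \<omega>(4) y(1) by (intro mult_right_mono) (auto simp: c_def)
    finally show ?thesis by (simp only: y_def)
  qed
  then have "2 * real n * (\<integral>\<theta>. hellinger_sq p \<sigma> (net ds \<theta>) f0 \<partial>q)
        \<le> (62 + 4 * \<kappa> + (3 + 2 * \<sigma>) / \<sigma>\<^sup>2 + 2 * C) * (\<omega> + x + n * \<xi>)"
    if "D \<in> E" "is_variational_posterior ds s sl \<sigma> n D q" for D q
    using main[OF that] by linarith
  moreover have "1 - 4 / real n \<le> measure (data_law p \<sigma> f0 n) E"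
    using E(2) n1 by (simp add: exp_minus inverse_eq_divide)
  ultimately show ?thesis using E(1) unfolding \<omega>_def by blast
qed

text \<open>The network is viewed as a perturbation of the zero network; with radius 0 the layer
  factor is 1.\<close>

lemma net_bounded_on_cube:
  assumes "length ds = L + 1" "L \<ge> 1" "ds ! L = 1" "ds ! 0 = p" "\<And>l. l < length ds \<Longrightarrow> ds ! l \<le> w" "x \<in> cube p"
  shows "\<bar>net ds \<theta> x\<bar> \<le> exp (\<Sum>q\<in>params ds. \<bar>\<theta> q\<bar>) - 1"
proof -
  have "\<bar>net ds \<theta> x - net ds (\<lambda>_. 0) x\<bar>
      \<le> (1 + 0 * real ((w + 1)\<^sup>2)) ^ L * (exp (\<Sum>q\<in>params ds. \<bar>\<theta> q - 0\<bar>) - 1)"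
    using assms by (intro net_perturbation) (auto simp: cube_def PiE_iff abs_le_iff minus_le_iff)
  moreover have "net ds (\<lambda>_. 0) x = 0" by (simp add: net_def Let_def)
  ultimately show ?thesis by simp
qed

text \<open>The infimum may fail to be attained, hence the strict inequality.\<close>

lemma approx_error_witness:
  assumes "approx_error ds s B p f0 < ereal e"
  shows "\<exists>\<theta>\<in>bounded_sparse_params ds s B. \<forall>x\<in>cube p. (net ds \<theta> x - f0 x)\<^sup>2 \<le> e"
proof -
  obtain \<theta> where \<theta>: "\<theta> \<in> bounded_sparse_params ds s B" "(sup_norm p (\<lambda>x. net ds \<theta> x - f0 x))\<^sup>2 < ereal e"
    using assms unfolding approx_error_def INF_less_iff by blast
  have "(net ds \<theta> x - f0 x)\<^sup>2 \<le> e" if "x \<in> cube p" for x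
  proof -
    define u where "u = ereal \<bar>net ds \<theta> x - f0 x\<bar>"
    have u: "u \<le> sup_norm p (\<lambda>x. net ds \<theta> x - f0 x)" "0 \<le> u"
      unfolding sup_norm_def u_def using that by (auto intro: SUP_upper)
    then have "u * u \<le> (sup_norm p (\<lambda>x. net ds \<theta> x - f0 x))\<^sup>2"
      unfolding power2_eq_square by (intro ereal_mult_mono) auto
    also have "\<dots> < ereal e" by (rule \<theta>(2))
    finally show ?thesis by (simp add: u_def power2_eq_square flip: abs_mult)
  qed
  then show ?thesis using \<theta>(1) by blast
qed

lemma approx_error_nonneg: "approx_error ds s B p f0 \<ge> 0"
proof -
  have "0 \<le> (y::ereal)\<^sup>2" for y by (cases y) (auto simp: power2_eq_square)
  then show ?thesis unfolding approx_error_def by (intro INF_greatest)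
qed

text \<open>That \<open>s \<le> n\<close> is extracted from \<open>small\<close>: for
  \<open>p * N \<ge> 2\<close> from the term with \<open>ln (p * N) > 1 / 2\<close>, and for
  \<open>p = N = 1\<close> from \<open>s \<le> 169 * L\<close>, which with
  \<open>n \<ge> 338\<close> gives \<open>n * L / s \<ge> 2\<close>. In the last claim the
  logarithmic factor of \<open>rate_eps\<close> supplies the \<open>ln n\<close> of the normal
  sieve, and \<open>L * s\<close> is at most \<open>2 * L * s * ln (p * N)\<close>.\<close>

lemma rate_arithmetic:
  fixes p N L s n H :: nat and B \<delta> M \<rho> :: real
  assumes p: "p \<ge> 1" and N: "N \<ge> 1" and L: "L \<ge> 1" and B: "B \<ge> 1" and w: "w = 12 * p * N"
    and H: "H \<le> L * (w + 1)\<^sup>2" and s: "1 \<le> s" "s \<le> H" and n: "n \<ge> 338"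
    and \<rho>: "\<rho> = ln (12 * B * real p * real N)"
    and small: "max (real s * ln (real n * real L / real s)) (real L * real s * ln (real p * real N)) \<le> n / 2"
    and \<delta>: "\<delta> \<ge> 1" and M: "M \<ge> 1"
  shows "s \<le> n" and "rate_r p B n L N s > 0"
    and "s * (L * \<rho> + ln (real n)) \<le> 4 * (n * rate_r p B n L N s)"
    and "(if p * N \<ge> 2 then s * (L * ln (real n)) else 0) \<le> 2 * (n * (rate_eps p M \<delta> n L N s)\<^sup>2)"
proof -
  note lb = log_rate_bounds[OF p N L B w H s \<rho>]
  define u where "u = ln (real n * real L / real s)"
  define v where "v = ln (real p * real N)"
  have pos: "real n > 0" "real L > 0" "real s > 0" "real n \<ge> 1" "real L \<ge> 1" "real s \<ge> 1" using n L s by auto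
  have pN: "real p * real N \<ge> 1" using p N by (metis mult_mono' mult_1 of_nat_1 of_nat_mono zero_le_one)
  then have v0: "v \<ge> 0" by (simp add: v_def)
  have half: "1 / 2 < ln (2::real)" using ln2_ge_two_thirds by simp
  have v2: "v > 1 / 2" if "p * N \<ge> 2"
  proof -
    have "real (p * N) \<ge> real 2" using that by (intro of_nat_mono)
    then have "ln 2 \<le> v" unfolding v_def by (intro ln_mono) auto
    then show ?thesis using half by linarith
  qed
  have us: "real s * u \<le> n / 2" and vs: "real L * real s * v \<le> n / 2" using small by (simp_all add: u_def v_def)
  have u_eq: "u = ln n + ln L - ln s" using pos by (simp add: u_def ln_mult ln_div)
  show sn: "s \<le> n"
  proof (cases "p * N \<ge> 2")
    case True
    have "real L * real s * (1 / 2) \<le> real L * real s * v" using v2[OF True] by (intro mult_left_mono) auto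
    then have "real L * real s \<le> n" using vs by simp
    moreover have "1 * real s \<le> real L * real s" using pos by (intro mult_right_mono) auto
    ultimately show ?thesis by simp
  next
    case False
    then have pN1: "p = 1" "N = 1" using p N by (auto simp: not_le less_Suc_eq numeral_2_eq_2 mult_eq_1_iff)
    have "s \<le> L * 169" using s(2) H by (simp add: w pN1)
    then have "2 * real s \<le> 338 * real L" by (simp flip: of_nat_mult)
    also have "\<dots> \<le> real n * real L" using n by (intro mult_right_mono) auto
    finally have "2 \<le> real n * real L / real s" using pos by (simp add: field_simps)
    then have "ln 2 \<le> u" unfolding u_def by (intro ln_mono) auto
    then have "real s * (1 / 2) \<le> real s * u" using half by (intro mult_left_mono) auto
    then show ?thesis using us by simp
  qed
  have u0: "u \<ge> 0"
  proof -
    have "real s * 1 \<le> real n * real L" using sn pos by (intro mult_mono) auto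
    then show ?thesis using pos by (simp add: u_def)
  qed
  have r: "n * rate_r p B n L N s = s * (L * \<rho> + u)"
    using pos by (simp add: rate_r_def u_def \<rho> field_simps)
  have "real s * (L * \<rho> + u) > 0" using pos lb(2) u0 by (intro mult_pos_pos) auto
  then show "rate_r p B n L N s > 0" using pos r by (metis zero_less_mult_pos)
  \<comment> \<open>As \<open>s \<le> H\<close>, the difference \<open>ln s - ln L\<close> is at
    most \<open>3 * \<rho>\<close>; this trades \<open>ln n\<close> for
    \<open>ln (n * L / s)\<close>.\<close>
  have "ln n \<le> u + 3 * \<rho>" using lb(3,5) u_eq by linarith
  moreover have "1 * \<rho> \<le> L * \<rho>" using pos lb(1) by (intro mult_right_mono) auto
  ultimately have "L * \<rho> + ln n \<le> 4 * (L * \<rho> + u)" using u0 unfolding distrib_left by linarith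
  then have "s * (L * \<rho> + ln (real n)) \<le> s * (4 * (L * \<rho> + u))" by (intro mult_left_mono) auto
  then show "s * (L * \<rho> + ln (real n)) \<le> 4 * (n * rate_r p B n L N s)" by (simp only: r mult.left_commute)
  have ln1: "ln (real n) \<ge> 1"
  proof -
    have "exp 1 \<le> real n" using n e_less_272 by simp
    then show ?thesis using pos by (simp add: ln_ge_iff)
  qed
  define g where "g = s * u + L * s * v"
  have g0: "g \<ge> 0" using u0 v0 by (simp add: g_def)
  have e: "n * (rate_eps p M \<delta> n L N s)\<^sup>2 = M\<^sup>2 * g * (ln n powr \<delta>)\<^sup>2"
    using pos g0 by (simp add: rate_eps_def u_def v_def g_def power_mult_distrib)
  have eg: "g * ln n \<le> n * (rate_eps p M \<delta> n L N s)\<^sup>2"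
  proof -
    have "ln n powr 1 \<le> ln n powr \<delta>" using ln1 \<delta> by (intro powr_mono) auto
    then have "ln n \<le> ln n powr \<delta>" using ln1 by simp
    then have "1 * ln n \<le> ln n powr \<delta> * ln n powr \<delta>" using ln1 by (intro mult_mono) auto
    moreover have "1 \<le> M\<^sup>2" using M by simp
    ultimately have "(1 * g) * ln n \<le> (M\<^sup>2 * g) * (ln n powr \<delta>)\<^sup>2"
      using g0 ln1 unfolding power2_eq_square by (intro mult_mono) auto
    then show ?thesis by (simp add: e)
  qed
  show "(if p * N \<ge> 2 then s * (L * ln (real n)) else 0) \<le> 2 * (n * (rate_eps p M \<delta> n L N s)\<^sup>2)"
  proof (cases "p * N \<ge> 2")
    case True
    have "real L * real s * (1 / 2) \<le> real L * real s * v" using v2[OF True] by (intro mult_left_mono) auto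
    moreover have "0 \<le> s * u" using u0 by simp
    ultimately have "real L * real s \<le> 2 * g" by (simp add: g_def)
    then have "(real L * real s) * ln n \<le> (2 * g) * ln n" using ln1 by (intro mult_right_mono) auto
    then show ?thesis using eg True by (simp add: mult_ac)
  next
    case False then show ?thesis by simp
  qed
qed

theorem theorem4p1:
  fixes p :: nat and f0 :: "(nat \<Rightarrow> real) \<Rightarrow> real" and \<sigma>\<^sub>\<epsilon> B \<delta> :: real
    and L N s :: "nat \<Rightarrow> nat" and sl :: slab
  defines "ds \<equiv> \<lambda>n. equal_width p (L n) (12 * p * N n)"
  assumes "p \<ge> 1" and "\<sigma>\<^sub>\<epsilon> > 0" and "\<delta> \<ge> 1"
    and "f0 \<in> borel_measurable (\<Pi>\<^sub>M i\<in>{..<p}. borel)"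
    and "\<And>n. L n \<ge> 1" and "\<And>n. N n \<ge> 1"
    and "\<And>n. 1 \<le> s n \<and> s n \<le> card (params (ds n))"
    and "case sl of Uniform_slab B\<^sub>0 \<Rightarrow> B\<^sub>0 > 1 \<and> B = B\<^sub>0 | Normal_slab \<sigma>\<^sub>0 \<Rightarrow> \<sigma>\<^sub>0 > 0 \<and> B \<ge> 2"
    and "(\<lambda>n. max (real (s n) * ln (real n * real (L n) / real (s n)))
                  (real (L n) * real (s n) * ln (real p * real (N n)))) \<in> o(\<lambda>n. real n)"
  shows "\<exists>C>0. \<exists>C'>0. \<exists>M\<^sub>0>0. \<forall>M\<ge>M\<^sub>0.
    with_dominating_probability (data_law p \<sigma>\<^sub>\<epsilon> f0) (\<lambda>n D.
      \<forall>q. is_variational_posterior (ds n) (s n) sl \<sigma>\<^sub>\<epsilon> n D q \<longrightarrow>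
        ereal (\<integral>\<theta>. hellinger_sq p \<sigma>\<^sub>\<epsilon> (net (ds n) \<theta>) f0 \<partial>q)
          \<le> ereal (C * (rate_eps p M \<delta> n (L n) (N n) (s n))\<^sup>2)
            + ereal (3 * C' * rate_r p B n (L n) (N n) (s n))
            + ereal (3 * C') * approx_error (ds n) (s n) B p f0)"
proof -
  note p = assms(2) and \<sigma> = assms(3) and \<delta> = assms(4) and f0 = assms(5) and L = assms(6) and N = assms(7)
    and s = assms(8)[THEN conjunct1] assms(8)[THEN conjunct2] and little = assms(10)
  have sl: "valid_slab sl B" using assms(9) by (simp add: valid_slab_def)
  have B1: "B \<ge> 1" by (rule valid_slab_ge_1[OF sl])
  define \<xi> where "\<xi> n = approx_error (ds n) (s n) B p f0" for n
  define r where "r n = rate_r p B n (L n) (N n) (s n)" for n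
  define \<epsilon> where "\<epsilon> M n = rate_eps p M \<delta> n (L n) (N n) (s n)" for M n
  define \<rho> where "\<rho> n = ln (12 * B * real p * real (N n))" for n
  have arch: "length (ds n) = L n + 1" "ds n ! L n = 1" "ds n ! 0 = p"
    "\<And>l. l < length (ds n) \<Longrightarrow> ds n ! l \<le> 12 * p * N n" "card (params (ds n)) \<le> L n * (12 * p * N n + 1)\<^sup>2" for n
    using equal_width_arch[OF L[of n] p N[of n] refl, of "ds n"] by (simp_all add: ds_def)
  \<comment> \<open>A single sample size with finite approximation error bounds \<open>f0\<close>
    once and for all, because a network is bounded on the cube. \<open>F\<close> is chosen before
    \<open>n\<close>, since the constants of the covers depend on it.\<close>
  have "\<exists>F\<ge>0. (\<exists>n. \<xi> n < \<infinity>) \<longrightarrow> (\<forall>x\<in>cube p. \<bar>f0 x\<bar> \<le> F)"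
  proof (cases "\<exists>n. \<xi> n < \<infinity>")
    case True
    then obtain n where "\<xi> n < \<infinity>" by blast
    then obtain e where "\<xi> n < ereal e" using less_PInf_Ex_of_nat[of "\<xi> n"] by auto
    then obtain \<theta> where e: "\<And>x. x \<in> cube p \<Longrightarrow> (net (ds n) \<theta> x - f0 x)\<^sup>2 \<le> e"
      using approx_error_witness unfolding \<xi>_def by blast
    define F where "F = exp (\<Sum>q\<in>params (ds n). \<bar>\<theta> q\<bar>) + sqrt e"
    have "\<bar>f0 x\<bar> \<le> F" if "x \<in> cube p" for x
    proof -
      have "\<bar>net (ds n) \<theta> x - f0 x\<bar> \<le> sqrt e" using e[OF that] by (metis real_sqrt_abs real_sqrt_le_mono)
      moreover have "\<bar>net (ds n) \<theta> x\<bar> \<le> exp (\<Sum>q\<in>params (ds n). \<bar>\<theta> q\<bar>) - 1"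
        by (rule net_bounded_on_cube[OF arch(1) L arch(2-4) that])
      ultimately show ?thesis unfolding F_def by linarith
    qed
    then show ?thesis by (intro exI[of _ "\<bar>F\<bar>"]) force
  qed auto
  then obtain F where F: "F \<ge> 0" "\<And>n x. \<xi> n < \<infinity> \<Longrightarrow> x \<in> cube p \<Longrightarrow> \<bar>f0 x\<bar> \<le> F" by blast
  obtain \<kappa> where \<kappa>: "\<kappa> \<ge> 0" "\<And>c \<tau>. 0 < \<tau> \<Longrightarrow> \<tau> \<le> 1 \<Longrightarrow> \<bar>c\<bar> \<le> B \<Longrightarrow> \<exists>S. narrow_slab sl \<kappa> c \<tau> S"
    using narrow_slab_exists[OF sl] by blast
  obtain C1 n1 where C1: "C1 \<ge> 0" and cover: "\<And>n L N s \<rho>. n \<ge> n1 \<Longrightarrow> 1 \<le> n \<Longrightarrow> s \<le> n \<Longrightarrow> 1 \<le> L \<Longrightarrow> 1 \<le> N \<Longrightarrow> 1 \<le> s \<Longrightarrow>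
    s \<le> card (params (equal_width p L (12 * p * N))) \<Longrightarrow> \<rho> = ln (12 * B * real p * real N) \<Longrightarrow>
    (\<exists>Nc. usable_cover (equal_width p L (12 * p * N)) p s sl F \<sigma>\<^sub>\<epsilon> n Nc \<and>
      ln Nc \<le> C1 * (s * (L * \<rho> + ln (real n)) + (if p * N \<ge> 2 then s * (L * ln (real n)) else 0)))"
    using usable_cover_exists[OF F(1) \<sigma> sl p] by blast
  define C where "C = 62 + 4 * \<kappa> + (3 + 2 * \<sigma>\<^sub>\<epsilon>) / \<sigma>\<^sub>\<epsilon>\<^sup>2 + 2 * C1"
  have C: "C > 0" unfolding C_def using \<kappa>(1) \<sigma> C1 by (simp add: add_pos_nonneg)
  have "\<forall>\<^sub>F n in at_top. max (real (s n) * ln (real n * real (L n) / real (s n)))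
                  (real (L n) * real (s n) * ln (real p * real (N n))) \<le> real n / 2"
    by (rule eventually_mono[OF landau_o.smallD[OF little, of "1/2"]]) auto
  then obtain n2 where n2: "\<And>n. n \<ge> n2 \<Longrightarrow> max (real (s n) * ln (real n * real (L n) / real (s n)))
                  (real (L n) * real (s n) * ln (real p * real (N n))) \<le> real n / 2"
    unfolding eventually_at_top_linorder by blast
  \<comment> \<open>Smaller sample sizes receive the empty event, which does not affect the
    limit.\<close>
  define n0 where "n0 = max 338 (max n1 n2)"
  let ?bound = "\<lambda>M n D. \<forall>q. is_variational_posterior (ds n) (s n) sl \<sigma>\<^sub>\<epsilon> n D q \<longrightarrow>
        ereal (\<integral>\<theta>. hellinger_sq p \<sigma>\<^sub>\<epsilon> (net (ds n) \<theta>) f0 \<partial>q)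
          \<le> ereal (C * (\<epsilon> M n)\<^sup>2) + ereal (3 * C * r n) + ereal (3 * C) * \<xi> n"
  have event: "\<exists>E. E \<in> sets (data_law p \<sigma>\<^sub>\<epsilon> f0 n) \<and> (\<forall>D\<in>E. ?bound M n D) \<and>
      (n \<ge> n0 \<longrightarrow> 1 - 4 / n \<le> measure (data_law p \<sigma>\<^sub>\<epsilon> f0 n) E)" if M: "M \<ge> 1" for M n
  proof -
    interpret P: prob_space "data_law p \<sigma>\<^sub>\<epsilon> f0 n" by (rule prob_space_data_law[OF f0 \<sigma>])
    consider "\<not> \<xi> n < \<infinity>" | "\<not> n0 \<le> n" | "\<xi> n < \<infinity>" "n0 \<le> n" by blast
    then show ?thesis
    proof cases
      case 1
      \<comment> \<open>The right-hand side is infinite, so the whole sample space serves as the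
        event.\<close>
      then have "\<xi> n = \<infinity>" by simp
      then show ?thesis using C by (intro exI[of _ "space (data_law p \<sigma>\<^sub>\<epsilon> f0 n)"]) (auto simp: P.prob_space)
    next
      case 2 then show ?thesis by (intro exI[of _ "{}"]) auto
    next
      case 3
      have n: "n \<ge> 338" "n \<ge> n1" "n \<ge> n2" using 3(2) by (auto simp: n0_def)
      then have pos: "n \<ge> 1" by simp
      note ra = rate_arithmetic[OF p N[of n] L[of n] B1 refl arch(5) s(1)[of n] s(2)[of n] n(1) \<rho>_def n2[OF n(3)] \<delta> M,
        folded r_def \<epsilon>_def]
      obtain e where e: "\<xi> n = ereal e" "e \<ge> 0"
        using 3(1) approx_error_nonneg[of "ds n" "s n" B p f0] unfolding \<xi>_def
        by (cases "approx_error (ds n) (s n) B p f0") auto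
      \<comment> \<open>The infimum may fail to be attained; the slack \<open>r n\<close> is
        positive and already part of the bound.\<close>
      define e' where "e' = e + r n"
      have "approx_error (ds n) (s n) B p f0 < ereal e'" using e(1) ra(2) by (simp add: e'_def flip: \<xi>_def)
      then obtain \<theta>s where \<theta>s: "\<theta>s \<in> bounded_sparse_params (ds n) (s n) B"
          "\<And>x. x \<in> cube p \<Longrightarrow> (net (ds n) \<theta>s x - f0 x)\<^sup>2 \<le> e'"
        using approx_error_witness by blast
      define x where "x = (if p * N n \<ge> 2 then s n * (L n * ln (real n)) else 0)"
      obtain Nc where Nc: "usable_cover (ds n) p (s n) sl F \<sigma>\<^sub>\<epsilon> n Nc"
          "ln Nc \<le> C1 * (s n * (L n * \<rho> n + ln (real n)) + x)"
        using cover[OF n(2) pos ra(1) L N s(1) s(2)[of n, unfolded ds_def] \<rho>_def] unfolding ds_def x_def by blast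
      have "ln (real n / 2) \<le> real n / 2 - 1" using pos by (intro ln_le_minus_one) simp
      then have ln2: "2 * ln (real n) \<le> n" using pos ln_2_less_1 by (simp add: ln_div)
      have x0: "x \<ge> 0" using pos by (simp add: x_def)
      have e'0: "e' \<ge> 0" using e(2) ra(2) by (simp add: e'_def)
      obtain E where E: "E \<in> sets (data_law p \<sigma>\<^sub>\<epsilon> f0 n)" "1 - 4 / n \<le> measure (data_law p \<sigma>\<^sub>\<epsilon> f0 n) E"
        and main: "\<And>D q. D \<in> E \<Longrightarrow> is_variational_posterior (ds n) (s n) sl \<sigma>\<^sub>\<epsilon> n D q \<Longrightarrow>
          2 * real n * (\<integral>\<theta>. hellinger_sq p \<sigma>\<^sub>\<epsilon> (net (ds n) \<theta>) f0 \<partial>q)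
            \<le> C * (s n * (L n * \<rho> n + ln (real n)) + x + n * e')"
        using rate_event[OF p N L refl ds_def[THEN meta_eq_to_obj_eq, THEN fun_cong] s(1) s(2) pos ln2 f0 F(2)[OF 3(1)] F(1) sl \<kappa> \<sigma> \<theta>s e'0 \<rho>_def Nc(1) C1 x0 Nc(2)]
          unfolding C_def[symmetric] by blast
      have "?bound M n D" if "D \<in> E" for D
      proof (intro allI impI)
        fix q assume q: "is_variational_posterior (ds n) (s n) sl \<sigma>\<^sub>\<epsilon> n D q"
        have "s n * (L n * \<rho> n + ln (real n)) + x + n * e'
            \<le> 4 * (n * r n) + 2 * (n * (\<epsilon> M n)\<^sup>2) + n * (e + r n)"
          using ra(3,4) unfolding x_def e'_def by (intro add_mono) auto
        \<comment> \<open>After dividing by \<open>n\<close>, the coefficients 5 of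
          \<open>r n\<close>, 2 of the squared \<open>\<epsilon> M n\<close> and 1 of
          \<open>e\<close> fit below 6, 2 and 6.\<close>
        also have "\<dots> \<le> 2 * real n * ((\<epsilon> M n)\<^sup>2 + 3 * r n + 3 * e)"
        proof -
          have "0 \<le> real n * r n + 5 * (real n * e)" using ra(2) e(2) by simp
          then show ?thesis by (simp add: algebra_simps)
        qed
        finally have "C * (s n * (L n * \<rho> n + ln (real n)) + x + n * e')
            \<le> C * (2 * real n * ((\<epsilon> M n)\<^sup>2 + 3 * r n + 3 * e))"
          using C by (intro mult_left_mono) auto
        then have "2 * real n * (\<integral>\<theta>. hellinger_sq p \<sigma>\<^sub>\<epsilon> (net (ds n) \<theta>) f0 \<partial>q)
            \<le> 2 * real n * (C * ((\<epsilon> M n)\<^sup>2 + 3 * r n + 3 * e))"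
          using main[OF that q] by (simp only: mult.left_commute[of C])
        then have "(\<integral>\<theta>. hellinger_sq p \<sigma>\<^sub>\<epsilon> (net (ds n) \<theta>) f0 \<partial>q) \<le> C * ((\<epsilon> M n)\<^sup>2 + 3 * r n + 3 * e)"
          using pos by simp
        then show "ereal (\<integral>\<theta>. hellinger_sq p \<sigma>\<^sub>\<epsilon> (net (ds n) \<theta>) f0 \<partial>q)
            \<le> ereal (C * (\<epsilon> M n)\<^sup>2) + ereal (3 * C * r n) + ereal (3 * C) * \<xi> n"
          by (simp add: e(1) algebra_simps)
      qed
      then show ?thesis using E by blast
    qed
  qed
  have "with_dominating_probability (data_law p \<sigma>\<^sub>\<epsilon> f0) (?bound M)" if M: "M \<ge> 1" for M
  proof -
    from event[OF M] obtain E where E: "\<And>n. E n \<in> sets (data_law p \<sigma>\<^sub>\<epsilon> f0 n)" "\<And>n D. D \<in> E n \<Longrightarrow> ?bound M n D"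
      "\<And>n. n \<ge> n0 \<Longrightarrow> 1 - 4 / n \<le> measure (data_law p \<sigma>\<^sub>\<epsilon> f0 n) (E n)"
      by metis
    have "(\<lambda>n. measure (data_law p \<sigma>\<^sub>\<epsilon> f0 n) (E n)) \<longlonglongrightarrow> 1"
    proof (rule tendsto_sandwich)
      show "\<forall>\<^sub>F n in sequentially. 1 - 4 / real n \<le> measure (data_law p \<sigma>\<^sub>\<epsilon> f0 n) (E n)"
        using E(3) unfolding eventually_sequentially by blast
      show "\<forall>\<^sub>F n in sequentially. measure (data_law p \<sigma>\<^sub>\<epsilon> f0 n) (E n) \<le> 1"
        using prob_space.prob_le_1[OF prob_space_data_law[OF f0 \<sigma>]] by simp
      have "(\<lambda>n. 1 - 4 * (1 / real n)) \<longlonglongrightarrow> 1 - 4 * 0" by (intro tendsto_intros lim_1_over_n)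
      then show "(\<lambda>n. 1 - 4 / real n) \<longlonglongrightarrow> 1" by simp
    qed simp
    then show ?thesis unfolding with_dominating_probability_def using E(1,2) by blast
  qed
  \<comment> \<open>One constant serves as both \<open>C\<close> and \<open>C'\<close>, and the
    threshold for \<open>M\<close> is 1.\<close>
  then show ?thesis using C unfolding \<xi>_def r_def \<epsilon>_def
    by (intro exI[of _ C] conjI exI[of _ "1::real"] allI impI) auto
qed

end
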